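(* Let $E$ and $F$ be vector bundles over a manifold $M$. The canonical $C^\infty(M)$-module isomorphism $$\Gamma(E)\otimes_{C^\infty(M)}\Gamma(F)\to\Gamma(E\otimes F),\qquad s\otimes t\mapsto [x\mapsto s(x)\otimes t(x)],$$ induces a homeomorphism ($C^\infty(M)$-module isomorphism) $$\Gamma(E)\otimes^\pi_{C^\infty(M)}\Gamma(F)\cong\Gamma(E\otimes F).$$
   Context: $\mathbb{K}$ is $\mathbb{R}$ or $\mathbb{C}$; functions and vector bundles are over $\mathbb{K}$. Manifolds are smooth, finite dimensional, second countable, Hausdorff; vector bundles have finite dimensional fibers. For a vector bundle $E\to M$ with typical fiber a finite dimensional Banach space $\mathbb{E}$, $\Gamma(E)$ is the space of smooth sections. It carries the projective locally convex topology defined by the maps $s\mapsto s_{U_i,V_j}:=\mathrm{pr}_2\circ\tau_j\circ s\circ\varphi_i^{-1}\in C^\infty(\varphi_i(U_i\cap V_j),\mathbb{E})$, where $\{(U_i,\varphi_i)\}_i$ is an atlas of $M$, $\{(V_j,\tau_j)\}_j$ a trivializing covering of $E$, and $C^\infty(\Omega,\mathbb{E})$ ($\Omega\subseteq\mathbb{R}^n$ open) carries the usual Fréchet topology of uniform convergence of all derivatives on compact sets. (This topology does not depend on the choices and is Fréchet.) $C^\infty(M)$ is topologized in this way as sections of the trivial line bundle. For locally convex spaces $P,Q$, $P\otimes_\pi Q$ is the algebraic tensor product over $\mathbb{K}$ with the finest locally convex topology making $(x,y)\mapsto x\otimes y$ continuous. For modules $P,Q$ over a commutative algebra $A$ which are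 locally convex (all are Hausdorff locally convex spaces with continuous multiplications), $P\otimes_A^\pi Q:=(P\otimes_\pi Q)/J$ with the quotient topology, where $J$ is the closure of the subspace generated by all $pa\otimes q-p\otimes aq$; it is an $A$-module via $a\cdot(p\otimes q)=(pa)\otimes q$. *)

theory Defs
  imports "HOL-Analysis.Analysis" "HOL-Algebra.Algebraic_Closure_Type"
begin

section \<open>Modules\<close>

text \<open>
  The mult and one fields of a module record are junk throughout. The ground field \<open>\<K>\<close> is a type
  of sort \<open>{real_normed_field, euclidean_space}\<close>: a finite-dimensional commutative real
  division algebra with multiplicative norm, hence a copy of the reals or of the complex numbers
  (and \<^typ>\<open>real\<close> and \<^typ>\<open>complex\<close> are instances). As a ring record it is
  \<open>ring_of_type_algebra\<close>.
\<close>

definition module_hom ::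
  "('a, 'u) ring_scheme \<Rightarrow> ('a, 'p, 'v) module_scheme \<Rightarrow> ('a, 'q, 'w) module_scheme \<Rightarrow> ('p \<Rightarrow> 'q) set"
  where "module_hom R P Q = {f \<in> carrier P \<rightarrow> carrier Q.
    (\<forall>x\<in>carrier P. \<forall>y\<in>carrier P. f (x \<oplus>\<^bsub>P\<^esub> y) = f x \<oplus>\<^bsub>Q\<^esub> f y) \<and>
    (\<forall>a\<in>carrier R. \<forall>x\<in>carrier P. f (a \<odot>\<^bsub>P\<^esub> x) = a \<odot>\<^bsub>Q\<^esub> f x)}"

definition module_iso ::
  "('a, 'u) ring_scheme \<Rightarrow> ('a, 'p, 'v) module_scheme \<Rightarrow> ('a, 'q, 'w) module_scheme \<Rightarrow> ('p \<Rightarrow> 'q) \<Rightarrow> bool"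
  where "module_iso R P Q f \<longleftrightarrow> module R P \<and> module R Q \<and>
    f \<in> module_hom R P Q \<and> bij_betw f (carrier P) (carrier Q)"

definition module_span ::
  "('a, 'u) ring_scheme \<Rightarrow> ('a, 'p, 'v) module_scheme \<Rightarrow> 'p set \<Rightarrow> 'p set"
  where "module_span R P S = \<Inter>{N. submodule N R P \<and> S \<subseteq> N}"

text \<open>On a coset \<open>S\<close> of a submodule \<open>N\<close>, the union defining the scalar action is the
  single coset of \<open>a \<odot> x\<close> for any \<open>x \<in> S\<close>.\<close>

definition quotient_module :: "('a, 'p, 'v) module_scheme \<Rightarrow> 'p set \<Rightarrow> ('a, 'p set) module"
  where "quotient_module P N =
    \<lparr>carrier = a_rcosets\<^bsub>P\<^esub> N, mult = undefined, one = undefined, zero = N, add = set_add P,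
     smult = (\<lambda>a S. \<Union>x\<in>S. N +>\<^bsub>P\<^esub> (a \<odot>\<^bsub>P\<^esub> x))\<rparr>"

definition restrict_scalars :: "('k \<Rightarrow> 'a) \<Rightarrow> ('a, 'p, 'v) module_scheme \<Rightarrow> ('k, 'p) module"
  where "restrict_scalars \<iota> P =
    \<lparr>carrier = carrier P, mult = mult P, one = one P, zero = zero P, add = add P,
     smult = (\<lambda>c x. \<iota> c \<odot>\<^bsub>P\<^esub> x)\<rparr>"

definition free_module :: "('a, 'u) ring_scheme \<Rightarrow> 'x set \<Rightarrow> ('a, 'x \<Rightarrow> 'a) module"
  where "free_module R S =
    \<lparr>carrier = {f. range f \<subseteq> carrier R \<and> (\<forall>x. x \<notin> S \<longrightarrow> f x = \<zero>\<^bsub>R\<^esub>) \<and> finite {x. f x \<noteq> \<zero>\<^bsub>R\<^esub>}},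
     mult = undefined, one = undefined,
     zero = (\<lambda>_. \<zero>\<^bsub>R\<^esub>), add = (\<lambda>f g x. f x \<oplus>\<^bsub>R\<^esub> g x), smult = (\<lambda>a f x. a \<otimes>\<^bsub>R\<^esub> f x)\<rparr>"

definition free_gen :: "('a, 'u) ring_scheme \<Rightarrow> 'x \<Rightarrow> 'x \<Rightarrow> 'a"
  where "free_gen R x = (\<lambda>y. if y = x then \<one>\<^bsub>R\<^esub> else \<zero>\<^bsub>R\<^esub>)"


section \<open>Tensor products over a commutative ring\<close>

definition tensor_free ::
  "('a, 'u) ring_scheme \<Rightarrow> ('a, 'p, 'v) module_scheme \<Rightarrow> ('a, 'q, 'w) module_scheme \<Rightarrow>
    ('a, 'p \<times> 'q \<Rightarrow> 'a) module"
  where "tensor_free R P Q = free_module R (carrier P \<times> carrier Q)"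

definition tensor_relations ::
  "('a, 'u) ring_scheme \<Rightarrow> ('a, 'p, 'v) module_scheme \<Rightarrow> ('a, 'q, 'w) module_scheme \<Rightarrow>
    ('p \<times> 'q \<Rightarrow> 'a) set"
  where "tensor_relations R P Q = (let L = tensor_free R P Q; \<delta> = (\<lambda>p q. free_gen R (p, q)) in
      {\<delta> (p \<oplus>\<^bsub>P\<^esub> p') q \<ominus>\<^bsub>L\<^esub> (\<delta> p q \<oplus>\<^bsub>L\<^esub> \<delta> p' q) | p p' q.
         p \<in> carrier P \<and> p' \<in> carrier P \<and> q \<in> carrier Q}
    \<union> {\<delta> p (q \<oplus>\<^bsub>Q\<^esub> q') \<ominus>\<^bsub>L\<^esub> (\<delta> p q \<oplus>\<^bsub>L\<^esub> \<delta> p q') | p q q'.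
         p \<in> carrier P \<and> q \<in> carrier Q \<and> q' \<in> carrier Q}
    \<union> {\<delta> (a \<odot>\<^bsub>P\<^esub> p) q \<ominus>\<^bsub>L\<^esub> a \<odot>\<^bsub>L\<^esub> \<delta> p q | a p q.
         a \<in> carrier R \<and> p \<in> carrier P \<and> q \<in> carrier Q}
    \<union> {\<delta> p (a \<odot>\<^bsub>Q\<^esub> q) \<ominus>\<^bsub>L\<^esub> a \<odot>\<^bsub>L\<^esub> \<delta> p q | a p q.
         a \<in> carrier R \<and> p \<in> carrier P \<and> q \<in> carrier Q})"

definition tensor_kernel ::
  "('a, 'u) ring_scheme \<Rightarrow> ('a, 'p, 'v) module_scheme \<Rightarrow> ('a, 'q, 'w) module_scheme \<Rightarrow>
    ('p \<times> 'q \<Rightarrow> 'a) set"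
  where "tensor_kernel R P Q = module_span R (tensor_free R P Q) (tensor_relations R P Q)"

definition tensor_module ::
  "('a, 'u) ring_scheme \<Rightarrow> ('a, 'p, 'v) module_scheme \<Rightarrow> ('a, 'q, 'w) module_scheme \<Rightarrow>
    ('a, ('p \<times> 'q \<Rightarrow> 'a) set) module"
  where "tensor_module R P Q = quotient_module (tensor_free R P Q) (tensor_kernel R P Q)"

definition pure_tensor ::
  "('a, 'u) ring_scheme \<Rightarrow> ('a, 'p, 'v) module_scheme \<Rightarrow> ('a, 'q, 'w) module_scheme \<Rightarrow>
    'p \<Rightarrow> 'q \<Rightarrow> ('p \<times> 'q \<Rightarrow> 'a) set"
  where "pure_tensor R P Q p q = tensor_kernel R P Q +>\<^bsub>tensor_free R P Q\<^esub> free_gen R (p, q)"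

text \<open>The additive map \<open>P \<otimes> Q \<rightarrow> N\<close> with \<open>p \<otimes> q \<mapsto> g p q\<close>, for
  \<open>g\<close> bilinear: every tensor is a finite sum of pure tensors, and the value of the sum of the
  \<open>g (p i) (q i)\<close> does not depend on the representation.\<close>

definition tensor_extend ::
  "('a, 'u) ring_scheme \<Rightarrow> ('a, 'p, 'v) module_scheme \<Rightarrow> ('a, 'q, 'w) module_scheme \<Rightarrow>
    ('n, 'z) ring_scheme \<Rightarrow> ('p \<Rightarrow> 'q \<Rightarrow> 'n) \<Rightarrow> ('p \<times> 'q \<Rightarrow> 'a) set \<Rightarrow> 'n"
  where "tensor_extend R P Q N g u = (THE v. \<exists>(n::nat) p q.
    p \<in> {..<n} \<rightarrow> carrier P \<and> q \<in> {..<n} \<rightarrow> carrier Q \<and>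
    u = (\<Oplus>\<^bsub>tensor_module R P Q\<^esub>i\<in>{..<n}. pure_tensor R P Q (p i) (q i)) \<and>
    v = (\<Oplus>\<^bsub>N\<^esub>i\<in>{..<n}. g (p i) (q i)))"


section \<open>Projective tensor products\<close>

definition K_convex :: "('k::real_algebra_1, 'p, 'v) module_scheme \<Rightarrow> 'p set \<Rightarrow> bool"
  where "K_convex V C \<longleftrightarrow> (\<forall>x\<in>C. \<forall>y\<in>C. \<forall>t\<in>{0..1}.
    of_real t \<odot>\<^bsub>V\<^esub> x \<oplus>\<^bsub>V\<^esub> of_real (1 - t) \<odot>\<^bsub>V\<^esub> y \<in> C)"

text \<open>Not necessarily Hausdorff.\<close>

definition locally_convex_topology ::
  "('k::real_normed_field, 'p, 'v) module_scheme \<Rightarrow> 'p topology \<Rightarrow> bool"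
  where "locally_convex_topology V T \<longleftrightarrow> topspace T = carrier V \<and>
    continuous_map (prod_topology T T) T (\<lambda>(x, y). x \<oplus>\<^bsub>V\<^esub> y) \<and>
    continuous_map (prod_topology euclidean T) T (\<lambda>(c, x). c \<odot>\<^bsub>V\<^esub> x) \<and>
    (\<forall>U. openin T U \<and> \<zero>\<^bsub>V\<^esub> \<in> U \<longrightarrow>
      (\<exists>C. openin T C \<and> \<zero>\<^bsub>V\<^esub> \<in> C \<and> C \<subseteq> U \<and> K_convex V C))"

text \<open>The finest locally convex topology on \<open>P \<otimes> Q\<close> for which
  \<open>(p, q) \<mapsto> p \<otimes> q\<close> is continuous, obtained as the supremum of all of them (the lemma
  \<open>projective_topology_finest\<close> below checks that the supremum is again one).\<close>

definition projective_topology ::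
  "('k::{real_normed_field,euclidean_space}, 'p, 'v) module_scheme \<Rightarrow> 'p topology \<Rightarrow>
    ('k, 'q, 'w) module_scheme \<Rightarrow> 'q topology \<Rightarrow> ('p \<times> 'q \<Rightarrow> 'k) set topology"
  where "projective_topology P TP Q TQ = topology_generated_by {U. \<exists>T.
    locally_convex_topology (tensor_module ring_of_type_algebra P Q) T \<and>
    continuous_map (prod_topology TP TQ) T (\<lambda>(p, q). pure_tensor ring_of_type_algebra P Q p q) \<and>
    openin T U}"

definition quotient_topology :: "'x topology \<Rightarrow> ('x \<Rightarrow> 'y) \<Rightarrow> 'y topology"
  where "quotient_topology T f =
    topology (\<lambda>U. U \<subseteq> f ` topspace T \<and> openin T {x \<in> topspace T. f x \<in> U})"

text \<open>Below, \<open>A\<close> is a commutative \<open>\<K>\<close>-algebra with unit map \<open>\<iota>\<close>, through which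
  an \<open>A\<close>-module is a \<open>\<K>\<close>-vector space. The topology of \<open>A\<close> itself does not enter.\<close>

abbreviation base_tensor ::
  "('k::{real_normed_field,euclidean_space} \<Rightarrow> 'a) \<Rightarrow> ('a, 'p) module \<Rightarrow> ('a, 'q) module \<Rightarrow>
    ('k, ('p \<times> 'q \<Rightarrow> 'k) set) module"
  where "base_tensor \<iota> P Q \<equiv>
    tensor_module ring_of_type_algebra (restrict_scalars \<iota> P) (restrict_scalars \<iota> Q)"

abbreviation base_pure_tensor ::
  "('k::{real_normed_field,euclidean_space} \<Rightarrow> 'a) \<Rightarrow> ('a, 'p) module \<Rightarrow> ('a, 'q) module \<Rightarrow>
    'p \<Rightarrow> 'q \<Rightarrow> ('p \<times> 'q \<Rightarrow> 'k) set"
  where "base_pure_tensor \<iota> P Q \<equiv>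
    pure_tensor ring_of_type_algebra (restrict_scalars \<iota> P) (restrict_scalars \<iota> Q)"

abbreviation base_topology ::
  "('k::{real_normed_field,euclidean_space} \<Rightarrow> 'a) \<Rightarrow> ('a, 'p) module \<Rightarrow> 'p topology \<Rightarrow>
    ('a, 'q) module \<Rightarrow> 'q topology \<Rightarrow> ('p \<times> 'q \<Rightarrow> 'k) set topology"
  where "base_topology \<iota> P TP Q TQ \<equiv>
    projective_topology (restrict_scalars \<iota> P) TP (restrict_scalars \<iota> Q) TQ"

definition balancing_subspace ::
  "('k::{real_normed_field,euclidean_space} \<Rightarrow> 'a) \<Rightarrow> 'a ring \<Rightarrow>
    ('a, 'p) module \<Rightarrow> 'p topology \<Rightarrow> ('a, 'q) module \<Rightarrow> 'q topology \<Rightarrow> ('p \<times> 'q \<Rightarrow> 'k) set set"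
  where "balancing_subspace \<iota> A P TP Q TQ = base_topology \<iota> P TP Q TQ closure_of
    module_span ring_of_type_algebra (base_tensor \<iota> P Q)
      {base_pure_tensor \<iota> P Q (a \<odot>\<^bsub>P\<^esub> p) q \<ominus>\<^bsub>base_tensor \<iota> P Q\<^esub>
         base_pure_tensor \<iota> P Q p (a \<odot>\<^bsub>Q\<^esub> q) | a p q.
       a \<in> carrier A \<and> p \<in> carrier P \<and> q \<in> carrier Q}"

definition proj_class ::
  "('k::{real_normed_field,euclidean_space} \<Rightarrow> 'a) \<Rightarrow> 'a ring \<Rightarrow>
    ('a, 'p) module \<Rightarrow> 'p topology \<Rightarrow> ('a, 'q) module \<Rightarrow> 'q topology \<Rightarrow>
    ('p \<times> 'q \<Rightarrow> 'k) set \<Rightarrow> ('p \<times> 'q \<Rightarrow> 'k) set set"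
  where "proj_class \<iota> A P TP Q TQ u =
    balancing_subspace \<iota> A P TP Q TQ +>\<^bsub>base_tensor \<iota> P Q\<^esub> u"

definition proj_pure_tensor ::
  "('k::{real_normed_field,euclidean_space} \<Rightarrow> 'a) \<Rightarrow> 'a ring \<Rightarrow>
    ('a, 'p) module \<Rightarrow> 'p topology \<Rightarrow> ('a, 'q) module \<Rightarrow> 'q topology \<Rightarrow>
    'p \<Rightarrow> 'q \<Rightarrow> ('p \<times> 'q \<Rightarrow> 'k) set set"
  where "proj_pure_tensor \<iota> A P TP Q TQ p q =
    proj_class \<iota> A P TP Q TQ (base_pure_tensor \<iota> P Q p q)"

text \<open>\<open>a\<close> acts on \<open>P \<otimes> Q\<close> by the linear map \<open>p \<otimes> q \<mapsto> (a p) \<otimes> q\<close>,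
  and on the quotient by the induced map.\<close>

definition proj_tensor_module ::
  "('k::{real_normed_field,euclidean_space} \<Rightarrow> 'a) \<Rightarrow> 'a ring \<Rightarrow>
    ('a, 'p) module \<Rightarrow> 'p topology \<Rightarrow> ('a, 'q) module \<Rightarrow> 'q topology \<Rightarrow>
    ('a, ('p \<times> 'q \<Rightarrow> 'k) set set) module"
  where "proj_tensor_module \<iota> A P TP Q TQ =
    quotient_module
      \<lparr>carrier = carrier (base_tensor \<iota> P Q), mult = undefined, one = undefined,
       zero = zero (base_tensor \<iota> P Q), add = add (base_tensor \<iota> P Q),
       smult = (\<lambda>a. tensor_extend ring_of_type_algebra
                 (restrict_scalars \<iota> P) (restrict_scalars \<iota> Q) (base_tensor \<iota> P Q)
                 (\<lambda>p q. base_pure_tensor \<iota> P Q (a \<odot>\<^bsub>P\<^esub> p) q))\<rparr>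
      (balancing_subspace \<iota> A P TP Q TQ)"

definition proj_tensor_topology ::
  "('k::{real_normed_field,euclidean_space} \<Rightarrow> 'a) \<Rightarrow> 'a ring \<Rightarrow>
    ('a, 'p) module \<Rightarrow> 'p topology \<Rightarrow> ('a, 'q) module \<Rightarrow> 'q topology \<Rightarrow>
    ('p \<times> 'q \<Rightarrow> 'k) set set topology"
  where "proj_tensor_topology \<iota> A P TP Q TQ =
    quotient_topology (base_topology \<iota> P TP Q TQ) (proj_class \<iota> A P TP Q TQ)"


section \<open>Smooth functions on open subsets of Euclidean space\<close>

text \<open>
  Model spaces are types of sort \<open>{real_inner, heine_borel}\<close>, i.e. finite-dimensional inner
  product spaces. Unlike \<^class>\<open>euclidean_space\<close> this sort does not exclude dimension 0.
\<close>

definition iter_deriv ::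
  "'b::real_normed_vector list \<Rightarrow> ('b \<Rightarrow> 'c::real_normed_vector) \<Rightarrow> 'b \<Rightarrow> 'c"
  where "iter_deriv vs f = foldr (\<lambda>v g x. frechet_derivative g (at x) v) vs f"

text \<open>For \<open>\<Omega>\<close> open and \<open>'b\<close> finite-dimensional this is \<open>C\<^sup>\<infinity>\<close>: \<open>f\<close> is
  differentiable, all its directional derivatives are differentiable, and so on.\<close>

definition smooth_on :: "'b::real_normed_vector set \<Rightarrow> ('b \<Rightarrow> 'c::real_normed_vector) \<Rightarrow> bool"
  where "smooth_on \<Omega> f \<longleftrightarrow> (\<forall>vs. \<forall>x\<in>\<Omega>. iter_deriv vs f differentiable (at x))"

text \<open>The coordinate space \<open>\<K>\<^sup>I\<close>; for finite \<open>I\<close> it is the typical fiber.\<close>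

definition coord_space :: "'i set \<Rightarrow> ('k::real_normed_field, 'i \<Rightarrow> 'k) module"
  where "coord_space I =
    \<lparr>carrier = {v. \<forall>i. i \<notin> I \<longrightarrow> v i = 0}, mult = undefined, one = undefined,
     zero = (\<lambda>_. 0), add = (\<lambda>v w i. v i + w i), smult = (\<lambda>c v i. c * v i)\<rparr>"

definition smooth_maps ::
  "'b::real_normed_vector set \<Rightarrow> 'i set \<Rightarrow> ('b \<Rightarrow> 'i \<Rightarrow> 'k::real_normed_field) set"
  where "smooth_maps \<Omega> I =
    {f \<in> \<Omega> \<rightarrow>\<^sub>E carrier (coord_space I). \<forall>i\<in>I. smooth_on \<Omega> (\<lambda>y. f y i)}"

definition smooth_topology ::
  "'b::real_normed_vector set \<Rightarrow> 'i set \<Rightarrow> ('b \<Rightarrow> 'i \<Rightarrow> 'k::real_normed_field) topology"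
  where "smooth_topology \<Omega> I = topology_generated_by (insert (smooth_maps \<Omega> I)
    {{g \<in> smooth_maps \<Omega> I. \<forall>y\<in>C.
        norm (iter_deriv vs (\<lambda>z. g z i) y - iter_deriv vs (\<lambda>z. f z i) y) < \<epsilon>} | f C vs i \<epsilon>.
      f \<in> smooth_maps \<Omega> I \<and> compact C \<and> C \<subseteq> \<Omega> \<and> i \<in> I \<and> 0 < \<epsilon>})"


section \<open>Manifolds and vector bundles\<close>

record ('m, 'b) manifold =
  mtop :: "'m topology"
  atlas :: "('m set \<times> ('m \<Rightarrow> 'b)) set"

abbreviation mset :: "('m, 'b, 'z) manifold_scheme \<Rightarrow> 'm set"
  where "mset M \<equiv> topspace (mtop M)"

definition smooth_manifold :: "('m, 'b::{real_inner,heine_borel}) manifold \<Rightarrow> bool"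
  where "smooth_manifold M \<longleftrightarrow>
    Hausdorff_space (mtop M) \<and> second_countable (mtop M) \<and>
    (\<Union>(U, \<phi>)\<in>atlas M. U) = mset M \<and>
    (\<forall>(U, \<phi>)\<in>atlas M. openin (mtop M) U \<and> open (\<phi> ` U) \<and>
      homeomorphic_map (subtopology (mtop M) U) (top_of_set (\<phi> ` U)) \<phi>) \<and>
    (\<forall>(U, \<phi>)\<in>atlas M. \<forall>(V, \<psi>)\<in>atlas M. smooth_on (\<phi> ` (U \<inter> V)) (\<psi> \<circ> inv_into U \<phi>))"

definition smooth_fun_on ::
  "('m, 'b::{real_inner,heine_borel}) manifold \<Rightarrow> 'm set \<Rightarrow> ('m \<Rightarrow> 'c::real_normed_vector) \<Rightarrow> bool"
  where "smooth_fun_on M W f \<longleftrightarrow>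
    (\<forall>(U, \<phi>)\<in>atlas M. smooth_on (\<phi> ` (U \<inter> W)) (f \<circ> inv_into U \<phi>))"

definition smooth_ring ::
  "('m, 'b::{real_inner,heine_borel}) manifold \<Rightarrow> ('m \<Rightarrow> 'k::real_normed_field) ring"
  where "smooth_ring M =
    \<lparr>carrier = {f \<in> extensional (mset M). smooth_fun_on M (mset M) f},
     mult = (\<lambda>f g. \<lambda>x\<in>mset M. f x * g x), one = (\<lambda>x\<in>mset M. 1),
     zero = (\<lambda>x\<in>mset M. 0), add = (\<lambda>f g. \<lambda>x\<in>mset M. f x + g x)\<rparr>"

definition const_fun ::
  "('m, 'b::{real_inner,heine_borel}) manifold \<Rightarrow> 'k \<Rightarrow> 'm \<Rightarrow> 'k::real_normed_field"
  where "const_fun M c = (\<lambda>x\<in>mset M. c)"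

text \<open>
  A vector bundle is given by its fibers and a trivializing covering \<open>{(V, \<tau>)}\<close>, where
  \<open>\<tau> x\<close> is the linear isomorphism from the fiber over \<open>x \<in> V\<close> to the typical fiber
  \<open>\<K>\<^sup>I\<close>, and the transition maps \<open>V \<inter> W \<rightarrow> GL(\<K>\<^sup>I)\<close> are smooth (entrywise, in the
  standard basis). The total space is the disjoint union of the fibers with the manifold structure
  determined by the trivializations.
\<close>

record ('m, 'k, 'e, 'i) vbundle =
  fiber :: "'m \<Rightarrow> ('k, 'e) module"
  index :: "'i set"
  trivs :: "('m set \<times> ('m \<Rightarrow> 'e \<Rightarrow> 'i \<Rightarrow> 'k)) set"

definition vector_bundle ::
  "('m, 'b::{real_inner,heine_borel}) manifold \<Rightarrow>
    ('m, 'k::{real_normed_field,euclidean_space}, 'e, 'i) vbundle \<Rightarrow> bool"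
  where "vector_bundle M E \<longleftrightarrow> finite (index E) \<and>
    (\<Union>(V, \<tau>)\<in>trivs E. V) = mset M \<and>
    (\<forall>(V, \<tau>)\<in>trivs E. openin (mtop M) V \<and>
      (\<forall>x\<in>V. module_iso ring_of_type_algebra (fiber E x) (coord_space (index E)) (\<tau> x))) \<and>
    (\<forall>(V, \<tau>)\<in>trivs E. \<forall>(W, \<sigma>)\<in>trivs E. \<forall>i\<in>index E. \<forall>j\<in>index E.
      smooth_fun_on M (V \<inter> W)
        (\<lambda>x. \<sigma> x (inv_into (carrier (fiber E x)) (\<tau> x) (\<lambda>l. if l = j then 1 else 0)) i))"

text \<open>The representative \<open>pr\<^sub>2 \<circ> \<tau> \<circ> s \<circ> \<phi>\<inverse>\<close> on \<open>\<phi>(U \<inter> V)\<close>.\<close>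

definition local_rep ::
  "'m set \<Rightarrow> ('m \<Rightarrow> 'b) \<Rightarrow> 'm set \<Rightarrow> ('m \<Rightarrow> 'e \<Rightarrow> 'i \<Rightarrow> 'k) \<Rightarrow> ('m \<Rightarrow> 'e) \<Rightarrow> 'b \<Rightarrow> 'i \<Rightarrow> 'k"
  where "local_rep U \<phi> V \<tau> s =
    (\<lambda>y\<in>\<phi> ` (U \<inter> V). \<tau> (inv_into U \<phi> y) (s (inv_into U \<phi> y)))"

definition smooth_sections ::
  "('m, 'b::{real_inner,heine_borel}) manifold \<Rightarrow>
    ('m, 'k::{real_normed_field,euclidean_space}, 'e, 'i) vbundle \<Rightarrow> ('m \<Rightarrow> 'e) set"
  where "smooth_sections M E = {s \<in> (\<Pi>\<^sub>E x\<in>mset M. carrier (fiber E x)).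
    \<forall>(U, \<phi>)\<in>atlas M. \<forall>(V, \<tau>)\<in>trivs E.
      local_rep U \<phi> V \<tau> s \<in> smooth_maps (\<phi> ` (U \<inter> V)) (index E)}"

definition section_module ::
  "('m, 'b::{real_inner,heine_borel}) manifold \<Rightarrow>
    ('m, 'k::{real_normed_field,euclidean_space}, 'e, 'i) vbundle \<Rightarrow> ('m \<Rightarrow> 'k, 'm \<Rightarrow> 'e) module"
  where "section_module M E =
    \<lparr>carrier = smooth_sections M E, mult = undefined, one = undefined,
     zero = (\<lambda>x\<in>mset M. \<zero>\<^bsub>fiber E x\<^esub>),
     add = (\<lambda>s t. \<lambda>x\<in>mset M. s x \<oplus>\<^bsub>fiber E x\<^esub> t x),
     smult = (\<lambda>f s. \<lambda>x\<in>mset M. f x \<odot>\<^bsub>fiber E x\<^esub> s x)\<rparr>"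

definition section_topology ::
  "('m, 'b::{real_inner,heine_borel}) manifold \<Rightarrow>
    ('m, 'k::{real_normed_field,euclidean_space}, 'e, 'i) vbundle \<Rightarrow> ('m \<Rightarrow> 'e) topology"
  where "section_topology M E = topology_generated_by (insert (smooth_sections M E)
    {{s \<in> smooth_sections M E. local_rep U \<phi> V \<tau> s \<in> B} | U \<phi> V \<tau> B.
      (U, \<phi>) \<in> atlas M \<and> (V, \<tau>) \<in> trivs E \<and> openin (smooth_topology (\<phi> ` (U \<inter> V)) (index E)) B})"

text \<open>The bundle with fibers the tensor products of the fibers, trivialized over \<open>V \<inter> W\<close> by
  \<open>\<tau> \<otimes> \<sigma>\<close>, where \<open>\<K>\<^sup>I \<otimes> \<K>\<^sup>J\<close> is identified with \<open>\<K>\<^bsup>I \<times> J\<^esup>\<close>.\<close>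

definition tensor_bundle ::
  "('m, 'k::{real_normed_field,euclidean_space}, 'e, 'i) vbundle \<Rightarrow> ('m, 'k, 'f, 'j) vbundle \<Rightarrow>
    ('m, 'k, ('e \<times> 'f \<Rightarrow> 'k) set, 'i \<times> 'j) vbundle"
  where "tensor_bundle E F =
    \<lparr>fiber = (\<lambda>x. tensor_module ring_of_type_algebra (fiber E x) (fiber F x)),
     index = index E \<times> index F,
     trivs = {(V \<inter> W, \<lambda>x u (i, j).
         tensor_extend ring_of_type_algebra (fiber E x) (fiber F x) ring_of_type_algebra
           (\<lambda>e f. \<tau> x e i * \<sigma> x f j) u) | V \<tau> W \<sigma>. (V, \<tau>) \<in> trivs E \<and> (W, \<sigma>) \<in> trivs F}\<rparr>"

definition tensor_section ::
  "('m, 'b::{real_inner,heine_borel}) manifold \<Rightarrow>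
    ('m, 'k::{real_normed_field,euclidean_space}, 'e, 'i) vbundle \<Rightarrow> ('m, 'k, 'f, 'j) vbundle \<Rightarrow>
    ('m \<Rightarrow> 'e) \<Rightarrow> ('m \<Rightarrow> 'f) \<Rightarrow> 'm \<Rightarrow> ('e \<times> 'f \<Rightarrow> 'k) set"
  where "tensor_section M E F s t =
    (\<lambda>x\<in>mset M. pure_tensor ring_of_type_algebra (fiber E x) (fiber F x) (s x) (t x))"


section \<open>Well-definedness\<close>

lemma openin_quotient_topology:
  "openin (quotient_topology T f) U \<longleftrightarrow>
    U \<subseteq> f ` topspace T \<and> openin T {x \<in> topspace T. f x \<in> U}"
proof -
  have "istopology (\<lambda>U. U \<subseteq> f ` topspace T \<and> openin T {x \<in> topspace T. f x \<in> U})"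
    unfolding istopology_def
  proof (intro conjI allI impI; (elim conjE)?)
    fix S S' assume *: "openin T {x \<in> topspace T. f x \<in> S}" "openin T {x \<in> topspace T. f x \<in> S'}"
    have "{x \<in> topspace T. f x \<in> S \<inter> S'} = {x \<in> topspace T. f x \<in> S} \<inter> {x \<in> topspace T. f x \<in> S'}"
      by auto
    then show "openin T {x \<in> topspace T. f x \<in> S \<inter> S'}" using * by auto
  next
    fix \<K> assume *: "\<forall>K\<in>\<K>. K \<subseteq> f ` topspace T \<and> openin T {x \<in> topspace T. f x \<in> K}"
    have "{x \<in> topspace T. f x \<in> \<Union>\<K>} = (\<Union>K\<in>\<K>. {x \<in> topspace T. f x \<in> K})" by auto
    then show "openin T {x \<in> topspace T. f x \<in> \<Union>\<K>}" using * by auto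
  qed auto
  then show ?thesis by (simp add: quotient_topology_def)
qed

lemma quotient_map_quotient_topology: "quotient_map T (quotient_topology T f) f"
proof -
  have "topspace (quotient_topology T f) = f ` topspace T"
  proof (rule subset_antisym)
    show "topspace (quotient_topology T f) \<subseteq> f ` topspace T"
      using openin_quotient_topology[of T f] openin_topspace by blast
    have "{x \<in> topspace T. f x \<in> f ` topspace T} = topspace T" by auto
    then have "openin (quotient_topology T f) (f ` topspace T)"
      by (simp add: openin_quotient_topology)
    then show "f ` topspace T \<subseteq> topspace (quotient_topology T f)" by (rule openin_subset)
  qed
  then show ?thesis unfolding quotient_map_def by (auto simp: openin_quotient_topology)
qed


lemma module_free_module:
  fixes R (structure)
  assumes "cring R"
  shows "module R (free_module R S)"
proof -
  interpret cring R by fact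
  have car: "f x \<in> carrier R" if "f \<in> carrier (free_module R S)" for f x
    using that by (auto simp: free_module_def)
  have add: "f \<oplus>\<^bsub>free_module R S\<^esub> g = (\<lambda>x. f x \<oplus> g x)" for f g :: "'c \<Rightarrow> 'a"
    by (simp add: free_module_def)
  have smult: "a \<odot>\<^bsub>free_module R S\<^esub> f = (\<lambda>x. a \<otimes> f x)" for a and f :: "'c \<Rightarrow> 'a"
    by (simp add: free_module_def)
  have fin: "finite {x. f x \<oplus> g x \<noteq> \<zero>}"
    if "finite {x. f x \<noteq> \<zero>}" "finite {x. g x \<noteq> \<zero>}" for f g :: "'c \<Rightarrow> 'a"
    by (rule finite_subset[OF _ finite_UnI[OF that]]) auto
  have fin': "finite {x. a \<otimes> f x \<noteq> \<zero>}"
    if "a \<in> carrier R" "finite {x. f x \<noteq> \<zero>}" for f :: "'c \<Rightarrow> 'a" and a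
    by (rule finite_subset[OF _ that(2)]) (use that(1) in auto)
  have fin'': "finite {x. \<ominus> f x \<noteq> \<zero>}" if "finite {x. f x \<noteq> \<zero>}" for f :: "'c \<Rightarrow> 'a"
    by (rule finite_subset[OF _ that]) auto
  show ?thesis
  proof (rule moduleI)
    show "abelian_group (free_module R S)"
    proof (rule abelian_groupI)
      fix f assume f: "f \<in> carrier (free_module R S)"
      show "\<exists>g\<in>carrier (free_module R S). g \<oplus>\<^bsub>free_module R S\<^esub> f = \<zero>\<^bsub>free_module R S\<^esub>"
        by (rule bexI[where x = "\<lambda>x. \<ominus> f x"])
          (use f car[OF f] fin''[of f] in \<open>auto simp: free_module_def l_neg image_subset_iff\<close>)
    qed (auto simp: free_module_def image_subset_iff fin a_ac)
  next
    fix a x assume "a \<in> carrier R" "x \<in> carrier (free_module R S)"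
    then show "a \<odot>\<^bsub>free_module R S\<^esub> x \<in> carrier (free_module R S)"
      using fin'[of a x] by (auto simp: free_module_def image_subset_iff)
  qed (simp_all add: assms add smult car l_distr r_distr m_assoc)
qed

lemma submodule_module_span:
  assumes "module R P" "S \<subseteq> carrier P"
  shows "submodule (module_span R P S) R P"
proof -
  interpret module R P by fact
  have "carrier P \<in> {N. submodule N R P \<and> S \<subseteq> N}" using assms carrier_is_submodule by auto
  moreover have "\<zero>\<^bsub>P\<^esub> \<in> N" "\<And>x y. x \<in> N \<Longrightarrow> y \<in> N \<Longrightarrow> x \<oplus>\<^bsub>P\<^esub> y \<in> N" "\<And>x. x \<in> N \<Longrightarrow> \<ominus>\<^bsub>P\<^esub> x \<in> N"
    "\<And>a x. a \<in> carrier R \<Longrightarrow> x \<in> N \<Longrightarrow> a \<odot>\<^bsub>P\<^esub> x \<in> N" if "submodule N R P" for N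
  proof -
    interpret N: submodule N R P by fact
    show "\<zero>\<^bsub>P\<^esub> \<in> N" using N.one_closed by simp
    show "\<And>x y. x \<in> N \<Longrightarrow> y \<in> N \<Longrightarrow> x \<oplus>\<^bsub>P\<^esub> y \<in> N" using N.m_closed by simp
    show "\<And>x. x \<in> N \<Longrightarrow> \<ominus>\<^bsub>P\<^esub> x \<in> N" using N.m_inv_closed by (simp add: a_inv_def)
    show "\<And>a x. a \<in> carrier R \<Longrightarrow> x \<in> N \<Longrightarrow> a \<odot>\<^bsub>P\<^esub> x \<in> N" by (rule N.smult_closed)
  qed
  ultimately show ?thesis
    by (intro submoduleI) (simp_all add: module_span_def Inter_lower)
qed

lemma module_quotient_module:
  assumes "module R P" "submodule N R P"
  shows "module R (quotient_module P N)"
proof -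
  interpret module R P by fact
  interpret N: submodule N R P by fact
  have sub: "subgroup N (add_monoid P)" by (rule submodule.axioms(1)[OF assms(2)])
  interpret N: abelian_subgroup N P
    by (rule abelian_subgroupI3) (simp_all add: sub additive_subgroup_def M.abelian_group_axioms)
  let ?Q = "quotient_module P N"
  have smult: "a \<odot>\<^bsub>?Q\<^esub> (N +>\<^bsub>P\<^esub> x) = N +>\<^bsub>P\<^esub> (a \<odot>\<^bsub>P\<^esub> x)"
    if a: "a \<in> carrier R" and x: "x \<in> carrier P" for a x
  proof -
    have "N +>\<^bsub>P\<^esub> (a \<odot>\<^bsub>P\<^esub> y) = N +>\<^bsub>P\<^esub> (a \<odot>\<^bsub>P\<^esub> x)" if y: "y \<in> N +>\<^bsub>P\<^esub> x" for y
    proof -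
      obtain h where h: "h \<in> N" "y = h \<oplus>\<^bsub>P\<^esub> x" using y by (auto simp: a_r_coset_def')
      have "a \<odot>\<^bsub>P\<^esub> y = a \<odot>\<^bsub>P\<^esub> h \<oplus>\<^bsub>P\<^esub> a \<odot>\<^bsub>P\<^esub> x"
        using h a x N.a_subset by (auto simp: smult_r_distr)
      then have "a \<odot>\<^bsub>P\<^esub> y \<in> N +>\<^bsub>P\<^esub> (a \<odot>\<^bsub>P\<^esub> x)"
        using h a N.smult_closed by (auto simp: a_r_coset_def')
      then show ?thesis using M.a_repr_independence[OF _ _ sub] a x by simp
    qed
    then have "(\<Union>y\<in>N +>\<^bsub>P\<^esub> x. N +>\<^bsub>P\<^esub> (a \<odot>\<^bsub>P\<^esub> y)) = (\<Union>y\<in>N +>\<^bsub>P\<^esub> x. N +>\<^bsub>P\<^esub> (a \<odot>\<^bsub>P\<^esub> x))"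
      by (intro SUP_cong refl)
    moreover have "x \<in> N +>\<^bsub>P\<^esub> x" by (rule N.a_rcos_self[OF x])
    ultimately show ?thesis unfolding quotient_module_def by (simp only: module.simps) blast
  qed
  have add: "(N +>\<^bsub>P\<^esub> x) \<oplus>\<^bsub>?Q\<^esub> (N +>\<^bsub>P\<^esub> y) = N +>\<^bsub>P\<^esub> (x \<oplus>\<^bsub>P\<^esub> y)"
    if "x \<in> carrier P" "y \<in> carrier P" for x y
    using N.a_rcos_sum[OF that] by (simp add: quotient_module_def)
  have car: "carrier ?Q = (\<lambda>x. N +>\<^bsub>P\<^esub> x) ` carrier P"
    by (auto simp: quotient_module_def A_RCOSETS_def')
  have zero: "\<zero>\<^bsub>?Q\<^esub> = N +>\<^bsub>P\<^esub> \<zero>\<^bsub>P\<^esub>"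
    using N.a_rcos_const[OF N.zero_closed] by (simp add: quotient_module_def)
  show ?thesis
  proof (rule moduleI)
    show "abelian_group ?Q"
    proof (rule abelian_groupI)
      fix x assume "x \<in> carrier ?Q"
      then obtain y where "y \<in> carrier P" "x = N +>\<^bsub>P\<^esub> y" by (auto simp: car)
      then show "\<exists>y\<in>carrier ?Q. y \<oplus>\<^bsub>?Q\<^esub> x = \<zero>\<^bsub>?Q\<^esub>"
        by (intro bexI[where x = "N +>\<^bsub>P\<^esub> (\<ominus>\<^bsub>P\<^esub> y)"]) (auto simp: car add zero M.l_neg)
    qed (auto simp: car add zero M.a_ac)
  qed (use assms in \<open>auto simp: car add smult smult_l_distr smult_r_distr smult_assoc1 is_cring\<close>)
qed

lemma free_gen_carrier:
  assumes "cring R" "p \<in> carrier P" "q \<in> carrier Q"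
  shows "free_gen R (p, q) \<in> carrier (tensor_free R P Q)"
proof -
  interpret cring R by fact
  have "finite {x. free_gen R (p, q) x \<noteq> \<zero>\<^bsub>R\<^esub>}"
    by (rule finite_subset[of _ "{(p, q)}"]) (auto simp: free_gen_def)
  then show ?thesis
    using assms by (auto simp: tensor_free_def free_module_def free_gen_def image_subset_iff)
qed

lemma tensor_kernel_submodule:
  assumes "module R P" "module R Q"
  shows "submodule (tensor_kernel R P Q) R (tensor_free R P Q)"
proof -
  interpret P: module R P by fact
  interpret Q: module R Q by fact
  interpret L: module R "tensor_free R P Q"
    unfolding tensor_free_def by (rule module_free_module) (rule P.is_cring)
  note gen = free_gen_carrier[OF P.is_cring, of _ P _ Q]
  show ?thesis
    unfolding tensor_kernel_def
    by (rule submodule_module_span[OF L.module_axioms])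
      (auto simp: tensor_relations_def Let_def intro!: gen L.minus_closed L.add.m_closed L.smult_closed)
qed

lemma module_tensor_module:
  assumes "module R P" "module R Q"
  shows "module R (tensor_module R P Q)"
proof -
  interpret P: module R P by fact
  show ?thesis
    unfolding tensor_module_def
    using module_quotient_module[OF _ tensor_kernel_submodule[OF assms]]
      module_free_module[OF P.is_cring] unfolding tensor_free_def by blast
qed

lemma pure_tensor_carrier:
  assumes "cring R" "p \<in> carrier P" "q \<in> carrier Q"
  shows "pure_tensor R P Q p q \<in> carrier (tensor_module R P Q)"
  using free_gen_carrier[OF assms]
  by (auto simp: pure_tensor_def tensor_module_def quotient_module_def A_RCOSETS_def')

lemma K_convex_Int: "K_convex V C \<Longrightarrow> K_convex V D \<Longrightarrow> K_convex V (C \<inter> D)"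
  by (simp add: K_convex_def)

lemma projective_topology_finest:
  fixes P :: "('k::{real_normed_field,euclidean_space}, 'p, 'v) module_scheme"
    and Q :: "('k, 'q, 'w) module_scheme"
  assumes P: "module ring_of_type_algebra P" and Q: "module ring_of_type_algebra Q"
    and TP: "topspace TP = carrier P" and TQ: "topspace TQ = carrier Q"
  defines "V \<equiv> tensor_module ring_of_type_algebra P Q"
    and "f \<equiv> \<lambda>(p, q). pure_tensor ring_of_type_algebra P Q p q"
    and "T0 \<equiv> projective_topology P TP Q TQ"
  shows "locally_convex_topology V T0" and "continuous_map (prod_topology TP TQ) T0 f"
    and "\<And>T U. locally_convex_topology V T \<Longrightarrow> continuous_map (prod_topology TP TQ) T f \<Longrightarrow>
           openin T U \<Longrightarrow> openin T0 U"
proof -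
  define \<T> where "\<T> = {T. locally_convex_topology V T \<and> continuous_map (prod_topology TP TQ) T f}"
  define \<B> where "\<B> = {U. \<exists>T\<in>\<T>. openin T U}"
  have T0: "T0 = topology_generated_by \<B>"
    by (simp add: T0_def \<B>_def \<T>_def projective_topology_def V_def f_def)
  interpret V: module ring_of_type_algebra V
    unfolding V_def by (rule module_tensor_module[OF P Q])
  have K: "c \<in> carrier ring_of_type_algebra" for c :: 'k
    by (simp add: ring_of_type_algebra_def)
  have f: "f \<in> topspace (prod_topology TP TQ) \<rightarrow> carrier V"
    using pure_tensor_carrier[OF V.is_cring] by (auto simp: f_def V_def TP TQ)
  let ?I = "topology_generated_by {carrier V}"
  have openI: "openin ?I U \<Longrightarrow> U = {} \<or> U = carrier V" for U
  proof -
    assume "openin ?I U"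
    then have "generate_topology_on {carrier V} U" by (simp add: openin_topology_generated_by_iff)
    then show "U = {} \<or> U = carrier V" by induction auto
  qed
  have contI: "continuous_map Z ?I g" if "g \<in> topspace Z \<rightarrow> carrier V" for Z :: "'z topology" and g
  proof -
    have "{x \<in> topspace Z. g x \<in> carrier V} = topspace Z" using that by auto
    then have "openin Z {x \<in> topspace Z. g x \<in> U}" if "openin ?I U" for U
      using openI[OF that] by auto
    then show ?thesis using that by (auto simp: continuous_map_def)
  qed
  have "locally_convex_topology V ?I"
    unfolding locally_convex_topology_def
  proof (intro conjI allI impI)
    fix U assume U: "openin ?I U \<and> \<zero>\<^bsub>V\<^esub> \<in> U"
    then have "U = carrier V" using openI by auto
    moreover have "K_convex V (carrier V)" unfolding K_convex_def
      by (intro ballI V.add.m_closed V.smult_closed K)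
    ultimately show "\<exists>C. openin ?I C \<and> \<zero>\<^bsub>V\<^esub> \<in> C \<and> C \<subseteq> U \<and> K_convex V C" using U by blast
  qed (auto intro!: contI K)
  then have I: "?I \<in> \<T>" using contI[OF f] by (simp add: \<T>_def)
  have top: "topspace T = carrier V" if "T \<in> \<T>" for T
    using that by (simp add: \<T>_def locally_convex_topology_def)
  have "openin ?I (carrier V)" using openin_topspace[of ?I] by simp
  then have "carrier V \<in> \<B>" using I by (auto simp: \<B>_def)
  moreover have "\<Union>\<B> \<subseteq> carrier V" using openin_subset top by (fastforce simp: \<B>_def)
  ultimately have top0: "topspace T0 = carrier V" by (auto simp: T0)
  have finer: "openin T0 U" if "T \<in> \<T>" "openin T U" for T U
    unfolding T0 using that by (intro topology_generated_by_Basis) (auto simp: \<B>_def)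
  then show "\<And>T U. locally_convex_topology V T \<Longrightarrow> continuous_map (prod_topology TP TQ) T f \<Longrightarrow>
      openin T U \<Longrightarrow> openin T0 U"
    by (auto simp: \<T>_def)
  have cont0: "continuous_map Z T0 g"
    if "\<And>T. T \<in> \<T> \<Longrightarrow> continuous_map Z T g" for Z :: "'z topology" and g
    unfolding T0
  proof (rule continuous_on_generated_topo)
    show "openin Z (g -` U \<inter> topspace Z)" if "U \<in> \<B>" for U
    proof -
      obtain T where T: "T \<in> \<T>" "openin T U" using \<open>U \<in> \<B>\<close> by (auto simp: \<B>_def)
      have "openin Z {x \<in> topspace Z. g x \<in> U}"
        using \<open>\<And>T. T \<in> \<T> \<Longrightarrow> continuous_map Z T g\<close>[OF T(1)] T(2) openin_continuous_map_preimage by blast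
      moreover have "{x \<in> topspace Z. g x \<in> U} = g -` U \<inter> topspace Z" by auto
      ultimately show ?thesis by simp
    qed
    show "g ` topspace Z \<subseteq> \<Union>\<B>"
      using \<open>\<And>T. T \<in> \<T> \<Longrightarrow> continuous_map Z T g\<close>[OF I] top0 top[OF I]
      by (auto simp: T0 continuous_map_def)
  qed
  have finer_prod: "continuous_map (prod_topology T0 T0) (prod_topology T T) (\<lambda>x. x)"
    "continuous_map (prod_topology euclidean T0) (prod_topology (euclidean :: 'k topology) T) (\<lambda>x. x)"
    if "T \<in> \<T>" for T
  proof -
    have "continuous_map T0 T (\<lambda>x. x)"
      unfolding continuous_map_def
    proof (intro conjI allI impI)
      fix U assume "openin T U"
      then have "openin T0 U" "U \<subseteq> topspace T0"
        using finer[OF that] openin_subset by blast+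
      moreover have "{x \<in> topspace T0. x \<in> U} = U" using \<open>U \<subseteq> topspace T0\<close> by auto
      ultimately show "openin T0 {x \<in> topspace T0. x \<in> U}" by simp
    qed (simp add: top[OF that] top0)
    then show "continuous_map (prod_topology T0 T0) (prod_topology T T) (\<lambda>x. x)"
      "continuous_map (prod_topology euclidean T0) (prod_topology (euclidean :: 'k topology) T) (\<lambda>x. x)"
      using continuous_map_prod_top[of T0 T0 T T "\<lambda>x. x" "\<lambda>x. x"]
        continuous_map_prod_top[of euclidean T0 "euclidean :: 'k topology" T "\<lambda>x. x" "\<lambda>x. x"]
      by (simp_all add: case_prod_unfold)
  qed
  show "continuous_map (prod_topology TP TQ) T0 f"
    by (rule cont0) (simp add: \<T>_def)
  show "locally_convex_topology V T0"
    unfolding locally_convex_topology_def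
  proof (intro conjI allI impI)
    show "continuous_map (prod_topology T0 T0) T0 (\<lambda>(x, y). x \<oplus>\<^bsub>V\<^esub> y)"
    proof (rule cont0)
      fix T assume T: "T \<in> \<T>"
      then have "continuous_map (prod_topology T T) T (\<lambda>(x, y). x \<oplus>\<^bsub>V\<^esub> y)"
        by (simp add: \<T>_def locally_convex_topology_def)
      from continuous_map_compose[OF finer_prod(1)[OF T] this]
      show "continuous_map (prod_topology T0 T0) T (\<lambda>(x, y). x \<oplus>\<^bsub>V\<^esub> y)" by (simp add: o_def)
    qed
    show "continuous_map (prod_topology euclidean T0) T0 (\<lambda>(c, x). c \<odot>\<^bsub>V\<^esub> x)"
    proof (rule cont0)
      fix T assume T: "T \<in> \<T>"
      then have "continuous_map (prod_topology euclidean T) T (\<lambda>(c, x). c \<odot>\<^bsub>V\<^esub> x)"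
        by (simp add: \<T>_def locally_convex_topology_def)
      from continuous_map_compose[OF finer_prod(2)[OF T] this]
      show "continuous_map (prod_topology euclidean T0) T (\<lambda>(c, x). c \<odot>\<^bsub>V\<^esub> x)" by (simp add: o_def)
    qed
    fix U assume U: "openin T0 U \<and> \<zero>\<^bsub>V\<^esub> \<in> U"
    then have "generate_topology_on \<B> U" by (simp add: T0 openin_topology_generated_by_iff)
    then have "\<zero>\<^bsub>V\<^esub> \<in> U \<longrightarrow> (\<exists>C. openin T0 C \<and> \<zero>\<^bsub>V\<^esub> \<in> C \<and> C \<subseteq> U \<and> K_convex V C)"
    proof induction
      case (Int a b)
      show ?case
      proof
        assume "\<zero>\<^bsub>V\<^esub> \<in> a \<inter> b"
        then obtain C D where "openin T0 C" "\<zero>\<^bsub>V\<^esub> \<in> C" "C \<subseteq> a" "K_convex V C"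
          "openin T0 D" "\<zero>\<^bsub>V\<^esub> \<in> D" "D \<subseteq> b" "K_convex V D"
          using Int.IH by auto
        then show "\<exists>C. openin T0 C \<and> \<zero>\<^bsub>V\<^esub> \<in> C \<and> C \<subseteq> a \<inter> b \<and> K_convex V C"
          by (intro exI[of _ "C \<inter> D"]) (auto intro: K_convex_Int)
      qed
    next
      case (UN \<K>)
      then show ?case by (meson Union_iff Union_upper subset_trans)
    next
      case (Basis S)
      then obtain T where T: "T \<in> \<T>" "openin T S" by (auto simp: \<B>_def)
      have "locally_convex_topology V T" using T(1) by (simp add: \<T>_def)
      then have "\<exists>C. openin T C \<and> \<zero>\<^bsub>V\<^esub> \<in> C \<and> C \<subseteq> S \<and> K_convex V C" if "\<zero>\<^bsub>V\<^esub> \<in> S"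
        using T(2) that unfolding locally_convex_topology_def by blast
      then show ?case using finer[OF T(1)] by blast
    qed simp
    then show "\<exists>C. openin T0 C \<and> \<zero>\<^bsub>V\<^esub> \<in> C \<and> C \<subseteq> U \<and> K_convex V C" using U by blast
  qed (rule top0)
qed

end

(* The projective tensor product of section spaces carries two dual pairs of finite families.
   Since M has finite dimension, the supports of a suitable family of cutoff functions subordinate
   to a trivializing cover can be coloured with finitely many colours so that supports of one colour
   are disjoint. Adding up the cut-off local frames of one colour gives finitely many global sections
   t_j of E and sections w_j of the dual of E with s = sum_j w_j(s) t_j, and likewise r_l, p_l for F.
   Hence u = sum_jl (w_j (x) p_l)(u) t_j (x) r_l for every section u of E (x) F, so that
   u |-> sum_jl ((w_j (x) p_l)(u) t_j) (x) r_l inverts the canonical map, algebraically as well as on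
   the projective tensor product, where it is continuous because every summand is. The closure of
   the balancing relations is then the kernel of the canonical map, as the target is Hausdorff. *)
theory Submission
  imports Defs
begin

section \<open>Calculus of smooth maps\<close>

text \<open>The delicate point is finiteness when \<open>M\<close> is not compact. An element of an
  algebraic tensor product is a finite sum, so the inverse map needs finitely many global sections
  that span every fiber, whereas a locally finite family of cutoff functions by itself gives
  infinitely many. What has to be found is a bound, the same at all points of \<open>M\<close>, on
  the number of cutoff functions that overlap. It comes from packing in the model space: the number
  of points with mutual distances at least \<open>d\<close> inside a ball of radius
  \<open>2 * d\<close> is bounded independently of \<open>d\<close>, hence in the same way in every
  chart and at every scale. Bounded overlap becomes a finite colouring by passing from single
  functions to sets of functions, with the cardinality of the set as the colour. On the whole of
  \<open>M\<close> an exhaustion by compact sets is used, and the number of the shell modulo 3 is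
  added to the colour.

  The projective topology enters through its universal property. The topology pulled back along the
  canonical map is one of those in the supremum, which makes that map continuous; tensoring with a
  fixed section is continuous, which handles the inverse.\<close>

lemma iter_deriv_Nil [simp]: "iter_deriv [] f = f"
  by (simp add: iter_deriv_def)

lemma iter_deriv_snoc:
  "iter_deriv (vs @ [v]) f = iter_deriv vs (\<lambda>x. frechet_derivative f (at x) v)"
  by (simp add: iter_deriv_def)

lemma iter_deriv_Cons:
  "iter_deriv (v # vs) f = (\<lambda>x. frechet_derivative (iter_deriv vs f) (at x) v)"
  by (simp add: iter_deriv_def)

text \<open>Near \<open>x\<close> both functions have exactly the same derivatives, if any, so the
  choice inside \<open>frechet_derivative\<close> returns the same map for both, whether or not they
  are differentiable.\<close>

lemma frechet_derivative_cong_open: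
  assumes "open \<Omega>" "x \<in> \<Omega>" "\<And>y. y \<in> \<Omega> \<Longrightarrow> f y = g y"
  shows "frechet_derivative f (at x) = frechet_derivative g (at x)"
proof -
  have "(f has_derivative f') (at x) \<longleftrightarrow> (g has_derivative f') (at x)" for f'
    using has_derivative_transform_within_open[OF _ assms(1,2)] assms(3) by metis
  then show ?thesis by (simp add: frechet_derivative_def)
qed

lemma differentiable_cong_open:
  assumes "open \<Omega>" "x \<in> \<Omega>" "\<And>y. y \<in> \<Omega> \<Longrightarrow> f y = g y"
  shows "f differentiable at x \<longleftrightarrow> g differentiable at x"
  using has_derivative_transform_within_open[OF _ assms(1,2)] assms(3)
  unfolding differentiable_def by metis

lemma iter_deriv_cong_open:
  assumes "open \<Omega>" "\<And>y. y \<in> \<Omega> \<Longrightarrow> f y = g y" "x \<in> \<Omega>"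
  shows "iter_deriv vs f x = iter_deriv vs g x"
  using assms(3)
proof (induction vs arbitrary: x)
  case (Cons v vs)
  then show ?case
    using frechet_derivative_cong_open[OF assms(1), of x "iter_deriv vs f" "iter_deriv vs g"]
    by (simp add: iter_deriv_Cons)
qed (simp add: assms(2))

text \<open>Finite order turns the product, quotient and chain rules into inductions on
  \<open>k\<close> in which the functions vary. An induction on the list of directions in
  \<open>iter_deriv\<close> would call for explicit Leibniz or Faa di Bruno sums.\<close>

primrec ksmooth_on :: "nat \<Rightarrow> 'b::real_normed_vector set \<Rightarrow> ('b \<Rightarrow> 'c::real_normed_vector) \<Rightarrow> bool" where
  "ksmooth_on 0 \<Omega> f \<longleftrightarrow> (\<forall>x\<in>\<Omega>. f differentiable at x)"
| "ksmooth_on (Suc k) \<Omega> f \<longleftrightarrow> (\<forall>x\<in>\<Omega>. f differentiable at x) \<and>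
    (\<forall>v. ksmooth_on k \<Omega> (\<lambda>x. frechet_derivative f (at x) v))"

lemma ksmooth_on_iff:
  "ksmooth_on k \<Omega> f \<longleftrightarrow> (\<forall>vs. length vs \<le> k \<longrightarrow> (\<forall>x\<in>\<Omega>. iter_deriv vs f differentiable at x))"
proof (induction k arbitrary: f)
  case (Suc k)
  \<comment> \<open>\<open>foldr\<close> applies the last direction first, so lists are split at
    their end: the last entry is the derivative that the recursion of \<open>ksmooth_on\<close>
    takes.\<close>
  have "(\<forall>vs. length vs \<le> Suc k \<longrightarrow> Q vs) \<longleftrightarrow> Q [] \<and> (\<forall>v vs. length vs \<le> k \<longrightarrow> Q (vs @ [v]))"
    for Q :: "'a list \<Rightarrow> bool"
  proof (intro iffI conjI allI impI; (elim conjE)?)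
    fix vs :: "'a list"
    assume "Q []" "\<forall>v vs. length vs \<le> k \<longrightarrow> Q (vs @ [v])" "length vs \<le> Suc k"
    then show "Q vs" by (cases vs rule: rev_cases) auto
  qed auto
  then show ?case by (auto simp: Suc.IH iter_deriv_snoc)
qed simp

lemma smooth_on_iff_ksmooth_on: "smooth_on \<Omega> f \<longleftrightarrow> (\<forall>k. ksmooth_on k \<Omega> f)"
  unfolding smooth_on_def ksmooth_on_iff by blast

lemma ksmooth_on_Suc_imp: "ksmooth_on (Suc k) \<Omega> f \<Longrightarrow> ksmooth_on k \<Omega> f"
  unfolding ksmooth_on_iff by simp

lemma ksmooth_on_differentiable: "ksmooth_on k \<Omega> f \<Longrightarrow> x \<in> \<Omega> \<Longrightarrow> f differentiable at x"
  by (cases k) auto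

lemma smooth_on_frechet_derivative:
  "smooth_on \<Omega> f \<Longrightarrow> smooth_on \<Omega> (\<lambda>x. frechet_derivative f (at x) v)"
  unfolding smooth_on_def using iter_deriv_snoc by metis

lemma smooth_on_differentiable: "smooth_on \<Omega> f \<Longrightarrow> x \<in> \<Omega> \<Longrightarrow> f differentiable at x"
  unfolding smooth_on_def by (metis iter_deriv_Nil)

lemma smooth_on_continuous_iter_deriv:
  "smooth_on \<Omega> f \<Longrightarrow> C \<subseteq> \<Omega> \<Longrightarrow> continuous_on C (iter_deriv vs f)"
  unfolding smooth_on_def
  by (meson continuous_at_imp_continuous_on differentiable_imp_continuous_within subsetD)

lemma ksmooth_on_cong_imp:
  assumes "open \<Omega>" "\<And>x. x \<in> \<Omega> \<Longrightarrow> f x = g x" "ksmooth_on k \<Omega> f"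
  shows "ksmooth_on k \<Omega> g"
  unfolding ksmooth_on_iff
proof (intro allI impI ballI)
  fix vs :: "'a list" and x assume "length vs \<le> k" "x \<in> \<Omega>"
  then show "iter_deriv vs g differentiable at x"
    using assms(3) differentiable_cong_open[of \<Omega> x "iter_deriv vs f" "iter_deriv vs g"]
      iter_deriv_cong_open[of \<Omega> f g _ vs] assms(1,2)
    unfolding ksmooth_on_iff by blast
qed

lemma smooth_on_cong:
  assumes "open \<Omega>" "\<And>x. x \<in> \<Omega> \<Longrightarrow> f x = g x"
  shows "smooth_on \<Omega> f \<longleftrightarrow> smooth_on \<Omega> g"
  unfolding smooth_on_iff_ksmooth_on
proof (intro iffI allI)
  show "ksmooth_on k \<Omega> g" if "\<forall>k. ksmooth_on k \<Omega> f" for k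
    using that by (intro ksmooth_on_cong_imp[OF assms, of "\<lambda>x. x"]) auto
  show "ksmooth_on k \<Omega> f" if "\<forall>k. ksmooth_on k \<Omega> g" for k
    by (rule ksmooth_on_cong_imp[OF assms(1), of g]) (use that assms(2) in auto)
qed

lemma smooth_on_subset: "smooth_on \<Omega> f \<Longrightarrow> \<Omega>' \<subseteq> \<Omega> \<Longrightarrow> smooth_on \<Omega>' f"
  unfolding smooth_on_def by blast

text \<open>The pieces may be arbitrary sets, because \<open>smooth_on\<close> is a pointwise
  condition on derivatives taken in the whole space.\<close>

lemma smooth_on_local:
  "(\<And>x. x \<in> \<Omega> \<Longrightarrow> \<exists>\<Omega>'. x \<in> \<Omega>' \<and> smooth_on \<Omega>' f) \<Longrightarrow> smooth_on \<Omega> f"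
  unfolding smooth_on_def by blast

text \<open>Derivatives are unique, so an explicit formula \<open>f'\<close> may stand in for
  \<open>frechet_derivative\<close>, with which it agrees on the open set. All rules below are
  proved through it.\<close>

lemma ksmooth_on_SucI:
  assumes "open \<Omega>" "\<And>x. x \<in> \<Omega> \<Longrightarrow> (f has_derivative f' x) (at x)"
    "\<And>v. ksmooth_on k \<Omega> (\<lambda>x. f' x v)"
  shows "ksmooth_on (Suc k) \<Omega> f"
proof -
  have "f' x = frechet_derivative f (at x)" if "x \<in> \<Omega>" for x
    using frechet_derivative_at assms(2) that by blast
  then have "ksmooth_on k \<Omega> (\<lambda>x. frechet_derivative f (at x) v)" for v
    by (intro ksmooth_on_cong_imp[OF assms(1) _ assms(3)]) auto
  moreover have "\<forall>x\<in>\<Omega>. f differentiable at x" using assms(2) differentiable_def by blast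
  ultimately show ?thesis by simp
qed

lemma ksmooth_on_has_derivative:
  "ksmooth_on k \<Omega> f \<Longrightarrow> x \<in> \<Omega> \<Longrightarrow> (f has_derivative frechet_derivative f (at x)) (at x)"
  using ksmooth_on_differentiable frechet_derivative_works by blast

lemma ksmooth_on_const: "ksmooth_on k \<Omega> (\<lambda>x. c)"
  by (induction k arbitrary: c) auto

lemma ksmooth_on_add:
  assumes "open \<Omega>" "ksmooth_on k \<Omega> f" "ksmooth_on k \<Omega> g"
  shows "ksmooth_on k \<Omega> (\<lambda>x. f x + g x)"
  using assms(2,3)
proof (induction k arbitrary: f g)
  case (Suc k)
  show ?case
    by (rule ksmooth_on_SucI[OF assms(1) has_derivative_add[OF
            ksmooth_on_has_derivative[OF Suc.prems(1)] ksmooth_on_has_derivative[OF Suc.prems(2)]]])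
      (use Suc in auto)
qed (auto intro: differentiable_add)

lemma (in bounded_linear) ksmooth_on_comp:
  assumes "open \<Omega>" "ksmooth_on k \<Omega> g"
  shows "ksmooth_on k \<Omega> (\<lambda>x. f (g x))"
  using assms(2)
proof (induction k arbitrary: g)
  case 0
  then show ?case using has_derivative unfolding ksmooth_on.simps differentiable_def by blast
next
  case (Suc k)
  show ?case
    by (rule ksmooth_on_SucI[OF assms(1) has_derivative[OF ksmooth_on_has_derivative[OF Suc.prems]]])
      (use Suc in auto)
qed

text \<open>Each term of the derivative pairs an undifferentiated factor with a derivative; the
  former is lowered from order \<open>Suc k\<close> to \<open>k\<close> before the induction
  hypothesis applies. Scalar multiplication, ring multiplication and the inner product are the
  instances used.\<close>

lemma (in bounded_bilinear) ksmooth_on_prod: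
  assumes "open \<Omega>" "ksmooth_on k \<Omega> f" "ksmooth_on k \<Omega> g"
  shows "ksmooth_on k \<Omega> (\<lambda>x. prod (f x) (g x))"
  using assms(2,3)
proof (induction k arbitrary: f g)
  case 0
  then show ?case using FDERIV unfolding ksmooth_on.simps differentiable_def by blast
next
  case (Suc k)
  show ?case
    by (rule ksmooth_on_SucI[OF assms(1) FDERIV[OF
            ksmooth_on_has_derivative[OF Suc.prems(1)] ksmooth_on_has_derivative[OF Suc.prems(2)]]])
      (use Suc.prems Suc.IH ksmooth_on_Suc_imp[OF Suc.prems(1)] ksmooth_on_Suc_imp[OF Suc.prems(2)]
        in \<open>auto intro!: ksmooth_on_add[OF assms(1)]\<close>)
qed

lemma ksmooth_on_sum:
  assumes "open \<Omega>" "\<And>i. i \<in> I \<Longrightarrow> ksmooth_on k \<Omega> (f i)"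
  shows "ksmooth_on k \<Omega> (\<lambda>x. \<Sum>i\<in>I. f i x)"
  using assms(2)
  by (induction I rule: infinite_finite_induct)
    (auto intro: ksmooth_on_add[OF assms(1)] ksmooth_on_const)

lemma ksmooth_on_ident: "open \<Omega> \<Longrightarrow> ksmooth_on k \<Omega> (\<lambda>x. x)"
  by (cases k) (auto intro: ksmooth_on_SucI[OF _ has_derivative_ident] ksmooth_on_const)

text \<open>Up to sign the derivative is a derivative of \<open>f\<close> between two copies of
  \<open>inverse (f x)\<close>. Order \<open>k\<close> of the inverse, known by induction for the
  same \<open>f\<close>, therefore gives order \<open>Suc k\<close>.\<close>

lemma ksmooth_on_inverse:
  fixes f :: "'b::real_normed_vector \<Rightarrow> 'c::real_normed_field"
  assumes "open \<Omega>" "ksmooth_on k \<Omega> f" "\<And>x. x \<in> \<Omega> \<Longrightarrow> f x \<noteq> 0"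
  shows "ksmooth_on k \<Omega> (\<lambda>x. inverse (f x))"
  using assms(2)
proof (induction k)
  case 0
  then show ?case using assms(3) by (auto intro: differentiable_inverse)
next
  case (Suc k)
  note mult = bounded_bilinear.ksmooth_on_prod[OF bounded_bilinear_mult assms(1)]
  show ?case
  proof (rule ksmooth_on_SucI[OF assms(1) Deriv.has_derivative_inverse[OF _ ksmooth_on_has_derivative[OF Suc.prems]]])
    fix v
    have *: "ksmooth_on k \<Omega> (\<lambda>x. inverse (f x))"
      using Suc.IH ksmooth_on_Suc_imp[OF Suc.prems] by blast
    have "ksmooth_on k \<Omega> (\<lambda>x. frechet_derivative f (at x) v)" using Suc.prems by auto
    then have "ksmooth_on k \<Omega> (\<lambda>x. inverse (f x) * frechet_derivative f (at x) v * inverse (f x))"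
      by (intro mult *)
    then show "ksmooth_on k \<Omega> (\<lambda>x. - (inverse (f x) * frechet_derivative f (at x) v * inverse (f x)))"
      by (rule bounded_linear.ksmooth_on_comp[OF bounded_linear_minus[OF bounded_linear_ident] assms(1)])
  qed (use assms(3) in auto)
qed

section \<open>Packing bounds in the model space, and an orthonormal basis\<close>

definition separated :: "'b::metric_space set \<Rightarrow> real \<Rightarrow> bool" where
  "separated S d \<longleftrightarrow> (\<forall>x\<in>S. \<forall>y\<in>S. x \<noteq> y \<longrightarrow> d \<le> dist x y)"

text \<open>\<open>SOME\<close> returns a valid bound, not necessarily the least one. The number
  depends on the model space alone, so a single constant controls overlaps in all charts, much as
  the dimension does in covering theory.\<close>

definition packing_number :: "'b::real_normed_vector itself \<Rightarrow> nat" where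
  "packing_number _ = (SOME N. \<forall>S::'b set. S \<subseteq> cball 0 2 \<longrightarrow> separated S 1 \<longrightarrow> finite S \<and> card S \<le> N)"

text \<open>Pigeonhole: finitely many balls of radius \<open>d/2\<close> cover \<open>C\<close>, and
  two points in one of them have distance less than \<open>d\<close>, so a separated set injects
  into the set of centres.\<close>

lemma separated_card_bound:
  fixes C :: "'b::metric_space set"
  assumes "compact C" "0 < d"
  shows "\<exists>N. \<forall>S. S \<subseteq> C \<longrightarrow> separated S d \<longrightarrow> finite S \<and> card S \<le> N"
proof -
  have "C \<subseteq> (\<Union>x\<in>C. ball x (d/2))" using assms(2) by auto
  then obtain D where D: "finite D" "C \<subseteq> (\<Union>x\<in>D. ball x (d/2))"
    using compactE_image[OF assms(1), of C "\<lambda>x. ball x (d/2)"] by (metis open_ball)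
  have *: "finite S \<and> card S \<le> card D" if S: "S \<subseteq> C" "separated S d" for S
  proof -
    have "\<forall>x\<in>S. \<exists>d'\<in>D. x \<in> ball d' (d/2)" using D(2) S(1) by blast
    then obtain h where h: "\<And>x. x \<in> S \<Longrightarrow> h x \<in> D \<and> x \<in> ball (h x) (d/2)" by metis
    have "inj_on h S"
    proof (rule inj_onI)
      fix x y assume "x \<in> S" "y \<in> S" "h x = h y"
      then have "dist x y < d" using h[of x] h[of y] dist_triangle_half_r[of "h x" x d y] by simp
      then show "x = y" using S(2) \<open>x \<in> S\<close> \<open>y \<in> S\<close> unfolding separated_def by force
    qed
    moreover have "h ` S \<subseteq> D" using h by auto
    ultimately show ?thesis using D(1) card_inj_on_le inj_on_finite by metis
  qed
  show ?thesis by (intro exI[of _ "card D"] allI impI *)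
qed

lemma packing_number:
  fixes S :: "'b::{real_normed_vector,heine_borel} set"
  assumes "S \<subseteq> cball 0 2" "separated S 1"
  shows "finite S \<and> card S \<le> packing_number TYPE('b)"
proof -
  have "\<exists>N. \<forall>S::'b set. S \<subseteq> cball 0 2 \<longrightarrow> separated S 1 \<longrightarrow> finite S \<and> card S \<le> N"
    by (rule separated_card_bound) simp_all
  from someI_ex[OF this] show ?thesis using assms unfolding packing_number_def by blast
qed

text \<open>Translation by \<open>y\<close> and scaling by \<open>1 / d\<close> put the points into
  the ball of radius 2 with unit separation, which is why the bound does not depend on
  \<open>d\<close>.\<close>

lemma packing_number_ball:
  fixes Q :: "'b::{real_normed_vector,heine_borel} set"
  assumes "0 < d" "separated Q d" "\<And>q. q \<in> Q \<Longrightarrow> dist y q < 2 * d"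
  shows "finite Q \<and> card Q \<le> packing_number TYPE('b)"
proof -
  let ?f = "\<lambda>q. (q - y) /\<^sub>R d"
  have dist: "dist (?f p) (?f q) = dist p q / d" for p q
  proof -
    have "?f p - ?f q = (p - q) /\<^sub>R d" by (simp add: scaleR_diff_right[symmetric])
    then show ?thesis using assms(1) by (simp add: dist_norm divide_inverse mult.commute)
  qed
  have "inj_on ?f Q" using assms(1) by (auto simp: inj_on_def)
  moreover have "?f ` Q \<subseteq> cball 0 2"
  proof
    fix z assume "z \<in> ?f ` Q"
    then obtain q where q: "q \<in> Q" "z = ?f q" by auto
    have "norm z = dist y q / d" using q(2) assms(1) by (simp add: dist_norm norm_minus_commute divide_inverse mult.commute)
    then show "z \<in> cball 0 2" using assms(1) assms(3)[OF q(1)] by (simp add: divide_le_eq)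
  qed
  moreover have "separated (?f ` Q) 1"
    unfolding separated_def
  proof (intro ballI impI)
    fix a b assume "a \<in> ?f ` Q" "b \<in> ?f ` Q" "a \<noteq> b"
    then obtain p q where "p \<in> Q" "q \<in> Q" "a = ?f p" "b = ?f q" "p \<noteq> q" by auto
    moreover from this have "d \<le> dist p q" using assms(2) by (simp add: separated_def)
    ultimately show "1 \<le> dist a b" using assms(1) by (simp only: dist) (simp add: le_divide_eq)
  qed
  ultimately show ?thesis using packing_number[of "?f ` Q"] by (simp add: card_image finite_image_iff)
qed

text \<open>A separated set of greatest cardinality is a net, since a point at distance at least
  \<open>d\<close> from all of \<open>Q\<close> could be added to it.\<close>

lemma maximal_separated_subset:
  fixes C :: "'b::metric_space set"
  assumes "compact C" "0 < d"
  obtains Q where "finite Q" "Q \<subseteq> C" "separated Q d" "\<And>y. y \<in> C \<Longrightarrow> \<exists>q\<in>Q. dist y q < d"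
proof -
  obtain N where N: "\<And>S. S \<subseteq> C \<Longrightarrow> separated S d \<Longrightarrow> finite S \<and> card S \<le> N"
    using separated_card_bound[OF assms] by auto
  have "\<exists>Q. (Q \<subseteq> C \<and> separated Q d) \<and> (\<forall>Q'. Q' \<subseteq> C \<and> separated Q' d \<longrightarrow> card Q' \<le> card Q)"
    by (rule ex_has_greatest_nat[of _ "{}" card "Suc N"]) (auto simp: separated_def N less_Suc_eq_le)
  then obtain Q where Q: "Q \<subseteq> C" "separated Q d" "\<And>Q'. Q' \<subseteq> C \<Longrightarrow> separated Q' d \<Longrightarrow> card Q' \<le> card Q"
    by blast
  have fin: "finite Q" using N Q by blast
  have "\<exists>q\<in>Q. dist y q < d" if y: "y \<in> C" for y
  proof (rule ccontr)
    assume "\<not> (\<exists>q\<in>Q. dist y q < d)"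
    then have far: "d \<le> dist y q" if "q \<in> Q" for q using that by force
    have "separated (insert y Q) d"
      using Q(2) far by (auto simp: separated_def dist_commute)
    moreover have "y \<notin> Q" using far[of y] assms(2) by auto
    ultimately show False using Q(3)[of "insert y Q"] Q(1) y fin by simp
  qed
  then show thesis using that fin Q by blast
qed

text \<open>Distinct orthonormal vectors have distance sqrt 2, so the packing number bounds the size
  of an orthonormal set. If a vector were not expanded by a largest one, its normalised remainder
  would enlarge that set. This supplies coordinates for the chain rule, also in dimension 0.\<close>

lemma finite_orthonormal_basis:
  "\<exists>B::'b::{real_inner,heine_borel} set. finite B \<and> (\<forall>v. v = (\<Sum>b\<in>B. inner v b *\<^sub>R b))"
proof -
  define onb where "onb B \<longleftrightarrow> (\<forall>b\<in>B. norm b = 1) \<and> (\<forall>b\<in>B. \<forall>c\<in>B. b \<noteq> c \<longrightarrow> inner b c = 0)"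
    for B :: "'b set"
  let ?N = "packing_number TYPE('b)"
  have fin: "finite B \<and> card B \<le> ?N" if "onb B" for B
  proof (rule packing_number)
    show "B \<subseteq> cball 0 2" using that by (auto simp: onb_def)
    show "separated B 1"
      unfolding separated_def
    proof (intro ballI impI)
      fix x y assume "x \<in> B" "y \<in> B" "x \<noteq> y"
      then have "norm x = 1" "norm y = 1" "inner x y = 0" using that by (auto simp: onb_def)
      then have "(dist x y)\<^sup>2 = 2"
        by (simp add: dist_norm power2_norm_eq_inner inner_diff inner_commute norm_eq_1)
      then show "1 \<le> dist x y" by (smt (verit) power_mono one_power2 zero_le_dist power_le_one)
    qed
  qed
  have "onb {}" by (simp add: onb_def)
  then obtain B where B: "onb B" "\<And>B'. onb B' \<Longrightarrow> card B' \<le> card B"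
  proof -
    have "\<exists>B. onb B \<and> (\<forall>B'. onb B' \<longrightarrow> card B' \<le> card B)"
      by (rule ex_has_greatest_nat[of onb "{}" card "Suc ?N", OF \<open>onb {}\<close>]) (simp add: fin less_Suc_eq_le)
    then show thesis using that by auto
  qed
  have "v = (\<Sum>b\<in>B. inner v b *\<^sub>R b)" for v
  proof (rule ccontr)
    assume ne: "v \<noteq> (\<Sum>b\<in>B. inner v b *\<^sub>R b)"
    define w where "w = v - (\<Sum>b\<in>B. inner v b *\<^sub>R b)"
    have w: "w \<noteq> 0" using ne by (simp add: w_def)
    have orth: "inner w c = 0" if "c \<in> B" for c
    proof -
      have "inner (\<Sum>b\<in>B. inner v b *\<^sub>R b) c = (\<Sum>b\<in>B. if b = c then inner v c else 0)"
        unfolding inner_sum_left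
        by (intro sum.cong refl) (use B(1) that in \<open>auto simp: onb_def norm_eq_1\<close>)
      then show ?thesis using fin[OF B(1)] that by (simp add: w_def inner_diff_left)
    qed
    let ?u = "w /\<^sub>R norm w"
    have "?u \<notin> B" using orth[of ?u] w by (auto simp: dot_square_norm power2_eq_square)
    moreover have "onb (insert ?u B)"
      using B(1) w orth by (auto simp: onb_def inner_commute)
    ultimately show False using B(2)[of "insert ?u B"] fin[OF B(1)] by simp
  qed
  then show ?thesis using fin[OF B(1)] by blast
qed

text \<open>In the derivative of the composite, the direction in which \<open>f\<close> is
  differentiated moves with \<open>x\<close>, while the induction hypothesis handles fixed
  directions. Expanding the direction in an orthonormal basis of the intermediate space leaves
  scalar functions times derivatives of \<open>f\<close> in fixed directions, composed with
  \<open>T\<close>.\<close>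

lemma ksmooth_on_compose:
  fixes T :: "'b::real_normed_vector \<Rightarrow> 'd::{real_inner,heine_borel}"
  assumes "open \<Omega>" "open \<Omega>'" "T ` \<Omega> \<subseteq> \<Omega>'"
    and "ksmooth_on k \<Omega> T" "ksmooth_on k \<Omega>' f"
  shows "ksmooth_on k \<Omega> (\<lambda>x. f (T x))"
  using assms(4,5)
proof (induction k arbitrary: f)
  case 0
  show ?case
    unfolding ksmooth_on.simps
  proof
    fix x assume "x \<in> \<Omega>"
    then have "T differentiable at x" "f differentiable at (T x)" using 0 assms(3) by auto
    from differentiable_chain_at[OF this] show "(\<lambda>x. f (T x)) differentiable at x" by (simp add: o_def)
  qed
next
  case (Suc k)
  obtain B :: "'d set" where B: "finite B" "\<And>v. v = (\<Sum>b\<in>B. inner v b *\<^sub>R b)"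
    using finite_orthonormal_basis by blast
  note T = ksmooth_on_has_derivative[OF Suc.prems(1)]
  have f: "(f has_derivative frechet_derivative f (at (T x))) (at (T x))" if "x \<in> \<Omega>" for x
    using ksmooth_on_has_derivative[OF Suc.prems(2)] assms(3) that by blast
  show ?case
  proof (rule ksmooth_on_SucI[OF assms(1) has_derivative_compose[OF T f]])
    fix v
    have eq: "frechet_derivative f (at (T x)) w =
        (\<Sum>b\<in>B. inner w b *\<^sub>R frechet_derivative f (at (T x)) b)" if "x \<in> \<Omega>" for x w
    proof -
      interpret linear "frechet_derivative f (at (T x))"
        using f[OF that] has_derivative_linear by blast
      have "frechet_derivative f (at (T x)) w = frechet_derivative f (at (T x)) (\<Sum>b\<in>B. inner w b *\<^sub>R b)"
        using B(2)[of w] by simp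
      then show ?thesis by (simp add: sum scale)
    qed
    have "ksmooth_on k \<Omega> (\<lambda>x. \<Sum>b\<in>B. inner (frechet_derivative T (at x) v) b *\<^sub>R
        frechet_derivative f (at (T x)) b)"
      using Suc.prems ksmooth_on_Suc_imp[OF Suc.prems(1)]
      by (intro ksmooth_on_sum bounded_bilinear.ksmooth_on_prod[OF bounded_bilinear_scaleR] assms(1)
          bounded_linear.ksmooth_on_comp[OF bounded_linear_inner_left] Suc.IH) auto
    then show "ksmooth_on k \<Omega> (\<lambda>x. frechet_derivative f (at (T x)) (frechet_derivative T (at x) v))"
      by (rule ksmooth_on_cong_imp[OF assms(1), rotated]) (rule eq[symmetric])
  qed
qed

section \<open>Closure properties of smooth maps on open sets\<close>

lemma smooth_on_const: "smooth_on \<Omega> (\<lambda>x. c)"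
  by (simp add: smooth_on_iff_ksmooth_on ksmooth_on_const)

lemma smooth_on_ident: "open \<Omega> \<Longrightarrow> smooth_on \<Omega> (\<lambda>x. x)"
  by (simp add: smooth_on_iff_ksmooth_on ksmooth_on_ident)

lemma smooth_on_add:
  "open \<Omega> \<Longrightarrow> smooth_on \<Omega> f \<Longrightarrow> smooth_on \<Omega> g \<Longrightarrow> smooth_on \<Omega> (\<lambda>x. f x + g x)"
  by (simp add: smooth_on_iff_ksmooth_on ksmooth_on_add)

lemma smooth_on_mult:
  fixes f g :: "'b::real_normed_vector \<Rightarrow> 'c::real_normed_algebra"
  shows "open \<Omega> \<Longrightarrow> smooth_on \<Omega> f \<Longrightarrow> smooth_on \<Omega> g \<Longrightarrow> smooth_on \<Omega> (\<lambda>x. f x * g x)"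
  by (simp add: smooth_on_iff_ksmooth_on bounded_bilinear.ksmooth_on_prod[OF bounded_bilinear_mult])

lemma smooth_on_inner:
  "open \<Omega> \<Longrightarrow> smooth_on \<Omega> f \<Longrightarrow> smooth_on \<Omega> g \<Longrightarrow> smooth_on \<Omega> (\<lambda>x. inner (f x) (g x))"
  by (simp add: smooth_on_iff_ksmooth_on bounded_bilinear.ksmooth_on_prod[OF bounded_bilinear_inner])

lemma smooth_on_bounded_linear:
  "bounded_linear L \<Longrightarrow> open \<Omega> \<Longrightarrow> smooth_on \<Omega> f \<Longrightarrow> smooth_on \<Omega> (\<lambda>x. L (f x))"
  by (simp add: smooth_on_iff_ksmooth_on bounded_linear.ksmooth_on_comp)

lemma smooth_on_diff:
  "open \<Omega> \<Longrightarrow> smooth_on \<Omega> f \<Longrightarrow> smooth_on \<Omega> g \<Longrightarrow> smooth_on \<Omega> (\<lambda>x. f x - g x)"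
  using smooth_on_add[of \<Omega> f "\<lambda>x. - g x"]
    smooth_on_bounded_linear[OF bounded_linear_minus[OF bounded_linear_ident], of \<Omega> g] by simp

lemma smooth_on_inverse:
  fixes f :: "'b::real_normed_vector \<Rightarrow> 'c::real_normed_field"
  shows "open \<Omega> \<Longrightarrow> smooth_on \<Omega> f \<Longrightarrow> (\<And>x. x \<in> \<Omega> \<Longrightarrow> f x \<noteq> 0) \<Longrightarrow> smooth_on \<Omega> (\<lambda>x. inverse (f x))"
  by (simp add: smooth_on_iff_ksmooth_on ksmooth_on_inverse)

lemma smooth_on_compose:
  fixes T :: "'b::real_normed_vector \<Rightarrow> 'd::{real_inner,heine_borel}"
  shows "open \<Omega> \<Longrightarrow> open \<Omega>' \<Longrightarrow> T ` \<Omega> \<subseteq> \<Omega>' \<Longrightarrow> smooth_on \<Omega> T \<Longrightarrow> smooth_on \<Omega>' f \<Longrightarrow>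
    smooth_on \<Omega> (\<lambda>x. f (T x))"
  using ksmooth_on_compose unfolding smooth_on_iff_ksmooth_on by blast

subsection \<open>A flat function\<close>

text \<open>The function exp(-1/t) t^(-n), extended by 0 to the left. The classical flat function is
  the case n = 0; the negative powers make the family closed under differentiation, up to linear
  combinations.\<close>

definition flat :: "nat \<Rightarrow> real \<Rightarrow> real" where
  "flat n t = (if t \<le> 0 then 0 else exp (- inverse t) * inverse t ^ n)"

lemma flat_nonneg: "0 \<le> flat n t"
  by (simp add: flat_def)

lemma flat_eq_0_iff: "flat n t = 0 \<longleftrightarrow> t \<le> 0"
  by (simp add: flat_def)

text \<open>With s = 1/t the limit from the right is that of s^n / exp s at infinity.\<close>

lemma flat_tendsto_0: "(flat n \<longlongrightarrow> 0) (at 0)"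
proof -
  have "((\<lambda>t. inverse t ^ n / exp (inverse t)) \<longlongrightarrow> 0) (at_right (0::real))"
    by (rule filterlim_compose[OF tendsto_power_div_exp_0 filterlim_inverse_at_top_right])
  then have "(flat n \<longlongrightarrow> 0) (at_right 0)"
    by (rule Lim_transform_eventually)
      (auto simp: eventually_at_filter flat_def exp_minus field_simps intro!: always_eventually)
  moreover have "(flat n \<longlongrightarrow> 0) (at_left 0)"
    by (rule Lim_transform_eventually[OF tendsto_const])
      (auto simp: eventually_at_filter flat_def intro!: always_eventually)
  ultimately show ?thesis by (rule filterlim_split_at_real[rotated])
qed

lemma flat_has_field_derivative:
  "(flat n has_field_derivative flat (n + 2) t - of_nat n * flat (Suc n) t) (at t)"
proof -
  consider "t > 0" | "t < 0" | "t = 0" by linarith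
  then show ?thesis
  proof cases
    case 1
    have "((\<lambda>t. exp (- inverse t) * inverse t ^ n) has_field_derivative
        flat (n + 2) t - of_nat n * flat (Suc n) t) (at t)"
      using 1 by (auto intro!: derivative_eq_intros simp: flat_def power2_eq_square algebra_simps)
        (cases n; simp add: algebra_simps)
    then show ?thesis
      by (rule has_field_derivative_transform_within_open[where S = "{0<..}"])
        (use 1 in \<open>auto simp: flat_def\<close>)
  next
    case 2
    have "((\<lambda>t. 0) has_field_derivative flat (n + 2) t - of_nat n * flat (Suc n) t) (at t)"
      using 2 by (simp add: flat_def)
    then show ?thesis
      by (rule has_field_derivative_transform_within_open[where S = "{..<0}"])
        (use 2 in \<open>auto simp: flat_def\<close>)
  next
    case 3
    \<comment> \<open>At 0 the difference quotient of \<open>flat n\<close> is exactly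
      \<open>flat (Suc n)\<close>, whose limit is 0.\<close>
    have "((\<lambda>h. (flat n (0 + h) - flat n 0) / h) \<longlongrightarrow> 0) (at 0)"
      by (rule Lim_transform_eventually[OF flat_tendsto_0[of "Suc n"]])
        (auto simp: eventually_at_filter flat_def field_simps intro!: always_eventually)
    then show ?thesis using 3 by (simp add: DERIV_def) (simp add: flat_def)
  qed
qed

lemma smooth_on_flat: "smooth_on UNIV (flat n)"
proof -
  have "ksmooth_on k UNIV (flat n)" for k
  proof (induction k arbitrary: n)
    case 0
    then show ?case using flat_has_field_derivative
      unfolding ksmooth_on.simps has_field_derivative_def differentiable_def by blast
  next
    case (Suc k)
    show ?case
    proof (rule ksmooth_on_SucI[OF _ flat_has_field_derivative[unfolded has_field_derivative_def]])
      fix v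
      have "ksmooth_on k UNIV (\<lambda>x. v * (flat (n + 2) x + (- of_nat n) * flat (Suc n) x))"
        by (intro bounded_bilinear.ksmooth_on_prod[OF bounded_bilinear_mult] ksmooth_on_add
            ksmooth_on_const Suc open_UNIV)
      then show "ksmooth_on k UNIV (\<lambda>x. (flat (n + 2) x - of_nat n * flat (Suc n) x) * v)"
        by (simp add: mult.commute)
    qed simp
  qed
  then show ?thesis by (simp add: smooth_on_iff_ksmooth_on)
qed

subsection \<open>Convergence of all derivatives on compact sets\<close>

text \<open>Convergence of smooth functions with all derivatives on compact sets, along an arbitrary
  filter. With the filter \<open>nhdsin Z z0\<close> it expresses continuity at \<open>z0\<close>,
  so that continuity of maps between section spaces can be proved by calculus with limits instead of
  with generating open sets.\<close>

definition smooth_convergent ::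
  "'b::real_normed_vector set \<Rightarrow> 'z filter \<Rightarrow> ('z \<Rightarrow> 'b \<Rightarrow> 'c::real_normed_vector) \<Rightarrow> ('b \<Rightarrow> 'c) \<Rightarrow> bool"
  where "smooth_convergent \<Omega> F h h0 \<longleftrightarrow> eventually (\<lambda>z. smooth_on \<Omega> (h z)) F \<and> smooth_on \<Omega> h0 \<and>
    (\<forall>C vs. compact C \<and> C \<subseteq> \<Omega> \<longrightarrow> uniform_limit C (\<lambda>z. iter_deriv vs (h z)) (iter_deriv vs h0) F)"

lemma uniform_limit_transform:
  assumes "uniform_limit S f h F" "eventually (\<lambda>y. \<forall>x\<in>S. f y x = g y x) F" "\<And>x. x \<in> S \<Longrightarrow> h x = i x"
  shows "uniform_limit S g i F"
  using uniform_limit_cong[OF assms(2,3)] assms(1) by auto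

lemma smooth_convergent_const:
  "smooth_on \<Omega> f \<Longrightarrow> smooth_convergent \<Omega> F (\<lambda>z. f) f"
  by (auto simp: smooth_convergent_def intro: uniform_limitI)

lemma smooth_convergent_cong:
  assumes "open \<Omega>" "eventually (\<lambda>z. \<forall>x\<in>\<Omega>. h z x = g z x) F" "\<And>x. x \<in> \<Omega> \<Longrightarrow> h0 x = g0 x"
    "smooth_convergent \<Omega> F h h0"
  shows "smooth_convergent \<Omega> F g g0"
  unfolding smooth_convergent_def
proof (intro conjI allI impI)
  show "eventually (\<lambda>z. smooth_on \<Omega> (g z)) F"
    using assms(4)[unfolded smooth_convergent_def, THEN conjunct1] assms(2)
    by eventually_elim (use smooth_on_cong[OF assms(1)] in blast)
  show "smooth_on \<Omega> g0"
    using assms(3,4) smooth_on_cong[OF assms(1)] unfolding smooth_convergent_def by blast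
  fix C :: "'a set" and vs assume C: "compact C \<and> C \<subseteq> \<Omega>"
  have 1: "eventually (\<lambda>z. \<forall>x\<in>C. iter_deriv vs (h z) x = iter_deriv vs (g z) x) F"
    using assms(2)
  proof eventually_elim
    case (elim z)
    then show ?case using C iter_deriv_cong_open[OF assms(1), of "h z" "g z"] by blast
  qed
  have 2: "iter_deriv vs h0 x = iter_deriv vs g0 x" if "x \<in> C" for x
    using iter_deriv_cong_open[of \<Omega> h0 g0 x vs] assms(1,3) C that by auto
  have 3: "uniform_limit C (\<lambda>z. iter_deriv vs (h z)) (iter_deriv vs h0) F"
    using assms(4) C unfolding smooth_convergent_def by blast
  show "uniform_limit C (\<lambda>z. iter_deriv vs (g z)) (iter_deriv vs g0) F"
    by (rule uniform_limit_transform[OF 3 1 2])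
qed

lemma smooth_convergent_subset:
  "smooth_convergent \<Omega> F h h0 \<Longrightarrow> \<Omega>' \<subseteq> \<Omega> \<Longrightarrow> smooth_convergent \<Omega>' F h h0"
  unfolding smooth_convergent_def
  by (auto intro: smooth_on_subset elim!: eventually_mono)

lemma iter_deriv_add:
  assumes "open \<Omega>" "smooth_on \<Omega> f" "smooth_on \<Omega> g" "x \<in> \<Omega>"
  shows "iter_deriv vs (\<lambda>x. f x + g x) x = iter_deriv vs f x + iter_deriv vs g x"
  using assms(2-4)
proof (induction vs arbitrary: f g x rule: rev_induct)
  case (snoc v vs)
  have "iter_deriv vs (\<lambda>x. frechet_derivative (\<lambda>x. f x + g x) (at x) v) x =
     iter_deriv vs (\<lambda>x. frechet_derivative f (at x) v + frechet_derivative g (at x) v) x"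
  proof (rule iter_deriv_cong_open[OF assms(1) _ snoc.prems(3)])
    fix y assume "y \<in> \<Omega>"
    then have "(f has_derivative frechet_derivative f (at y)) (at y)"
      "(g has_derivative frechet_derivative g (at y)) (at y)"
      using snoc.prems smooth_on_differentiable frechet_derivative_works by blast+
    from frechet_derivative_at[OF has_derivative_add[OF this], symmetric]
    show "frechet_derivative (\<lambda>x. f x + g x) (at y) v =
        frechet_derivative f (at y) v + frechet_derivative g (at y) v"
      by simp
  qed
  then show ?case
    using snoc.IH[OF smooth_on_frechet_derivative smooth_on_frechet_derivative] snoc.prems
    by (simp add: iter_deriv_snoc)
qed simp

lemma smooth_convergent_add:
  assumes "open \<Omega>" "smooth_convergent \<Omega> F h h0" "smooth_convergent \<Omega> F g g0"
  shows "smooth_convergent \<Omega> F (\<lambda>z x. h z x + g z x) (\<lambda>x. h0 x + g0 x)"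
  unfolding smooth_convergent_def
proof (intro conjI allI impI)
  have ev: "eventually (\<lambda>z. smooth_on \<Omega> (h z) \<and> smooth_on \<Omega> (g z)) F"
    using assms(2,3) by (simp add: smooth_convergent_def eventually_conj)
  have s0: "smooth_on \<Omega> h0" "smooth_on \<Omega> g0" using assms(2,3) by (auto simp: smooth_convergent_def)
  show "eventually (\<lambda>z. smooth_on \<Omega> (\<lambda>x. h z x + g z x)) F"
    using ev by eventually_elim (use smooth_on_add assms(1) in blast)
  show "smooth_on \<Omega> (\<lambda>x. h0 x + g0 x)" using smooth_on_add assms(1) s0 by blast
  fix C :: "'a set" and vs assume C: "compact C \<and> C \<subseteq> \<Omega>"
  have "uniform_limit C (\<lambda>z x. iter_deriv vs (h z) x + iter_deriv vs (g z) x)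
      (\<lambda>x. iter_deriv vs h0 x + iter_deriv vs g0 x) F"
    using assms(2,3) C unfolding smooth_convergent_def by (intro uniform_limit_add) auto
  moreover have "eventually (\<lambda>z. \<forall>x\<in>C. iter_deriv vs (h z) x + iter_deriv vs (g z) x =
      iter_deriv vs (\<lambda>x. h z x + g z x) x) F"
    using ev by eventually_elim (use iter_deriv_add[OF assms(1)] C in fastforce)
  moreover have "iter_deriv vs h0 x + iter_deriv vs g0 x = iter_deriv vs (\<lambda>x. h0 x + g0 x) x"
    if "x \<in> C" for x
    using iter_deriv_add[OF assms(1) s0] C that by fastforce
  ultimately show "uniform_limit C (\<lambda>z. iter_deriv vs (\<lambda>x. h z x + g z x))
      (iter_deriv vs (\<lambda>x. h0 x + g0 x)) F"
    by (rule uniform_limit_transform)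
qed

lemma smooth_convergent_frechet_derivative:
  assumes "smooth_convergent \<Omega> F h h0"
  shows "smooth_convergent \<Omega> F
    (\<lambda>z x. frechet_derivative (h z) (at x) v) (\<lambda>x. frechet_derivative h0 (at x) v)"
proof -
  have *: "eventually (\<lambda>z. smooth_on \<Omega> (h z)) F" "smooth_on \<Omega> h0"
    "\<And>C vs. compact C \<Longrightarrow> C \<subseteq> \<Omega> \<Longrightarrow> uniform_limit C (\<lambda>z. iter_deriv vs (h z)) (iter_deriv vs h0) F"
    using assms by (simp_all add: smooth_convergent_def)
  from *(1) have "eventually (\<lambda>z. smooth_on \<Omega> (\<lambda>x. frechet_derivative (h z) (at x) v)) F"
    by (rule eventually_mono) (rule smooth_on_frechet_derivative)
  then show ?thesis
    using *(3)[of _ "_ @ [v]"] smooth_on_frechet_derivative[OF *(2)]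
    by (simp add: smooth_convergent_def iter_deriv_snoc)
qed

lemma frechet_derivative_mult:
  fixes f g :: "'b::real_normed_vector \<Rightarrow> 'c::real_normed_algebra"
  assumes "f differentiable at x" "g differentiable at x"
  shows "frechet_derivative (\<lambda>x. f x * g x) (at x) v =
    f x * frechet_derivative g (at x) v + frechet_derivative f (at x) v * g x"
proof -
  have "(f has_derivative frechet_derivative f (at x)) (at x)"
    "(g has_derivative frechet_derivative g (at x)) (at x)"
    using assms frechet_derivative_works by blast+
  from frechet_derivative_at[OF has_derivative_mult[OF this], symmetric] show ?thesis by simp
qed

text \<open>Peeling off the derivative that is taken first writes the derivative of the product as a
  sum of two products of smoothly convergent families. The induction over the list of directions
  therefore generalises all four functions and meets no binomial sums.\<close>

lemma smooth_convergent_mult: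
  fixes h g :: "'z \<Rightarrow> 'b::real_normed_vector \<Rightarrow> 'c::real_normed_algebra"
  assumes "open \<Omega>" "smooth_convergent \<Omega> F h h0" "smooth_convergent \<Omega> F g g0"
  shows "smooth_convergent \<Omega> F (\<lambda>z x. h z x * g z x) (\<lambda>x. h0 x * g0 x)"
proof -
  have "uniform_limit C (\<lambda>z. iter_deriv vs (\<lambda>x. h z x * g z x)) (iter_deriv vs (\<lambda>x. h0 x * g0 x)) F"
    if C: "compact C" "C \<subseteq> \<Omega>" for C vs
    using assms(2,3)
  proof (induction vs arbitrary: h g h0 g0 rule: rev_induct)
    case Nil
    have "uniform_limit C (\<lambda>z. iter_deriv [] (h z)) (iter_deriv [] h0) F"
      "uniform_limit C (\<lambda>z. iter_deriv [] (g z)) (iter_deriv [] g0) F"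
      and s0: "smooth_on \<Omega> h0" "smooth_on \<Omega> g0"
      using Nil C unfolding smooth_convergent_def by blast+
    then have "uniform_limit C h h0 F" "uniform_limit C g g0 F" by simp_all
    \<comment> \<open>Uniform limits may be multiplied when the limits are bounded; here they are
      continuous on a compact set.\<close>
    moreover have "continuous_on C h0" "continuous_on C g0"
      using smooth_on_continuous_iter_deriv[OF s0(1) C(2), of "[]"]
        smooth_on_continuous_iter_deriv[OF s0(2) C(2), of "[]"] by simp_all
    then have "bounded (h0 ` C)" "bounded (g0 ` C)"
      using C(1) compact_imp_bounded compact_continuous_image by blast+
    ultimately show ?case by (simp add: uniform_lim_mult)
  next
    case (snoc v vs)
    let ?D = "\<lambda>f x. frechet_derivative f (at x) v"
    have ev: "eventually (\<lambda>z. smooth_on \<Omega> (h z) \<and> smooth_on \<Omega> (g z)) F"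
      using snoc.prems by (simp add: smooth_convergent_def eventually_conj)
    have s0: "smooth_on \<Omega> h0" "smooth_on \<Omega> g0" using snoc.prems by (auto simp: smooth_convergent_def)
    note D = smooth_convergent_frechet_derivative[of _ _ _ _ v]
    have split: "iter_deriv vs (\<lambda>x. f x * ?D f' x) x + iter_deriv vs (\<lambda>x. ?D f x * f' x) x =
        iter_deriv (vs @ [v]) (\<lambda>x. f x * f' x) x"
      if "smooth_on \<Omega> f" "smooth_on \<Omega> f'" "x \<in> \<Omega>" for x and f f' :: "'b \<Rightarrow> 'c"
    proof -
      have "iter_deriv (vs @ [v]) (\<lambda>x. f x * f' x) x = iter_deriv vs (\<lambda>x. f x * ?D f' x + ?D f x * f' x) x"
        unfolding iter_deriv_snoc
        by (intro iter_deriv_cong_open[OF assms(1) _ that(3)] frechet_derivative_mult)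
          (use that smooth_on_differentiable in auto)
      also have "\<dots> = iter_deriv vs (\<lambda>x. f x * ?D f' x) x + iter_deriv vs (\<lambda>x. ?D f x * f' x) x"
        by (intro iter_deriv_add[OF assms(1) _ _ that(3)] smooth_on_mult assms(1)
            smooth_on_frechet_derivative that(1,2))
      finally show ?thesis by simp
    qed
    have "uniform_limit C (\<lambda>z x. iter_deriv vs (\<lambda>x. h z x * ?D (g z) x) x + iter_deriv vs (\<lambda>x. ?D (h z) x * g z x) x)
        (\<lambda>x. iter_deriv vs (\<lambda>x. h0 x * ?D g0 x) x + iter_deriv vs (\<lambda>x. ?D h0 x * g0 x) x) F"
      by (intro uniform_limit_add snoc.IH D snoc.prems)
    moreover have "eventually (\<lambda>z. \<forall>x\<in>C. iter_deriv vs (\<lambda>x. h z x * ?D (g z) x) x +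
        iter_deriv vs (\<lambda>x. ?D (h z) x * g z x) x = iter_deriv (vs @ [v]) (\<lambda>x. h z x * g z x) x) F"
      using ev by eventually_elim (use split C in fastforce)
    moreover have "iter_deriv vs (\<lambda>x. h0 x * ?D g0 x) x + iter_deriv vs (\<lambda>x. ?D h0 x * g0 x) x =
        iter_deriv (vs @ [v]) (\<lambda>x. h0 x * g0 x) x" if "x \<in> C" for x
      using split[OF s0] C that by blast
    ultimately show ?case
      by (rule uniform_limit_transform)
  qed
  moreover have "eventually (\<lambda>z. smooth_on \<Omega> (\<lambda>x. h z x * g z x)) F"
    using assms(2)[unfolded smooth_convergent_def, THEN conjunct1]
      assms(3)[unfolded smooth_convergent_def, THEN conjunct1]
    by eventually_elim (use smooth_on_mult assms(1) in blast)
  moreover have "smooth_on \<Omega> (\<lambda>x. h0 x * g0 x)"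
    using smooth_on_mult assms unfolding smooth_convergent_def by blast
  ultimately show ?thesis unfolding smooth_convergent_def by blast
qed

lemma smooth_convergent_sum:
  assumes "open \<Omega>" "\<And>i. i \<in> I \<Longrightarrow> smooth_convergent \<Omega> F (h i) (h0 i)"
  shows "smooth_convergent \<Omega> F (\<lambda>z x. \<Sum>i\<in>I. h i z x) (\<lambda>x. \<Sum>i\<in>I. h0 i x)"
  using assms(2)
proof (induction I rule: infinite_finite_induct)
  case (insert i I)
  then show ?case
    using smooth_convergent_add[OF assms(1) insert.prems[of i] insert.IH] by simp
qed (simp_all add: smooth_convergent_const smooth_on_const)

lemma uniform_limit_finite_cover:
  fixes W :: "'b set set"
  assumes fin: "finite W" and cov: "S \<subseteq> \<Union>W" and lim: "\<And>C. C \<in> W \<Longrightarrow> uniform_limit C f g F"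
  shows "uniform_limit S f g F"
  unfolding uniform_limit_iff
proof (intro allI impI)
  fix e :: real assume "e > 0"
  then have "\<forall>C\<in>W. eventually (\<lambda>z. \<forall>x\<in>C. dist (f z x) (g x) < e) F"
    using lim by (simp add: uniform_limit_iff)
  then have "eventually (\<lambda>z. \<forall>C\<in>W. \<forall>x\<in>C. dist (f z x) (g x) < e) F"
    using fin by (simp add: eventually_ball_finite)
  then show "eventually (\<lambda>z. \<forall>x\<in>S. dist (f z x) (g x) < e) F"
    by eventually_elim (use cov in blast)
qed

text \<open>Convergence on a piece concerns its compact subsets, so \<open>C\<close> is covered by
  finitely many closed balls, each compact and inside one piece. Eventual smoothness on all of
  \<open>\<Omega>\<close> is assumed separately, since the eventualities of infinitely many pieces
  need not combine.\<close>

lemma smooth_convergent_local: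
  fixes \<Omega> :: "'b::{real_normed_vector,heine_borel} set"
  assumes "eventually (\<lambda>z. smooth_on \<Omega> (h z)) F"
    and loc: "\<And>x. x \<in> \<Omega> \<Longrightarrow> \<exists>\<Omega>'. open \<Omega>' \<and> x \<in> \<Omega>' \<and> smooth_convergent \<Omega>' F h h0"
  shows "smooth_convergent \<Omega> F h h0"
  unfolding smooth_convergent_def
proof (intro conjI allI impI)
  show "smooth_on \<Omega> h0" using loc smooth_on_local[of \<Omega> h0] unfolding smooth_convergent_def by blast
  fix C :: "'b set" and vs assume C: "compact C \<and> C \<subseteq> \<Omega>"
  have "\<exists>r>0. uniform_limit (cball x r) (\<lambda>z. iter_deriv vs (h z)) (iter_deriv vs h0) F" if "x \<in> C" for x
  proof -
    obtain \<Omega>' where \<Omega>': "open \<Omega>'" "x \<in> \<Omega>'" "smooth_convergent \<Omega>' F h h0" using loc C \<open>x \<in> C\<close> by blast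
    then obtain r where "r > 0" "cball x r \<subseteq> \<Omega>'" using open_contains_cball by blast
    then show ?thesis using \<Omega>'(3) compact_cball unfolding smooth_convergent_def by blast
  qed
  then obtain r where r: "\<And>x. x \<in> C \<Longrightarrow> r x > 0"
    "\<And>x. x \<in> C \<Longrightarrow> uniform_limit (cball x (r x)) (\<lambda>z. iter_deriv vs (h z)) (iter_deriv vs h0) F"
    by metis
  have "C \<subseteq> (\<Union>x\<in>C. ball x (r x))" using r(1) by force
  then obtain D where D: "D \<subseteq> C" "finite D" "C \<subseteq> (\<Union>x\<in>D. ball x (r x))"
    using compactE_image[of C C "\<lambda>x. ball x (r x)"] C by (metis open_ball)
  show "uniform_limit C (\<lambda>z. iter_deriv vs (h z)) (iter_deriv vs h0) F"
  proof (rule uniform_limit_finite_cover[of "(\<lambda>x. cball x (r x)) ` D"])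
    show "C \<subseteq> \<Union>((\<lambda>x. cball x (r x)) ` D)" using D(3) ball_subset_cball by blast
    show "uniform_limit B (\<lambda>z. iter_deriv vs (h z)) (iter_deriv vs h0) F"
      if "B \<in> (\<lambda>x. cball x (r x)) ` D" for B
      using that r(2) D(1) by blast
  qed (use D(2) in simp)
qed (rule assms(1))

section \<open>Tensor products of modules\<close>

text \<open>Forgetting the scalars lets one set of finite-sum lemmas serve maps linear over the
  functions, maps linear over the field, maps between modules over different rings, and evaluation
  of sections at a point.\<close>

definition additive_map :: "('p, 'v) ring_scheme \<Rightarrow> ('q, 'w) ring_scheme \<Rightarrow> ('p \<Rightarrow> 'q) \<Rightarrow> bool" where
  "additive_map P Q f \<longleftrightarrow> f \<in> carrier P \<rightarrow> carrier Q \<and>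
    (\<forall>x\<in>carrier P. \<forall>y\<in>carrier P. f (x \<oplus>\<^bsub>P\<^esub> y) = f x \<oplus>\<^bsub>Q\<^esub> f y)"

lemma additive_mapD:
  assumes "additive_map P Q f"
  shows "x \<in> carrier P \<Longrightarrow> f x \<in> carrier Q"
    and "x \<in> carrier P \<Longrightarrow> y \<in> carrier P \<Longrightarrow> f (x \<oplus>\<^bsub>P\<^esub> y) = f x \<oplus>\<^bsub>Q\<^esub> f y"
  using assms by (auto simp: additive_map_def)

lemma module_homD:
  assumes "f \<in> module_hom R P Q"
  shows "additive_map P Q f" "x \<in> carrier P \<Longrightarrow> f x \<in> carrier Q"
    and "x \<in> carrier P \<Longrightarrow> y \<in> carrier P \<Longrightarrow> f (x \<oplus>\<^bsub>P\<^esub> y) = f x \<oplus>\<^bsub>Q\<^esub> f y"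
    and "a \<in> carrier R \<Longrightarrow> x \<in> carrier P \<Longrightarrow> f (a \<odot>\<^bsub>P\<^esub> x) = a \<odot>\<^bsub>Q\<^esub> f x"
  using assms by (auto simp: additive_map_def module_hom_def)

lemma module_homI:
  assumes "\<And>x. x \<in> carrier P \<Longrightarrow> f x \<in> carrier Q"
    and "\<And>x y. x \<in> carrier P \<Longrightarrow> y \<in> carrier P \<Longrightarrow> f (x \<oplus>\<^bsub>P\<^esub> y) = f x \<oplus>\<^bsub>Q\<^esub> f y"
    and "\<And>a x. a \<in> carrier R \<Longrightarrow> x \<in> carrier P \<Longrightarrow> f (a \<odot>\<^bsub>P\<^esub> x) = a \<odot>\<^bsub>Q\<^esub> f x"
  shows "f \<in> module_hom R P Q"
  using assms by (auto simp: module_hom_def)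

lemma additive_map_zero:
  assumes "abelian_group P" "abelian_group Q" "additive_map P Q f"
  shows "f \<zero>\<^bsub>P\<^esub> = \<zero>\<^bsub>Q\<^esub>"
proof -
  interpret P: abelian_group P by fact
  interpret Q: abelian_group Q by fact
  have c: "f \<zero>\<^bsub>P\<^esub> \<in> carrier Q" using additive_mapD(1)[OF assms(3)] by simp
  have "f \<zero>\<^bsub>P\<^esub> = f \<zero>\<^bsub>P\<^esub> \<oplus>\<^bsub>Q\<^esub> f \<zero>\<^bsub>P\<^esub>"
    using additive_mapD(2)[OF assms(3) P.zero_closed P.zero_closed] by simp
  then have "f \<zero>\<^bsub>P\<^esub> \<oplus>\<^bsub>Q\<^esub> f \<zero>\<^bsub>P\<^esub> = f \<zero>\<^bsub>P\<^esub> \<oplus>\<^bsub>Q\<^esub> \<zero>\<^bsub>Q\<^esub>" using c by simp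
  then show ?thesis using Q.add.l_cancel[of "f \<zero>\<^bsub>P\<^esub>" "f \<zero>\<^bsub>P\<^esub>" "\<zero>\<^bsub>Q\<^esub>"] c by simp
qed

lemma (in abelian_group) minus_eq_zero_iff:
  assumes "x \<in> carrier G" "y \<in> carrier G"
  shows "x \<ominus> y = \<zero> \<longleftrightarrow> x = y"
proof
  assume "x \<ominus> y = \<zero>"
  then have "(x \<ominus> y) \<oplus> y = y" using assms by simp
  then show "x = y" using assms by (simp add: a_minus_def a_assoc l_neg)
qed (use assms in \<open>simp add: a_minus_def r_neg\<close>)

lemma additive_map_minus:
  assumes "abelian_group P" "abelian_group Q" "additive_map P Q f" "x \<in> carrier P" "y \<in> carrier P"
  shows "f (x \<ominus>\<^bsub>P\<^esub> y) = f x \<ominus>\<^bsub>Q\<^esub> f y"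
proof -
  interpret P: abelian_group P by fact
  interpret Q: abelian_group Q by fact
  note f = additive_mapD[OF assms(3)]
  have "f (\<ominus>\<^bsub>P\<^esub> y) \<oplus>\<^bsub>Q\<^esub> f y = \<zero>\<^bsub>Q\<^esub>"
    using f(2)[of "\<ominus>\<^bsub>P\<^esub> y" y] assms(5) additive_map_zero[OF assms(1-3)] by (simp add: P.l_neg)
  then have "f (\<ominus>\<^bsub>P\<^esub> y) = \<ominus>\<^bsub>Q\<^esub> f y"
    using f(1) assms(5) by (simp add: Q.minus_equality)
  then show ?thesis using f(2)[of x "\<ominus>\<^bsub>P\<^esub> y"] assms(4,5) by (simp add: a_minus_def)
qed

lemma additive_map_finsum:
  assumes "abelian_group P" "abelian_group Q" "additive_map P Q f" "finite I" "x \<in> I \<rightarrow> carrier P"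
  shows "f (\<Oplus>\<^bsub>P\<^esub>i\<in>I. x i) = (\<Oplus>\<^bsub>Q\<^esub>i\<in>I. f (x i))"
proof -
  interpret P: abelian_group P by fact
  interpret Q: abelian_group Q by fact
  note f = additive_mapD[OF assms(3)]
  show ?thesis
    using assms(4,5)
  proof (induction I rule: finite_induct)
    case empty
    then show ?case using additive_map_zero[OF assms(1-3)] by simp
  next
    case (insert i I)
    have x: "x \<in> I \<rightarrow> carrier P" "x i \<in> carrier P" "finsum P x I \<in> carrier P" 
      using insert.prems P.finsum_closed[of x I] by auto
    have "(\<lambda>i. f (x i)) \<in> I \<rightarrow> carrier Q" using f(1) x by auto
    then show ?case using insert.IH insert.hyps x f by simp
  qed
qed

lemma additive_map_comp:
  "additive_map P Q f \<Longrightarrow> additive_map Q S g \<Longrightarrow> additive_map P S (\<lambda>x. g (f x))"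
  by (auto simp: additive_map_def Pi_iff)

section \<open>Quotient modules, free modules and their universal properties\<close>

lemma quotient_module_class:
  assumes "module R P" "submodule N R P"
  shows "(\<lambda>x. N +>\<^bsub>P\<^esub> x) \<in> module_hom R P (quotient_module P N)"
    and "carrier (quotient_module P N) = (\<lambda>x. N +>\<^bsub>P\<^esub> x) ` carrier P"
    and "x \<in> carrier P \<Longrightarrow> y \<in> carrier P \<Longrightarrow> N +>\<^bsub>P\<^esub> x = N +>\<^bsub>P\<^esub> y \<longleftrightarrow> x \<ominus>\<^bsub>P\<^esub> y \<in> N"
proof -
  interpret module R P by fact
  interpret N: submodule N R P by fact
  have sub: "subgroup N (add_monoid P)" by (rule submodule.axioms(1)[OF assms(2)])
  interpret N: abelian_subgroup N P
    by (rule abelian_subgroupI3) (simp_all add: sub additive_subgroup_def M.abelian_group_axioms)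
  show eq: "N +>\<^bsub>P\<^esub> x = N +>\<^bsub>P\<^esub> y \<longleftrightarrow> x \<ominus>\<^bsub>P\<^esub> y \<in> N"
    if x: "x \<in> carrier P" and y: "y \<in> carrier P" for x y
  proof
    assume "N +>\<^bsub>P\<^esub> x = N +>\<^bsub>P\<^esub> y"
    then have "N +>\<^bsub>P\<^esub> (x \<ominus>\<^bsub>P\<^esub> y) = N"
      using M.a_coset_add_inv2[OF _ x y N.a_subset] by (simp add: a_minus_def)
    then show "x \<ominus>\<^bsub>P\<^esub> y \<in> N" using M.a_coset_join1[OF _ _ sub] x y by simp
  next
    assume d: "x \<ominus>\<^bsub>P\<^esub> y \<in> N"
    have "(x \<ominus>\<^bsub>P\<^esub> y) \<oplus>\<^bsub>P\<^esub> y = x" using x y by (simp add: a_minus_def M.a_assoc M.l_neg)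
    then have "x \<in> N +>\<^bsub>P\<^esub> y" using M.a_rcosI[OF d N.a_subset y] by simp
    from M.a_repr_independence[OF this y sub] show "N +>\<^bsub>P\<^esub> x = N +>\<^bsub>P\<^esub> y" by simp
  qed
  show car: "carrier (quotient_module P N) = (\<lambda>x. N +>\<^bsub>P\<^esub> x) ` carrier P"
    by (auto simp: quotient_module_def A_RCOSETS_def')
  have smult: "a \<odot>\<^bsub>quotient_module P N\<^esub> (N +>\<^bsub>P\<^esub> x) = N +>\<^bsub>P\<^esub> (a \<odot>\<^bsub>P\<^esub> x)"
    if a: "a \<in> carrier R" and x: "x \<in> carrier P" for a x
  proof -
    have "N +>\<^bsub>P\<^esub> (a \<odot>\<^bsub>P\<^esub> y) = N +>\<^bsub>P\<^esub> (a \<odot>\<^bsub>P\<^esub> x)" if y: "y \<in> N +>\<^bsub>P\<^esub> x" for y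
    proof -
      obtain h where h: "h \<in> N" "y = h \<oplus>\<^bsub>P\<^esub> x" using y by (auto simp: a_r_coset_def')
      have "a \<odot>\<^bsub>P\<^esub> y = a \<odot>\<^bsub>P\<^esub> h \<oplus>\<^bsub>P\<^esub> a \<odot>\<^bsub>P\<^esub> x"
        using h a x N.a_subset by (auto simp: smult_r_distr)
      then have "a \<odot>\<^bsub>P\<^esub> y \<in> N +>\<^bsub>P\<^esub> (a \<odot>\<^bsub>P\<^esub> x)"
        using h a N.smult_closed by (auto simp: a_r_coset_def')
      then show ?thesis using M.a_repr_independence[OF _ _ sub] a x by simp
    qed
    then have "(\<Union>y\<in>N +>\<^bsub>P\<^esub> x. N +>\<^bsub>P\<^esub> (a \<odot>\<^bsub>P\<^esub> y)) = (\<Union>y\<in>N +>\<^bsub>P\<^esub> x. N +>\<^bsub>P\<^esub> (a \<odot>\<^bsub>P\<^esub> x))"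
      by (intro SUP_cong refl)
    moreover have "x \<in> N +>\<^bsub>P\<^esub> x" by (rule N.a_rcos_self[OF x])
    ultimately show ?thesis unfolding quotient_module_def by (simp only: module.simps) blast
  qed
  show "(\<lambda>x. N +>\<^bsub>P\<^esub> x) \<in> module_hom R P (quotient_module P N)"
  proof (rule module_homI)
    show "N +>\<^bsub>P\<^esub> (x \<oplus>\<^bsub>P\<^esub> y) = (N +>\<^bsub>P\<^esub> x) \<oplus>\<^bsub>quotient_module P N\<^esub> (N +>\<^bsub>P\<^esub> y)"
      if "x \<in> carrier P" "y \<in> carrier P" for x y
      using N.a_rcos_sum[OF that] by (simp add: quotient_module_def)
  qed (simp_all add: car smult)
qed

lemma quotient_module_lift:
  assumes P: "module R P" and Q: "module R Q" and N: "submodule N R P"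
    and F: "F \<in> module_hom R P Q" and ker: "\<And>x. x \<in> N \<Longrightarrow> F x = \<zero>\<^bsub>Q\<^esub>"
  obtains f where "f \<in> module_hom R (quotient_module P N) Q"
    "\<And>x. x \<in> carrier P \<Longrightarrow> f (N +>\<^bsub>P\<^esub> x) = F x"
proof
  interpret P: module R P by fact
  interpret Q: module R Q by fact
  note c = quotient_module_class[OF P N]
  note F' = module_homD[OF F]
  \<comment> \<open>The value at a chosen representative. Two representatives differ by an element
    of \<open>N\<close>, on which \<open>F\<close> vanishes.\<close>
  define f where "f = (\<lambda>S. F (SOME x. x \<in> carrier P \<and> S = N +>\<^bsub>P\<^esub> x))"
  show f: "f (N +>\<^bsub>P\<^esub> x) = F x" if x: "x \<in> carrier P" for x
  proof -
    define y where "y = (SOME y. y \<in> carrier P \<and> N +>\<^bsub>P\<^esub> x = N +>\<^bsub>P\<^esub> y)"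
    have y: "y \<in> carrier P" "N +>\<^bsub>P\<^esub> x = N +>\<^bsub>P\<^esub> y"
      using someI[of "\<lambda>y. y \<in> carrier P \<and> N +>\<^bsub>P\<^esub> x = N +>\<^bsub>P\<^esub> y" x] x by (auto simp: y_def)
    then have "F (x \<ominus>\<^bsub>P\<^esub> y) = \<zero>\<^bsub>Q\<^esub>" using c(3)[OF x y(1)] ker by blast
    then have "F x \<ominus>\<^bsub>Q\<^esub> F y = \<zero>\<^bsub>Q\<^esub>"
      using additive_map_minus[OF P.M.abelian_group_axioms Q.M.abelian_group_axioms F'(1) x y(1)] by simp
    then have "F x = F y"
      using Q.M.minus_eq_zero_iff[OF F'(2)[OF x] F'(2)[OF y(1)]] by simp
    then show ?thesis by (simp add: f_def y_def)
  qed
  show "f \<in> module_hom R (quotient_module P N) Q"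
  proof (rule module_homI)
    fix S assume "S \<in> carrier (quotient_module P N)"
    then obtain x where x: "x \<in> carrier P" "S = N +>\<^bsub>P\<^esub> x" using c(2) by auto
    then show "f S \<in> carrier Q" using f F'(2) by simp
    show "f (a \<odot>\<^bsub>quotient_module P N\<^esub> S) = a \<odot>\<^bsub>Q\<^esub> f S" if "a \<in> carrier R" for a
      using x f F'(4) that module_homD(4)[OF c(1) that x(1), symmetric] by simp
    fix T assume "T \<in> carrier (quotient_module P N)"
    then obtain y where y: "y \<in> carrier P" "T = N +>\<^bsub>P\<^esub> y" using c(2) by auto
    show "f (S \<oplus>\<^bsub>quotient_module P N\<^esub> T) = f S \<oplus>\<^bsub>Q\<^esub> f T"
      using x y f F'(3) module_homD(3)[OF c(1) x(1) y(1), symmetric] by simp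
  qed
qed

lemma quotient_by_kernel_iso:
  assumes P: "module R P" and Q: "module R Q" and F: "F \<in> module_hom R P Q"
    and surj: "F ` carrier P = carrier Q"
  defines "N \<equiv> {x \<in> carrier P. F x = \<zero>\<^bsub>Q\<^esub>}"
  obtains f where "module_iso R (quotient_module P N) Q f"
    "\<And>x. x \<in> carrier P \<Longrightarrow> f (N +>\<^bsub>P\<^esub> x) = F x"
proof -
  interpret P: module R P by fact
  interpret Q: module R Q by fact
  note F' = module_homD[OF F]
  note ab = P.M.abelian_group_axioms Q.M.abelian_group_axioms F'(1)
  have N: "submodule N R P"
  proof (rule P.submoduleI)
    show "\<ominus>\<^bsub>P\<^esub> a \<in> N" if "a \<in> N" for a
      using additive_map_minus[OF ab, of "\<zero>\<^bsub>P\<^esub>" a] that additive_map_zero[OF ab]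
      by (simp add: N_def a_minus_def)
  qed (auto simp: N_def F' additive_map_zero[OF ab])
  note c = quotient_module_class[OF P N]
  obtain f where f: "f \<in> module_hom R (quotient_module P N) Q"
    "\<And>x. x \<in> carrier P \<Longrightarrow> f (N +>\<^bsub>P\<^esub> x) = F x"
    by (rule quotient_module_lift[OF P Q N F]) (auto simp: N_def)
  have "inj_on f (carrier (quotient_module P N))"
  proof (rule inj_onI)
    fix S T assume S: "S \<in> carrier (quotient_module P N)" and T: "T \<in> carrier (quotient_module P N)"
      and eq: "f S = f T"
    from S obtain x where x: "x \<in> carrier P" "S = N +>\<^bsub>P\<^esub> x" using c(2) by auto
    from T obtain y where y: "y \<in> carrier P" "T = N +>\<^bsub>P\<^esub> y" using c(2) by auto
    have "F x = F y" using eq f(2) x y by simp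
    then have "F (x \<ominus>\<^bsub>P\<^esub> y) = \<zero>\<^bsub>Q\<^esub>"
      using additive_map_minus[OF ab x(1) y(1)] Q.M.minus_eq_zero_iff F'(2) x y by simp
    then show "S = T" using c(3)[OF x(1) y(1)] x y by (simp add: N_def)
  qed
  moreover have "f ` carrier (quotient_module P N) = carrier Q"
    using f(2) surj by (simp add: c(2) image_image)
  ultimately have "module_iso R (quotient_module P N) Q f"
    using module_quotient_module[OF P N] Q f(1) by (simp add: module_iso_def bij_betw_def)
  then show thesis using f(2) that by blast
qed

lemma free_module_lift:
  assumes Q: "module R Q" and g: "\<And>s. s \<in> S \<Longrightarrow> g s \<in> carrier Q"
  obtains F where "F \<in> module_hom R (free_module R S) Q" "\<And>s. s \<in> S \<Longrightarrow> F (free_gen R s) = g s"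
proof
  interpret Q: module R Q by fact
  define F where "F = (\<lambda>x. \<Oplus>\<^bsub>Q\<^esub>s\<in>{s. x s \<noteq> \<zero>\<^bsub>R\<^esub>}. x s \<odot>\<^bsub>Q\<^esub> g s)"
  have car: "x s \<in> carrier R" "finite {s. x s \<noteq> \<zero>\<^bsub>R\<^esub>}" "x s \<noteq> \<zero>\<^bsub>R\<^esub> \<Longrightarrow> s \<in> S"
    if "x \<in> carrier (free_module R S)" for x s
    using that by (auto simp: free_module_def)
  \<comment> \<open>Any finite set between the support and \<open>S\<close> gives the same sum, so
    that for additivity both arguments can be summed over the union of their supports.\<close>
  have F: "F x = (\<Oplus>\<^bsub>Q\<^esub>s\<in>T. x s \<odot>\<^bsub>Q\<^esub> g s)"
    if "x \<in> carrier (free_module R S)" "finite T" "{s. x s \<noteq> \<zero>\<^bsub>R\<^esub>} \<subseteq> T" "T \<subseteq> S" for x T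
    unfolding F_def
    by (rule Q.M.add.finprod_mono_neutral_cong_left) (use that car g in auto)
  show "F (free_gen R s) = g s" if "s \<in> S" for s
  proof -
    have "free_gen R s \<in> carrier (free_module R S)"
      using finite_subset[of "{x. free_gen R s x \<noteq> \<zero>\<^bsub>R\<^esub>}" "{s}"] that
      by (auto simp: free_module_def free_gen_def)
    then have "F (free_gen R s) = (\<Oplus>\<^bsub>Q\<^esub>s'\<in>{s}. free_gen R s s' \<odot>\<^bsub>Q\<^esub> g s')"
      by (rule F) (use that in \<open>auto simp: free_gen_def\<close>)
    then show ?thesis using g[OF that] by (simp add: free_gen_def)
  qed
  show "F \<in> module_hom R (free_module R S) Q"
  proof (rule module_homI)
    fix x assume x: "x \<in> carrier (free_module R S)"
    show "F x \<in> carrier Q"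
      unfolding F_def by (rule Q.M.finsum_closed) (use car[OF x] g in auto)
    show "F (a \<odot>\<^bsub>free_module R S\<^esub> x) = a \<odot>\<^bsub>Q\<^esub> F x" if a: "a \<in> carrier R" for a
    proof -
      interpret L: module R "free_module R S" by (rule module_free_module[OF Q.is_cring])
      let ?T = "{s. x s \<noteq> \<zero>\<^bsub>R\<^esub>}"
      have "F (a \<odot>\<^bsub>free_module R S\<^esub> x) = (\<Oplus>\<^bsub>Q\<^esub>s\<in>?T. (a \<odot>\<^bsub>free_module R S\<^esub> x) s \<odot>\<^bsub>Q\<^esub> g s)"
        by (rule F) (use L.smult_closed[OF a x] car[OF x] a in \<open>auto simp: free_module_def\<close>)
      also have "\<dots> = (\<Oplus>\<^bsub>Q\<^esub>s\<in>?T. a \<odot>\<^bsub>Q\<^esub> (x s \<odot>\<^bsub>Q\<^esub> g s))"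
        by (rule Q.M.finsum_cong') (use car[OF x] a g in \<open>auto simp: free_module_def Q.smult_assoc1\<close>)
      also have "\<dots> = a \<odot>\<^bsub>Q\<^esub> F x"
        unfolding F_def by (rule Q.finsum_smult_ldistr[symmetric]) (use car[OF x] a g in auto)
      finally show ?thesis .
    qed
    fix y assume y: "y \<in> carrier (free_module R S)"
    interpret L: module R "free_module R S" by (rule module_free_module[OF Q.is_cring])
    let ?T = "{s. x s \<noteq> \<zero>\<^bsub>R\<^esub>} \<union> {s. y s \<noteq> \<zero>\<^bsub>R\<^esub>}"
    have T: "finite ?T" "?T \<subseteq> S" using car[OF x] car[OF y] by auto
    have "F (x \<oplus>\<^bsub>free_module R S\<^esub> y) = (\<Oplus>\<^bsub>Q\<^esub>s\<in>?T. (x \<oplus>\<^bsub>free_module R S\<^esub> y) s \<odot>\<^bsub>Q\<^esub> g s)"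
      by (rule F[OF _ T(1) _ T(2)]) (use L.M.a_closed[OF x y] in \<open>auto simp: free_module_def\<close>)
    also have "\<dots> = (\<Oplus>\<^bsub>Q\<^esub>s\<in>?T. x s \<odot>\<^bsub>Q\<^esub> g s \<oplus>\<^bsub>Q\<^esub> y s \<odot>\<^bsub>Q\<^esub> g s)"
      by (rule Q.M.finsum_cong')
        (use car(1)[OF x] car(1)[OF y] T g in \<open>auto simp: free_module_def Q.smult_l_distr subset_iff\<close>)
    also have "\<dots> = (\<Oplus>\<^bsub>Q\<^esub>s\<in>?T. x s \<odot>\<^bsub>Q\<^esub> g s) \<oplus>\<^bsub>Q\<^esub> (\<Oplus>\<^bsub>Q\<^esub>s\<in>?T. y s \<odot>\<^bsub>Q\<^esub> g s)"
      by (rule Q.M.finsum_addf) (use car(1)[OF x] car(1)[OF y] T g in \<open>auto simp: subset_iff\<close>)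
    also have "\<dots> = F x \<oplus>\<^bsub>Q\<^esub> F y"
      using F[OF x T(1) _ T(2)] F[OF y T(1) _ T(2)] by simp
    finally show "F (x \<oplus>\<^bsub>free_module R S\<^esub> y) = F x \<oplus>\<^bsub>Q\<^esub> F y" .
  qed
qed

section \<open>Bilinear maps and the universal property of the tensor product\<close>

definition bilinear_map ::
  "('a, 'u) ring_scheme \<Rightarrow> ('a, 'p, 'v) module_scheme \<Rightarrow> ('a, 'q, 'w) module_scheme \<Rightarrow>
    ('a, 'n, 'z) module_scheme \<Rightarrow> ('p \<Rightarrow> 'q \<Rightarrow> 'n) \<Rightarrow> bool" where
  "bilinear_map R P Q N g \<longleftrightarrow> (\<forall>p\<in>carrier P. g p \<in> module_hom R Q N) \<and>
    (\<forall>q\<in>carrier Q. (\<lambda>p. g p q) \<in> module_hom R P N)"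

context
  fixes R :: "('a, 'u) ring_scheme" and P :: "('a, 'p, 'v) module_scheme"
    and Q :: "('a, 'q, 'w) module_scheme"
  assumes P: "module R P" and Q: "module R Q"
begin

interpretation P: module R P by (rule P)
interpretation Q: module R Q by (rule Q)

private abbreviation "L \<equiv> tensor_free R P Q"
private abbreviation "T \<equiv> tensor_module R P Q"

interpretation L: module R L
  unfolding tensor_free_def by (rule module_free_module) (rule P.is_cring)
interpretation T: module R T
  by (rule module_tensor_module[OF P Q])

lemmas tensor_class = quotient_module_class[OF L.module_axioms tensor_kernel_submodule[OF P Q],
    folded tensor_module_def]

lemma tensor_relation_in_kernel: "x \<in> tensor_relations R P Q \<Longrightarrow> x \<in> tensor_kernel R P Q"
  by (auto simp: tensor_kernel_def module_span_def)

lemma tensor_lift: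
  assumes N: "module R N" and g: "bilinear_map R P Q N g"
  obtains f where "f \<in> module_hom R T N"
    "\<And>p q. p \<in> carrier P \<Longrightarrow> q \<in> carrier Q \<Longrightarrow> f (pure_tensor R P Q p q) = g p q"
proof -
  interpret N: module R N by fact
  have gl: "g p \<in> module_hom R Q N" if "p \<in> carrier P" for p using g that by (simp add: bilinear_map_def)
  have gr: "(\<lambda>p. g p q) \<in> module_hom R P N" if "q \<in> carrier Q" for q
    using g that by (simp add: bilinear_map_def)
  note gl' = module_homD[OF gl] and gr' = module_homD[OF gr]
  note gen = free_gen_carrier[OF P.is_cring, of _ P _ Q]
  obtain F where F: "F \<in> module_hom R L N"
    "\<And>s. s \<in> carrier P \<times> carrier Q \<Longrightarrow> F (free_gen R s) = (case s of (p, q) \<Rightarrow> g p q)"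
    unfolding tensor_free_def
    by (rule free_module_lift[OF N, of "carrier P \<times> carrier Q" "\<lambda>(p, q). g p q"]) (use gl'(2) in auto)
  have Fg: "F (free_gen R (p, q)) = g p q" if "p \<in> carrier P" "q \<in> carrier Q" for p q
    using F(2)[of "(p, q)"] that by simp
  note F' = module_homD[OF F(1)]
  note ab = L.M.abelian_group_axioms N.M.abelian_group_axioms F'(1)
  \<comment> \<open>The kernel of the lift to the free module is a submodule containing the four
    kinds of relations, hence it contains \<open>tensor_kernel\<close>, the least such
    submodule.\<close>
  let ?K = "{x \<in> carrier L. F x = \<zero>\<^bsub>N\<^esub>}"
  have "submodule ?K R L"
  proof (rule L.submoduleI)
    show "\<ominus>\<^bsub>L\<^esub> a \<in> ?K" if "a \<in> ?K" for a
      using additive_map_minus[OF ab, of "\<zero>\<^bsub>L\<^esub>" a] that additive_map_zero[OF ab]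
      by (simp add: a_minus_def)
  qed (auto simp: F' additive_map_zero[OF ab])
  moreover have rel: "x \<ominus>\<^bsub>L\<^esub> y \<in> ?K" if "x \<in> carrier L" "y \<in> carrier L" "F x = F y" for x y
    using additive_map_minus[OF ab that(1,2)] that F'(2) by (simp add: N.M.minus_eq_zero_iff)
  then have "tensor_relations R P Q \<subseteq> ?K"
    unfolding tensor_relations_def Let_def
    by (intro Un_least subsetI; elim CollectE exE conjE; hypsubst; intro rel)
      (simp_all add: gen F' Fg gl' gr')
  ultimately have "tensor_kernel R P Q \<subseteq> ?K"
    unfolding tensor_kernel_def module_span_def by (intro Inter_lower) auto
  then obtain f where "f \<in> module_hom R T N"
    "\<And>x. x \<in> carrier L \<Longrightarrow> f (tensor_kernel R P Q +>\<^bsub>L\<^esub> x) = F x"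
    unfolding tensor_module_def
    using quotient_module_lift[OF L.module_axioms N tensor_kernel_submodule[OF P Q] F(1)] by blast
  then show thesis using that gen Fg by (simp add: pure_tensor_def)
qed

lemma pure_tensor_bilinear: "bilinear_map R P Q T (pure_tensor R P Q)"
proof -
  note gen = free_gen_carrier[OF P.is_cring, of _ P _ Q]
  note c = module_homD[OF tensor_class(1)]
  have eq: "tensor_kernel R P Q +>\<^bsub>L\<^esub> x = tensor_kernel R P Q +>\<^bsub>L\<^esub> y"
    if "x \<ominus>\<^bsub>L\<^esub> y \<in> tensor_relations R P Q" "x \<in> carrier L" "y \<in> carrier L" for x y
    using tensor_class(3)[OF that(2,3)] tensor_relation_in_kernel[OF that(1)] by simp
  show ?thesis
    unfolding bilinear_map_def
  proof (intro conjI ballI module_homI)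
    fix p q assume p: "p \<in> carrier P" and q: "q \<in> carrier Q"
    show "pure_tensor R P Q p q \<in> carrier T" "pure_tensor R P Q p q \<in> carrier T"
      using pure_tensor_carrier[OF P.is_cring p q] by auto
    fix a assume a: "a \<in> carrier R"
    show "pure_tensor R P Q p (a \<odot>\<^bsub>Q\<^esub> q) = a \<odot>\<^bsub>T\<^esub> pure_tensor R P Q p q"
      unfolding pure_tensor_def c(4)[OF a gen[OF p q], symmetric]
      by (rule eq) (use p q a gen in \<open>auto simp: tensor_relations_def Let_def\<close>)
    show "pure_tensor R P Q (a \<odot>\<^bsub>P\<^esub> p) q = a \<odot>\<^bsub>T\<^esub> pure_tensor R P Q p q"
      unfolding pure_tensor_def c(4)[OF a gen[OF p q], symmetric]
      by (rule eq) (use p q a gen in \<open>auto simp: tensor_relations_def Let_def\<close>)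
  next
    fix p q q' assume p: "p \<in> carrier P" and q: "q \<in> carrier Q" "q' \<in> carrier Q"
    show "pure_tensor R P Q p (q \<oplus>\<^bsub>Q\<^esub> q') = pure_tensor R P Q p q \<oplus>\<^bsub>T\<^esub> pure_tensor R P Q p q'"
      unfolding pure_tensor_def c(3)[OF gen[OF p q(1)] gen[OF p q(2)], symmetric]
      by (rule eq) (use p q gen in \<open>auto simp: tensor_relations_def Let_def\<close>)
  next
    fix q p p' assume q: "q \<in> carrier Q" and p: "p \<in> carrier P" "p' \<in> carrier P"
    show "pure_tensor R P Q (p \<oplus>\<^bsub>P\<^esub> p') q = pure_tensor R P Q p q \<oplus>\<^bsub>T\<^esub> pure_tensor R P Q p' q"
      unfolding pure_tensor_def c(3)[OF gen[OF p(1) q] gen[OF p(2) q], symmetric]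
      by (rule eq) (use p q gen in \<open>auto simp: tensor_relations_def Let_def\<close>)
  qed
qed

lemma pure_tensor_left_hom: "q \<in> carrier Q \<Longrightarrow> (\<lambda>p. pure_tensor R P Q p q) \<in> module_hom R P T"
  and pure_tensor_right_hom: "p \<in> carrier P \<Longrightarrow> pure_tensor R P Q p \<in> module_hom R Q T"
  using pure_tensor_bilinear by (simp_all add: bilinear_map_def)

text \<open>Scalars are absorbed into the left factor, and 0 is the pure tensor of two zeros, so
  pure tensors and sums exhaust the tensor product. Equality of additive maps on tensors is
  therefore checked on pure tensors.\<close>

lemma tensor_induct [consumes 1, case_names pure add]:
  assumes "u \<in> carrier T"
    and pure: "\<And>p q. p \<in> carrier P \<Longrightarrow> q \<in> carrier Q \<Longrightarrow> Pr (pure_tensor R P Q p q)"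
    and add: "\<And>u v. u \<in> carrier T \<Longrightarrow> v \<in> carrier T \<Longrightarrow> Pr u \<Longrightarrow> Pr v \<Longrightarrow> Pr (u \<oplus>\<^bsub>T\<^esub> v)"
  shows "Pr u"
proof -
  note gen = free_gen_carrier[OF P.is_cring, of _ P _ Q]
  let ?c = "\<lambda>x. tensor_kernel R P Q +>\<^bsub>L\<^esub> x"
  note c = module_homD[OF tensor_class(1)]
  have zero: "Pr (?c \<zero>\<^bsub>L\<^esub>)"
  proof -
    have "?c \<zero>\<^bsub>L\<^esub> = \<zero>\<^bsub>T\<^esub>"
      by (rule additive_map_zero[OF L.M.abelian_group_axioms T.M.abelian_group_axioms c(1)])
    also have "\<dots> = pure_tensor R P Q \<zero>\<^bsub>P\<^esub> \<zero>\<^bsub>Q\<^esub>"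
      using additive_map_zero[OF Q.M.abelian_group_axioms T.M.abelian_group_axioms
          module_homD(1)[OF pure_tensor_right_hom[OF P.M.zero_closed]]] by simp
    finally show ?thesis using pure by simp
  qed
  \<comment> \<open>\<open>S\<close> is merely a finite set containing the support, so that
    resetting \<open>x\<close> to 0 at one point of \<open>S\<close> leads into the induction
    hypothesis.\<close>
  have "Pr (?c x)" if "finite S" "x \<in> carrier L" "{s. x s \<noteq> \<zero>\<^bsub>R\<^esub>} \<subseteq> S" for S x
    using that
  proof (induction S arbitrary: x rule: finite_induct)
    case empty
    then have "x = \<zero>\<^bsub>L\<^esub>" by (auto simp: tensor_free_def free_module_def)
    then show ?case using zero by simp
  next
    case (insert s S)
    obtain p q where s: "s = (p, q)" by (cases s)
    show ?case
    proof (cases "x s = \<zero>\<^bsub>R\<^esub>")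
      case True
      then show ?thesis using insert by auto
    next
      case False
      then have pq: "p \<in> carrier P" "q \<in> carrier Q" and xs: "x s \<in> carrier R"
        using insert.prems(1) s by (auto simp: tensor_free_def free_module_def)
      define y where "y = x(s := \<zero>\<^bsub>R\<^esub>)"
      have y: "y \<in> carrier L"
      proof -
        have "finite {s. x s \<noteq> \<zero>\<^bsub>R\<^esub>}"
          using insert.prems(1) by (simp add: tensor_free_def free_module_def)
        then have "finite {s. y s \<noteq> \<zero>\<^bsub>R\<^esub>}"
          by (rule rev_finite_subset) (auto simp: y_def)
        then show ?thesis
          using insert.prems(1) by (simp add: tensor_free_def free_module_def y_def image_subset_iff)
      qed
      have "x = x s \<odot>\<^bsub>L\<^esub> free_gen R (p, q) \<oplus>\<^bsub>L\<^esub> y"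
      proof
        fix z
        have "x z \<in> carrier R"
          using insert.prems(1) by (auto simp: tensor_free_def free_module_def)
        then show "x z = (x s \<odot>\<^bsub>L\<^esub> free_gen R (p, q) \<oplus>\<^bsub>L\<^esub> y) z"
          using xs s by (auto simp: tensor_free_def free_module_def y_def free_gen_def)
      qed
      then have "?c x = ?c (x s \<odot>\<^bsub>L\<^esub> free_gen R (p, q)) \<oplus>\<^bsub>T\<^esub> ?c y"
        using c(3)[OF L.smult_closed[OF xs gen[OF pq]] y] by simp
      also have "?c (x s \<odot>\<^bsub>L\<^esub> free_gen R (p, q)) = x s \<odot>\<^bsub>T\<^esub> pure_tensor R P Q p q"
        using c(4)[OF xs gen[OF pq]] by (simp add: pure_tensor_def)
      also have "\<dots> = pure_tensor R P Q (x s \<odot>\<^bsub>P\<^esub> p) q"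
        using module_homD(4)[OF pure_tensor_left_hom[OF pq(2)] xs pq(1)] by simp
      finally have "?c x = pure_tensor R P Q (x s \<odot>\<^bsub>P\<^esub> p) q \<oplus>\<^bsub>T\<^esub> ?c y" .
      moreover have "Pr (?c y)"
        using insert.prems(2) by (intro insert.IH y) (auto simp: y_def)
      moreover have "x s \<odot>\<^bsub>P\<^esub> p \<in> carrier P" using pq xs by simp
      ultimately show ?thesis
        using add[OF pure_tensor_carrier[OF P.is_cring _ pq(2)] c(2)[OF y] pure[OF _ pq(2)]] by simp
    qed
  qed
  note ind = this
  obtain x where x: "x \<in> carrier L" "u = ?c x" using assms(1) tensor_class(2) by auto
  then have "finite {s. x s \<noteq> \<zero>\<^bsub>R\<^esub>}" by (simp add: tensor_free_def free_module_def)
  from ind[OF this x(1)] show ?thesis using x(2) by simp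
qed

text \<open>Two sums are concatenated by shifting the second index by \<open>n\<close>. Index sets
  are initial segments of the naturals because the description in \<open>tensor_extend\<close> has
  this form.\<close>

lemma tensor_finite_sum:
  assumes "u \<in> carrier T"
  shows "\<exists>(n::nat) p q. p \<in> {..<n} \<rightarrow> carrier P \<and> q \<in> {..<n} \<rightarrow> carrier Q \<and>
    u = (\<Oplus>\<^bsub>T\<^esub>i\<in>{..<n}. pure_tensor R P Q (p i) (q i))"
  using assms
proof (induction rule: tensor_induct)
  case (pure p q)
  then show ?case
    using pure_tensor_carrier[OF P.is_cring, of p P q Q]
    by (intro exI[of _ 1] exI[of _ "\<lambda>_. p"] exI[of _ "\<lambda>_. q"]) (simp add: lessThan_Suc)
next
  case (add u v)
  from add(3) obtain n p q where u: "p \<in> {..<n::nat} \<rightarrow> carrier P" "q \<in> {..<n} \<rightarrow> carrier Q"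
    "u = (\<Oplus>\<^bsub>T\<^esub>i\<in>{..<n}. pure_tensor R P Q (p i) (q i))" by blast
  from add(4) obtain m p' q' where v: "p' \<in> {..<m::nat} \<rightarrow> carrier P" "q' \<in> {..<m} \<rightarrow> carrier Q"
    "v = (\<Oplus>\<^bsub>T\<^esub>i\<in>{..<m}. pure_tensor R P Q (p' i) (q' i))" by blast
  define p'' where "p'' i = (if i < n then p i else p' (i - n))" for i
  define q'' where "q'' i = (if i < n then q i else q' (i - n))" for i
  have pq: "p'' \<in> {..<n + m} \<rightarrow> carrier P" "q'' \<in> {..<n + m} \<rightarrow> carrier Q"
    using u v by (auto simp: p''_def q''_def Pi_iff)
  let ?g = "\<lambda>i. pure_tensor R P Q (p'' i) (q'' i)"
  have g: "?g \<in> A \<rightarrow> carrier T" if "A \<subseteq> {..<n + m}" for A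
    using pq that by (auto intro!: pure_tensor_carrier[OF P.is_cring])
  have "(\<lambda>i. i + n) ` {..<m} = {n..<n + m}"
    using image_add_atLeastLessThan'[of n 0 m] by (simp add: lessThan_atLeast0 add.commute)
  moreover have "inj_on (\<lambda>i. i + n) {..<m}" by simp
  moreover have "?g \<in> {n..<n+m} \<rightarrow> carrier T" by (rule g) auto
  ultimately have "(\<Oplus>\<^bsub>T\<^esub>i\<in>{n..<n+m}. ?g i) = (\<Oplus>\<^bsub>T\<^esub>i\<in>{..<m}. ?g (i + n))"
    using T.M.finsum_reindex[of ?g "\<lambda>i. i + n" "{..<m}"] by simp
  also have "\<dots> = v"
    unfolding v(3) by (rule T.M.finsum_cong')
      (use v in \<open>auto simp: p''_def q''_def intro!: pure_tensor_carrier[OF P.is_cring]\<close>)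
  finally have 1: "(\<Oplus>\<^bsub>T\<^esub>i\<in>{n..<n+m}. ?g i) = v" .
  have 2: "(\<Oplus>\<^bsub>T\<^esub>i\<in>{..<n}. ?g i) = u"
    unfolding u(3) by (rule T.M.finsum_cong')
      (use u in \<open>auto simp: p''_def q''_def intro!: pure_tensor_carrier[OF P.is_cring]\<close>)
  have "{..<n + m} = {..<n} \<union> {n..<n+m}" by auto
  then have "(\<Oplus>\<^bsub>T\<^esub>i\<in>{..<n + m}. ?g i) = u \<oplus>\<^bsub>T\<^esub> v"
    using T.M.finsum_Un_disjoint[of "{..<n}" "{n..<n+m}" ?g] g[of "{..<n}"] g[of "{n..<n+m}"] 1 2
    by (simp add: ivl_disj_int)
  then show ?case using pq by (intro exI[of _ "n + m"] exI[of _ p''] exI[of _ q'']) simp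
qed

text \<open>Makes the definite description usable: a representation exists by
  \<open>tensor_finite_sum\<close>, and every representation yields \<open>f u\<close> because
  \<open>f\<close> is additive. In the applications \<open>f\<close> is supplied by the universal
  property.\<close>

lemma tensor_extend_eq:
  assumes N: "abelian_group N" and f: "additive_map T N f"
    and g: "\<And>p q. p \<in> carrier P \<Longrightarrow> q \<in> carrier Q \<Longrightarrow> f (pure_tensor R P Q p q) = g p q"
    and u: "u \<in> carrier T"
  shows "tensor_extend R P Q N g u = f u"
proof -
  interpret N: abelian_group N by fact
  have *: "(\<Oplus>\<^bsub>N\<^esub>i\<in>{..<n}. g (p i) (q i)) = f (\<Oplus>\<^bsub>T\<^esub>i\<in>{..<n}. pure_tensor R P Q (p i) (q i))"
    if "p \<in> {..<n} \<rightarrow> carrier P" "q \<in> {..<n} \<rightarrow> carrier Q" for n :: nat and p q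
  proof -
    have pc: "(\<lambda>i. pure_tensor R P Q (p i) (q i)) \<in> {..<n} \<rightarrow> carrier T"
      using that by (auto intro!: pure_tensor_carrier[OF P.is_cring])
    have "f (\<Oplus>\<^bsub>T\<^esub>i\<in>{..<n}. pure_tensor R P Q (p i) (q i)) =
        (\<Oplus>\<^bsub>N\<^esub>i\<in>{..<n}. f (pure_tensor R P Q (p i) (q i)))"
      by (rule additive_map_finsum[OF T.M.abelian_group_axioms N f _ pc]) simp
    also have "\<dots> = (\<Oplus>\<^bsub>N\<^esub>i\<in>{..<n}. g (p i) (q i))"
    proof (rule N.finsum_cong'[OF refl])
      show "(\<lambda>i. g (p i) (q i)) \<in> {..<n} \<rightarrow> carrier N"
      proof
        fix i assume "i \<in> {..<n}"
        then have "p i \<in> carrier P" "q i \<in> carrier Q" using that by auto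
        then show "g (p i) (q i) \<in> carrier N"
          using additive_mapD(1)[OF f pure_tensor_carrier[OF P.is_cring]] g by metis
      qed
    qed (use that g in auto)
    finally show ?thesis by simp
  qed
  show ?thesis
    unfolding tensor_extend_def
  proof (rule the_equality)
    show "\<exists>(n::nat) p q. p \<in> {..<n} \<rightarrow> carrier P \<and> q \<in> {..<n} \<rightarrow> carrier Q \<and>
      u = (\<Oplus>\<^bsub>T\<^esub>i\<in>{..<n}. pure_tensor R P Q (p i) (q i)) \<and> f u = (\<Oplus>\<^bsub>N\<^esub>i\<in>{..<n}. g (p i) (q i))"
    proof -
      obtain n p q where "p \<in> {..<n::nat} \<rightarrow> carrier P" "q \<in> {..<n} \<rightarrow> carrier Q"
        "u = (\<Oplus>\<^bsub>T\<^esub>i\<in>{..<n}. pure_tensor R P Q (p i) (q i))"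
        using tensor_finite_sum[OF u] by blast
      then show ?thesis
        using *[of p n q] by (intro exI[of _ n] exI[of _ p] exI[of _ q] conjI) simp_all
    qed
    fix v assume "\<exists>(n::nat) p q. p \<in> {..<n} \<rightarrow> carrier P \<and> q \<in> {..<n} \<rightarrow> carrier Q \<and>
      u = (\<Oplus>\<^bsub>T\<^esub>i\<in>{..<n}. pure_tensor R P Q (p i) (q i)) \<and> v = (\<Oplus>\<^bsub>N\<^esub>i\<in>{..<n}. g (p i) (q i))"
    then show "v = f u" using * by (elim exE conjE) simp
  qed
qed

end

section \<open>Restriction of scalars and modules with finite dual bases\<close>

lemma restrict_scalars_simps [simp]:
  "carrier (restrict_scalars \<iota> P) = carrier P" "zero (restrict_scalars \<iota> P) = zero P"
  "add (restrict_scalars \<iota> P) = add P" "smult (restrict_scalars \<iota> P) c = smult P (\<iota> c)"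
  by (simp_all add: restrict_scalars_def)

lemma ring_of_type_algebra_simps [simp]:
  "carrier ring_of_type_algebra = UNIV" "\<zero>\<^bsub>ring_of_type_algebra\<^esub> = 0" "\<one>\<^bsub>ring_of_type_algebra\<^esub> = 1"
  "x \<oplus>\<^bsub>ring_of_type_algebra\<^esub> y = x + y" "x \<otimes>\<^bsub>ring_of_type_algebra\<^esub> y = x * y"
  by (simp_all add: ring_of_type_algebra_def)

lemma abelian_group_cong:
  assumes "abelian_group P" "carrier Q = carrier P" "zero Q = zero P" "add Q = add P"
  shows "abelian_group Q"
proof -
  interpret P: abelian_group P by fact
  show ?thesis
  proof (rule abelian_groupI)
    fix x assume "x \<in> carrier Q"
    then show "\<exists>y\<in>carrier Q. y \<oplus>\<^bsub>Q\<^esub> x = \<zero>\<^bsub>Q\<^esub>"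
      using assms(2-4) by (intro bexI[of _ "\<ominus>\<^bsub>P\<^esub> x"]) (auto simp: P.l_neg)
  qed (use assms(2-4) in \<open>auto simp: P.a_ac\<close>)
qed

lemma a_r_coset_cong: "add Q = add P \<Longrightarrow> N +>\<^bsub>Q\<^esub> x = N +>\<^bsub>P\<^esub> x"
  by (simp add: a_r_coset_def')

text \<open>Two instances matter: smooth functions with the constants, and the field itself with the
  identity. Through the latter the algebra of dual bases also applies to single fibers.\<close>

locale scalar_algebra =
  fixes A :: "'a ring" and \<iota> :: "'k::{real_normed_field,euclidean_space} \<Rightarrow> 'a"
  assumes A: "cring A" and \<iota>_carrier: "\<And>c. \<iota> c \<in> carrier A"
    and \<iota>_add: "\<And>c d. \<iota> (c + d) = \<iota> c \<oplus>\<^bsub>A\<^esub> \<iota> d"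
    and \<iota>_mult: "\<And>c d. \<iota> (c * d) = \<iota> c \<otimes>\<^bsub>A\<^esub> \<iota> d"
    and \<iota>_one: "\<iota> 1 = \<one>\<^bsub>A\<^esub>"
begin

lemma restrict_scalars_module:
  assumes "module A P"
  shows "module ring_of_type_algebra (restrict_scalars \<iota> P)"
proof -
  interpret P: module A P by fact
  show ?thesis
  proof (rule moduleI)
    show "cring (ring_of_type_algebra :: 'k ring)" by (rule cring_from_type_algebra)
    show "abelian_group (restrict_scalars \<iota> P)"
      by (rule abelian_group_cong[OF P.M.abelian_group_axioms]) simp_all
  qed (simp_all add: \<iota>_carrier \<iota>_add \<iota>_mult \<iota>_one P.smult_l_distr P.smult_r_distr P.smult_assoc1)
qed

lemma restrict_scalars_hom:
  "f \<in> module_hom A P Q \<Longrightarrow>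
    f \<in> module_hom ring_of_type_algebra (restrict_scalars \<iota> P) (restrict_scalars \<iota> Q)"
  by (auto simp: module_hom_def \<iota>_carrier)

lemma restrict_scalars_bilinear:
  "bilinear_map A P Q N g \<Longrightarrow> bilinear_map ring_of_type_algebra
    (restrict_scalars \<iota> P) (restrict_scalars \<iota> Q) (restrict_scalars \<iota> N) g"
  by (simp add: bilinear_map_def restrict_scalars_hom)

end

text \<open>
  \<open>(t, \<omega>)\<close> and \<open>(r, \<rho>)\<close> are finite dual bases of the modules \<open>P\<close> and \<open>Q\<close>, and \<open>\<Omega>\<close> is the
  family of coordinates on \<open>R\<close> with respect to the products \<open>\<beta> (t j) (r l)\<close>.
\<close>

locale dual_bases = scalar_algebra A \<iota> for A :: "'a ring" and \<iota> :: "'k::{real_normed_field,euclidean_space} \<Rightarrow> 'a" +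
  fixes P :: "('a, 'p) module" and Q :: "('a, 'q) module" and R :: "('a, 'r) module"
    and \<beta> :: "'p \<Rightarrow> 'q \<Rightarrow> 'r" and J :: "'j set" and L :: "'l set"
    and t :: "'j \<Rightarrow> 'p" and \<omega> :: "'j \<Rightarrow> 'p \<Rightarrow> 'a" and r :: "'l \<Rightarrow> 'q" and \<rho> :: "'l \<Rightarrow> 'q \<Rightarrow> 'a"
    and \<Omega> :: "'j \<Rightarrow> 'l \<Rightarrow> 'r \<Rightarrow> 'a"
  assumes P: "module A P" and Q: "module A Q" and R: "module A R"
    and \<beta>: "bilinear_map A P Q R \<beta>"
    and fin: "finite J" "finite L"
    and t: "\<And>j. j \<in> J \<Longrightarrow> t j \<in> carrier P" and r: "\<And>l. l \<in> L \<Longrightarrow> r l \<in> carrier Q"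
    and \<omega>: "\<And>j p. j \<in> J \<Longrightarrow> p \<in> carrier P \<Longrightarrow> \<omega> j p \<in> carrier A"
    and \<rho>: "\<And>l q. l \<in> L \<Longrightarrow> q \<in> carrier Q \<Longrightarrow> \<rho> l q \<in> carrier A"
    and \<Omega>: "\<And>j l u. j \<in> J \<Longrightarrow> l \<in> L \<Longrightarrow> u \<in> carrier R \<Longrightarrow> \<Omega> j l u \<in> carrier A"
    and \<Omega>_add: "\<And>j l u v. j \<in> J \<Longrightarrow> l \<in> L \<Longrightarrow> u \<in> carrier R \<Longrightarrow> v \<in> carrier R \<Longrightarrow>
      \<Omega> j l (u \<oplus>\<^bsub>R\<^esub> v) = \<Omega> j l u \<oplus>\<^bsub>A\<^esub> \<Omega> j l v"
    and \<Omega>_\<beta>: "\<And>j l p q. j \<in> J \<Longrightarrow> l \<in> L \<Longrightarrow> p \<in> carrier P \<Longrightarrow> q \<in> carrier Q \<Longrightarrow>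
      \<Omega> j l (\<beta> p q) = \<omega> j p \<otimes>\<^bsub>A\<^esub> \<rho> l q"
    and expand_P: "\<And>p. p \<in> carrier P \<Longrightarrow> p = (\<Oplus>\<^bsub>P\<^esub>j\<in>J. \<omega> j p \<odot>\<^bsub>P\<^esub> t j)"
    and expand_Q: "\<And>q. q \<in> carrier Q \<Longrightarrow> q = (\<Oplus>\<^bsub>Q\<^esub>l\<in>L. \<rho> l q \<odot>\<^bsub>Q\<^esub> r l)"
    and expand_R: "\<And>u. u \<in> carrier R \<Longrightarrow>
      u = (\<Oplus>\<^bsub>R\<^esub>j\<in>J. \<Oplus>\<^bsub>R\<^esub>l\<in>L. \<Omega> j l u \<odot>\<^bsub>R\<^esub> \<beta> (t j) (r l))"
begin

sublocale A: cring A by (rule A)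
sublocale P: module A P by (rule P)
sublocale Q: module A Q by (rule Q)
sublocale R: module A R by (rule R)

lemma \<beta>_left: "q \<in> carrier Q \<Longrightarrow> (\<lambda>p. \<beta> p q) \<in> module_hom A P R"
  and \<beta>_right: "p \<in> carrier P \<Longrightarrow> \<beta> p \<in> module_hom A Q R"
  using \<beta> by (simp_all add: bilinear_map_def)

text \<open>Asking for additivity in each variable only makes it apply to the tensor product over
  \<open>A\<close> and also to classes of tensors over the field modulo balancing relations, where
  \<open>g\<close> has no \<open>A\<close>-linearity in general.\<close>

lemma biadditive_expand:
  assumes N: "abelian_group N"
    and g: "\<And>p. p \<in> carrier P \<Longrightarrow> additive_map Q N (g p)"
      "\<And>q. q \<in> carrier Q \<Longrightarrow> additive_map P N (\<lambda>p. g p q)"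
    and p: "p \<in> carrier P" and q: "q \<in> carrier Q"
  shows "g p q = (\<Oplus>\<^bsub>N\<^esub>j\<in>J. \<Oplus>\<^bsub>N\<^esub>l\<in>L. g (\<omega> j p \<odot>\<^bsub>P\<^esub> t j) (\<rho> l q \<odot>\<^bsub>Q\<^esub> r l))"
proof -
  interpret N: abelian_group N by fact
  have tj: "\<omega> j p \<odot>\<^bsub>P\<^esub> t j \<in> carrier P" if "j \<in> J" for j using \<omega> t p that by simp
  have rl: "\<rho> l q \<odot>\<^bsub>Q\<^esub> r l \<in> carrier Q" if "l \<in> L" for l using \<rho> r q that by simp
  have "g p q = g (\<Oplus>\<^bsub>P\<^esub>j\<in>J. \<omega> j p \<odot>\<^bsub>P\<^esub> t j) q" using expand_P[OF p] by simp
  also have "\<dots> = (\<Oplus>\<^bsub>N\<^esub>j\<in>J. g (\<omega> j p \<odot>\<^bsub>P\<^esub> t j) q)"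
    by (rule additive_map_finsum[OF P.M.abelian_group_axioms N g(2)[OF q] fin(1)]) (use tj in auto)
  also have "\<dots> = (\<Oplus>\<^bsub>N\<^esub>j\<in>J. \<Oplus>\<^bsub>N\<^esub>l\<in>L. g (\<omega> j p \<odot>\<^bsub>P\<^esub> t j) (\<rho> l q \<odot>\<^bsub>Q\<^esub> r l))"
  proof (rule N.finsum_cong'[OF refl])
    show "(\<lambda>j. \<Oplus>\<^bsub>N\<^esub>l\<in>L. g (\<omega> j p \<odot>\<^bsub>P\<^esub> t j) (\<rho> l q \<odot>\<^bsub>Q\<^esub> r l)) \<in> J \<rightarrow> carrier N"
      using additive_mapD(1)[OF g(1)[OF tj] rl] by (auto intro!: N.finsum_closed)
    fix j assume j: "j \<in> J"
    have "g (\<omega> j p \<odot>\<^bsub>P\<^esub> t j) q = g (\<omega> j p \<odot>\<^bsub>P\<^esub> t j) (\<Oplus>\<^bsub>Q\<^esub>l\<in>L. \<rho> l q \<odot>\<^bsub>Q\<^esub> r l)"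
      using expand_Q[OF q] by simp
    also have "\<dots> = (\<Oplus>\<^bsub>N\<^esub>l\<in>L. g (\<omega> j p \<odot>\<^bsub>P\<^esub> t j) (\<rho> l q \<odot>\<^bsub>Q\<^esub> r l))"
      by (rule additive_map_finsum[OF Q.M.abelian_group_axioms N g(1)[OF tj[OF j]] fin(2)])
        (use rl in auto)
    finally show "g (\<omega> j p \<odot>\<^bsub>P\<^esub> t j) q = (\<Oplus>\<^bsub>N\<^esub>l\<in>L. g (\<omega> j p \<odot>\<^bsub>P\<^esub> t j) (\<rho> l q \<odot>\<^bsub>Q\<^esub> r l))" .
  qed
  finally show ?thesis .
qed

lemma double_finsum_cong:
  assumes N: "abelian_group N" and car: "\<And>j l. j \<in> J \<Longrightarrow> l \<in> L \<Longrightarrow> g j l \<in> carrier N"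
    and eq: "\<And>j l. j \<in> J \<Longrightarrow> l \<in> L \<Longrightarrow> f j l = g j l"
  shows "(\<Oplus>\<^bsub>N\<^esub>j\<in>J. \<Oplus>\<^bsub>N\<^esub>l\<in>L. f j l) = (\<Oplus>\<^bsub>N\<^esub>j\<in>J. \<Oplus>\<^bsub>N\<^esub>l\<in>L. g j l)"
proof -
  interpret N: abelian_group N by fact
  have "(\<Oplus>\<^bsub>N\<^esub>l\<in>L. f j l) = (\<Oplus>\<^bsub>N\<^esub>l\<in>L. g j l)" if "j \<in> J" for j
    by (rule N.finsum_cong'[OF refl]) (use car eq that in auto)
  moreover have "(\<lambda>j. \<Oplus>\<^bsub>N\<^esub>l\<in>L. g j l) \<in> J \<rightarrow> carrier N"
    using car by (auto intro!: N.finsum_closed)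
  ultimately show ?thesis by (rule N.finsum_cong'[OF refl, rotated])
qed

lemma additive_map_double_finsum:
  assumes "abelian_group N" "abelian_group N'" "additive_map N N' f"
    and car: "\<And>j l. j \<in> J \<Longrightarrow> l \<in> L \<Longrightarrow> g j l \<in> carrier N"
  shows "f (\<Oplus>\<^bsub>N\<^esub>j\<in>J. \<Oplus>\<^bsub>N\<^esub>l\<in>L. g j l) = (\<Oplus>\<^bsub>N'\<^esub>j\<in>J. \<Oplus>\<^bsub>N'\<^esub>l\<in>L. f (g j l))"
proof -
  interpret N: abelian_group N by fact
  interpret N': abelian_group N' by fact
  have "f (\<Oplus>\<^bsub>N\<^esub>j\<in>J. \<Oplus>\<^bsub>N\<^esub>l\<in>L. g j l) = (\<Oplus>\<^bsub>N'\<^esub>j\<in>J. f (\<Oplus>\<^bsub>N\<^esub>l\<in>L. g j l))"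
    by (rule additive_map_finsum[OF assms(1-3) fin(1)]) (use car in \<open>auto intro!: N.finsum_closed\<close>)
  also have "\<dots> = (\<Oplus>\<^bsub>N'\<^esub>j\<in>J. \<Oplus>\<^bsub>N'\<^esub>l\<in>L. f (g j l))"
  proof (rule N'.finsum_cong'[OF refl])
    show "(\<lambda>j. \<Oplus>\<^bsub>N'\<^esub>l\<in>L. f (g j l)) \<in> J \<rightarrow> carrier N'"
      using additive_mapD(1)[OF assms(3)] car by (auto intro!: N'.finsum_closed)
    show "f (\<Oplus>\<^bsub>N\<^esub>l\<in>L. g j l) = (\<Oplus>\<^bsub>N'\<^esub>l\<in>L. f (g j l))" if "j \<in> J" for j
      by (rule additive_map_finsum[OF assms(1-3) fin(2)]) (use car that in auto)
  qed
  finally show ?thesis .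
qed

lemma double_finsum_addf:
  assumes "abelian_group N"
    and car: "\<And>j l. j \<in> J \<Longrightarrow> l \<in> L \<Longrightarrow> f j l \<in> carrier N" "\<And>j l. j \<in> J \<Longrightarrow> l \<in> L \<Longrightarrow> g j l \<in> carrier N"
  shows "(\<Oplus>\<^bsub>N\<^esub>j\<in>J. \<Oplus>\<^bsub>N\<^esub>l\<in>L. f j l \<oplus>\<^bsub>N\<^esub> g j l) =
    (\<Oplus>\<^bsub>N\<^esub>j\<in>J. \<Oplus>\<^bsub>N\<^esub>l\<in>L. f j l) \<oplus>\<^bsub>N\<^esub> (\<Oplus>\<^bsub>N\<^esub>j\<in>J. \<Oplus>\<^bsub>N\<^esub>l\<in>L. g j l)"
proof -
  interpret N: abelian_group N by fact
  have "(\<Oplus>\<^bsub>N\<^esub>j\<in>J. \<Oplus>\<^bsub>N\<^esub>l\<in>L. f j l \<oplus>\<^bsub>N\<^esub> g j l) =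
      (\<Oplus>\<^bsub>N\<^esub>j\<in>J. (\<Oplus>\<^bsub>N\<^esub>l\<in>L. f j l) \<oplus>\<^bsub>N\<^esub> (\<Oplus>\<^bsub>N\<^esub>l\<in>L. g j l))"
  proof (rule N.finsum_cong'[OF refl])
    show "(\<Oplus>\<^bsub>N\<^esub>l\<in>L. f j l \<oplus>\<^bsub>N\<^esub> g j l) = (\<Oplus>\<^bsub>N\<^esub>l\<in>L. f j l) \<oplus>\<^bsub>N\<^esub> (\<Oplus>\<^bsub>N\<^esub>l\<in>L. g j l)" if "j \<in> J" for j
      by (rule N.finsum_addf) (use car that in auto)
  qed (use car in \<open>auto intro!: N.finsum_closed\<close>)
  also have "\<dots> = (\<Oplus>\<^bsub>N\<^esub>j\<in>J. \<Oplus>\<^bsub>N\<^esub>l\<in>L. f j l) \<oplus>\<^bsub>N\<^esub> (\<Oplus>\<^bsub>N\<^esub>j\<in>J. \<Oplus>\<^bsub>N\<^esub>l\<in>L. g j l)"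
    by (rule N.finsum_addf) (use car in \<open>auto intro!: N.finsum_closed\<close>)
  finally show ?thesis .
qed

text \<open>\<open>\<Psi> \<circ> \<Theta>\<close> is the identity by \<open>expand_R\<close>. The
  other composite is additive, hence compared on pure tensors: there both factors are expanded, and
  the coefficients, pulled out of the tensor over \<open>A\<close>, multiply to
  \<open>\<Omega> j l (\<beta> p q)\<close>.\<close>

lemma algebraic_iso:
  obtains \<Psi> where "module_iso A (tensor_module A P Q) R \<Psi>"
    "\<And>p q. p \<in> carrier P \<Longrightarrow> q \<in> carrier Q \<Longrightarrow> \<Psi> (pure_tensor A P Q p q) = \<beta> p q"
proof -
  let ?T = "tensor_module A P Q" and ?\<tau> = "pure_tensor A P Q"
  interpret T: module A ?T by (rule module_tensor_module[OF P Q])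
  note \<tau>l = module_homD[OF pure_tensor_left_hom[OF P Q]]
    and \<tau>r = module_homD[OF pure_tensor_right_hom[OF P Q]]
  obtain \<Psi> where \<Psi>: "\<Psi> \<in> module_hom A ?T R"
    "\<And>p q. p \<in> carrier P \<Longrightarrow> q \<in> carrier Q \<Longrightarrow> \<Psi> (?\<tau> p q) = \<beta> p q"
    by (rule tensor_lift[OF P Q R \<beta>]) (rule that)
  note \<Psi>' = module_homD[OF \<Psi>(1)]
  define \<Theta> where "\<Theta> u = (\<Oplus>\<^bsub>?T\<^esub>j\<in>J. \<Oplus>\<^bsub>?T\<^esub>l\<in>L. \<Omega> j l u \<odot>\<^bsub>?T\<^esub> ?\<tau> (t j) (r l))" for u
  have tr: "?\<tau> (t j) (r l) \<in> carrier ?T" if "j \<in> J" "l \<in> L" for j l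
    using \<tau>l(2) t r that by simp
  have \<Theta>_closed: "\<Theta> u \<in> carrier ?T" if "u \<in> carrier R" for u
    unfolding \<Theta>_def using tr \<Omega> that by (auto intro!: T.M.finsum_closed)
  have \<Theta>_add: "\<Theta> (u \<oplus>\<^bsub>R\<^esub> v) = \<Theta> u \<oplus>\<^bsub>?T\<^esub> \<Theta> v" if u: "u \<in> carrier R" "v \<in> carrier R" for u v
  proof -
    have "\<Theta> (u \<oplus>\<^bsub>R\<^esub> v) = (\<Oplus>\<^bsub>?T\<^esub>j\<in>J. \<Oplus>\<^bsub>?T\<^esub>l\<in>L.
        \<Omega> j l u \<odot>\<^bsub>?T\<^esub> ?\<tau> (t j) (r l) \<oplus>\<^bsub>?T\<^esub> \<Omega> j l v \<odot>\<^bsub>?T\<^esub> ?\<tau> (t j) (r l))"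
      unfolding \<Theta>_def by (rule double_finsum_cong[OF T.M.abelian_group_axioms])
        (use u tr \<Omega> \<Omega>_add in \<open>simp_all add: T.smult_l_distr\<close>)
    also have "\<dots> = \<Theta> u \<oplus>\<^bsub>?T\<^esub> \<Theta> v"
      unfolding \<Theta>_def by (rule double_finsum_addf[OF T.M.abelian_group_axioms]) (use u tr \<Omega> in simp_all)
    finally show ?thesis .
  qed
  have \<Psi>\<Theta>: "\<Psi> (\<Theta> u) = u" if u: "u \<in> carrier R" for u
  proof -
    have "\<Psi> (\<Theta> u) = (\<Oplus>\<^bsub>R\<^esub>j\<in>J. \<Oplus>\<^bsub>R\<^esub>l\<in>L. \<Psi> (\<Omega> j l u \<odot>\<^bsub>?T\<^esub> ?\<tau> (t j) (r l)))"
      unfolding \<Theta>_def by (rule additive_map_double_finsum[OF T.M.abelian_group_axioms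
            R.M.abelian_group_axioms \<Psi>'(1)]) (use u tr \<Omega> in simp)
    also have "\<dots> = (\<Oplus>\<^bsub>R\<^esub>j\<in>J. \<Oplus>\<^bsub>R\<^esub>l\<in>L. \<Omega> j l u \<odot>\<^bsub>R\<^esub> \<beta> (t j) (r l))"
      by (rule double_finsum_cong[OF R.M.abelian_group_axioms])
        (use u tr \<Omega> t r \<Psi>(2) \<Psi>'(4) module_homD(2)[OF \<beta>_left] in simp_all)
    finally show ?thesis using expand_R[OF u] by simp
  qed
  have \<Theta>\<Psi>: "\<Theta> (\<Psi> x) = x" if "x \<in> carrier ?T" for x
    using that
  proof (induction rule: tensor_induct[OF P Q, consumes 1, case_names pure add])
    case (pure p q)
    have "?\<tau> p q = (\<Oplus>\<^bsub>?T\<^esub>j\<in>J. \<Oplus>\<^bsub>?T\<^esub>l\<in>L. ?\<tau> (\<omega> j p \<odot>\<^bsub>P\<^esub> t j) (\<rho> l q \<odot>\<^bsub>Q\<^esub> r l))"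
      by (rule biadditive_expand[OF T.M.abelian_group_axioms \<tau>r(1) \<tau>l(1) pure])
    also have "\<dots> = (\<Oplus>\<^bsub>?T\<^esub>j\<in>J. \<Oplus>\<^bsub>?T\<^esub>l\<in>L. \<Omega> j l (\<beta> p q) \<odot>\<^bsub>?T\<^esub> ?\<tau> (t j) (r l))"
    proof (rule double_finsum_cong[OF T.M.abelian_group_axioms])
      fix j l assume jl: "j \<in> J" "l \<in> L"
      show "\<Omega> j l (\<beta> p q) \<odot>\<^bsub>?T\<^esub> ?\<tau> (t j) (r l) \<in> carrier ?T"
        using \<Omega>[OF jl] module_homD(2)[OF \<beta>_left] pure tr[OF jl] by simp
      have "?\<tau> (\<omega> j p \<odot>\<^bsub>P\<^esub> t j) (\<rho> l q \<odot>\<^bsub>Q\<^esub> r l) = \<rho> l q \<odot>\<^bsub>?T\<^esub> (\<omega> j p \<odot>\<^bsub>?T\<^esub> ?\<tau> (t j) (r l))"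
        using jl pure t r \<omega> \<rho> \<tau>l(4) \<tau>r(4) by simp
      then show "?\<tau> (\<omega> j p \<odot>\<^bsub>P\<^esub> t j) (\<rho> l q \<odot>\<^bsub>Q\<^esub> r l) = \<Omega> j l (\<beta> p q) \<odot>\<^bsub>?T\<^esub> ?\<tau> (t j) (r l)"
        using jl pure tr \<omega> \<rho> by (simp add: \<Omega>_\<beta> T.smult_assoc1[symmetric] A.m_comm)
    qed
    also have "\<dots> = \<Theta> (\<Psi> (?\<tau> p q))" using \<Psi>(2) pure by (simp add: \<Theta>_def)
    finally show ?case by simp
  next
    case (add x y)
    then show ?case using \<Psi>'(2,3) \<Theta>_add by simp
  qed
  have "bij_betw \<Psi> (carrier ?T) (carrier R)"
    by (rule bij_betw_byWitness[where f' = \<Theta>]) (use \<Psi>\<Theta> \<Theta>\<Psi> \<Theta>_closed \<Psi>'(2) in auto)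
  then have "module_iso A ?T R \<Psi>"
    using \<Psi>(1) T.module_axioms R by (simp add: module_iso_def)
  then show thesis using \<Psi>(2) that by blast
qed

end

section \<open>Projective tensor products and dual bases\<close>

lemma continuous_map_add:
  assumes "locally_convex_topology V T" "continuous_map Z T f" "continuous_map Z T g"
  shows "continuous_map Z T (\<lambda>z. f z \<oplus>\<^bsub>V\<^esub> g z)"
proof -
  have "continuous_map (prod_topology T T) T (\<lambda>(x, y). x \<oplus>\<^bsub>V\<^esub> y)"
    using assms(1) by (simp add: locally_convex_topology_def)
  from continuous_map_compose[OF continuous_map_pairedI[OF assms(2,3)] this]
  show ?thesis by (simp add: o_def)
qed

lemma continuous_map_finsum:
  assumes "locally_convex_topology V T" "abelian_group V" "finite I"
    "\<And>i. i \<in> I \<Longrightarrow> continuous_map Z T (f i)"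
  shows "continuous_map Z T (\<lambda>z. \<Oplus>\<^bsub>V\<^esub>i\<in>I. f i z)"
proof -
  interpret V: abelian_group V by fact
  have top: "topspace T = carrier V" using assms(1) by (simp add: locally_convex_topology_def)
  show ?thesis
    using assms(3,4)
  proof (induction I rule: finite_induct)
    case empty
    then show ?case using top by simp
  next
    case (insert i I)
    have car: "f j z \<in> carrier V" if "j \<in> insert i I" "z \<in> topspace Z" for j z
      using continuous_map_image_subset_topspace[OF insert.prems[OF that(1)]] that(2) top by auto
    have "continuous_map Z T (\<lambda>z. f i z \<oplus>\<^bsub>V\<^esub> (\<Oplus>\<^bsub>V\<^esub>i\<in>I. f i z))"
      using insert by (intro continuous_map_add[OF assms(1)]) auto
    then show ?case
    proof (rule continuous_map_eq)
      fix z assume "z \<in> topspace Z"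
      then show "f i z \<oplus>\<^bsub>V\<^esub> (\<Oplus>\<^bsub>V\<^esub>i\<in>I. f i z) = (\<Oplus>\<^bsub>V\<^esub>i\<in>insert i I. f i z)"
        using car insert.hyps by simp
    qed
  qed
qed

text \<open>This is how maps out of a projective tensor product are shown continuous: the topology
  pulled back along \<open>F\<close> competes in the supremum that defines the projective topology.
  It fails to be Hausdorff when \<open>F\<close> has a kernel, which
  \<open>locally_convex_topology\<close> permits.\<close>

lemma locally_convex_pullback:
  fixes V :: "('k::real_normed_field, 'p, 'v) module_scheme"
  assumes V: "module ring_of_type_algebra V" and lc: "locally_convex_topology W T"
    and F: "F \<in> module_hom ring_of_type_algebra V W"
    and W: "abelian_group W"
  shows "locally_convex_topology V (pullback_topology (carrier V) F T)" (is "locally_convex_topology V ?T")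
  unfolding locally_convex_topology_def
proof (intro conjI allI impI)
  interpret V: module ring_of_type_algebra V by (rule V)
  note F' = module_homD[OF F]
  have top: "topspace T = carrier W" using lc by (simp add: locally_convex_topology_def)
  show top': "topspace ?T = carrier V"
    using F'(2) by (auto simp: topspace_pullback_topology top)
  have cF: "continuous_map ?T T F" using continuous_map_pullback[of T T id "carrier V" F] by simp
  have c: "continuous_map Z ?T g"
    if "continuous_map Z T (\<lambda>z. F (g z))" "\<And>z. z \<in> topspace Z \<Longrightarrow> g z \<in> carrier V" for g :: "'z \<Rightarrow> 'p" and Z
    using that by (intro continuous_map_pullback') (auto simp: o_def)
  show "continuous_map (prod_topology ?T ?T) ?T (\<lambda>(x, y). x \<oplus>\<^bsub>V\<^esub> y)"
  proof (rule c)
    have 1: "continuous_map (prod_topology T T) T (\<lambda>(x, y). x \<oplus>\<^bsub>W\<^esub> y)"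
      using lc by (simp add: locally_convex_topology_def)
    have 2: "continuous_map (prod_topology ?T ?T) (prod_topology T T) (\<lambda>z. (F (fst z), F (snd z)))"
      by (intro continuous_map_pairedI continuous_map_compose[OF continuous_map_fst cF, unfolded o_def]
          continuous_map_compose[OF continuous_map_snd cF, unfolded o_def])
    have "continuous_map (prod_topology ?T ?T) T (\<lambda>z. F (fst z) \<oplus>\<^bsub>W\<^esub> F (snd z))"
      using continuous_map_compose[OF 2 1] by (simp add: o_def)
    then show "continuous_map (prod_topology ?T ?T) T (\<lambda>z. F (case z of (x, y) \<Rightarrow> x \<oplus>\<^bsub>V\<^esub> y))"
      by (rule continuous_map_eq) (use F'(3) top' in \<open>auto simp: topspace_prod_topology\<close>)
  qed (use top' in \<open>auto simp: topspace_prod_topology\<close>)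
  show "continuous_map (prod_topology euclidean ?T) ?T (\<lambda>(c, x). c \<odot>\<^bsub>V\<^esub> x)"
  proof (rule c)
    have 1: "continuous_map (prod_topology euclidean T) T (\<lambda>(c, x). c \<odot>\<^bsub>W\<^esub> x)"
      using lc by (simp add: locally_convex_topology_def)
    have 2: "continuous_map (prod_topology euclidean ?T) (prod_topology euclidean T) (\<lambda>z. (fst z, F (snd z)))"
      by (intro continuous_map_pairedI continuous_map_fst
          continuous_map_compose[OF continuous_map_snd cF, unfolded o_def])
    have "continuous_map (prod_topology euclidean ?T) T (\<lambda>z. fst z \<odot>\<^bsub>W\<^esub> F (snd z))"
      using continuous_map_compose[OF 2 1] by (simp add: o_def)
    then show "continuous_map (prod_topology euclidean ?T) T (\<lambda>z. F (case z of (c, x) \<Rightarrow> c \<odot>\<^bsub>V\<^esub> x))"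
      by (rule continuous_map_eq) (use F'(4) top' in \<open>auto simp: topspace_prod_topology\<close>)
    fix z :: "'k \<times> 'p" assume "z \<in> topspace (prod_topology euclidean ?T)"
    then show "(case z of (c, x) \<Rightarrow> c \<odot>\<^bsub>V\<^esub> x) \<in> carrier V"
      using top' by (cases z) simp
  qed
  fix U assume "openin ?T U \<and> \<zero>\<^bsub>V\<^esub> \<in> U"
  then obtain U' where U': "openin T U'" "U = F -` U' \<inter> carrier V" "F \<zero>\<^bsub>V\<^esub> \<in> U'"
    by (auto simp: openin_pullback_topology)
  have F0: "F \<zero>\<^bsub>V\<^esub> = \<zero>\<^bsub>W\<^esub>" by (rule additive_map_zero[OF V.M.abelian_group_axioms W F'(1)])
  have "\<forall>U. openin T U \<and> \<zero>\<^bsub>W\<^esub> \<in> U \<longrightarrow> (\<exists>C. openin T C \<and> \<zero>\<^bsub>W\<^esub> \<in> C \<and> C \<subseteq> U \<and> K_convex W C)"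
    using lc by (simp add: locally_convex_topology_def)
  then obtain C where C: "openin T C" "\<zero>\<^bsub>W\<^esub> \<in> C" "C \<subseteq> U'" "K_convex W C"
    using U'(1,3) F0 by auto
  have "K_convex V (F -` C \<inter> carrier V)"
    using C(4) F' unfolding K_convex_def by simp
  then show "\<exists>C. openin ?T C \<and> \<zero>\<^bsub>V\<^esub> \<in> C \<and> C \<subseteq> U \<and> K_convex V C"
    using C F0 U'(2) by (intro exI[of _ "F -` C \<inter> carrier V"]) (auto simp: openin_pullback_topology)
qed

context dual_bases begin

text \<open>Over the field, \<open>F \<circ> \<Theta>\<close> is the identity, but
  \<open>\<Theta> \<circ> F\<close> is so only modulo the span \<open>N\<close> of the balancing
  relations. Hence \<open>N\<close> is the kernel of \<open>F\<close> by pure algebra, it is closed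
  once \<open>F\<close> is continuous, and \<open>\<Theta>\<close> followed by the class map inverts
  the induced map.\<close>

lemma topological_iso:
  assumes topP: "topspace TP = carrier P" and topQ: "topspace TQ = carrier Q"
    and lcR: "locally_convex_topology (restrict_scalars \<iota> R) TR" and hausR: "Hausdorff_space TR"
    and cont\<beta>: "continuous_map (prod_topology TP TQ) TR (\<lambda>(p, q). \<beta> p q)"
    and cont\<Omega>: "\<And>j l. j \<in> J \<Longrightarrow> l \<in> L \<Longrightarrow> continuous_map TR TP (\<lambda>u. \<Omega> j l u \<odot>\<^bsub>P\<^esub> t j)"
  obtains \<Phi> where "module_iso A (proj_tensor_module \<iota> A P TP Q TQ) R \<Phi>"
    "homeomorphic_map (proj_tensor_topology \<iota> A P TP Q TQ) TR \<Phi>"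
    "\<And>p q. p \<in> carrier P \<Longrightarrow> q \<in> carrier Q \<Longrightarrow> \<Phi> (proj_pure_tensor \<iota> A P TP Q TQ p q) = \<beta> p q"
proof -
  let ?K = "ring_of_type_algebra :: 'k ring"
  let ?P = "restrict_scalars \<iota> P" and ?Q = "restrict_scalars \<iota> Q" and ?R = "restrict_scalars \<iota> R"
  let ?X = "base_tensor \<iota> P Q" and ?\<tau> = "base_pure_tensor \<iota> P Q" and ?TX = "base_topology \<iota> P TP Q TQ"
  note MP = restrict_scalars_module[OF P] and MQ = restrict_scalars_module[OF Q]
    and MR = restrict_scalars_module[OF R]
  interpret X: module ?K ?X by (rule module_tensor_module[OF MP MQ])
  note aX = X.M.abelian_group_axioms and aR = R.M.abelian_group_axioms
  note \<tau>l = module_homD[OF pure_tensor_left_hom[OF MP MQ], unfolded restrict_scalars_simps]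
    and \<tau>r = module_homD[OF pure_tensor_right_hom[OF MP MQ], unfolded restrict_scalars_simps]
  have \<tau>: "?\<tau> p q \<in> carrier ?X" if "p \<in> carrier P" "q \<in> carrier Q" for p q
    using \<tau>l(2) that by simp
  have \<tau>al: "additive_map P ?X (\<lambda>p. ?\<tau> p q)" if "q \<in> carrier Q" for q
    using \<tau>l(2,3) that by (simp add: additive_map_def)
  have \<tau>ar: "additive_map Q ?X (?\<tau> p)" if "p \<in> carrier P" for p
    using \<tau>r(2,3) that by (simp add: additive_map_def)
  note induct = tensor_induct[OF MP MQ, unfolded restrict_scalars_simps, consumes 1, case_names pure add]
  obtain F where F: "F \<in> module_hom ?K ?X ?R"
    "\<And>p q. p \<in> carrier ?P \<Longrightarrow> q \<in> carrier ?Q \<Longrightarrow> F (?\<tau> p q) = \<beta> p q"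
    by (rule tensor_lift[OF MP MQ MR restrict_scalars_bilinear[OF \<beta>]]) (rule that)
  note F\<tau> = F(2)[unfolded restrict_scalars_simps]
  note F' = module_homD[OF F(1), unfolded restrict_scalars_simps]
  have Fa: "additive_map ?X R F" using F'(2,3) by (simp add: additive_map_def)
  note F0 = additive_map_zero[OF aX aR Fa]

  \<comment> \<open>Over the field a coefficient function cannot be pulled out of the tensor, so it
    is attached to \<open>t j\<close>. Each summand is then a map into \<open>P\<close> followed by
    tensoring with the fixed element \<open>r l\<close>.\<close>
  define \<Theta> where "\<Theta> u = (\<Oplus>\<^bsub>?X\<^esub>j\<in>J. \<Oplus>\<^bsub>?X\<^esub>l\<in>L. ?\<tau> (\<Omega> j l u \<odot>\<^bsub>P\<^esub> t j) (r l))" for u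
  have tr: "?\<tau> (\<Omega> j l u \<odot>\<^bsub>P\<^esub> t j) (r l) \<in> carrier ?X" if "j \<in> J" "l \<in> L" "u \<in> carrier R" for j l u
    using \<tau> t r \<Omega> that by simp
  have \<Theta>_closed: "\<Theta> u \<in> carrier ?X" if "u \<in> carrier R" for u
    unfolding \<Theta>_def using tr that by (auto intro!: X.M.finsum_closed)
  have \<Theta>_add: "\<Theta> (u \<oplus>\<^bsub>R\<^esub> v) = \<Theta> u \<oplus>\<^bsub>?X\<^esub> \<Theta> v" if u: "u \<in> carrier R" "v \<in> carrier R" for u v
  proof -
    have "\<Theta> (u \<oplus>\<^bsub>R\<^esub> v) = (\<Oplus>\<^bsub>?X\<^esub>j\<in>J. \<Oplus>\<^bsub>?X\<^esub>l\<in>L.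
        ?\<tau> (\<Omega> j l u \<odot>\<^bsub>P\<^esub> t j) (r l) \<oplus>\<^bsub>?X\<^esub> ?\<tau> (\<Omega> j l v \<odot>\<^bsub>P\<^esub> t j) (r l))"
      unfolding \<Theta>_def by (rule double_finsum_cong[OF aX])
        (use u tr \<Omega> \<Omega>_add t r \<tau>l(3) in \<open>simp_all add: P.smult_l_distr\<close>)
    also have "\<dots> = \<Theta> u \<oplus>\<^bsub>?X\<^esub> \<Theta> v"
      unfolding \<Theta>_def by (rule double_finsum_addf[OF aX]) (use u tr in simp_all)
    finally show ?thesis .
  qed
  have \<Theta>a: "additive_map R ?X \<Theta>" using \<Theta>_closed \<Theta>_add by (simp add: additive_map_def)
  have F\<Theta>: "F (\<Theta> u) = u" if u: "u \<in> carrier R" for u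
  proof -
    have "F (\<Theta> u) = (\<Oplus>\<^bsub>R\<^esub>j\<in>J. \<Oplus>\<^bsub>R\<^esub>l\<in>L. F (?\<tau> (\<Omega> j l u \<odot>\<^bsub>P\<^esub> t j) (r l)))"
      unfolding \<Theta>_def by (rule additive_map_double_finsum[OF aX aR Fa]) (use u tr in simp)
    also have "\<dots> = (\<Oplus>\<^bsub>R\<^esub>j\<in>J. \<Oplus>\<^bsub>R\<^esub>l\<in>L. \<Omega> j l u \<odot>\<^bsub>R\<^esub> \<beta> (t j) (r l))"
      by (rule double_finsum_cong[OF aR])
        (use u \<Omega> t r F\<tau> module_homD(2)[OF \<beta>_left] module_homD(4)[OF \<beta>_left] in simp_all)
    finally show ?thesis using expand_R[OF u] by simp
  qed

  define S where "S = {?\<tau> (a \<odot>\<^bsub>P\<^esub> p) q \<ominus>\<^bsub>?X\<^esub> ?\<tau> p (a \<odot>\<^bsub>Q\<^esub> q) | a p q.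
       a \<in> carrier A \<and> p \<in> carrier P \<and> q \<in> carrier Q}"
  define N where "N = module_span ?K ?X S"
  have S_sub: "S \<subseteq> carrier ?X" using \<tau> by (auto simp: S_def intro!: X.M.minus_closed)
  have N: "submodule N ?K ?X"
    unfolding N_def by (rule submodule_module_span[OF X.module_axioms S_sub])
  have SN: "S \<subseteq> N" by (auto simp: N_def module_span_def)
  note c = quotient_module_class[OF X.module_axioms N]
  let ?c = "\<lambda>x. N +>\<^bsub>?X\<^esub> x"
  note c' = module_homD[OF c(1)]
  interpret Xq: module ?K "quotient_module ?X N" by (rule module_quotient_module[OF X.module_axioms N])
  note aq = Xq.M.abelian_group_axioms
  have balance: "?c (?\<tau> (a \<odot>\<^bsub>P\<^esub> p) q) = ?c (?\<tau> p (a \<odot>\<^bsub>Q\<^esub> q))"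
    if "a \<in> carrier A" "p \<in> carrier P" "q \<in> carrier Q" for a p q
  proof -
    have "?\<tau> (a \<odot>\<^bsub>P\<^esub> p) q \<ominus>\<^bsub>?X\<^esub> ?\<tau> p (a \<odot>\<^bsub>Q\<^esub> q) \<in> S" using that unfolding S_def by blast
    then show ?thesis using c(3)[OF \<tau> \<tau>, of "a \<odot>\<^bsub>P\<^esub> p" q p "a \<odot>\<^bsub>Q\<^esub> q"] SN that by auto
  qed
  \<comment> \<open>Expanding \<open>?\<tau> p q\<close> leaves the coefficient
    \<open>\<rho> l q\<close> on the right factor; moving it over to \<open>t j\<close> is a
    balancing relation, and this is the only place where classes modulo \<open>N\<close> are
    taken.\<close>
  have c\<Theta>: "?c (\<Theta> (F x)) = ?c x" if "x \<in> carrier ?X" for x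
    using that
  proof (induction rule: induct)
    case (pure p q)
    have "?c (?\<tau> p q) = (\<Oplus>\<^bsub>quotient_module ?X N\<^esub>j\<in>J. \<Oplus>\<^bsub>quotient_module ?X N\<^esub>l\<in>L.
        ?c (?\<tau> (\<omega> j p \<odot>\<^bsub>P\<^esub> t j) (\<rho> l q \<odot>\<^bsub>Q\<^esub> r l)))"
      by (rule biadditive_expand[OF aq additive_map_comp[OF \<tau>ar c'(1)] additive_map_comp[OF \<tau>al c'(1)] pure])
    also have "\<dots> = (\<Oplus>\<^bsub>quotient_module ?X N\<^esub>j\<in>J. \<Oplus>\<^bsub>quotient_module ?X N\<^esub>l\<in>L.
        ?c (?\<tau> (\<Omega> j l (\<beta> p q) \<odot>\<^bsub>P\<^esub> t j) (r l)))"
    proof (rule double_finsum_cong[OF aq])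
      fix j l assume jl: "j \<in> J" "l \<in> L"
      have \<beta>pq: "\<beta> p q \<in> carrier R" using pure module_homD(2)[OF \<beta>_left] by simp
      show "?c (?\<tau> (\<Omega> j l (\<beta> p q) \<odot>\<^bsub>P\<^esub> t j) (r l)) \<in> carrier (quotient_module ?X N)"
        using c'(2) tr[OF jl \<beta>pq] by simp
      have "?c (?\<tau> (\<omega> j p \<odot>\<^bsub>P\<^esub> t j) (\<rho> l q \<odot>\<^bsub>Q\<^esub> r l)) = ?c (?\<tau> (\<rho> l q \<odot>\<^bsub>P\<^esub> (\<omega> j p \<odot>\<^bsub>P\<^esub> t j)) (r l))"
        by (rule balance[symmetric]) (use jl pure t r \<omega> \<rho> in simp_all)
      also have "\<rho> l q \<odot>\<^bsub>P\<^esub> (\<omega> j p \<odot>\<^bsub>P\<^esub> t j) = \<Omega> j l (\<beta> p q) \<odot>\<^bsub>P\<^esub> t j"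
        using jl pure t \<omega> \<rho> by (simp add: \<Omega>_\<beta> P.smult_assoc1[symmetric] A.m_comm)
      finally show "?c (?\<tau> (\<omega> j p \<odot>\<^bsub>P\<^esub> t j) (\<rho> l q \<odot>\<^bsub>Q\<^esub> r l)) =
          ?c (?\<tau> (\<Omega> j l (\<beta> p q) \<odot>\<^bsub>P\<^esub> t j) (r l))" .
    qed
    also have "\<dots> = ?c (\<Theta> (\<beta> p q))"
      unfolding \<Theta>_def by (rule additive_map_double_finsum[OF aX aq c'(1), symmetric])
        (use tr pure module_homD(2)[OF \<beta>_left] in simp)
    finally show ?case using F\<tau> pure by simp
  next
    case (add x y)
    then show ?case using F'(2,3) \<Theta>_add \<Theta>_closed c'(3) by simp
  qed
  have Nker: "N = {x \<in> carrier ?X. F x = \<zero>\<^bsub>R\<^esub>}" (is "N = ?ker")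
  proof
    have "submodule ?ker ?K ?X"
    proof (rule X.submoduleI)
      show "\<ominus>\<^bsub>?X\<^esub> a \<in> ?ker" if "a \<in> ?ker" for a
        using additive_map_minus[OF aX aR Fa, of "\<zero>\<^bsub>?X\<^esub>" a] that F0
        by (simp add: a_minus_def)
    qed (auto simp: F' F0 \<iota>_carrier)
    moreover have "S \<subseteq> ?ker"
    proof
      fix x assume "x \<in> S"
      then obtain a p q where x: "x = ?\<tau> (a \<odot>\<^bsub>P\<^esub> p) q \<ominus>\<^bsub>?X\<^esub> ?\<tau> p (a \<odot>\<^bsub>Q\<^esub> q)"
        and apq: "a \<in> carrier A" "p \<in> carrier P" "q \<in> carrier Q" unfolding S_def by blast
      have "F x = \<beta> (a \<odot>\<^bsub>P\<^esub> p) q \<ominus>\<^bsub>R\<^esub> \<beta> p (a \<odot>\<^bsub>Q\<^esub> q)"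
        unfolding x using additive_map_minus[OF aX aR Fa \<tau> \<tau>] apq F\<tau> by simp
      also have "\<dots> = \<zero>\<^bsub>R\<^esub>"
        using apq module_homD(2,4)[OF \<beta>_left] module_homD(4)[OF \<beta>_right]
        by (simp add: R.M.minus_eq_zero_iff)
      finally show "x \<in> ?ker" using S_sub \<open>x \<in> S\<close> by auto
    qed
    ultimately show "N \<subseteq> ?ker" unfolding N_def module_span_def by (intro Inter_lower) simp
    show "?ker \<subseteq> N"
    proof
      fix x assume "x \<in> ?ker"
      then have x: "x \<in> carrier ?X" "F x = \<zero>\<^bsub>R\<^esub>" by auto
      \<comment> \<open>If \<open>F x\<close> is zero, then \<open>x\<close> is congruent modulo
        \<open>N\<close> to the image of 0 under the additive map \<open>\<Theta>\<close>, so it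
        lies in \<open>N\<close>.\<close>
      have "?c x = ?c (\<Theta> \<zero>\<^bsub>R\<^esub>)" using c\<Theta>[OF x(1)] x(2) by simp
      then have "?c x = ?c \<zero>\<^bsub>?X\<^esub>" using additive_map_zero[OF aR aX \<Theta>a] by simp
      moreover have "x \<ominus>\<^bsub>?X\<^esub> \<zero>\<^bsub>?X\<^esub> = x"
        using x(1) by (simp add: a_minus_def X.M.add.inv_one[unfolded a_inv_def[symmetric]])
      ultimately show "x \<in> N" using c(3)[OF x(1) X.M.zero_closed] by simp
    qed
  qed

  have topP': "topspace TP = carrier ?P" and topQ': "topspace TQ = carrier ?Q" using topP topQ by simp_all
  note finest = projective_topology_finest[OF MP MQ topP' topQ']
  have topX: "topspace ?TX = carrier ?X" using finest(1) by (simp add: locally_convex_topology_def)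
  have topR: "topspace TR = carrier R" using lcR by (simp add: locally_convex_topology_def)
  \<comment> \<open>The pullback of \<open>TR\<close> along \<open>F\<close> is locally convex, and
    the tensor map is continuous into it because composing with \<open>F\<close> gives
    \<open>\<beta>\<close>. The projective topology is therefore finer than this pullback.\<close>
  have F_cont: "continuous_map ?TX TR F"
  proof -
    let ?T = "pullback_topology (carrier ?X) F TR"
    have "locally_convex_topology ?X ?T"
      by (rule locally_convex_pullback[OF X.module_axioms lcR F(1) restrict_scalars_module[OF R, THEN module.axioms(2)]])
    moreover have "continuous_map (prod_topology TP TQ) ?T (\<lambda>(p, q). ?\<tau> p q)"
    proof (rule continuous_map_pullback')
      show "continuous_map (prod_topology TP TQ) TR (F \<circ> (\<lambda>(p, q). ?\<tau> p q))"
        by (rule continuous_map_eq[OF cont\<beta>]) (use topP topQ F\<tau> in \<open>auto simp: topspace_prod_topology\<close>)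
    qed (use topP topQ \<tau> in \<open>auto simp: topspace_prod_topology\<close>)
    ultimately have fine: "openin ?TX U" if "openin ?T U" for U using finest(3) that by blast
    show ?thesis
      unfolding continuous_map_def
    proof (intro conjI allI impI)
      show "F \<in> topspace ?TX \<rightarrow> topspace TR" using topX topR F'(2) by simp
      fix U assume "openin TR U"
      then have "openin ?T (F -` U \<inter> carrier ?X)" by (auto simp: openin_pullback_topology)
      moreover have "F -` U \<inter> carrier ?X = {x \<in> topspace ?TX. F x \<in> U}" using topX by auto
      ultimately show "openin ?TX {x \<in> topspace ?TX. F x \<in> U}" using fine by simp
    qed
  qed
  \<comment> \<open>\<open>N\<close> is the preimage of the closed point 0 under a continuous map,
    so the span of the balancing relations is already closed.\<close>
  have B: "balancing_subspace \<iota> A P TP Q TQ = N"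
  proof -
    have "closedin TR {\<zero>\<^bsub>R\<^esub>}" using closedin_Hausdorff_singleton[OF hausR] topR by simp
    then have "closedin ?TX {x \<in> topspace ?TX. F x \<in> {\<zero>\<^bsub>R\<^esub>}}"
      by (rule closedin_continuous_map_preimage[OF F_cont])
    then have "closedin ?TX N" by (simp add: Nker topX)
    then show ?thesis
      using closure_of_closedin unfolding balancing_subspace_def N_def S_def by blast
  qed

  \<comment> \<open>The action is defined by a description; each \<open>act a\<close> is now
    identified with the linear map that the universal property provides.\<close>
  define act where "act a = tensor_extend ?K ?P ?Q ?X (\<lambda>p q. ?\<tau> (a \<odot>\<^bsub>P\<^esub> p) q)" for a
  have act: "act a \<in> module_hom ?K ?X ?X \<and>
      (\<forall>p\<in>carrier P. \<forall>q\<in>carrier Q. act a (?\<tau> p q) = ?\<tau> (a \<odot>\<^bsub>P\<^esub> p) q)" if a: "a \<in> carrier A" for a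
  proof -
    have "bilinear_map ?K ?P ?Q ?X (\<lambda>p q. ?\<tau> (a \<odot>\<^bsub>P\<^esub> p) q)"
      unfolding bilinear_map_def
    proof (intro conjI ballI)
      show "?\<tau> (a \<odot>\<^bsub>P\<^esub> p) \<in> module_hom ?K ?Q ?X" if "p \<in> carrier ?P" for p
        using pure_tensor_right_hom[OF MP MQ] that a by simp
      fix q assume q: "q \<in> carrier ?Q"
      show "(\<lambda>p. ?\<tau> (a \<odot>\<^bsub>P\<^esub> p) q) \<in> module_hom ?K ?P ?X"
      proof (rule module_homI)
        fix c :: 'k and p assume p: "p \<in> carrier ?P"
        have "a \<odot>\<^bsub>P\<^esub> (\<iota> c \<odot>\<^bsub>P\<^esub> p) = \<iota> c \<odot>\<^bsub>P\<^esub> (a \<odot>\<^bsub>P\<^esub> p)"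
          using p a \<iota>_carrier by (simp add: P.smult_assoc1[symmetric] A.m_comm)
        then show "?\<tau> (a \<odot>\<^bsub>P\<^esub> (c \<odot>\<^bsub>?P\<^esub> p)) q = c \<odot>\<^bsub>?X\<^esub> ?\<tau> (a \<odot>\<^bsub>P\<^esub> p) q"
          using \<tau>l(4)[of q c "a \<odot>\<^bsub>P\<^esub> p"] p q a by simp
      qed (use \<tau>l(2,3) q a in \<open>simp_all add: P.smult_r_distr\<close>)
    qed
    then obtain f where f: "f \<in> module_hom ?K ?X ?X"
      "\<And>p q. p \<in> carrier ?P \<Longrightarrow> q \<in> carrier ?Q \<Longrightarrow> f (?\<tau> p q) = ?\<tau> (a \<odot>\<^bsub>P\<^esub> p) q"
      by (rule tensor_lift[OF MP MQ X.module_axioms]) (rule that)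
    have eq: "act a x = f x" if "x \<in> carrier ?X" for x
      unfolding act_def by (rule tensor_extend_eq[OF MP MQ aX module_homD(1)[OF f(1)] f(2) that])
    have "act a \<in> module_hom ?K ?X ?X"
      by (rule module_homI) (use eq module_homD(2-4)[OF f(1)] in simp_all)
    then show ?thesis using f(2) eq \<tau> by simp
  qed
  then have act_hom: "act a \<in> module_hom ?K ?X ?X" if "a \<in> carrier A" for a using that by blast
  have act_\<tau>: "act a (?\<tau> p q) = ?\<tau> (a \<odot>\<^bsub>P\<^esub> p) q"
    if "a \<in> carrier A" "p \<in> carrier P" "q \<in> carrier Q" for a p q using act that by blast
  note act' = module_homD[OF act_hom]

  \<comment> \<open>The record inside \<open>proj_tensor_module\<close>: the tensor product over the
    field, with \<open>A\<close> acting on the left factor.\<close>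
  define V :: "('a, ('p \<times> 'q \<Rightarrow> 'k) set) module" where "V = \<lparr>carrier = carrier ?X, mult = undefined, one = undefined,
       zero = zero ?X, add = add ?X, smult = act\<rparr>"
  have Vs: "carrier V = carrier ?X" "zero V = zero ?X" "add V = add ?X" "smult V = act"
    by (simp_all add: V_def)
  have V: "module A V"
  proof (rule moduleI)
    show "abelian_group V" by (rule abelian_group_cong[OF aX]) (simp_all add: Vs)
    fix a b x assume a: "a \<in> carrier A" and b: "b \<in> carrier A" and "x \<in> carrier V"
    then have x: "x \<in> carrier ?X" by (simp add: Vs)
    show "(a \<oplus>\<^bsub>A\<^esub> b) \<odot>\<^bsub>V\<^esub> x = a \<odot>\<^bsub>V\<^esub> x \<oplus>\<^bsub>V\<^esub> b \<odot>\<^bsub>V\<^esub> x"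
      unfolding Vs using x
    proof (induction rule: induct)
      case (pure p q)
      then show ?case using a b act_\<tau> \<tau>l(3) by (simp add: P.smult_l_distr)
    next
      case (add x y)
      then show ?case using a b act'(2,3) by (simp add: X.M.a_ac)
    qed
    show "(a \<otimes>\<^bsub>A\<^esub> b) \<odot>\<^bsub>V\<^esub> x = a \<odot>\<^bsub>V\<^esub> (b \<odot>\<^bsub>V\<^esub> x)"
      unfolding Vs using x
    proof (induction rule: induct)
      case (pure p q)
      then show ?case using a b act_\<tau> by (simp add: P.smult_assoc1)
    next
      case (add x y)
      then show ?case using a b act'(2,3) by simp
    qed
  next
    fix x assume "x \<in> carrier V"
    then have x: "x \<in> carrier ?X" by (simp add: Vs)
    show "\<one>\<^bsub>A\<^esub> \<odot>\<^bsub>V\<^esub> x = x"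
      unfolding Vs using x
    proof (induction rule: induct)
      case (pure p q)
      then show ?case using act_\<tau> by simp
    next
      case (add x y)
      then show ?case using act'(3) by simp
    qed
  qed (use A act'(2,3) in \<open>simp_all add: Vs\<close>)
  have FV: "F \<in> module_hom A V R"
  proof (rule module_homI)
    fix a x assume a: "a \<in> carrier A" and "x \<in> carrier V"
    then have "x \<in> carrier ?X" by (simp add: Vs)
    then show "F (a \<odot>\<^bsub>V\<^esub> x) = a \<odot>\<^bsub>R\<^esub> F x"
      unfolding Vs
    proof (induction rule: induct)
      case (pure p q)
      then show ?case using a act_\<tau> F\<tau> module_homD(4)[OF \<beta>_left] by simp
    next
      case (add x y)
      then show ?case using a act'(2,3) F'(2,3) by (simp add: R.smult_r_distr)
    qed
  qed (use F' in \<open>simp_all add: Vs\<close>)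
  have surj: "F ` carrier V = carrier R"
  proof
    show "carrier R \<subseteq> F ` carrier V" 
    proof
      fix u assume "u \<in> carrier R"
      then show "u \<in> F ` carrier V"
        using F\<Theta> \<Theta>_closed Vs(1) by (intro image_eqI[of _ _ "\<Theta> u"]) simp_all
    qed
  qed (use F'(2) in \<open>auto simp: Vs\<close>)
  \<comment> \<open>\<open>N\<close> was generated as a subspace over the field. As the kernel of
    the \<open>A\<close>-linear map \<open>F\<close> on \<open>V\<close> it is also stable under
    \<open>A\<close>, so the quotient is an \<open>A\<close>-module.\<close>
  have kerV: "{x \<in> carrier V. F x = \<zero>\<^bsub>R\<^esub>} = N" by (simp add: Nker Vs)
  obtain \<Phi> where \<Phi>: "module_iso A (quotient_module V N) R \<Phi>"
    "\<And>x. x \<in> carrier V \<Longrightarrow> \<Phi> (N +>\<^bsub>V\<^esub> x) = F x"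
    by (rule quotient_by_kernel_iso[OF V R FV surj, unfolded kerV]) (rule that)
  have mod: "proj_tensor_module \<iota> A P TP Q TQ = quotient_module V N"
    unfolding proj_tensor_module_def B V_def act_def ..
  have cls: "proj_class \<iota> A P TP Q TQ x = ?c x" for x by (simp add: proj_class_def B)
  have \<Phi>c: "\<Phi> (?c x) = F x" if "x \<in> carrier ?X" for x
    using \<Phi>(2)[of x] that a_r_coset_cong[of V ?X N x] by (simp add: Vs)
  have qm: "quotient_map ?TX (proj_tensor_topology \<iota> A P TP Q TQ) ?c"
    unfolding proj_tensor_topology_def cls[abs_def] by (rule quotient_map_quotient_topology)
  have "homeomorphic_maps (proj_tensor_topology \<iota> A P TP Q TQ) TR \<Phi> (?c \<circ> \<Theta>)"
    unfolding homeomorphic_maps_def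
  proof (intro conjI ballI)
    show "continuous_map (proj_tensor_topology \<iota> A P TP Q TQ) TR \<Phi>"
    proof (rule continuous_compose_quotient_map[OF qm])
      show "continuous_map ?TX TR (\<Phi> \<circ> ?c)"
        by (rule continuous_map_eq[OF F_cont]) (simp add: topX \<Phi>c)
    qed
    \<comment> \<open>Continuity of sums in a locally convex topology is available for finite sums,
      which is where finiteness of \<open>J\<close> and \<open>L\<close> is decisive.\<close>
    have "continuous_map TR ?TX \<Theta>"
      unfolding \<Theta>_def
    proof (intro continuous_map_finsum[OF finest(1) aX fin(1)] continuous_map_finsum[OF finest(1) aX fin(2)])
      fix j l assume jl: "j \<in> J" "l \<in> L"
      have "continuous_map TR (prod_topology TP TQ) (\<lambda>u. (\<Omega> j l u \<odot>\<^bsub>P\<^esub> t j, r l))"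
        using cont\<Omega>[OF jl] r[OF jl(2)] topQ by (intro continuous_map_pairedI) simp_all
      from continuous_map_compose[OF this finest(2)]
      show "continuous_map TR ?TX (\<lambda>u. ?\<tau> (\<Omega> j l u \<odot>\<^bsub>P\<^esub> t j) (r l))" by (simp add: o_def)
    qed
    then show "continuous_map TR (proj_tensor_topology \<iota> A P TP Q TQ) (?c \<circ> \<Theta>)"
      by (rule continuous_map_compose) (rule quotient_imp_continuous_map[OF qm])
    show "\<Phi> ((?c \<circ> \<Theta>) u) = u" if "u \<in> topspace TR" for u
      using that topR \<Phi>c \<Theta>_closed F\<Theta> by simp
    fix S assume "S \<in> topspace (proj_tensor_topology \<iota> A P TP Q TQ)"
    then have "S \<in> ?c ` carrier ?X"
      using quotient_imp_surjective_map[OF qm] topX by simp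
    then obtain x where "x \<in> carrier ?X" "S = ?c x" by (rule imageE) (rule that)
    then show "(?c \<circ> \<Theta>) (\<Phi> S) = S" using \<Phi>c c\<Theta> by simp
  qed
  then have homeo: "homeomorphic_map (proj_tensor_topology \<iota> A P TP Q TQ) TR \<Phi>"
    by (rule homeomorphic_maps_imp_map)
  show thesis
  proof (rule that)
    show "module_iso A (proj_tensor_module \<iota> A P TP Q TQ) R \<Phi>" unfolding mod by (rule \<Phi>(1))
    show "\<Phi> (proj_pure_tensor \<iota> A P TP Q TQ p q) = \<beta> p q" if "p \<in> carrier P" "q \<in> carrier Q" for p q
      using \<Phi>c \<tau> F\<tau> that by (simp add: proj_pure_tensor_def cls)
  qed (rule homeo)
qed

end

section \<open>Smooth functions on manifolds\<close>

lemma smooth_on_cong_imp: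
  assumes "open \<Omega>" "smooth_on \<Omega> f" "\<And>x. x \<in> \<Omega> \<Longrightarrow> f x = g x"
  shows "smooth_on \<Omega> g"
  by (rule iffD1[OF smooth_on_cong[OF assms(1)] assms(2)]) (rule assms(3))

locale smooth_mfd =
  fixes M :: "('m, 'b::{real_inner,heine_borel}) manifold"
  assumes mfd: "smooth_manifold M"
begin

lemma hausdorff: "Hausdorff_space (mtop M)" and second_countable: "second_countable (mtop M)"
  using mfd by (auto simp: smooth_manifold_def)

lemma chart:
  assumes "(U, \<phi>) \<in> atlas M"
  shows "openin (mtop M) U" "open (\<phi> ` U)"
    "homeomorphic_map (subtopology (mtop M) U) (top_of_set (\<phi> ` U)) \<phi>"
  using assms mfd by (auto simp: smooth_manifold_def)

lemma chart_subset: "(U, \<phi>) \<in> atlas M \<Longrightarrow> U \<subseteq> mset M"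
  using chart(1) openin_subset by blast

lemma chart_inj: "(U, \<phi>) \<in> atlas M \<Longrightarrow> inj_on \<phi> U"
  using homeomorphic_imp_injective_map[OF chart(3)] chart_subset by (simp add: Int_absorb1)

lemma chart_inv: "(U, \<phi>) \<in> atlas M \<Longrightarrow> x \<in> U \<Longrightarrow> inv_into U \<phi> (\<phi> x) = x"
  by (rule inv_into_f_f[OF chart_inj])

lemma atlas_cover: "x \<in> mset M \<Longrightarrow> \<exists>U \<phi>. (U, \<phi>) \<in> atlas M \<and> x \<in> U"
proof -
  assume "x \<in> mset M"
  then have "x \<in> (\<Union>(U, \<phi>)\<in>atlas M. U)" using mfd by (simp add: smooth_manifold_def)
  then show ?thesis by fast
qed

lemma transition:
  "(U, \<phi>) \<in> atlas M \<Longrightarrow> (V, \<psi>) \<in> atlas M \<Longrightarrow> smooth_on (\<phi> ` (U \<inter> V)) (\<psi> \<circ> inv_into U \<phi>)"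
  using mfd unfolding smooth_manifold_def by fast

lemma open_chart_image:
  assumes c: "(U, \<phi>) \<in> atlas M" and W: "openin (mtop M) W"
  shows "open (\<phi> ` (U \<inter> W))"
proof -
  have "openin (subtopology (mtop M) U) (U \<inter> W)"
    using W by (metis inf_commute openin_subtopology_Int)
  then have "openin (top_of_set (\<phi> ` U)) (\<phi> ` (U \<inter> W))"
    using homeomorphic_imp_open_map[OF chart(3)[OF c]] unfolding open_map_def by blast
  then show ?thesis using chart(2)[OF c] by (simp add: openin_open_eq)
qed

lemma openin_chart_preimage:
  assumes c: "(U, \<phi>) \<in> atlas M" and "open \<Omega>"
  shows "openin (mtop M) {x \<in> U. \<phi> x \<in> \<Omega>}"
proof -
  have "openin (top_of_set (\<phi> ` U)) (\<phi> ` U \<inter> \<Omega>)" using assms(2) by (rule openin_open_Int)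
  then have "openin (subtopology (mtop M) U) {x \<in> topspace (subtopology (mtop M) U). \<phi> x \<in> \<phi> ` U \<inter> \<Omega>}"
    by (rule openin_continuous_map_preimage[OF homeomorphic_imp_continuous_map[OF chart(3)[OF c]]])
  moreover have "{x \<in> topspace (subtopology (mtop M) U). \<phi> x \<in> \<phi> ` U \<inter> \<Omega>} = {x \<in> U. \<phi> x \<in> \<Omega>}"
    using chart_subset[OF c] by auto
  ultimately show ?thesis using chart(1)[OF c] openin_trans_full by metis
qed

lemma compactin_chart_preimage:
  assumes c: "(U, \<phi>) \<in> atlas M" and C: "compact C" "C \<subseteq> \<phi> ` U"
  shows "compactin (mtop M) {x \<in> U. \<phi> x \<in> C}"
proof -
  obtain g where g: "homeomorphic_maps (subtopology (mtop M) U) (top_of_set (\<phi> ` U)) \<phi> g"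
    using chart(3)[OF c] homeomorphic_map_maps by blast
  then have cont: "continuous_map (top_of_set (\<phi> ` U)) (subtopology (mtop M) U) g"
    and g\<phi>: "\<And>x. x \<in> U \<Longrightarrow> g (\<phi> x) = x"
    using chart_subset[OF c] by (auto simp: homeomorphic_maps_def)
  have "compactin (top_of_set (\<phi> ` U)) C" using C by (simp add: compactin_subtopology)
  then have "compactin (subtopology (mtop M) U) (g ` C)" by (rule image_compactin[OF _ cont])
  then have "compactin (mtop M) (g ` C)" by (simp add: compactin_subtopology)
  moreover have "g ` C = {x \<in> U. \<phi> x \<in> C}"
  proof -
    have "g y \<in> U \<and> \<phi> (g y) = y" if "y \<in> C" for y
      using that C(2) g\<phi> by auto
    moreover have "x \<in> g ` C" if "x \<in> U" "\<phi> x \<in> C" for x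
      using g\<phi>[OF that(1)] that(2) by (metis image_eqI)
    ultimately show ?thesis by auto
  qed
  ultimately show ?thesis by simp
qed

lemma compact_chart_image:
  assumes c: "(U, \<phi>) \<in> atlas M" and L: "compactin (mtop M) L" "L \<subseteq> U"
  shows "compact (\<phi> ` L)"
proof -
  have "compactin (subtopology (mtop M) U) L" using L by (simp add: compactin_subtopology)
  then have "compactin (top_of_set (\<phi> ` U)) (\<phi> ` L)"
    by (rule image_compactin[OF _ homeomorphic_imp_continuous_map[OF chart(3)[OF c]]])
  then show ?thesis by (simp add: compactin_subtopology)
qed

section \<open>Smooth functions on open subsets of a manifold\<close>

lemma smooth_fun_onD:
  "smooth_fun_on M W f \<Longrightarrow> (U, \<phi>) \<in> atlas M \<Longrightarrow> smooth_on (\<phi> ` (U \<inter> W)) (f \<circ> inv_into U \<phi>)"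
  by (auto simp: smooth_fun_on_def)

lemma smooth_fun_onI:
  "(\<And>U \<phi>. (U, \<phi>) \<in> atlas M \<Longrightarrow> smooth_on (\<phi> ` (U \<inter> W)) (f \<circ> inv_into U \<phi>)) \<Longrightarrow> smooth_fun_on M W f"
  by (auto simp: smooth_fun_on_def)

lemma smooth_fun_on_subset: "smooth_fun_on M W f \<Longrightarrow> W' \<subseteq> W \<Longrightarrow> smooth_fun_on M W' f"
  by (rule smooth_fun_onI, rule smooth_on_subset, erule (1) smooth_fun_onD) auto

lemma smooth_fun_on_cong:
  assumes W: "openin (mtop M) W" and eq: "\<And>x. x \<in> W \<Longrightarrow> f x = g x" and f: "smooth_fun_on M W f"
  shows "smooth_fun_on M W g"
proof (rule smooth_fun_onI)
  fix U \<phi> assume c: "(U, \<phi>) \<in> atlas M"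
  show "smooth_on (\<phi> ` (U \<inter> W)) (g \<circ> inv_into U \<phi>)"
  proof (rule smooth_on_cong_imp[OF open_chart_image[OF c W] smooth_fun_onD[OF f c]])
    show "(f \<circ> inv_into U \<phi>) y = (g \<circ> inv_into U \<phi>) y" if "y \<in> \<phi> ` (U \<inter> W)" for y
      using that chart_inv[OF c] eq by auto
  qed
qed

lemma smooth_fun_on_local:
  assumes "\<And>x. x \<in> W \<Longrightarrow> \<exists>W'. x \<in> W' \<and> smooth_fun_on M W' f"
  shows "smooth_fun_on M W f"
proof (rule smooth_fun_onI, rule smooth_on_local)
  fix U \<phi> y assume c: "(U, \<phi>) \<in> atlas M" and "y \<in> \<phi> ` (U \<inter> W)"
  then obtain x where x: "x \<in> U" "x \<in> W" "y = \<phi> x" by auto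
  then obtain W' where "x \<in> W'" "smooth_fun_on M W' f" using assms by blast
  then have "smooth_on (\<phi> ` (U \<inter> W')) (f \<circ> inv_into U \<phi>)" "y \<in> \<phi> ` (U \<inter> W')"
    using smooth_fun_onD[OF _ c, of W' f] x by simp_all
  then show "\<exists>\<Omega>'. y \<in> \<Omega>' \<and> smooth_on \<Omega>' (f \<circ> inv_into U \<phi>)"
    by (intro exI[of _ "\<phi> ` (U \<inter> W')"] conjI)
qed

text \<open>Smooth transition maps carry the condition from one chart to all others.\<close>

lemma smooth_fun_on_chart:
  assumes c: "(U, \<phi>) \<in> atlas M" and W: "openin (mtop M) W" "W \<subseteq> U"
    and f: "smooth_on (\<phi> ` W) (f \<circ> inv_into U \<phi>)"
  shows "smooth_fun_on M W f"
proof (rule smooth_fun_onI)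
  fix V \<psi> assume d: "(V, \<psi>) \<in> atlas M"
  let ?T = "\<phi> \<circ> inv_into V \<psi>"
  have o: "open (\<psi> ` (V \<inter> W))" "open (\<phi> ` W)"
    using open_chart_image[OF d W(1)] open_chart_image[OF c W(1)] W(2) by (simp_all add: Int_absorb1)
  have "smooth_on (\<psi> ` (V \<inter> W)) ?T"
    by (rule smooth_on_subset[OF transition[OF d c]]) (use W(2) in auto)
  moreover have "?T ` \<psi> ` (V \<inter> W) \<subseteq> \<phi> ` W" using chart_inv[OF d] by auto
  ultimately have "smooth_on (\<psi> ` (V \<inter> W)) (\<lambda>y. (f \<circ> inv_into U \<phi>) (?T y))"
    by (intro smooth_on_compose[OF o _ _ f])
  then show "smooth_on (\<psi> ` (V \<inter> W)) (f \<circ> inv_into V \<psi>)"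
  proof (rule smooth_on_cong_imp[OF o(1)])
    show "(f \<circ> inv_into U \<phi>) (?T y) = (f \<circ> inv_into V \<psi>) y" if "y \<in> \<psi> ` (V \<inter> W)" for y
      using that chart_inv[OF d] chart_inv[OF c] W(2) by auto
  qed
qed

lemma smooth_fun_on_const: "smooth_fun_on M W (\<lambda>x. c)"
  by (rule smooth_fun_onI) (simp add: o_def smooth_on_const)

lemma smooth_fun_on_zero:
  assumes "openin (mtop M) W" "\<And>x. x \<in> W \<Longrightarrow> f x = 0"
  shows "smooth_fun_on M W f"
  by (rule smooth_fun_on_cong[OF assms(1) _ smooth_fun_on_const[of _ 0]]) (use assms(2) in auto)

context
  fixes W assumes W: "openin (mtop M) W"
begin

lemma smooth_fun_on_add:
  assumes "smooth_fun_on M W f" "smooth_fun_on M W g"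
  shows "smooth_fun_on M W (\<lambda>x. f x + g x)"
proof (rule smooth_fun_onI)
  fix U \<phi> assume c: "(U, \<phi>) \<in> atlas M"
  show "smooth_on (\<phi> ` (U \<inter> W)) ((\<lambda>x. f x + g x) \<circ> inv_into U \<phi>)"
    using smooth_on_add[OF open_chart_image[OF c W] smooth_fun_onD[OF assms(1) c] smooth_fun_onD[OF assms(2) c]]
    by (simp add: o_def)
qed

lemma smooth_fun_on_mult:
  fixes f g :: "'m \<Rightarrow> 'c::real_normed_algebra"
  assumes "smooth_fun_on M W f" "smooth_fun_on M W g"
  shows "smooth_fun_on M W (\<lambda>x. f x * g x)"
proof (rule smooth_fun_onI)
  fix U \<phi> assume c: "(U, \<phi>) \<in> atlas M"
  show "smooth_on (\<phi> ` (U \<inter> W)) ((\<lambda>x. f x * g x) \<circ> inv_into U \<phi>)"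
    using smooth_on_mult[OF open_chart_image[OF c W] smooth_fun_onD[OF assms(1) c] smooth_fun_onD[OF assms(2) c]]
    by (simp add: o_def)
qed

lemma smooth_fun_on_bounded_linear:
  assumes "bounded_linear h" "smooth_fun_on M W f"
  shows "smooth_fun_on M W (\<lambda>x. h (f x))"
proof (rule smooth_fun_onI)
  fix U \<phi> assume c: "(U, \<phi>) \<in> atlas M"
  show "smooth_on (\<phi> ` (U \<inter> W)) ((\<lambda>x. h (f x)) \<circ> inv_into U \<phi>)"
    using smooth_on_bounded_linear[OF assms(1) open_chart_image[OF c W] smooth_fun_onD[OF assms(2) c]]
    by (simp add: o_def)
qed

lemma smooth_fun_on_diff:
  assumes "smooth_fun_on M W f" "smooth_fun_on M W g"
  shows "smooth_fun_on M W (\<lambda>x. f x - g x)"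
  using smooth_fun_on_add[OF assms(1) smooth_fun_on_bounded_linear[OF
      bounded_linear_minus[OF bounded_linear_ident] assms(2)]] by simp

lemma smooth_fun_on_inverse:
  fixes f :: "'m \<Rightarrow> 'c::real_normed_field"
  assumes "smooth_fun_on M W f" "\<And>x. x \<in> W \<Longrightarrow> f x \<noteq> 0"
  shows "smooth_fun_on M W (\<lambda>x. inverse (f x))"
proof (rule smooth_fun_onI)
  fix U \<phi> assume c: "(U, \<phi>) \<in> atlas M"
  have "(f \<circ> inv_into U \<phi>) y \<noteq> 0" if "y \<in> \<phi> ` (U \<inter> W)" for y
    using that chart_inv[OF c] assms(2) by auto
  from smooth_on_inverse[OF open_chart_image[OF c W] smooth_fun_onD[OF assms(1) c] this]
  show "smooth_on (\<phi> ` (U \<inter> W)) ((\<lambda>x. inverse (f x)) \<circ> inv_into U \<phi>)" by (simp add: o_def)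
qed

lemma smooth_fun_on_flat:
  assumes "smooth_fun_on M W f"
  shows "smooth_fun_on M W (\<lambda>x. flat n (f x))"
proof (rule smooth_fun_onI)
  fix U \<phi> assume c: "(U, \<phi>) \<in> atlas M"
  show "smooth_on (\<phi> ` (U \<inter> W)) ((\<lambda>x. flat n (f x)) \<circ> inv_into U \<phi>)"
    using smooth_on_compose[OF open_chart_image[OF c W] open_UNIV _ smooth_fun_onD[OF assms c] smooth_on_flat]
    by (simp add: o_def)
qed

lemma smooth_fun_on_sum:
  assumes "\<And>i. i \<in> I \<Longrightarrow> smooth_fun_on M W (f i)"
  shows "smooth_fun_on M W (\<lambda>x. \<Sum>i\<in>I. f i x)"
  using assms
  by (induction I rule: infinite_finite_induct) (simp_all add: smooth_fun_on_const smooth_fun_on_add)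

lemma smooth_fun_on_prod:
  fixes f :: "'i \<Rightarrow> 'm \<Rightarrow> 'c::real_normed_field"
  assumes "\<And>i. i \<in> I \<Longrightarrow> smooth_fun_on M W (f i)"
  shows "smooth_fun_on M W (\<lambda>x. \<Prod>i\<in>I. f i x)"
  using assms
  by (induction I rule: infinite_finite_induct) (simp_all add: smooth_fun_on_const smooth_fun_on_mult)

text \<open>The index set depends on \<open>x\<close>, so that the sum is finite at every point.
  Near a point it can be replaced by one fixed finite set, which only adds zero terms.\<close>

lemma smooth_fun_on_locally_finite_sum:
  assumes f: "\<And>s. s \<in> S \<Longrightarrow> smooth_fun_on M W (f s)"
    and lf: "\<And>x. x \<in> W \<Longrightarrow> \<exists>W'. openin (mtop M) W' \<and> x \<in> W' \<and> finite {s \<in> S. \<exists>y\<in>W'. f s y \<noteq> 0}"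
  shows "smooth_fun_on M W (\<lambda>x. \<Sum>s\<in>{s \<in> S. f s x \<noteq> 0}. f s x)"
proof (rule smooth_fun_on_local)
  fix x assume "x \<in> W"
  then obtain W' where W': "openin (mtop M) W'" "x \<in> W'" "finite {s \<in> S. \<exists>y\<in>W'. f s y \<noteq> 0}"
    using lf by blast
  let ?F = "{s \<in> S. \<exists>y\<in>W'. f s y \<noteq> 0}"
  have "smooth_fun_on M (W' \<inter> W) (\<lambda>x. \<Sum>s\<in>?F. f s x)"
    by (rule smooth_fun_on_subset[OF smooth_fun_on_sum]) (use f in auto)
  then have "smooth_fun_on M (W' \<inter> W) (\<lambda>x. \<Sum>s\<in>{s \<in> S. f s x \<noteq> 0}. f s x)"
  proof (rule smooth_fun_on_cong[OF openin_Int[OF W'(1) W], rotated])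
    fix y assume "y \<in> W' \<inter> W"
    then show "(\<Sum>s\<in>?F. f s y) = (\<Sum>s\<in>{s \<in> S. f s y \<noteq> 0}. f s y)"
      by (intro sum.mono_neutral_right W'(3)) auto
  qed
  then show "\<exists>W'. x \<in> W' \<and> smooth_fun_on M W' (\<lambda>x. \<Sum>s\<in>{s \<in> S. f s x \<noteq> 0}. f s x)"
    using W'(2) \<open>x \<in> W\<close> by blast
qed

end

lemma smooth_fun_on_continuous:
  assumes f: "smooth_fun_on M (mset M) f" and c: "(U, \<phi>) \<in> atlas M"
  shows "continuous_on (\<phi> ` U) (f \<circ> inv_into U \<phi>)"
proof -
  have "smooth_on (\<phi> ` U) (f \<circ> inv_into U \<phi>)"
    using smooth_fun_onD[OF f c] chart_subset[OF c] by (simp add: Int_absorb2)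
  from smooth_on_continuous_iter_deriv[OF this subset_refl, of "[]"] show ?thesis by simp
qed

lemma open_chart_nonzero:
  fixes f :: "'m \<Rightarrow> 'c::real_normed_vector"
  assumes f: "smooth_fun_on M (mset M) f" and c: "(U, \<phi>) \<in> atlas M"
  shows "open (\<phi> ` {x \<in> U. f x \<noteq> 0})"
proof -
  have "open ((f \<circ> inv_into U \<phi>) -` (- {0}) \<inter> \<phi> ` U)"
    by (rule iffD1[OF continuous_on_open_vimage[OF chart(2)[OF c]] smooth_fun_on_continuous[OF f c],
          rule_format]) (simp add: open_Compl)
  moreover have "(f \<circ> inv_into U \<phi>) -` (- {0}) \<inter> \<phi> ` U = \<phi> ` {x \<in> U. f x \<noteq> 0}"
    using chart_inv[OF c] by auto
  ultimately show ?thesis by simp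
qed

lemma openin_nonzero:
  fixes f :: "'m \<Rightarrow> 'c::real_normed_vector"
  assumes f: "smooth_fun_on M (mset M) f"
  shows "openin (mtop M) {x \<in> mset M. f x \<noteq> 0}"
proof (rule iffD2[OF openin_subopen], intro ballI)
  fix x assume "x \<in> {x \<in> mset M. f x \<noteq> 0}"
  then have x: "x \<in> mset M" "f x \<noteq> 0" by auto
  then obtain U \<phi> where c: "(U, \<phi>) \<in> atlas M" "x \<in> U" using atlas_cover by blast
  have "openin (mtop M) {y \<in> U. \<phi> y \<in> \<phi> ` {x \<in> U. f x \<noteq> 0}}"
    by (rule openin_chart_preimage[OF c(1) open_chart_nonzero[OF f c(1)]])
  moreover have "{y \<in> U. \<phi> y \<in> \<phi> ` {x \<in> U. f x \<noteq> 0}} = {x \<in> U. f x \<noteq> 0}"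
    using chart_inj[OF c(1)] by (auto simp: inj_on_def)
  ultimately show "\<exists>T. openin (mtop M) T \<and> x \<in> T \<and> T \<subseteq> {x \<in> mset M. f x \<noteq> 0}"
    using c(2) x chart_subset[OF c(1)] by (intro exI[of _ "{x \<in> U. f x \<noteq> 0}"]) auto
qed

text \<open>The squared distance is smooth, so \<open>flat 0\<close> of \<open>r\<^sup>2\<close>
  minus it is smooth and nonzero exactly on the open ball. Extension by 0 is smooth because the
  preimage of the closed ball is compact, hence closed in the Hausdorff space \<open>M\<close>: the
  chart domain and the complement of this set are open and cover \<open>M\<close>.\<close>

lemma bump_function:
  assumes c: "(U, \<phi>) \<in> atlas M" and r: "0 < r" "cball q r \<subseteq> \<phi> ` U"
  obtains \<beta> :: "'m \<Rightarrow> real" where "smooth_fun_on M (mset M) \<beta>" "\<And>x. 0 \<le> \<beta> x"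
    "\<And>x. \<beta> x \<noteq> 0 \<longleftrightarrow> x \<in> U \<and> dist (\<phi> x) q < r"
proof
  define h where "h = (\<lambda>y. flat 0 (r\<^sup>2 - inner (y - q) (y - q)))"
  define \<beta> where "\<beta> = (\<lambda>x. if x \<in> U then h (\<phi> x) else 0)"
  have h: "h y \<noteq> 0 \<longleftrightarrow> dist y q < r" for y
  proof -
    have "h y \<noteq> 0 \<longleftrightarrow> (dist y q)\<^sup>2 < r\<^sup>2"
      unfolding h_def flat_eq_0_iff by (simp add: dist_norm power2_norm_eq_inner not_le)
    also have "\<dots> \<longleftrightarrow> dist y q < r"
      using r(1) by (metis less_imp_le not_le power2_le_imp_le power_mono zero_le_dist)
    finally show ?thesis .
  qed
  show \<beta>: "\<beta> x \<noteq> 0 \<longleftrightarrow> x \<in> U \<and> dist (\<phi> x) q < r" for x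
    by (simp add: \<beta>_def h)
  show "0 \<le> \<beta> x" for x by (simp add: \<beta>_def h_def flat_nonneg)
  let ?Z = "{x \<in> U. \<phi> x \<in> cball q r}"
  have "closedin (mtop M) ?Z"
    by (rule compactin_imp_closedin[OF hausdorff compactin_chart_preimage[OF c compact_cball r(2)]])
  then have o: "openin (mtop M) (mset M - ?Z)" by (rule openin_diff[OF openin_topspace])
  have "smooth_on UNIV (\<lambda>y. r\<^sup>2 - inner (y - q) (y - q))"
    by (intro smooth_on_diff smooth_on_inner smooth_on_const smooth_on_ident open_UNIV)
  then have hs: "smooth_on UNIV h"
    unfolding h_def by (intro smooth_on_compose[OF open_UNIV open_UNIV _ _ smooth_on_flat]) auto
  have "smooth_fun_on M U \<beta>"
  proof (rule smooth_fun_on_chart[OF c chart(1)[OF c] subset_refl])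
    have "smooth_on (\<phi> ` U) h" by (rule smooth_on_subset[OF hs]) simp
    then show "smooth_on (\<phi> ` U) (\<beta> \<circ> inv_into U \<phi>)"
    proof (rule smooth_on_cong_imp[OF chart(2)[OF c]])
      show "h y = (\<beta> \<circ> inv_into U \<phi>) y" if "y \<in> \<phi> ` U" for y
        using that chart_inv[OF c] by (auto simp: \<beta>_def)
    qed
  qed
  moreover have "smooth_fun_on M (mset M - ?Z) \<beta>"
  proof (rule smooth_fun_on_zero[OF o])
    show "\<beta> x = 0" if "x \<in> mset M - ?Z" for x
      using \<beta>[of x] that by (auto simp: dist_commute)
  qed
  ultimately show "smooth_fun_on M (mset M) \<beta>"
    by (intro smooth_fun_on_local) (metis (no_types, lifting) DiffI mem_Collect_eq)
qed

subsection \<open>Families of functions with few active members\<close>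

text \<open>By the Lebesgue number lemma in the chart, every ball of radius \<open>e\<close> about a
  point of the image of \<open>L\<close> lies in the nonzero set of a single function. Bumps around
  a net of mesh \<open>d\<close> are handed to such indices and take over from the old functions on
  \<open>L\<close>. A point meets only bumps with centres within \<open>2 * d\<close>, and packing
  bounds the number of these.\<close>

lemma reduce_active:
  fixes \<rho> :: "'i \<Rightarrow> 'm \<Rightarrow> real"
  assumes I: "finite I" and \<rho>: "\<And>i. i \<in> I \<Longrightarrow> smooth_fun_on M (mset M) (\<rho> i)" "\<And>i x. 0 \<le> \<rho> i x"
    and c: "(U, \<phi>) \<in> atlas M" and L: "compactin (mtop M) L" "L \<subseteq> U"
    and pos: "\<And>x. x \<in> L \<Longrightarrow> \<exists>i\<in>I. \<rho> i x \<noteq> 0"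
  obtains \<rho>' :: "'i \<Rightarrow> 'm \<Rightarrow> real"
  where "\<And>i. i \<in> I \<Longrightarrow> smooth_fun_on M (mset M) (\<rho>' i)" "\<And>i x. 0 \<le> \<rho>' i x"
    "\<And>i x. i \<in> I \<Longrightarrow> \<rho>' i x \<noteq> 0 \<Longrightarrow> \<rho> i x \<noteq> 0"
    "\<And>x. \<exists>i\<in>I. \<rho> i x \<noteq> 0 \<Longrightarrow> \<exists>i\<in>I. \<rho>' i x \<noteq> 0"
    "\<And>x. x \<in> L \<Longrightarrow> card {i \<in> I. \<rho>' i x \<noteq> 0} \<le> packing_number TYPE('b)"
proof -
  define G where "G i = \<phi> ` {x \<in> U. \<rho> i x \<noteq> 0}" for i
  have C: "compact (\<phi> ` L)" by (rule compact_chart_image[OF c L])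
  have cov: "\<phi> ` L \<subseteq> \<Union>(G ` I)"
  proof
    fix y assume "y \<in> \<phi> ` L"
    then obtain x where x: "x \<in> L" "y = \<phi> x" by (rule imageE)
    obtain i where "i \<in> I" "\<rho> i x \<noteq> 0" using pos[OF x(1)] by (rule bexE)
    then show "y \<in> \<Union>(G ` I)" using x L(2) by (auto simp: G_def)
  qed
  have G_open: "open B" if "B \<in> G ` I" for B
    using that open_chart_nonzero[OF \<rho>(1) c] by (auto simp: G_def)
  obtain e where e: "0 < e" "\<And>y. y \<in> \<phi> ` L \<Longrightarrow> \<exists>B\<in>G ` I. ball y e \<subseteq> B"
    by (rule Heine_Borel_lemma[OF C cov G_open]) (assumption, rule that)
  \<comment> \<open>What counts is \<open>2 * d < e\<close>: bumps of radius \<open>2 * d\<close>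
    stay inside balls of radius \<open>e\<close>, so nonzero sets do not grow, while their radius
    exceeds the mesh \<open>d\<close>, so they are positive on all of \<open>L\<close>.\<close>
  define d where "d = e / 3"
  have d: "0 < d" "2 * d < e" using e(1) by (simp_all add: d_def)
  obtain Q where Q: "finite Q" "Q \<subseteq> \<phi> ` L" "separated Q d" "\<And>y. y \<in> \<phi> ` L \<Longrightarrow> \<exists>q\<in>Q. dist y q < d"
    by (rule maximal_separated_subset[OF C d(1)]) (rule that)
  have "\<exists>i. i \<in> I \<and> ball q e \<subseteq> G i" if "q \<in> Q" for q
    using e(2)[of q] Q(2) that by auto
  then obtain \<iota> where \<iota>: "\<And>q. q \<in> Q \<Longrightarrow> \<iota> q \<in> I \<and> ball q e \<subseteq> G (\<iota> q)" by metis
  have G_sub: "G i \<subseteq> \<phi> ` U" for i by (auto simp: G_def)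
  have "\<exists>\<beta>::'m \<Rightarrow> real. smooth_fun_on M (mset M) \<beta> \<and> (\<forall>x. 0 \<le> \<beta> x) \<and>
      (\<forall>x. \<beta> x \<noteq> 0 \<longleftrightarrow> x \<in> U \<and> dist (\<phi> x) q < 2 * d)" if q: "q \<in> Q" for q
  proof -
    have "cball q (2 * d) \<subseteq> ball q e" using d by auto
    then have sub: "cball q (2 * d) \<subseteq> \<phi> ` U" using \<iota>[OF q] G_sub by (meson subset_trans)
    have pos: "0 < 2 * d" using d(1) by simp
    obtain \<beta> :: "'m \<Rightarrow> real" where "smooth_fun_on M (mset M) \<beta>" "\<And>x. 0 \<le> \<beta> x"
      "\<And>x. \<beta> x \<noteq> 0 \<longleftrightarrow> x \<in> U \<and> dist (\<phi> x) q < 2 * d"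
      by (rule bump_function[OF c pos sub]) (rule that)
    then show ?thesis by (intro exI[of _ \<beta>]) simp
  qed
  then obtain \<beta> :: "'b \<Rightarrow> 'm \<Rightarrow> real" where \<beta>': "\<And>q. q \<in> Q \<Longrightarrow> smooth_fun_on M (mset M) (\<beta> q) \<and>
    (\<forall>x. 0 \<le> \<beta> q x) \<and> (\<forall>x. \<beta> q x \<noteq> 0 \<longleftrightarrow> x \<in> U \<and> dist (\<phi> x) q < 2 * d)"
    by metis
  have \<beta>: "smooth_fun_on M (mset M) (\<beta> q)" "0 \<le> \<beta> q x" "\<beta> q x \<noteq> 0 \<longleftrightarrow> x \<in> U \<and> dist (\<phi> x) q < 2 * d"
    if "q \<in> Q" for q x using \<beta>'[OF that] by blast+
  define B where "B x = (\<Sum>q\<in>Q. \<beta> q x)" for x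
  have B_smooth: "smooth_fun_on M (mset M) B"
    unfolding B_def by (rule smooth_fun_on_sum[OF openin_topspace \<beta>(1)])
  have B_eq0: "B x = 0 \<longleftrightarrow> (\<forall>q\<in>Q. \<beta> q x = 0)" for x
    unfolding B_def by (rule sum_nonneg_eq_0_iff[OF Q(1) \<beta>(2)])
  have B0: "0 \<le> B x" for x unfolding B_def by (rule sum_nonneg) (rule \<beta>(2))
  have BL: "0 < B x" if "x \<in> L" for x
  proof -
    obtain q where "q \<in> Q" "dist (\<phi> x) q < d" using Q(4) \<open>x \<in> L\<close> by blast
    then have "\<beta> q x \<noteq> 0" using \<beta>(3)[of q x] L(2) \<open>x \<in> L\<close> d(1) by auto
    then have "B x \<noteq> 0" using B_eq0 \<open>q \<in> Q\<close> by blast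
    then show ?thesis using B0[of x] by simp
  qed
  \<comment> \<open>A positive lower bound of \<open>B\<close> on the compact set \<open>L\<close>;
    the value 1 is arbitrary when \<open>L\<close> is empty.\<close>
  obtain m where m: "0 < m" "\<And>x. x \<in> L \<Longrightarrow> m \<le> B x"
  proof (cases "L = {}")
    case True
    then show ?thesis using that[of 1] by simp
  next
    case False
    have cont: "continuous_on (\<phi> ` L) (B \<circ> inv_into U \<phi>)"
      by (rule continuous_on_subset[OF smooth_fun_on_continuous[OF B_smooth c] image_mono[OF L(2)]])
    then obtain y where y: "y \<in> \<phi> ` L" "\<And>z. z \<in> \<phi> ` L \<Longrightarrow> (B \<circ> inv_into U \<phi>) y \<le> (B \<circ> inv_into U \<phi>) z"
      using continuous_attains_inf[OF C _ cont] False by blast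
    then obtain x where x: "x \<in> L" "y = \<phi> x" by auto
    have "B x \<le> B x'" if "x' \<in> L" for x'
    proof -
      have "x \<in> U" "x' \<in> U" "\<phi> x' \<in> \<phi> ` L" using L(2) x(1) that by auto
      then show ?thesis using y(2)[of "\<phi> x'"] x(2) by (simp add: chart_inv[OF c])
    qed
    then show ?thesis using that[of "B x"] BL[OF x(1)] by blast
  qed
  \<comment> \<open>On \<open>L\<close> the factor \<open>flat 0 (m - B x)\<close> vanishes and only
    bumps remain. Elsewhere, a point at which this factor vanishes has
    \<open>B x \<ge> m > 0\<close>, so some bump is active: no point loses all its
    functions.\<close>
  define \<rho>' where "\<rho>' i x = flat 0 (m - B x) * \<rho> i x + (\<Sum>q\<in>{q \<in> Q. \<iota> q = i}. \<beta> q x)" for i x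
  have nonneg: "0 \<le> flat 0 (m - B x) * \<rho> i x" "0 \<le> (\<Sum>q\<in>{q \<in> Q. \<iota> q = i}. \<beta> q x)" for i x
    using \<rho>(2) \<beta>(2) by (auto simp: flat_nonneg intro!: sum_nonneg)
  have \<rho>'_iff: "\<rho>' i x \<noteq> 0 \<longleftrightarrow> (B x < m \<and> \<rho> i x \<noteq> 0) \<or> (\<exists>q\<in>Q. \<iota> q = i \<and> \<beta> q x \<noteq> 0)" for i x
  proof -
    have "(\<Sum>q\<in>{q \<in> Q. \<iota> q = i}. \<beta> q x) = 0 \<longleftrightarrow> (\<forall>q\<in>{q \<in> Q. \<iota> q = i}. \<beta> q x = 0)"
      by (rule sum_nonneg_eq_0_iff) (use Q(1) \<beta>(2) in auto)
    moreover have "\<rho>' i x = 0 \<longleftrightarrow> flat 0 (m - B x) * \<rho> i x = 0 \<and> (\<Sum>q\<in>{q \<in> Q. \<iota> q = i}. \<beta> q x) = 0"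
      unfolding \<rho>'_def using nonneg[of x i] by linarith
    ultimately show ?thesis by (auto simp: flat_eq_0_iff)
  qed
  show thesis
  proof (rule that)
    show "smooth_fun_on M (mset M) (\<rho>' i)" if "i \<in> I" for i
      unfolding \<rho>'_def using \<beta>(1)
      by (intro smooth_fun_on_add smooth_fun_on_mult smooth_fun_on_flat smooth_fun_on_diff
          smooth_fun_on_const smooth_fun_on_sum openin_topspace B_smooth \<rho>(1) that) auto
    show "0 \<le> \<rho>' i x" for i x unfolding \<rho>'_def using nonneg[of x i] by linarith
    show "\<rho> i x \<noteq> 0" if "i \<in> I" "\<rho>' i x \<noteq> 0" for i x
    proof (cases "\<exists>q\<in>Q. \<iota> q = i \<and> \<beta> q x \<noteq> 0")
      case True
      then obtain q where q: "q \<in> Q" "\<iota> q = i" "x \<in> U" "dist (\<phi> x) q < 2 * d" using \<beta>(3) by blast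
      then have "\<phi> x \<in> ball q e" using d(2) by (simp add: dist_commute)
      then have "\<phi> x \<in> G i" using \<iota>[OF q(1)] q(2) by blast
      then obtain x' where x': "x' \<in> U" "\<rho> i x' \<noteq> 0" "\<phi> x = \<phi> x'" by (auto simp: G_def)
      then have "x = x'" using inj_onD[OF chart_inj[OF c] x'(3) q(3)] by blast
      then show ?thesis using x'(2) by simp
    qed (use that(2) \<rho>'_iff in blast)
    show "\<exists>i\<in>I. \<rho>' i x \<noteq> 0" if ex: "\<exists>i\<in>I. \<rho> i x \<noteq> 0" for x
    proof (cases "B x < m")
      case True
      then show ?thesis using ex \<rho>'_iff by blast
    next
      case False
      then have "B x \<noteq> 0" using m(1) by linarith
      then obtain q where "q \<in> Q" "\<beta> q x \<noteq> 0" using B_eq0 by blast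
      then show ?thesis using \<rho>'_iff \<iota> by blast
    qed
    show "card {i \<in> I. \<rho>' i x \<noteq> 0} \<le> packing_number TYPE('b)" if x: "x \<in> L" for x
    proof -
      let ?Q = "{q \<in> Q. dist (\<phi> x) q < 2 * d}"
      have "finite ?Q \<and> card ?Q \<le> packing_number TYPE('b)"
        by (rule packing_number_ball[OF d(1), of _ "\<phi> x"]) (use Q(3) in \<open>auto simp: separated_def\<close>)
      moreover have "{i \<in> I. \<rho>' i x \<noteq> 0} \<subseteq> \<iota> ` ?Q"
        using m(2)[OF x] \<rho>'_iff[of _ x] \<beta>(3)[of _ x] by auto
      ultimately show ?thesis
        by (meson card_image_le card_mono finite_imageI order_trans)
    qed
  qed
qed

text \<open>The pieces are treated one after the other. A step never enlarges the set of active
  indices at a point, so the bounds reached on earlier pieces persist.\<close>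

lemma reduce_active_many:
  fixes \<rho> :: "'i \<Rightarrow> 'm \<Rightarrow> real" and L :: "'j \<Rightarrow> 'm set"
  assumes I: "finite I" and \<rho>: "\<And>i. i \<in> I \<Longrightarrow> smooth_fun_on M (mset M) (\<rho> i)" "\<And>i x. 0 \<le> \<rho> i x"
    and D: "finite D" and L: "\<And>k. k \<in> D \<Longrightarrow> compactin (mtop M) (L k)"
      "\<And>k. k \<in> D \<Longrightarrow> \<exists>U \<phi>. (U, \<phi>) \<in> atlas M \<and> L k \<subseteq> U"
      "\<And>k x. k \<in> D \<Longrightarrow> x \<in> L k \<Longrightarrow> \<exists>i\<in>I. \<rho> i x \<noteq> 0"
  shows "\<exists>\<rho>'. (\<forall>i\<in>I. smooth_fun_on M (mset M) (\<rho>' i)) \<and> (\<forall>i x. 0 \<le> (\<rho>' i x :: real)) \<and>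
    (\<forall>i\<in>I. \<forall>x. \<rho>' i x \<noteq> 0 \<longrightarrow> \<rho> i x \<noteq> 0) \<and> (\<forall>x. (\<exists>i\<in>I. \<rho> i x \<noteq> 0) \<longrightarrow> (\<exists>i\<in>I. \<rho>' i x \<noteq> 0)) \<and>
    (\<forall>k\<in>D. \<forall>x\<in>L k. card {i \<in> I. \<rho>' i x \<noteq> 0} \<le> packing_number TYPE('b))"
  using D L
proof (induction D rule: finite_induct)
  case empty
  show ?case by (rule exI[of _ \<rho>]) (use \<rho> in auto)
next
  case (insert k D)
  have "\<exists>\<rho>'. (\<forall>i\<in>I. smooth_fun_on M (mset M) (\<rho>' i)) \<and> (\<forall>i x. 0 \<le> (\<rho>' i x :: real)) \<and>
    (\<forall>i\<in>I. \<forall>x. \<rho>' i x \<noteq> 0 \<longrightarrow> \<rho> i x \<noteq> 0) \<and> (\<forall>x. (\<exists>i\<in>I. \<rho> i x \<noteq> 0) \<longrightarrow> (\<exists>i\<in>I. \<rho>' i x \<noteq> 0)) \<and>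
    (\<forall>k\<in>D. \<forall>x\<in>L k. card {i \<in> I. \<rho>' i x \<noteq> 0} \<le> packing_number TYPE('b))"
  proof (rule insert.IH)
    show "compactin (mtop M) (L k')" "\<exists>U \<phi>. (U, \<phi>) \<in> atlas M \<and> L k' \<subseteq> U" if "k' \<in> D" for k'
      using insert.prems(1,2)[of k'] that by simp_all
    show "\<exists>i\<in>I. \<rho> i x \<noteq> 0" if "k' \<in> D" "x \<in> L k'" for k' x
      using insert.prems(3)[of k' x] that by simp
  qed
  then obtain \<rho>1 :: "'i \<Rightarrow> 'm \<Rightarrow> real" where \<rho>1: "\<And>i. i \<in> I \<Longrightarrow> smooth_fun_on M (mset M) (\<rho>1 i)"
    "\<And>i x. 0 \<le> \<rho>1 i x" "\<And>i x. i \<in> I \<Longrightarrow> \<rho>1 i x \<noteq> 0 \<Longrightarrow> \<rho> i x \<noteq> 0"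
    "\<And>x. \<exists>i\<in>I. \<rho> i x \<noteq> 0 \<Longrightarrow> \<exists>i\<in>I. \<rho>1 i x \<noteq> 0"
    "\<And>k x. k \<in> D \<Longrightarrow> x \<in> L k \<Longrightarrow> card {i \<in> I. \<rho>1 i x \<noteq> 0} \<le> packing_number TYPE('b)"
    by blast
  obtain U \<phi> where c: "(U, \<phi>) \<in> atlas M" "L k \<subseteq> U" using insert.prems(2)[of k] by blast
  have Lk: "compactin (mtop M) (L k)" using insert.prems(1) by blast
  have pos: "\<exists>i\<in>I. \<rho>1 i x \<noteq> 0" if "x \<in> L k" for x using insert.prems(3)[of k x] \<rho>1(4) that by blast
  obtain \<rho>2 :: "'i \<Rightarrow> 'm \<Rightarrow> real" where \<rho>2: "\<And>i. i \<in> I \<Longrightarrow> smooth_fun_on M (mset M) (\<rho>2 i)"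
    "\<And>i x. 0 \<le> \<rho>2 i x" "\<And>i x. i \<in> I \<Longrightarrow> \<rho>2 i x \<noteq> 0 \<Longrightarrow> \<rho>1 i x \<noteq> 0"
    "\<And>x. \<exists>i\<in>I. \<rho>1 i x \<noteq> 0 \<Longrightarrow> \<exists>i\<in>I. \<rho>2 i x \<noteq> 0"
    "\<And>x. x \<in> L k \<Longrightarrow> card {i \<in> I. \<rho>2 i x \<noteq> 0} \<le> packing_number TYPE('b)"
    by (rule reduce_active[OF I \<rho>1(1,2) c(1) Lk c(2) pos]) (assumption | rule that)+
  have cards: "card {i \<in> I. \<rho>2 i x \<noteq> 0} \<le> packing_number TYPE('b)" if "k' \<in> insert k D" "x \<in> L k'" for k' x
  proof (cases "k' = k")
    case False
    have "card {i \<in> I. \<rho>2 i x \<noteq> 0} \<le> card {i \<in> I. \<rho>1 i x \<noteq> 0}"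
      by (rule card_mono) (use I \<rho>2(3) in auto)
    then show ?thesis using \<rho>1(5)[of k' x] that False by auto
  qed (use \<rho>2(5) that in blast)
  show ?case
  proof (intro exI[of _ \<rho>2] conjI ballI allI impI)
    show "\<rho> i x \<noteq> 0" if "i \<in> I" "\<rho>2 i x \<noteq> 0" for i x
      by (rule \<rho>1(3)[OF that(1) \<rho>2(3)[OF that]])
    show "\<exists>i\<in>I. \<rho>2 i x \<noteq> 0" if "\<exists>i\<in>I. \<rho> i x \<noteq> 0" for x
      by (rule \<rho>2(4)[OF \<rho>1(4)[OF that]])
  qed (rule \<rho>2(1,2) cards; assumption)+
qed

text \<open>Bumps around points of \<open>K\<close> are shrunk into a member of the cover and into
  \<open>O'\<close>, and compactness selects finitely many. Their compact carriers cut
  \<open>K\<close> into finitely many compact pieces, each inside one chart, on which the overlap is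
  then reduced.\<close>

lemma few_active_functions:
  assumes K: "compactin (mtop M) K" "K \<subseteq> O'" "openin (mtop M) O'"
    and cov: "\<And>V. V \<in> \<V> \<Longrightarrow> openin (mtop M) V" "mset M \<subseteq> \<Union>\<V>"
  obtains D :: "'m set" and \<rho> :: "'m \<Rightarrow> 'm \<Rightarrow> real" where "finite D"
    "\<And>i. i \<in> D \<Longrightarrow> smooth_fun_on M (mset M) (\<rho> i)" "\<And>i x. 0 \<le> \<rho> i x"
    "\<And>i. i \<in> D \<Longrightarrow> \<exists>V\<in>\<V>. \<exists>Z. closedin (mtop M) Z \<and> Z \<subseteq> V \<inter> O' \<and> {x. \<rho> i x \<noteq> 0} \<subseteq> Z"
    "\<And>x. x \<in> K \<Longrightarrow> \<exists>i\<in>D. \<rho> i x \<noteq> 0"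
    "\<And>x. x \<in> K \<Longrightarrow> card {i \<in> D. \<rho> i x \<noteq> 0} \<le> packing_number TYPE('b)"
proof -
  have "\<exists>\<beta>::'m \<Rightarrow> real. \<exists>Z U \<phi>. smooth_fun_on M (mset M) \<beta> \<and> (\<forall>y. 0 \<le> \<beta> y) \<and> \<beta> x \<noteq> 0 \<and>
      (U, \<phi>) \<in> atlas M \<and> compactin (mtop M) Z \<and> Z \<subseteq> U \<and> (\<exists>V\<in>\<V>. Z \<subseteq> V \<inter> O') \<and> {y. \<beta> y \<noteq> 0} \<subseteq> Z"
    if x: "x \<in> K" for x
  proof -
    have xM: "x \<in> mset M" using x K compactin_subset_topspace by blast
    obtain U \<phi> where c: "(U, \<phi>) \<in> atlas M" "x \<in> U" using atlas_cover[OF xM] by blast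
    obtain V where V: "V \<in> \<V>" "x \<in> V" using cov(2) xM by blast
    have "open (\<phi> ` (U \<inter> (V \<inter> O')))"
      using open_chart_image[OF c(1)] openin_Int[OF cov(1)[OF V(1)] K(3)] by blast
    moreover have "\<phi> x \<in> \<phi> ` (U \<inter> (V \<inter> O'))" using c(2) V(2) x K(2) by blast
    ultimately obtain r where r: "0 < r" "cball (\<phi> x) r \<subseteq> \<phi> ` (U \<inter> (V \<inter> O'))"
      using open_contains_cball by blast
    then have r': "cball (\<phi> x) r \<subseteq> \<phi> ` U" by blast
    obtain \<beta> :: "'m \<Rightarrow> real" where \<beta>: "smooth_fun_on M (mset M) \<beta>" "\<And>x. 0 \<le> \<beta> x"
      "\<And>y. \<beta> y \<noteq> 0 \<longleftrightarrow> y \<in> U \<and> dist (\<phi> y) (\<phi> x) < r"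
      by (rule bump_function[OF c(1) r(1) r']) (rule that)
    let ?Z = "{y \<in> U. \<phi> y \<in> cball (\<phi> x) r}"
    have "compactin (mtop M) ?Z" by (rule compactin_chart_preimage[OF c(1) compact_cball r'])
    moreover have "?Z \<subseteq> V \<inter> O'"
    proof
      fix y assume y: "y \<in> ?Z"
      then obtain z where "z \<in> U \<inter> (V \<inter> O')" "\<phi> y = \<phi> z" using r(2) by blast
      then show "y \<in> V \<inter> O'" using inj_onD[OF chart_inj[OF c(1)], of y z] y by auto
    qed
    moreover have "{y. \<beta> y \<noteq> 0} \<subseteq> ?Z" using \<beta>(3) by (auto simp: dist_commute)
    moreover have "\<beta> x \<noteq> 0" using \<beta>(3) c(2) r(1) by simp
    ultimately show ?thesis using \<beta>(1,2) c(1) V(1)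
      by (intro exI[of _ \<beta>] exI[of _ ?Z] exI[of _ U] exI[of _ \<phi>]) auto
  qed
  then obtain \<beta> :: "'m \<Rightarrow> 'm \<Rightarrow> real" and Z where
    \<beta>: "\<And>x. x \<in> K \<Longrightarrow> smooth_fun_on M (mset M) (\<beta> x) \<and> (\<forall>y. 0 \<le> \<beta> x y) \<and> \<beta> x x \<noteq> 0"
    and Z: "\<And>x. x \<in> K \<Longrightarrow> compactin (mtop M) (Z x) \<and> (\<exists>U \<phi>. (U, \<phi>) \<in> atlas M \<and> Z x \<subseteq> U) \<and>
      (\<exists>V\<in>\<V>. Z x \<subseteq> V \<inter> O') \<and> {y. \<beta> x y \<noteq> 0} \<subseteq> Z x"
    by metis
  let ?G = "\<lambda>x. {y \<in> mset M. \<beta> x y \<noteq> 0}"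
  have "openin (mtop M) B" if "B \<in> ?G ` K" for B
    using that \<beta> openin_nonzero by blast
  moreover have "K \<subseteq> \<Union>(?G ` K)" using \<beta> compactin_subset_topspace[OF K(1)] by blast
  ultimately have "\<exists>\<F>. finite \<F> \<and> \<F> \<subseteq> ?G ` K \<and> K \<subseteq> \<Union>\<F>"
    using K(1) unfolding compactin_def by meson
  then obtain \<F> where F: "finite \<F>" "\<F> \<subseteq> ?G ` K" "K \<subseteq> \<Union>\<F>" by blast
  obtain D where "D \<subseteq> K" "finite D" "\<F> = ?G ` D" using finite_subset_image[OF F(1,2)] by blast
  then have D: "D \<subseteq> K" "finite D" "K \<subseteq> \<Union>(?G ` D)" using F(3) by simp_all
  \<comment> \<open>The value 0 for indices outside \<open>K\<close> serves nonnegativity for all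
    indices.\<close>
  define \<rho> where "\<rho> = (\<lambda>i. if i \<in> K then \<beta> i else (\<lambda>_. 0))"
  have \<rho>D: "\<rho> i = \<beta> i" if "i \<in> D" for i using that D(1) by (auto simp: \<rho>_def)
  \<comment> \<open>These pieces cover \<open>K\<close>: each point of \<open>K\<close> has an
    active bump, and the nonzero set of that bump lies in the corresponding
    \<open>Z i\<close>.\<close>
  define L where "L i = Z i \<inter> K" for i
  have 1: "smooth_fun_on M (mset M) (\<rho> i)" if "i \<in> D" for i using \<beta> \<rho>D[OF that] D(1) that by auto
  have 2: "0 \<le> \<rho> i x" for i x using \<beta> by (simp add: \<rho>_def)
  have pos: "\<exists>i\<in>D. \<rho> i x \<noteq> 0" if "x \<in> K" for x using D(3) that \<rho>D by fastforce
  have 3: "compactin (mtop M) (L i)" if "i \<in> D" for i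
    unfolding L_def using Z[of i] D(1) that compactin_imp_closedin[OF hausdorff K(1)]
    by (intro compact_Int_closedin) auto
  have 4: "\<exists>U \<phi>. (U, \<phi>) \<in> atlas M \<and> L i \<subseteq> U" if "i \<in> D" for i
    using Z[of i] D(1) that unfolding L_def by blast
  have 5: "\<exists>i\<in>D. \<rho> i x \<noteq> 0" if "k \<in> D" "x \<in> L k" for k x
    using pos that unfolding L_def by blast
  have "\<exists>\<rho>'. (\<forall>i\<in>D. smooth_fun_on M (mset M) (\<rho>' i)) \<and> (\<forall>i x. 0 \<le> (\<rho>' i x :: real)) \<and>
    (\<forall>i\<in>D. \<forall>x. \<rho>' i x \<noteq> 0 \<longrightarrow> \<rho> i x \<noteq> 0) \<and> (\<forall>x. (\<exists>i\<in>D. \<rho> i x \<noteq> 0) \<longrightarrow> (\<exists>i\<in>D. \<rho>' i x \<noteq> 0)) \<and>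
    (\<forall>k\<in>D. \<forall>x\<in>L k. card {i \<in> D. \<rho>' i x \<noteq> 0} \<le> packing_number TYPE('b))"
    by (rule reduce_active_many[where \<rho> = \<rho> and L = L]) (fact D(2) 1 2 3 4 5)+
  then obtain \<rho>' :: "'m \<Rightarrow> 'm \<Rightarrow> real" where \<rho>': "\<forall>i\<in>D. smooth_fun_on M (mset M) (\<rho>' i)" "\<forall>i x. 0 \<le> \<rho>' i x"
    "\<forall>i\<in>D. \<forall>x. \<rho>' i x \<noteq> 0 \<longrightarrow> \<rho> i x \<noteq> 0" "\<forall>x. (\<exists>i\<in>D. \<rho> i x \<noteq> 0) \<longrightarrow> (\<exists>i\<in>D. \<rho>' i x \<noteq> 0)"
    "\<forall>k\<in>D. \<forall>x\<in>L k. card {i \<in> D. \<rho>' i x \<noteq> 0} \<le> packing_number TYPE('b)"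
    by (elim exE conjE) (rule that)
  show thesis
  proof (rule that[OF D(2), of \<rho>'])
    show "\<exists>V\<in>\<V>. \<exists>Z. closedin (mtop M) Z \<and> Z \<subseteq> V \<inter> O' \<and> {x. \<rho>' i x \<noteq> 0} \<subseteq> Z" if i: "i \<in> D" for i
    proof -
      have iK: "i \<in> K" using i D(1) by blast
      then obtain V where V: "V \<in> \<V>" "Z i \<subseteq> V \<inter> O'" using Z by blast
      have "closedin (mtop M) (Z i)" using Z[OF iK] compactin_imp_closedin[OF hausdorff] by blast
      moreover have "{x. \<rho>' i x \<noteq> 0} \<subseteq> Z i"
      proof
        fix x assume "x \<in> {x. \<rho>' i x \<noteq> 0}"
        then have "\<rho> i x \<noteq> 0" using \<rho>'(3) i by simp
        then have "\<beta> i x \<noteq> 0" by (simp add: \<rho>D[OF i])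
        then show "x \<in> Z i" using Z[OF iK] by blast
      qed
      ultimately show ?thesis using V by blast
    qed
    show "card {i \<in> D. \<rho>' i x \<noteq> 0} \<le> packing_number TYPE('b)" if "x \<in> K" for x
    proof -
      obtain k where "k \<in> D" "\<beta> k x \<noteq> 0" using D(3) \<open>x \<in> K\<close> by blast
      then have "x \<in> L k" using Z[of k] D(1) that by (auto simp: L_def)
      then show ?thesis using \<rho>'(5) \<open>k \<in> D\<close> by blast
    qed
  qed (use \<rho>' pos in auto)
qed

text \<open>
  \<open>g S\<close> is supported where all \<open>\<rho> i\<close> with \<open>i \<in> S\<close> dominate the sum of the remaining ones; for
  distinct sets of equal cardinality these supports are disjoint.
\<close>

lemma colored_functions_compact:
  assumes K: "compactin (mtop M) K" "K \<subseteq> O'" "openin (mtop M) O'"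
    and cov: "\<And>V. V \<in> \<V> \<Longrightarrow> openin (mtop M) V" "mset M \<subseteq> \<Union>\<V>"
  shows "\<exists>\<S> (g :: 'm set \<Rightarrow> 'm \<Rightarrow> real). finite \<S> \<and> (\<forall>S\<in>\<S>. smooth_fun_on M (mset M) (g S) \<and>
      (\<forall>x. 0 \<le> g S x) \<and> card S \<le> packing_number TYPE('b) \<and>
      (\<exists>V\<in>\<V>. \<exists>Z. closedin (mtop M) Z \<and> Z \<subseteq> V \<inter> O' \<and> {x. g S x \<noteq> 0} \<subseteq> Z)) \<and>
    (\<forall>S\<in>\<S>. \<forall>S'\<in>\<S>. S \<noteq> S' \<longrightarrow> card S = card S' \<longrightarrow> (\<forall>x. g S x = 0 \<or> g S' x = 0)) \<and>
    (\<forall>x\<in>K. \<exists>S\<in>\<S>. g S x \<noteq> 0)"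
proof -
  obtain D :: "'m set" and \<rho> :: "'m \<Rightarrow> 'm \<Rightarrow> real" where D: "finite D"
    and \<rho>: "\<And>i. i \<in> D \<Longrightarrow> smooth_fun_on M (mset M) (\<rho> i)" "\<And>i x. 0 \<le> \<rho> i x"
    and supp: "\<And>i. i \<in> D \<Longrightarrow> \<exists>V\<in>\<V>. \<exists>Z. closedin (mtop M) Z \<and> Z \<subseteq> V \<inter> O' \<and> {x. \<rho> i x \<noteq> 0} \<subseteq> Z"
    and pos: "\<And>x. x \<in> K \<Longrightarrow> \<exists>i\<in>D. \<rho> i x \<noteq> 0"
    and few: "\<And>x. x \<in> K \<Longrightarrow> card {i \<in> D. \<rho> i x \<noteq> 0} \<le> packing_number TYPE('b)"
    by (rule few_active_functions[OF K cov]) (assumption+, rule that)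
  define g where "g S x = (\<Prod>i\<in>S. flat 0 (\<rho> i x - (\<Sum>j\<in>D - S. \<rho> j x)))" for S x
  \<comment> \<open>A non-empty \<open>S\<close> has a member \<open>i\<close>, and where
    \<open>g S\<close> is nonzero so is \<open>\<rho> i\<close>; hence \<open>g S\<close> inherits
    the small support of \<open>\<rho> i\<close>.\<close>
  define \<S> where "\<S> = {S. S \<subseteq> D \<and> S \<noteq> {} \<and> card S \<le> packing_number TYPE('b)}"
  have fin: "finite S" if "S \<in> \<S>" for S using that D finite_subset by (auto simp: \<S>_def)
  have g: "g S x \<noteq> 0 \<longleftrightarrow> (\<forall>i\<in>S. (\<Sum>j\<in>D - S. \<rho> j x) < \<rho> i x)" if "S \<in> \<S>" for S x
    using fin[OF that] by (auto simp: g_def flat_eq_0_iff not_le)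
  have sum_nn: "0 \<le> (\<Sum>j\<in>D - S. \<rho> j x)" for S x by (rule sum_nonneg) (rule \<rho>(2))
  have c1: "finite \<S>" by (rule finite_subset[of _ "Pow D"]) (use D in \<open>auto simp: \<S>_def\<close>)
  have c2: "smooth_fun_on M (mset M) (g S)" if "S \<in> \<S>" for S
    unfolding g_def
    by (intro smooth_fun_on_prod smooth_fun_on_flat smooth_fun_on_diff smooth_fun_on_sum openin_topspace \<rho>(1))
      (use that in \<open>auto simp: \<S>_def\<close>)
  have c3: "0 \<le> g S x" for S x unfolding g_def by (rule prod_nonneg) (simp add: flat_nonneg)
  have c4: "card S \<le> packing_number TYPE('b)" if "S \<in> \<S>" for S using that by (simp add: \<S>_def)
  have c5: "\<exists>V\<in>\<V>. \<exists>Z. closedin (mtop M) Z \<and> Z \<subseteq> V \<inter> O' \<and> {x. g S x \<noteq> 0} \<subseteq> Z" if S: "S \<in> \<S>" for S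
  proof -
    obtain i where i: "i \<in> S" "i \<in> D" using S by (auto simp: \<S>_def)
    have "{x. g S x \<noteq> 0} \<subseteq> {x. \<rho> i x \<noteq> 0}"
    proof
      fix x assume "x \<in> {x. g S x \<noteq> 0}"
      then have "(\<Sum>j\<in>D - S. \<rho> j x) < \<rho> i x" using g[OF S, of x] i(1) by simp
      then show "x \<in> {x. \<rho> i x \<noteq> 0}" using sum_nn[of x S] by simp
    qed
    then show ?thesis using supp[OF i(2)] by (meson subset_trans)
  qed
  have c6: "g S x = 0 \<or> g S' x = 0"
    if S: "S \<in> \<S>" "S' \<in> \<S>" "S \<noteq> S'" "card S = card S'" for S S' x
  proof (rule ccontr)
    assume "\<not> ?thesis"
    then have "g S x \<noteq> 0" "g S' x \<noteq> 0" by auto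
    then have *: "\<And>i. i \<in> S \<Longrightarrow> (\<Sum>j\<in>D - S. \<rho> j x) < \<rho> i x" "\<And>i. i \<in> S' \<Longrightarrow> (\<Sum>j\<in>D - S'. \<rho> j x) < \<rho> i x"
      using g S(1,2) by auto
    \<comment> \<open>Equal cardinality excludes proper inclusion, so each set has a member outside
      the other. At a common point of the supports each of these two functions would exceed the
      other.\<close>
    have "\<not> S \<subseteq> S'" "\<not> S' \<subseteq> S" using card_subset_eq[of S' S] card_subset_eq[of S S'] fin S by auto
    then obtain i j where ij: "i \<in> S" "i \<notin> S'" "j \<in> S'" "j \<notin> S" by blast
    have "i \<in> D" "j \<in> D" using ij S by (auto simp: \<S>_def)
    then have "\<rho> j x \<le> (\<Sum>j\<in>D - S. \<rho> j x)" "\<rho> i x \<le> (\<Sum>j\<in>D - S'. \<rho> j x)"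
      using ij D \<rho>(2) by (auto intro!: member_le_sum)
    then show False using *(1)[OF ij(1)] *(2)[OF ij(3)] by linarith
  qed
  have c7: "\<exists>S\<in>\<S>. g S x \<noteq> 0" if x: "x \<in> K" for x
  proof -
    \<comment> \<open>The set of all active indices: the sum over its complement is 0, and every
      member exceeds it.\<close>
    let ?S = "{i \<in> D. \<rho> i x \<noteq> 0}"
    have S: "?S \<in> \<S>" using pos[OF x] few[OF x] by (auto simp: \<S>_def)
    have "(\<Sum>j\<in>D - ?S. \<rho> j x) = 0" by (rule sum.neutral) auto
    then have "g ?S x \<noteq> 0" unfolding g[OF S] using \<rho>(2) by (auto simp: less_le)
    then show ?thesis using S by blast
  qed
  show ?thesis
    by (intro exI[of _ \<S>] exI[of _ g] conjI ballI allI impI) (assumption | rule c1 c2 c3 c4 c5 c6 c7)+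
qed

text \<open>Countably many basic open sets lie in compact sets, and they still cover
  \<open>M\<close> because charts supply compact neighbourhoods. Each stage covers the previous one
  by finitely many of them and adds the next set of an enumeration.\<close>

lemma compact_exhaustion:
  obtains E :: "nat \<Rightarrow> 'm set" where "E 0 = {}" "\<And>k. compactin (mtop M) (E k)"
    "\<And>k. E k \<subseteq> mtop M interior_of E (Suc k)" "mset M \<subseteq> (\<Union>k. E k)"
proof -
  obtain \<B> where \<B>': "countable \<B>" "\<forall>V\<in>\<B>. openin (mtop M) V"
    "\<forall>U x. openin (mtop M) U \<and> x \<in> U \<longrightarrow> (\<exists>V\<in>\<B>. x \<in> V \<and> V \<subseteq> U)"
    using second_countable unfolding second_countable_def by (elim exE conjE) (rule that)
  have \<B>: "countable \<B>" "\<And>V. V \<in> \<B> \<Longrightarrow> openin (mtop M) V"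
    "\<And>U x. openin (mtop M) U \<Longrightarrow> x \<in> U \<Longrightarrow> \<exists>V\<in>\<B>. x \<in> V \<and> V \<subseteq> U"
    using \<B>' by simp_all
  \<comment> \<open>The empty set is inserted so that the family is non-empty and can be enumerated
    by the naturals even when \<open>M\<close> is empty.\<close>
  define \<G> where "\<G> = insert {} {B \<in> \<B>. \<exists>Z. compactin (mtop M) Z \<and> B \<subseteq> Z}"
  have G_open: "openin (mtop M) B" if "B \<in> \<G>" for B using that \<B>(2) by (auto simp: \<G>_def)
  have "\<exists>Z. compactin (mtop M) Z \<and> B \<subseteq> Z" if "B \<in> \<G>" for B
    using that compactin_empty[of "mtop M"] by (auto simp: \<G>_def)
  then obtain Z where Z: "\<And>B. B \<in> \<G> \<Longrightarrow> compactin (mtop M) (Z B)" "\<And>B. B \<in> \<G> \<Longrightarrow> B \<subseteq> Z B" by metis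
  have cover: "\<exists>B\<in>\<G>. x \<in> B" if x: "x \<in> mset M" for x
  proof -
    obtain U \<phi> where c: "(U, \<phi>) \<in> atlas M" "x \<in> U" using atlas_cover[OF x] by blast
    obtain r where r: "0 < r" "cball (\<phi> x) r \<subseteq> \<phi> ` U"
      using chart(2)[OF c(1)] c(2) open_contains_cball by blast
    let ?B = "{y \<in> U. \<phi> y \<in> ball (\<phi> x) r}"
    have "openin (mtop M) ?B" by (rule openin_chart_preimage[OF c(1) open_ball])
    then obtain V where V: "V \<in> \<B>" "x \<in> V" "V \<subseteq> ?B" using \<B>(3)[of ?B x] c(2) r(1) by auto
    have "compactin (mtop M) {y \<in> U. \<phi> y \<in> cball (\<phi> x) r}"
      by (rule compactin_chart_preimage[OF c(1) compact_cball r(2)])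
    moreover have "V \<subseteq> {y \<in> U. \<phi> y \<in> cball (\<phi> x) r}" using V(3) by auto
    ultimately show ?thesis using V by (auto simp: \<G>_def)
  qed
  have "countable \<G>" using \<B>(1) by (auto simp: \<G>_def intro: countable_subset)
  then obtain b :: "nat \<Rightarrow> 'm set" where b: "range b = \<G>"
    using that[OF range_from_nat_into[of \<G>]] by (simp add: \<G>_def)
  have step: "\<exists>E'. compactin (mtop M) E' \<and> E \<subseteq> mtop M interior_of E' \<and> b k \<subseteq> E'"
    if E: "compactin (mtop M) E" for E k
  proof -
    have "E \<subseteq> \<Union>\<G>" using cover compactin_subset_topspace[OF E] by blast
    then have "\<exists>\<F>. finite \<F> \<and> \<F> \<subseteq> \<G> \<and> E \<subseteq> \<Union>\<F>"
      using E G_open unfolding compactin_def by meson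
    then obtain \<F> where F: "finite \<F>" "\<F> \<subseteq> \<G>" "E \<subseteq> \<Union>\<F>" by blast
    let ?E = "\<Union>(Z ` insert (b k) \<F>)"
    have bk: "b k \<in> \<G>" using b by blast
    have "compactin (mtop M) ?E"
      by (rule compactin_Union) (use F Z bk in auto)
    moreover have "E \<subseteq> mtop M interior_of ?E"
    proof -
      have "\<Union>\<F> \<subseteq> mtop M interior_of ?E"
        by (rule interior_of_maximal) (use F Z(2) G_open in \<open>blast+\<close>)
      then show ?thesis using F(3) by blast
    qed
    moreover have "b k \<subseteq> ?E" using Z(2)[OF bk] by blast
    ultimately show ?thesis by blast
  qed
  \<comment> \<open>The clause for \<open>k = 0\<close> makes the exhaustion start with the empty
    set, on which the treatment of the first shell relies.\<close>
  have "\<exists>E. \<forall>k::nat. (compactin (mtop M) (E k) \<and> (k = 0 \<longrightarrow> E k = {})) \<and>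
      (E k \<subseteq> mtop M interior_of E (Suc k) \<and> b k \<subseteq> E (Suc k))"
  proof (rule dependent_nat_choice)
    show "\<exists>x. compactin (mtop M) x \<and> ((0::nat) = 0 \<longrightarrow> x = {})" by simp
  next
    fix E and k :: nat assume "compactin (mtop M) E \<and> (k = 0 \<longrightarrow> E = {})"
    then show "\<exists>y. (compactin (mtop M) y \<and> (Suc k = 0 \<longrightarrow> y = {})) \<and>
        (E \<subseteq> mtop M interior_of y \<and> b k \<subseteq> y)" using step[of E k] by auto
  qed
  then obtain E where "\<forall>k::nat. (compactin (mtop M) (E k) \<and> (k = 0 \<longrightarrow> E k = {})) \<and>
      (E k \<subseteq> mtop M interior_of E (Suc k) \<and> b k \<subseteq> E (Suc k))"
    by (elim exE) (rule that)
  then have E: "\<And>k. compactin (mtop M) (E k)" "E 0 = {}"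
    "\<And>k. E k \<subseteq> mtop M interior_of E (Suc k)" "\<And>k. b k \<subseteq> E (Suc k)" by simp_all
  have "mset M \<subseteq> (\<Union>k. E k)"
  proof
    fix x assume "x \<in> mset M"
    then obtain B where "B \<in> \<G>" "x \<in> B" using cover by blast
    then obtain k where "x \<in> b k" using b by blast
    then show "x \<in> (\<Union>k. E k)" using E(4) by blast
  qed
  with E show thesis by (intro that[of E])
qed

text \<open>Open neighbourhoods of shells with index distance at least 3 are disjoint, so the shell
  modulo 3 together with the cardinality from the compact case separates supports. The cardinalities
  are bounded by one number for all shells, which keeps the set of colours finite.\<close>

lemma colored_functions:
  assumes cov: "\<And>V. V \<in> \<V> \<Longrightarrow> openin (mtop M) V" "mset M \<subseteq> \<Union>\<V>"
  obtains I :: "(nat \<times> 'm set) set" and g :: "nat \<times> 'm set \<Rightarrow> 'm \<Rightarrow> real" and col :: "nat \<times> 'm set \<Rightarrow> nat \<times> nat"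
    and V :: "nat \<times> 'm set \<Rightarrow> 'm set"
  where "finite (col ` I)" "\<And>s. s \<in> I \<Longrightarrow> smooth_fun_on M (mset M) (g s)" "\<And>s. s \<in> I \<Longrightarrow> V s \<in> \<V>"
    "\<And>s. s \<in> I \<Longrightarrow> \<exists>Z. closedin (mtop M) Z \<and> Z \<subseteq> V s \<and> {x. g s x \<noteq> 0} \<subseteq> Z"
    "\<And>s s' x. s \<in> I \<Longrightarrow> s' \<in> I \<Longrightarrow> col s = col s' \<Longrightarrow> g s x \<noteq> 0 \<Longrightarrow> g s' x \<noteq> 0 \<Longrightarrow> s = s'"
    "\<And>x. x \<in> mset M \<Longrightarrow> \<exists>s\<in>I. g s x \<noteq> 0"
    "\<And>x. x \<in> mset M \<Longrightarrow> \<exists>W. openin (mtop M) W \<and> x \<in> W \<and> finite {s \<in> I. \<exists>y\<in>W. g s y \<noteq> 0}"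
proof -
  obtain E :: "nat \<Rightarrow> 'm set" where E: "E 0 = {}" "\<And>k. compactin (mtop M) (E k)"
    "\<And>k. E k \<subseteq> mtop M interior_of E (Suc k)" "mset M \<subseteq> (\<Union>k. E k)"
    by (rule compact_exhaustion) (rule that)
  let ?int = "\<lambda>k. mtop M interior_of E k"
  have E_step: "E k \<subseteq> E (Suc k)" for k using subset_trans[OF E(3) interior_of_subset] .
  have E_mono: "E k \<subseteq> E l" if "k \<le> l" for k l using lift_Suc_mono_le[of E, OF E_step that] .
  define K where "K k = E (Suc k) - ?int k" for k
  \<comment> \<open>An open neighbourhood of the shell \<open>K k\<close>. For \<open>k = 0\<close>
    the truncated difference gives \<open>E 0\<close>, which is empty.\<close>
  define Ok where "Ok k = ?int (Suc (Suc k)) - E (k - 1)" for k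
  have K: "compactin (mtop M) (K k)" for k
  proof -
    have "K k = E (Suc k) \<inter> (mset M - ?int k)"
      using compactin_subset_topspace[OF E(2)] by (auto simp: K_def)
    moreover have "closedin (mtop M) (mset M - ?int k)" by (intro closedin_diff) simp_all
    ultimately show ?thesis using compact_Int_closedin[OF E(2), of "mset M - ?int k" "Suc k"] by simp
  qed
  have KO: "K k \<subseteq> Ok k" for k
  proof (cases k)
    case 0
    then show ?thesis using E(1) E(3)[of "Suc 0"] by (auto simp: K_def Ok_def)
  next
    case (Suc l)
    then show ?thesis using E(3)[of "Suc k"] E(3)[of l] by (auto simp: K_def Ok_def)
  qed
  have Ok: "openin (mtop M) (Ok k)" for k
    unfolding Ok_def using compactin_imp_closedin[OF hausdorff E(2)] by (intro openin_diff) auto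
  have "\<forall>k. \<exists>\<S> (g :: 'm set \<Rightarrow> 'm \<Rightarrow> real). finite \<S> \<and> (\<forall>S\<in>\<S>. smooth_fun_on M (mset M) (g S) \<and>
      (\<forall>x. 0 \<le> g S x) \<and> card S \<le> packing_number TYPE('b) \<and>
      (\<exists>V\<in>\<V>. \<exists>Z. closedin (mtop M) Z \<and> Z \<subseteq> V \<inter> Ok k \<and> {x. g S x \<noteq> 0} \<subseteq> Z)) \<and>
    (\<forall>S\<in>\<S>. \<forall>S'\<in>\<S>. S \<noteq> S' \<longrightarrow> card S = card S' \<longrightarrow> (\<forall>x. g S x = 0 \<or> g S' x = 0)) \<and>
    (\<forall>x\<in>K k. \<exists>S\<in>\<S>. g S x \<noteq> 0)"
    by (intro allI colored_functions_compact K KO Ok cov)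
  then obtain \<S> and h :: "nat \<Rightarrow> 'm set \<Rightarrow> 'm \<Rightarrow> real" where
    \<S>: "\<forall>k. finite (\<S> k) \<and> (\<forall>S\<in>\<S> k. smooth_fun_on M (mset M) (h k S) \<and>
      (\<forall>x. 0 \<le> h k S x) \<and> card S \<le> packing_number TYPE('b) \<and>
      (\<exists>V\<in>\<V>. \<exists>Z. closedin (mtop M) Z \<and> Z \<subseteq> V \<inter> Ok k \<and> {x. h k S x \<noteq> 0} \<subseteq> Z)) \<and>
    (\<forall>S\<in>\<S> k. \<forall>S'\<in>\<S> k. S \<noteq> S' \<longrightarrow> card S = card S' \<longrightarrow> (\<forall>x. h k S x = 0 \<or> h k S' x = 0)) \<and>
    (\<forall>x\<in>K k. \<exists>S\<in>\<S> k. h k S x \<noteq> 0)"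
    unfolding choice_iff by (elim exE) (rule that)
  have fin: "finite (\<S> k)" for k using \<S>[rule_format, of k] by simp
  have sm: "smooth_fun_on M (mset M) (h k S)" "card S \<le> packing_number TYPE('b)"
    "\<exists>V\<in>\<V>. \<exists>Z. closedin (mtop M) Z \<and> Z \<subseteq> V \<inter> Ok k \<and> {x. h k S x \<noteq> 0} \<subseteq> Z" if "S \<in> \<S> k" for k S
    using \<S>[rule_format, of k] that by simp_all
  have disj: "S = S'" if "S \<in> \<S> k" "S' \<in> \<S> k" "card S = card S'" "h k S x \<noteq> 0" "h k S' x \<noteq> 0" for k S S' x
    using \<S>[rule_format, of k] that by blast
  have cover: "\<exists>S\<in>\<S> k. h k S x \<noteq> 0" if "x \<in> K k" for k x using \<S>[rule_format, of k] that by simp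
  have inO: "x \<in> Ok k" if "S \<in> \<S> k" "h k S x \<noteq> 0" for k S x using sm(3)[OF that(1)] that(2) by blast
  define I where "I = {(k, S). S \<in> \<S> k}"
  define g where "g = (\<lambda>(k, S). h k S)"
  define col where "col = (\<lambda>(k::nat, S::'m set). (k mod 3, card S))"
  have "\<forall>s\<in>I. \<exists>V. V \<in> \<V> \<and> (\<exists>Z. closedin (mtop M) Z \<and> Z \<subseteq> V \<and> {x. g s x \<noteq> 0} \<subseteq> Z)"
    using sm(3) unfolding I_def g_def by fastforce
  then obtain V where V: "\<And>s. s \<in> I \<Longrightarrow> V s \<in> \<V>"
    "\<And>s. s \<in> I \<Longrightarrow> \<exists>Z. closedin (mtop M) Z \<and> Z \<subseteq> V s \<and> {x. g s x \<noteq> 0} \<subseteq> Z" by metis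
  have Ok_disj: "\<not> (x \<in> Ok k \<and> x \<in> Ok l)" if "k + 3 \<le> l" for k l x
  proof
    assume x: "x \<in> Ok k \<and> x \<in> Ok l"
    then have "x \<in> E (Suc (Suc k))" using interior_of_subset[of "mtop M" "E (Suc (Suc k))"] by (auto simp: Ok_def)
    moreover have "Suc (Suc k) \<le> l - 1" using that by arith
    ultimately have "x \<in> E (l - 1)" by (rule subsetD[OF E_mono, rotated])
    then show False using x by (simp add: Ok_def)
  qed
  show thesis
  proof (rule that[of col I g V])
    have "col ` I \<subseteq> {..<3} \<times> {..packing_number TYPE('b)}" using sm(2) by (auto simp: col_def I_def)
    then show "finite (col ` I)" by (rule finite_subset) simp
    show "smooth_fun_on M (mset M) (g s)" if "s \<in> I" for s using that sm(1) by (auto simp: I_def g_def)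
    show "s = s'" if s: "s \<in> I" "s' \<in> I" "col s = col s'" "g s x \<noteq> 0" "g s' x \<noteq> 0" for s s' x
    proof -
      obtain k S l S' where ks: "s = (k, S)" "s' = (l, S')" by (cases s, cases s')
      have mem: "S \<in> \<S> k" "S' \<in> \<S> l" "h k S x \<noteq> 0" "h l S' x \<noteq> 0" "k mod 3 = l mod 3" "card S = card S'"
        using s ks by (auto simp: I_def g_def col_def)
      have "x \<in> Ok k" "x \<in> Ok l" using inO mem by blast+
      \<comment> \<open>Shells that meet have index distance less than 3, and with equal residues
        modulo 3 they coincide.\<close>
      then have "\<not> k + 3 \<le> l" "\<not> l + 3 \<le> k" using Ok_disj by blast+
      then have "k = l" using mem(5) by presburger
      then show ?thesis using disj[of S k S' x] mem ks by simp
    qed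
    show "\<exists>s\<in>I. g s x \<noteq> 0" if x: "x \<in> mset M" for x
    proof -
      have "\<exists>n. x \<in> E n" using E(4) x by blast
      \<comment> \<open>The first stage containing \<open>x\<close>. It is not 0 because
        \<open>E 0\<close> is empty, so \<open>x\<close> lies in the shell with index
        \<open>n - 1\<close>.\<close>
      define n where "n = (LEAST n. x \<in> E n)"
      have n: "x \<in> E n" "\<And>m. m < n \<Longrightarrow> x \<notin> E m"
        unfolding n_def by (rule LeastI_ex[OF \<open>\<exists>n. x \<in> E n\<close>], rule not_less_Least)
      obtain k where k: "n = Suc k" using n(1) E(1) by (cases n) auto
      have "x \<in> K k" using n k interior_of_subset[of "mtop M" "E k"] by (auto simp: K_def)
      then obtain S where "S \<in> \<S> k" "h k S x \<noteq> 0" using cover by blast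
      then show ?thesis by (intro bexI[of _ "(k, S)"]) (auto simp: I_def g_def)
    qed
    show "\<exists>W. openin (mtop M) W \<and> x \<in> W \<and> finite {s \<in> I. \<exists>y\<in>W. g s y \<noteq> 0}" if x: "x \<in> mset M" for x
    proof -
      obtain n where n: "x \<in> E n" using E(4) x by blast
      \<comment> \<open>Functions of shell \<open>k\<close> vanish on \<open>E (k - 1)\<close>, so
        only shells up to \<open>Suc n\<close> are active on the interior of
        \<open>E (Suc n)\<close>.\<close>
      have "{s \<in> I. \<exists>y\<in>?int (Suc n). g s y \<noteq> 0} \<subseteq> (\<Union>k\<in>{..Suc n}. Pair k ` \<S> k)"
      proof
        fix s assume "s \<in> {s \<in> I. \<exists>y\<in>?int (Suc n). g s y \<noteq> 0}"
        then obtain k S y where s: "s = (k, S)" "S \<in> \<S> k" "y \<in> ?int (Suc n)" "h k S y \<noteq> 0"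
          by (auto simp: I_def g_def)
        have "y \<in> E (Suc n)" using s(3) interior_of_subset[of "mtop M" "E (Suc n)"] by blast
        moreover have "y \<notin> E (k - 1)" using inO[OF s(2,4)] by (simp add: Ok_def)
        ultimately have "\<not> Suc n \<le> k - 1" using E_mono by blast
        then show "s \<in> (\<Union>k\<in>{..Suc n}. Pair k ` \<S> k)" using s(1,2) by auto
      qed
      moreover have "finite (\<Union>k\<in>{..Suc n}. Pair k ` \<S> k)" using fin by auto
      ultimately have "finite {s \<in> I. \<exists>y\<in>?int (Suc n). g s y \<noteq> 0}" by (rule finite_subset)
      then show ?thesis using n E(3)[of n] by (intro exI[of _ "?int (Suc n)"]) auto
    qed
  qed (use V in auto)
qed

end

section \<open>Sections of vector bundles\<close>

lemma coord_space_simps [simp]: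
  "carrier (coord_space I) = {v. \<forall>i. i \<notin> I \<longrightarrow> v i = 0}" "zero (coord_space I) = (\<lambda>_. 0)"
  "add (coord_space I) v w = (\<lambda>i. v i + w i)" "smult (coord_space I) c v = (\<lambda>i. c * v i)"
  by (simp_all add: coord_space_def)

lemma abelian_group_type_algebra: "abelian_group (ring_of_type_algebra :: 'k::comm_ring_1 ring)"
  using cring_from_type_algebra[where ?'a = 'k] by (simp add: cring_def ring_def)

lemma finsum_type_algebra:
  fixes f :: "'i \<Rightarrow> 'k::comm_ring_1"
  shows "finite I \<Longrightarrow> finsum ring_of_type_algebra f I = sum f I"
proof (induction I rule: finite_induct)
  case (insert i I)
  then show ?case
    using abelian_monoid.finsum_insert[OF abelian_group.axioms(1)[OF abelian_group_type_algebra[where ?'k = 'k]], of I i f]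
    by simp
qed (simp add: abelian_monoid.finsum_empty[OF abelian_group.axioms(1)[OF abelian_group_type_algebra]])

section \<open>Linear functionals on tensor products over the field\<close>

definition linear_functional :: "('k::comm_ring_1, 'e, 'z) module_scheme \<Rightarrow> ('e \<Rightarrow> 'k) \<Rightarrow> bool" where
  "linear_functional V f \<longleftrightarrow> (\<forall>x\<in>carrier V. \<forall>y\<in>carrier V. f (x \<oplus>\<^bsub>V\<^esub> y) = f x + f y) \<and>
    (\<forall>c. \<forall>x\<in>carrier V. f (c \<odot>\<^bsub>V\<^esub> x) = c * f x)"

lemma linear_functionalD:
  assumes "linear_functional V f"
  shows "x \<in> carrier V \<Longrightarrow> y \<in> carrier V \<Longrightarrow> f (x \<oplus>\<^bsub>V\<^esub> y) = f x + f y"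
    "x \<in> carrier V \<Longrightarrow> f (c \<odot>\<^bsub>V\<^esub> x) = c * f x"
    "additive_map V ring_of_type_algebra f"
  using assms by (simp_all add: linear_functional_def additive_map_def)

lemma linear_functional_finsum:
  assumes "abelian_group V" "linear_functional V f" "finite I" "\<And>i. i \<in> I \<Longrightarrow> x i \<in> carrier V"
  shows "f (\<Oplus>\<^bsub>V\<^esub>i\<in>I. x i) = (\<Sum>i\<in>I. f (x i))"
  using additive_map_finsum[OF assms(1) abelian_group_type_algebra linear_functionalD(3)[OF assms(2)] assms(3), of x]
    assms(3,4) finsum_type_algebra by (simp add: Pi_iff)

text \<open>The field as a module over itself: the universal property maps into module records,
  while \<open>ring_of_type_algebra\<close> is a ring record.\<close>

definition scalar_module :: "('k::comm_ring_1, 'k) module" where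
  "scalar_module = \<lparr>carrier = UNIV, mult = undefined, one = undefined, zero = 0, add = (+), smult = (*)\<rparr>"

lemma module_scalar_module: "module ring_of_type_algebra (scalar_module :: ('k::comm_ring_1, 'k) module)"
proof (rule moduleI)
  show "abelian_group (scalar_module :: ('k, 'k) module)"
    by (rule abelian_group_cong[OF abelian_group_type_algebra])
      (simp_all add: scalar_module_def ring_of_type_algebra_def)
qed (auto simp: scalar_module_def algebra_simps)

lemma linear_functional_iff_hom:
  "linear_functional V f \<longleftrightarrow> f \<in> module_hom ring_of_type_algebra V scalar_module"
  by (auto simp: linear_functional_def module_hom_def scalar_module_def)

text \<open>The functional \<omega> \<otimes> \<rho>. The body repeats the expression in the
  trivialisations of \<open>tensor_bundle\<close>, so these consist of tensor functionals by mere
  unfolding.\<close>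

definition tensor_functional ::
  "('k::{real_normed_field,euclidean_space}, 'e) module \<Rightarrow> ('k, 'f) module \<Rightarrow> ('e \<Rightarrow> 'k) \<Rightarrow> ('f \<Rightarrow> 'k) \<Rightarrow>
    ('e \<times> 'f \<Rightarrow> 'k) set \<Rightarrow> 'k" where
  "tensor_functional V W \<omega> \<rho> =
    tensor_extend ring_of_type_algebra V W ring_of_type_algebra (\<lambda>e f. \<omega> e * \<rho> f)"

lemma tensor_functional:
  fixes V :: "('k::{real_normed_field,euclidean_space}, 'e) module" and W :: "('k, 'f) module"
  assumes V: "module ring_of_type_algebra V" and W: "module ring_of_type_algebra W"
    and \<omega>: "linear_functional V \<omega>" and \<rho>: "linear_functional W \<rho>"
  shows "linear_functional (tensor_module ring_of_type_algebra V W) (tensor_functional V W \<omega> \<rho>)"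
    and "e \<in> carrier V \<Longrightarrow> f \<in> carrier W \<Longrightarrow>
      tensor_functional V W \<omega> \<rho> (pure_tensor ring_of_type_algebra V W e f) = \<omega> e * \<rho> f"
proof -
  let ?K = "ring_of_type_algebra :: 'k ring"
  interpret VV: module ?K V by (rule V)
  interpret T: module ?K "tensor_module ?K V W" by (rule module_tensor_module[OF V W])
  note w = linear_functionalD[OF \<omega>] and r = linear_functionalD[OF \<rho>]
  have "bilinear_map ?K V W scalar_module (\<lambda>e f. \<omega> e * \<rho> f)"
    unfolding bilinear_map_def linear_functional_iff_hom[symmetric] linear_functional_def
    using w(1,2) r(1,2) by (simp add: algebra_simps)
  then obtain h where h: "h \<in> module_hom ?K (tensor_module ?K V W) scalar_module"
    "\<And>e f. e \<in> carrier V \<Longrightarrow> f \<in> carrier W \<Longrightarrow> h (pure_tensor ?K V W e f) = \<omega> e * \<rho> f"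
    by (rule tensor_lift[OF V W module_scalar_module]) (rule that)
  have hl: "linear_functional (tensor_module ?K V W) h" using h(1) by (simp add: linear_functional_iff_hom)
  have eq: "tensor_functional V W \<omega> \<rho> u = h u" if "u \<in> carrier (tensor_module ?K V W)" for u
    unfolding tensor_functional_def
    by (rule tensor_extend_eq[OF V W abelian_group_type_algebra linear_functionalD(3)[OF hl] h(2) that])
  show "linear_functional (tensor_module ?K V W) (tensor_functional V W \<omega> \<rho>)"
    using eq linear_functionalD(1,2)[OF hl] T.M.a_closed
    unfolding linear_functional_def by simp
  show "tensor_functional V W \<omega> \<rho> (pure_tensor ?K V W e f) = \<omega> e * \<rho> f"
    if "e \<in> carrier V" "f \<in> carrier W"
    using eq[OF pure_tensor_carrier[OF VV.is_cring that]] h(2)[OF that] by simp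
qed

section \<open>The ring of smooth functions\<close>

context smooth_mfd begin

abbreviation fun_ring :: "('m \<Rightarrow> 'k::real_normed_field) ring" where "fun_ring \<equiv> smooth_ring M"

lemma smooth_ring_simps [simp]:
  "mult fun_ring f g = (\<lambda>x\<in>mset M. f x * g x)" "one fun_ring = (\<lambda>x\<in>mset M. 1)"
  "zero fun_ring = (\<lambda>x\<in>mset M. 0)" "add fun_ring f g = (\<lambda>x\<in>mset M. f x + g x)"
  by (simp_all add: smooth_ring_def)

lemma smooth_ring_carrier:
  "f \<in> carrier fun_ring \<longleftrightarrow> f \<in> extensional (mset M) \<and> smooth_fun_on M (mset M) f"
  by (simp add: smooth_ring_def)

lemma smooth_ring_restrictI:
  assumes "smooth_fun_on M (mset M) f"
  shows "(\<lambda>x\<in>mset M. f x) \<in> carrier fun_ring"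
  using smooth_fun_on_cong[OF openin_topspace _ assms, of "\<lambda>x\<in>mset M. f x"] by (simp add: smooth_ring_carrier)

lemma extensional_eqI:
  assumes "f \<in> extensional S" "g \<in> extensional S" "\<And>x. x \<in> S \<Longrightarrow> f x = g x"
  shows "f = g"
  by (rule extensionalityI[OF assms])

lemma cring_smooth_ring: "cring (fun_ring :: ('m \<Rightarrow> 'k::real_normed_field) ring)"
proof -
  have ext: "f \<in> extensional (mset M)" and sm: "smooth_fun_on M (mset M) f"
    if "f \<in> carrier fun_ring" for f :: "'m \<Rightarrow> 'k" using that by (simp_all add: smooth_ring_carrier)
  note eqI = extensional_eqI[of _ "mset M"]
  show ?thesis
  proof (rule cringI)
    show "abelian_group (fun_ring :: ('m \<Rightarrow> 'k) ring)"
    proof (rule abelian_groupI)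
      fix f g h :: "'m \<Rightarrow> 'k" assume f: "f \<in> carrier fun_ring" and g: "g \<in> carrier fun_ring"
        and h: "h \<in> carrier fun_ring"
      show "f \<oplus>\<^bsub>fun_ring\<^esub> g \<in> carrier fun_ring"
        using smooth_ring_restrictI[OF smooth_fun_on_add[OF openin_topspace sm[OF f] sm[OF g]]] by simp
      show "f \<oplus>\<^bsub>fun_ring\<^esub> g \<oplus>\<^bsub>fun_ring\<^esub> h = f \<oplus>\<^bsub>fun_ring\<^esub> (g \<oplus>\<^bsub>fun_ring\<^esub> h)"
        "f \<oplus>\<^bsub>fun_ring\<^esub> g = g \<oplus>\<^bsub>fun_ring\<^esub> f" "\<zero>\<^bsub>fun_ring\<^esub> \<oplus>\<^bsub>fun_ring\<^esub> f = f"
        by (rule eqI; use ext[OF f] in \<open>simp add: algebra_simps\<close>)+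
      have "(\<lambda>x\<in>mset M. - f x) \<in> carrier fun_ring"
        by (intro smooth_ring_restrictI smooth_fun_on_bounded_linear[OF openin_topspace
              bounded_linear_minus[OF bounded_linear_ident]] sm f)
      then show "\<exists>g\<in>carrier fun_ring. g \<oplus>\<^bsub>fun_ring\<^esub> f = \<zero>\<^bsub>fun_ring\<^esub>"
        by (rule rev_bexI) (auto intro!: restrict_ext)
    next
      show "\<zero>\<^bsub>fun_ring\<^esub> \<in> carrier (fun_ring :: ('m \<Rightarrow> 'k) ring)"
        using smooth_ring_restrictI[OF smooth_fun_on_const[of _ 0]] by simp
    qed
    show "Group.comm_monoid (fun_ring :: ('m \<Rightarrow> 'k) ring)"
    proof (rule comm_monoidI)
      fix f g h :: "'m \<Rightarrow> 'k" assume f: "f \<in> carrier fun_ring" and g: "g \<in> carrier fun_ring"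
        and h: "h \<in> carrier fun_ring"
      show "f \<otimes>\<^bsub>fun_ring\<^esub> g \<in> carrier fun_ring"
        using smooth_ring_restrictI[OF smooth_fun_on_mult[OF openin_topspace sm[OF f] sm[OF g]]] by simp
      show "f \<otimes>\<^bsub>fun_ring\<^esub> g \<otimes>\<^bsub>fun_ring\<^esub> h = f \<otimes>\<^bsub>fun_ring\<^esub> (g \<otimes>\<^bsub>fun_ring\<^esub> h)"
        "f \<otimes>\<^bsub>fun_ring\<^esub> g = g \<otimes>\<^bsub>fun_ring\<^esub> f" "\<one>\<^bsub>fun_ring\<^esub> \<otimes>\<^bsub>fun_ring\<^esub> f = f"
        by (rule eqI; use ext[OF f] in \<open>simp add: algebra_simps\<close>)+
    next
      show "\<one>\<^bsub>fun_ring\<^esub> \<in> carrier (fun_ring :: ('m \<Rightarrow> 'k) ring)"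
        using smooth_ring_restrictI[OF smooth_fun_on_const[of _ 1]] by simp
    qed
    fix f g h :: "'m \<Rightarrow> 'k"
    show "(f \<oplus>\<^bsub>fun_ring\<^esub> g) \<otimes>\<^bsub>fun_ring\<^esub> h = f \<otimes>\<^bsub>fun_ring\<^esub> h \<oplus>\<^bsub>fun_ring\<^esub> g \<otimes>\<^bsub>fun_ring\<^esub> h"
      by (rule eqI; simp add: algebra_simps)
  qed
qed

lemma scalar_algebra_smooth_ring:
  "scalar_algebra (fun_ring :: ('m \<Rightarrow> 'k::{real_normed_field,euclidean_space}) ring) (const_fun M)"
  by (rule scalar_algebra.intro)
    (auto simp: const_fun_def intro!: cring_smooth_ring smooth_ring_restrictI smooth_fun_on_const restrict_ext)

text \<open>The product is smooth on \<open>V \<inter> W\<close> and vanishes on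
  \<open>W - Z\<close>; these open sets cover \<open>W\<close> because
  \<open>Z \<subseteq> V\<close>. Outside \<open>V\<close> the function \<open>h\<close> is
  arbitrary, as coordinates are outside a trivialising set.\<close>

lemma smooth_fun_on_cutoff:
  fixes g :: "'m \<Rightarrow> real" and h :: "'m \<Rightarrow> 'k::real_normed_field"
  assumes g: "smooth_fun_on M (mset M) g" and V: "openin (mtop M) V" and W: "openin (mtop M) W"
    and Z: "closedin (mtop M) Z" "Z \<subseteq> V" "{x. g x \<noteq> 0} \<subseteq> Z" and h: "smooth_fun_on M (V \<inter> W) h"
  shows "smooth_fun_on M W (\<lambda>x. of_real (g x) * h x)"
proof (rule smooth_fun_on_local)
  fix x assume x: "x \<in> W"
  show "\<exists>W'. x \<in> W' \<and> smooth_fun_on M W' (\<lambda>x. of_real (g x) * h x)"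
  proof (cases "x \<in> V")
    case True
    have VW: "openin (mtop M) (V \<inter> W)" by (rule openin_Int[OF V W])
    have "smooth_fun_on M (V \<inter> W) (\<lambda>x. of_real (g x) * h x)"
      using openin_subset[OF VW]
      by (intro smooth_fun_on_mult smooth_fun_on_bounded_linear[OF _ bounded_linear_of_real] VW h
          smooth_fun_on_subset[OF g])
    then show ?thesis using True x by blast
  next
    case False
    have o: "openin (mtop M) (W - Z)" by (rule openin_diff[OF W Z(1)])
    have "smooth_fun_on M (W - Z) (\<lambda>x. of_real (g x) * h x)"
      by (rule smooth_fun_on_zero[OF o]) (use Z(3) in auto)
    then show ?thesis using False x Z(2) by blast
  qed
qed

end

section \<open>Local frames and the module of smooth sections\<close>

locale smooth_bundle = smooth_mfd M for M :: "('m, 'b::{real_inner,heine_borel}) manifold" +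
  fixes E :: "('m, 'k::{real_normed_field,euclidean_space}, 'e, 'i) vbundle"
  assumes vb: "vector_bundle M E"
begin

abbreviation "K \<equiv> ring_of_type_algebra :: 'k ring"
abbreviation "\<Gamma> \<equiv> section_module M E"

lemma finite_index: "finite (index E)"
  using vb by (simp add: vector_bundle_def)

lemma triv_cover: "x \<in> mset M \<Longrightarrow> \<exists>V \<tau>. (V, \<tau>) \<in> trivs E \<and> x \<in> V"
proof -
  assume "x \<in> mset M"
  then have "x \<in> (\<Union>(V, \<tau>)\<in>trivs E. V)" using vb by (simp add: vector_bundle_def)
  then show ?thesis by fast
qed

lemma triv:
  assumes "(V, \<tau>) \<in> trivs E"
  shows "openin (mtop M) V" "x \<in> V \<Longrightarrow> module_iso K (fiber E x) (coord_space (index E)) (\<tau> x)"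
  using assms vb unfolding vector_bundle_def by fast+

lemma triv_subset: "(V, \<tau>) \<in> trivs E \<Longrightarrow> V \<subseteq> mset M"
  using openin_subset[OF triv(1)] .

lemma fiber_module: "x \<in> mset M \<Longrightarrow> module K (fiber E x)"
  using triv_cover triv(2) unfolding module_iso_def by fast

lemma fiber_group: "x \<in> mset M \<Longrightarrow> abelian_group (fiber E x)"
  using module.axioms(2)[OF fiber_module] .

context
  fixes V \<tau> x assumes V: "(V, \<tau>) \<in> trivs E" and x: "x \<in> V"
begin

lemma triv_hom: "\<tau> x \<in> module_hom K (fiber E x) (coord_space (index E))"
  and triv_bij: "bij_betw (\<tau> x) (carrier (fiber E x)) (carrier (coord_space (index E)))"
  using triv(2)[OF V x] by (auto simp: module_iso_def)

lemma triv_functional: "linear_functional (fiber E x) (\<lambda>e. \<tau> x e i)"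
  unfolding linear_functional_def using module_homD(3,4)[OF triv_hom] by simp

lemma triv_outside: "e \<in> carrier (fiber E x) \<Longrightarrow> i \<notin> index E \<Longrightarrow> \<tau> x e i = 0"
  using module_homD(2)[OF triv_hom] by simp

lemma triv_eqI:
  assumes "e \<in> carrier (fiber E x)" "f \<in> carrier (fiber E x)" "\<And>i. i \<in> index E \<Longrightarrow> \<tau> x e i = \<tau> x f i"
  shows "e = f"
proof -
  have "\<tau> x e = \<tau> x f"
  proof
    show "\<tau> x e i = \<tau> x f i" for i using assms triv_outside by (cases "i \<in> index E") auto
  qed
  then show ?thesis using bij_betw_imp_inj_on[OF triv_bij] assms(1,2) by (meson inj_onD)
qed

end

text \<open>The preimage of a standard basis vector, written as in the transition condition of
  \<open>vector_bundle\<close>, which thereby states smoothness of one frame in the coordinates of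
  another.\<close>

definition local_frame :: "('m \<Rightarrow> 'e \<Rightarrow> 'i \<Rightarrow> 'k) \<Rightarrow> 'm \<Rightarrow> 'i \<Rightarrow> 'e" where
  "local_frame \<tau> x a = inv_into (carrier (fiber E x)) (\<tau> x) (\<lambda>l. if l = a then 1 else 0)"

lemma local_frame:
  assumes "(V, \<tau>) \<in> trivs E" "x \<in> V" "a \<in> index E"
  shows "local_frame \<tau> x a \<in> carrier (fiber E x)" "\<tau> x (local_frame \<tau> x a) = (\<lambda>l. if l = a then 1 else 0)"
proof -
  have "(\<lambda>l. if l = a then 1 else 0) \<in> \<tau> x ` carrier (fiber E x)"
    using bij_betw_imp_surj_on[OF triv_bij[OF assms(1,2)]] assms(3) by auto
  then show "local_frame \<tau> x a \<in> carrier (fiber E x)" "\<tau> x (local_frame \<tau> x a) = (\<lambda>l. if l = a then 1 else 0)"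
    unfolding local_frame_def by (rule inv_into_into, rule f_inv_into_f)
qed

lemma transition_smooth:
  assumes "(V, \<tau>) \<in> trivs E" "(W, \<sigma>) \<in> trivs E" "i \<in> index E" "j \<in> index E"
  shows "smooth_fun_on M (V \<inter> W) (\<lambda>x. \<sigma> x (local_frame \<tau> x j) i)"
  using assms vb unfolding vector_bundle_def local_frame_def by fast

lemma frame_expand:
  assumes V: "(V, \<tau>) \<in> trivs E" "x \<in> V" and e: "e \<in> carrier (fiber E x)"
  shows "e = (\<Oplus>\<^bsub>fiber E x\<^esub>a\<in>index E. \<tau> x e a \<odot>\<^bsub>fiber E x\<^esub> local_frame \<tau> x a)"
proof -
  interpret F: module K "fiber E x" using fiber_module triv_subset V by blast
  have car: "\<tau> x e a \<odot>\<^bsub>fiber E x\<^esub> local_frame \<tau> x a \<in> carrier (fiber E x)" if "a \<in> index E" for a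
    using local_frame(1)[OF V that] by simp
  show ?thesis
  proof (rule triv_eqI[OF V e])
    show "(\<Oplus>\<^bsub>fiber E x\<^esub>a\<in>index E. \<tau> x e a \<odot>\<^bsub>fiber E x\<^esub> local_frame \<tau> x a) \<in> carrier (fiber E x)"
      using car by (auto intro!: F.M.finsum_closed)
    fix i assume i: "i \<in> index E"
    have "\<tau> x (\<Oplus>\<^bsub>fiber E x\<^esub>a\<in>index E. \<tau> x e a \<odot>\<^bsub>fiber E x\<^esub> local_frame \<tau> x a) i =
        (\<Sum>a\<in>index E. \<tau> x (\<tau> x e a \<odot>\<^bsub>fiber E x\<^esub> local_frame \<tau> x a) i)"
      by (rule linear_functional_finsum[OF F.M.abelian_group_axioms triv_functional[OF V] finite_index car])
    also have "\<dots> = (\<Sum>a\<in>index E. if i = a then \<tau> x e a else 0)"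
      by (rule sum.cong[OF refl])
        (simp add: linear_functionalD(2)[OF triv_functional[OF V]] local_frame[OF V])
    also have "\<dots> = \<tau> x e i" using i finite_index by simp
    finally show "\<tau> x e i = \<tau> x (\<Oplus>\<^bsub>fiber E x\<^esub>a\<in>index E. \<tau> x e a \<odot>\<^bsub>fiber E x\<^esub> local_frame \<tau> x a) i"
      by simp
  qed
qed

text \<open>Pairing the frame expansion with a functional replaces sums in varying fibers by sums of
  scalars, to which smoothness and convergence arguments apply.\<close>

lemma functional_expand:
  assumes V: "(V, \<tau>) \<in> trivs E" "x \<in> V" and e: "e \<in> carrier (fiber E x)"
    and f: "linear_functional (fiber E x) f"
  shows "f e = (\<Sum>a\<in>index E. \<tau> x e a * f (local_frame \<tau> x a))"
proof -
  interpret F: module K "fiber E x" using fiber_module triv_subset V by blast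
  have car: "\<tau> x e a \<odot>\<^bsub>fiber E x\<^esub> local_frame \<tau> x a \<in> carrier (fiber E x)" if "a \<in> index E" for a
    using local_frame(1)[OF V that] by simp
  have "f e = f (\<Oplus>\<^bsub>fiber E x\<^esub>a\<in>index E. \<tau> x e a \<odot>\<^bsub>fiber E x\<^esub> local_frame \<tau> x a)"
    using frame_expand[OF V e] by simp
  also have "\<dots> = (\<Sum>a\<in>index E. f (\<tau> x e a \<odot>\<^bsub>fiber E x\<^esub> local_frame \<tau> x a))"
    by (rule linear_functional_finsum[OF F.M.abelian_group_axioms f finite_index car])
  also have "\<dots> = (\<Sum>a\<in>index E. \<tau> x e a * f (local_frame \<tau> x a))"
    by (rule sum.cong[OF refl]) (simp add: linear_functionalD(2)[OF f] local_frame[OF V])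
  finally show ?thesis .
qed

lemma local_rep_chart:
  assumes "(U, \<phi>) \<in> atlas M" "y \<in> \<phi> ` (U \<inter> V)"
  shows "local_rep U \<phi> V \<tau> s y i = ((\<lambda>x. \<tau> x (s x) i) \<circ> inv_into U \<phi>) y"
  using assms(2) by (simp add: local_rep_def)

text \<open>Absorbing the charts into \<open>smooth_fun_on\<close> leaves one condition for each
  trivialisation and coordinate, so the calculus of smooth functions on open subsets of
  \<open>M\<close> takes over.\<close>

lemma smooth_sections_iff:
  "s \<in> smooth_sections M E \<longleftrightarrow> s \<in> (\<Pi>\<^sub>E x\<in>mset M. carrier (fiber E x)) \<and>
    (\<forall>V \<tau> i. (V, \<tau>) \<in> trivs E \<longrightarrow> i \<in> index E \<longrightarrow> smooth_fun_on M V (\<lambda>x. \<tau> x (s x) i))"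
proof -
  have "local_rep U \<phi> V \<tau> s \<in> smooth_maps (\<phi> ` (U \<inter> V)) (index E) \<longleftrightarrow>
      (\<forall>i\<in>index E. smooth_on (\<phi> ` (U \<inter> V)) ((\<lambda>x. \<tau> x (s x) i) \<circ> inv_into U \<phi>))"
    if c: "(U, \<phi>) \<in> atlas M" and V: "(V, \<tau>) \<in> trivs E" and s: "s \<in> (\<Pi>\<^sub>E x\<in>mset M. carrier (fiber E x))"
    for U \<phi> V \<tau>
  proof -
    have "local_rep U \<phi> V \<tau> s \<in> \<phi> ` (U \<inter> V) \<rightarrow>\<^sub>E carrier (coord_space (index E))"
    proof
      fix y assume "y \<in> \<phi> ` (U \<inter> V)"
      then obtain x where x: "x \<in> U" "x \<in> V" "y = \<phi> x" by auto
      have "s x \<in> carrier (fiber E x)" using s x(2) triv_subset[OF V] by auto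
      then have "\<tau> x (s x) \<in> carrier (coord_space (index E))"
        by (rule module_homD(2)[OF triv_hom[OF V x(2)]])
      then show "local_rep U \<phi> V \<tau> s y \<in> carrier (coord_space (index E))"
        using x chart_inv[OF c x(1)] by (auto simp: local_rep_def)
    qed (simp add: local_rep_def)
    moreover have "smooth_on (\<phi> ` (U \<inter> V)) (\<lambda>y. local_rep U \<phi> V \<tau> s y i) \<longleftrightarrow>
        smooth_on (\<phi> ` (U \<inter> V)) ((\<lambda>x. \<tau> x (s x) i) \<circ> inv_into U \<phi>)" for i
      by (rule smooth_on_cong[OF open_chart_image[OF c triv(1)[OF V]] local_rep_chart[OF c]])
    ultimately show ?thesis by (simp add: smooth_maps_def)
  qed
  then show ?thesis
    unfolding smooth_sections_def smooth_fun_on_def by fast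
qed

lemma sectionD:
  assumes "s \<in> smooth_sections M E"
  shows "x \<in> mset M \<Longrightarrow> s x \<in> carrier (fiber E x)" "s \<in> extensional (mset M)"
    "(V, \<tau>) \<in> trivs E \<Longrightarrow> i \<in> index E \<Longrightarrow> smooth_fun_on M V (\<lambda>x. \<tau> x (s x) i)"
  using assms by (auto simp: smooth_sections_iff PiE_def)

lemma sectionI:
  assumes "\<And>x. x \<in> mset M \<Longrightarrow> s x \<in> carrier (fiber E x)" "s \<in> extensional (mset M)"
    "\<And>V \<tau> i. (V, \<tau>) \<in> trivs E \<Longrightarrow> i \<in> index E \<Longrightarrow> smooth_fun_on M V (\<lambda>x. \<tau> x (s x) i)"
  shows "s \<in> smooth_sections M E"
  using assms by (auto simp: smooth_sections_iff PiE_def)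

lemma section_module_simps [simp]:
  "carrier \<Gamma> = smooth_sections M E" "zero \<Gamma> = (\<lambda>x\<in>mset M. \<zero>\<^bsub>fiber E x\<^esub>)"
  "add \<Gamma> s t = (\<lambda>x\<in>mset M. s x \<oplus>\<^bsub>fiber E x\<^esub> t x)"
  "smult \<Gamma> f s = (\<lambda>x\<in>mset M. f x \<odot>\<^bsub>fiber E x\<^esub> s x)"
  by (simp_all add: section_module_def)

lemma section_add:
  assumes s: "s \<in> smooth_sections M E" and t: "t \<in> smooth_sections M E"
  shows "(\<lambda>x\<in>mset M. s x \<oplus>\<^bsub>fiber E x\<^esub> t x) \<in> smooth_sections M E"
proof (rule sectionI)
  fix x assume x: "x \<in> mset M"
  interpret F: module K "fiber E x" by (rule fiber_module[OF x])
  show "(\<lambda>x\<in>mset M. s x \<oplus>\<^bsub>fiber E x\<^esub> t x) x \<in> carrier (fiber E x)"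
    using x sectionD(1)[OF s x] sectionD(1)[OF t x] by simp
next
  fix V \<tau> i assume V: "(V, \<tau>) \<in> trivs E" and i: "i \<in> index E"
  have "smooth_fun_on M V (\<lambda>x. \<tau> x (s x) i + \<tau> x (t x) i)"
    by (intro smooth_fun_on_add triv(1)[OF V] sectionD(3)[OF s V i] sectionD(3)[OF t V i])
  then show "smooth_fun_on M V (\<lambda>x. \<tau> x ((\<lambda>x\<in>mset M. s x \<oplus>\<^bsub>fiber E x\<^esub> t x) x) i)"
  proof (rule smooth_fun_on_cong[OF triv(1)[OF V], rotated])
    fix x assume x: "x \<in> V"
    then have xM: "x \<in> mset M" using triv_subset[OF V] by blast
    show "\<tau> x (s x) i + \<tau> x (t x) i = \<tau> x ((\<lambda>x\<in>mset M. s x \<oplus>\<^bsub>fiber E x\<^esub> t x) x) i"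
      using linear_functionalD(1)[OF triv_functional[OF V x] sectionD(1)[OF s xM] sectionD(1)[OF t xM]] xM by simp
  qed
qed simp

lemma section_smult:
  assumes f: "smooth_fun_on M (mset M) f" and s: "s \<in> smooth_sections M E"
  shows "(\<lambda>x\<in>mset M. f x \<odot>\<^bsub>fiber E x\<^esub> s x) \<in> smooth_sections M E"
proof (rule sectionI)
  fix x assume x: "x \<in> mset M"
  interpret F: module K "fiber E x" by (rule fiber_module[OF x])
  show "(\<lambda>x\<in>mset M. f x \<odot>\<^bsub>fiber E x\<^esub> s x) x \<in> carrier (fiber E x)"
    using x sectionD(1)[OF s x] by simp
next
  fix V \<tau> i assume V: "(V, \<tau>) \<in> trivs E" and i: "i \<in> index E"
  have "smooth_fun_on M V (\<lambda>x. f x * \<tau> x (s x) i)"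
    by (intro smooth_fun_on_mult triv(1)[OF V] sectionD(3)[OF s V i] smooth_fun_on_subset[OF f triv_subset[OF V]])
  then show "smooth_fun_on M V (\<lambda>x. \<tau> x ((\<lambda>x\<in>mset M. f x \<odot>\<^bsub>fiber E x\<^esub> s x) x) i)"
  proof (rule smooth_fun_on_cong[OF triv(1)[OF V], rotated])
    fix x assume x: "x \<in> V"
    then have xM: "x \<in> mset M" using triv_subset[OF V] by blast
    show "f x * \<tau> x (s x) i = \<tau> x ((\<lambda>x\<in>mset M. f x \<odot>\<^bsub>fiber E x\<^esub> s x) x) i"
      using linear_functionalD(2)[OF triv_functional[OF V x] sectionD(1)[OF s xM]] xM by simp
  qed
qed simp

lemma section_zero: "(\<lambda>x\<in>mset M. \<zero>\<^bsub>fiber E x\<^esub>) \<in> smooth_sections M E"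
proof (rule sectionI)
  fix x assume x: "x \<in> mset M"
  interpret F: module K "fiber E x" by (rule fiber_module[OF x])
  show "(\<lambda>x\<in>mset M. \<zero>\<^bsub>fiber E x\<^esub>) x \<in> carrier (fiber E x)" using x by simp
next
  fix V \<tau> i assume V: "(V, \<tau>) \<in> trivs E" and i: "i \<in> index E"
  show "smooth_fun_on M V (\<lambda>x. \<tau> x ((\<lambda>x\<in>mset M. \<zero>\<^bsub>fiber E x\<^esub>) x) i)"
  proof (rule smooth_fun_on_zero[OF triv(1)[OF V]])
    fix x assume x: "x \<in> V"
    then have xM: "x \<in> mset M" using triv_subset[OF V] by blast
    interpret F: module K "fiber E x" by (rule fiber_module[OF xM])
    show "\<tau> x ((\<lambda>x\<in>mset M. \<zero>\<^bsub>fiber E x\<^esub>) x) i = 0"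
      using linear_functionalD(2)[OF triv_functional[OF V x, of i] F.M.zero_closed, of 0] xM by simp
  qed
qed simp

lemma module_section_module: "module fun_ring \<Gamma>"
proof (rule moduleI)
  note F = module.axioms(2)[OF fiber_module] module.smult_l_distr[OF fiber_module]
    module.smult_r_distr[OF fiber_module] module.smult_assoc1[OF fiber_module] module.smult_one[OF fiber_module]
  note ext = extensional_eqI[of _ "mset M"]
  show "cring (fun_ring :: ('m \<Rightarrow> 'k) ring)" by (rule cring_smooth_ring)
  show "abelian_group \<Gamma>"
  proof (rule abelian_groupI)
    fix s assume s: "s \<in> carrier \<Gamma>"
    let ?t = "\<lambda>x\<in>mset M. (- 1) \<odot>\<^bsub>fiber E x\<^esub> s x"
    have "?t \<in> carrier \<Gamma>" using section_smult[OF smooth_fun_on_const] s by simp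
    moreover have "?t \<oplus>\<^bsub>\<Gamma>\<^esub> s = \<zero>\<^bsub>\<Gamma>\<^esub>"
    proof (rule ext)
      fix x assume x: "x \<in> mset M"
      interpret F: module K "fiber E x" by (rule fiber_module[OF x])
      have "s x \<in> carrier (fiber E x)" using sectionD(1) s x by simp
      then show "(?t \<oplus>\<^bsub>\<Gamma>\<^esub> s) x = \<zero>\<^bsub>\<Gamma>\<^esub> x"
        using x F.smult_l_distr[of "-1" 1 "s x"] F.smult_one[of "s x"] F.smult_l_null[of "s x"] by simp
    qed simp_all
    ultimately show "\<exists>t\<in>carrier \<Gamma>. t \<oplus>\<^bsub>\<Gamma>\<^esub> s = \<zero>\<^bsub>\<Gamma>\<^esub>" by blast
  next
    fix s t u assume s: "s \<in> carrier \<Gamma>" and t: "t \<in> carrier \<Gamma>" and u: "u \<in> carrier \<Gamma>"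
    show "s \<oplus>\<^bsub>\<Gamma>\<^esub> t \<oplus>\<^bsub>\<Gamma>\<^esub> u = s \<oplus>\<^bsub>\<Gamma>\<^esub> (t \<oplus>\<^bsub>\<Gamma>\<^esub> u)"
    proof (rule ext)
      fix x assume x: "x \<in> mset M"
      interpret F: module K "fiber E x" by (rule fiber_module[OF x])
      show "(s \<oplus>\<^bsub>\<Gamma>\<^esub> t \<oplus>\<^bsub>\<Gamma>\<^esub> u) x = (s \<oplus>\<^bsub>\<Gamma>\<^esub> (t \<oplus>\<^bsub>\<Gamma>\<^esub> u)) x"
        using x s t u sectionD(1) by (simp add: F.M.a_assoc)
    qed simp_all
    show "s \<oplus>\<^bsub>\<Gamma>\<^esub> t = t \<oplus>\<^bsub>\<Gamma>\<^esub> s"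
    proof (rule ext)
      fix x assume x: "x \<in> mset M"
      interpret F: module K "fiber E x" by (rule fiber_module[OF x])
      show "(s \<oplus>\<^bsub>\<Gamma>\<^esub> t) x = (t \<oplus>\<^bsub>\<Gamma>\<^esub> s) x"
        using x s t sectionD(1) by (simp add: F.M.a_comm)
    qed simp_all
    show "\<zero>\<^bsub>\<Gamma>\<^esub> \<oplus>\<^bsub>\<Gamma>\<^esub> s = s"
    proof (rule ext)
      fix x assume x: "x \<in> mset M"
      interpret F: module K "fiber E x" by (rule fiber_module[OF x])
      show "(\<zero>\<^bsub>\<Gamma>\<^esub> \<oplus>\<^bsub>\<Gamma>\<^esub> s) x = s x"
        using x s sectionD(1) by simp
    qed (use s sectionD(2) in simp_all)
  qed (simp_all add: section_add section_zero)
next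
  fix f :: "'m \<Rightarrow> 'k" and s assume f: "f \<in> carrier fun_ring" and s: "s \<in> carrier \<Gamma>"
  then show "f \<odot>\<^bsub>\<Gamma>\<^esub> s \<in> carrier \<Gamma>" using section_smult by (simp add: smooth_ring_carrier)
next
  fix s assume s: "s \<in> carrier \<Gamma>"
  show "\<one>\<^bsub>fun_ring\<^esub> \<odot>\<^bsub>\<Gamma>\<^esub> s = s"
  proof (rule extensional_eqI[of _ "mset M"])
    fix x assume x: "x \<in> mset M"
    interpret F: module K "fiber E x" by (rule fiber_module[OF x])
    show "(\<one>\<^bsub>fun_ring\<^esub> \<odot>\<^bsub>\<Gamma>\<^esub> s) x = s x"
      using x s sectionD(1) F.smult_one[of "s x"] by simp
  qed (use s sectionD(2) in simp_all)
next
  fix f g :: "'m \<Rightarrow> 'k" and s assume s: "s \<in> carrier \<Gamma>"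
  show "(f \<oplus>\<^bsub>fun_ring\<^esub> g) \<odot>\<^bsub>\<Gamma>\<^esub> s = f \<odot>\<^bsub>\<Gamma>\<^esub> s \<oplus>\<^bsub>\<Gamma>\<^esub> g \<odot>\<^bsub>\<Gamma>\<^esub> s"
  proof (rule extensional_eqI[of _ "mset M"])
    fix x assume x: "x \<in> mset M"
    interpret F: module K "fiber E x" by (rule fiber_module[OF x])
    show "((f \<oplus>\<^bsub>fun_ring\<^esub> g) \<odot>\<^bsub>\<Gamma>\<^esub> s) x = (f \<odot>\<^bsub>\<Gamma>\<^esub> s \<oplus>\<^bsub>\<Gamma>\<^esub> g \<odot>\<^bsub>\<Gamma>\<^esub> s) x"
      using x s sectionD(1) F.smult_l_distr[of "f x" "g x" "s x"] by simp
  qed simp_all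
  show "(f \<otimes>\<^bsub>fun_ring\<^esub> g) \<odot>\<^bsub>\<Gamma>\<^esub> s = f \<odot>\<^bsub>\<Gamma>\<^esub> (g \<odot>\<^bsub>\<Gamma>\<^esub> s)"
  proof (rule extensional_eqI[of _ "mset M"])
    fix x assume x: "x \<in> mset M"
    interpret F: module K "fiber E x" by (rule fiber_module[OF x])
    show "((f \<otimes>\<^bsub>fun_ring\<^esub> g) \<odot>\<^bsub>\<Gamma>\<^esub> s) x = (f \<odot>\<^bsub>\<Gamma>\<^esub> (g \<odot>\<^bsub>\<Gamma>\<^esub> s)) x"
      using x s sectionD(1) F.smult_assoc1[of "f x" "g x" "s x"] by simp
  qed simp_all
next
  fix f :: "'m \<Rightarrow> 'k" and s t assume s: "s \<in> carrier \<Gamma>" and t: "t \<in> carrier \<Gamma>"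
  show "f \<odot>\<^bsub>\<Gamma>\<^esub> (s \<oplus>\<^bsub>\<Gamma>\<^esub> t) = f \<odot>\<^bsub>\<Gamma>\<^esub> s \<oplus>\<^bsub>\<Gamma>\<^esub> f \<odot>\<^bsub>\<Gamma>\<^esub> t"
  proof (rule extensional_eqI[of _ "mset M"])
    fix x assume x: "x \<in> mset M"
    interpret F: module K "fiber E x" by (rule fiber_module[OF x])
    show "(f \<odot>\<^bsub>\<Gamma>\<^esub> (s \<oplus>\<^bsub>\<Gamma>\<^esub> t)) x = (f \<odot>\<^bsub>\<Gamma>\<^esub> s \<oplus>\<^bsub>\<Gamma>\<^esub> f \<odot>\<^bsub>\<Gamma>\<^esub> t) x"
      using x s t sectionD(1) F.smult_r_distr[of "f x" "s x" "t x"] by simp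
  qed simp_all
qed

lemma section_finsum:
  assumes "finite J" "\<And>j. j \<in> J \<Longrightarrow> s j \<in> smooth_sections M E" "x \<in> mset M"
  shows "(\<Oplus>\<^bsub>\<Gamma>\<^esub>j\<in>J. s j) x = (\<Oplus>\<^bsub>fiber E x\<^esub>j\<in>J. s j x)"
proof -
  have "additive_map \<Gamma> (fiber E x) (\<lambda>s. s x)"
    using sectionD(1) assms(3) by (simp add: additive_map_def)
  from additive_map_finsum[OF module.axioms(2)[OF module_section_module] fiber_group[OF assms(3)] this assms(1), of s]
  show ?thesis using assms(2) by (simp add: Pi_iff)
qed

text \<open>A smooth section of the dual bundle, described without that bundle as an object:
  smoothness is tested on local frames.\<close>

definition dual_section :: "('m \<Rightarrow> 'e \<Rightarrow> 'k) \<Rightarrow> bool" where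
  "dual_section \<omega> \<longleftrightarrow> (\<forall>x\<in>mset M. linear_functional (fiber E x) (\<omega> x)) \<and>
    (\<forall>V \<tau> a. (V, \<tau>) \<in> trivs E \<longrightarrow> a \<in> index E \<longrightarrow> smooth_fun_on M V (\<lambda>x. \<omega> x (local_frame \<tau> x a)))"

lemma dual_sectionD:
  assumes "dual_section \<omega>"
  shows "x \<in> mset M \<Longrightarrow> linear_functional (fiber E x) (\<omega> x)"
    "(V, \<tau>) \<in> trivs E \<Longrightarrow> a \<in> index E \<Longrightarrow> smooth_fun_on M V (\<lambda>x. \<omega> x (local_frame \<tau> x a))"
  using assms by (auto simp: dual_section_def)

text \<open>Locally the pairing is the finite sum of the coordinates of \<open>s\<close> times the
  values of \<open>\<omega>\<close> on a frame.\<close>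

lemma dual_section_smooth:
  assumes \<omega>: "dual_section \<omega>" and s: "s \<in> smooth_sections M E"
  shows "smooth_fun_on M (mset M) (\<lambda>x. \<omega> x (s x))"
proof (rule smooth_fun_on_local)
  fix x assume x: "x \<in> mset M"
  then obtain V \<tau> where V: "(V, \<tau>) \<in> trivs E" "x \<in> V" using triv_cover by blast
  have "smooth_fun_on M V (\<lambda>x. \<Sum>a\<in>index E. \<tau> x (s x) a * \<omega> x (local_frame \<tau> x a))"
    by (intro smooth_fun_on_sum smooth_fun_on_mult triv(1)[OF V(1)] sectionD(3)[OF s V(1)] dual_sectionD(2)[OF \<omega> V(1)])
  then have "smooth_fun_on M V (\<lambda>x. \<omega> x (s x))"
  proof (rule smooth_fun_on_cong[OF triv(1)[OF V(1)], rotated])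
    fix y assume y: "y \<in> V"
    then have yM: "y \<in> mset M" using triv_subset[OF V(1)] by blast
    show "(\<Sum>a\<in>index E. \<tau> y (s y) a * \<omega> y (local_frame \<tau> y a)) = \<omega> y (s y)"
      by (rule functional_expand[OF V(1) y sectionD(1)[OF s yM] dual_sectionD(1)[OF \<omega> yM], symmetric])
  qed
  then show "\<exists>W'. x \<in> W' \<and> smooth_fun_on M W' (\<lambda>x. \<omega> x (s x))" using V(2) by blast
qed

end

subsection \<open>The topology on sections\<close>

text \<open>Lifts the existence of neighbourhoods with a property \<open>Q\<close> stable under
  intersection, here convexity, from generating sets to all open sets. The map \<open>g\<close> is
  there because the section topology is generated in two layers: by preimages under local
  representatives of sets that are themselves generated.\<close>

lemma topology_generated_local_base:
  assumes S: "\<And>S x. S \<in> \<S> \<Longrightarrow> x \<in> A \<Longrightarrow> g x \<in> S \<Longrightarrow>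
      \<exists>C. openin T C \<and> x \<in> C \<and> (\<forall>z\<in>C. z \<in> A \<and> g z \<in> S) \<and> Q C"
    and Int: "\<And>C D. Q C \<Longrightarrow> Q D \<Longrightarrow> Q (C \<inter> D)"
    and U: "openin (topology_generated_by \<S>) U" and x: "x \<in> A" "g x \<in> U"
  shows "\<exists>C. openin T C \<and> x \<in> C \<and> (\<forall>z\<in>C. z \<in> A \<and> g z \<in> U) \<and> Q C"
proof -
  have "generate_topology_on \<S> U" using U by (simp add: openin_topology_generated_by_iff)
  then show ?thesis
    using x
  proof (induction arbitrary: x)
    case (Int a b)
    from Int.prems have "g x \<in> a" "g x \<in> b" by auto
    from Int.IH(1)[OF Int.prems(1) this(1)] obtain C where
      C: "openin T C" "x \<in> C" "\<forall>z\<in>C. z \<in> A \<and> g z \<in> a" "Q C" by (elim exE conjE) (rule that)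
    from Int.IH(2)[OF Int.prems(1) \<open>g x \<in> b\<close>] obtain D where
      D: "openin T D" "x \<in> D" "\<forall>z\<in>D. z \<in> A \<and> g z \<in> b" "Q D" by (elim exE conjE) (rule that)
    show ?case
      using C D assms(2)[OF C(4) D(4)] by (intro exI[of _ "C \<inter> D"]) auto
  next
    case (UN \<K>)
    then obtain k where k: "k \<in> \<K>" "g x \<in> k" by auto
    from UN.IH[OF k(1) UN.prems(1) k(2)] obtain C where
      C: "openin T C" "x \<in> C" "\<forall>z\<in>C. z \<in> A \<and> g z \<in> k" "Q C" by (elim exE conjE) (rule that)
    then show ?case using k(1) by (intro exI[of _ C]) auto
  next
    case (Basis S)
    then show ?case by (intro assms(1))
  qed simp
qed

lemma openin_if_eventually:
  assumes "S \<subseteq> topspace Z" "\<And>z. z \<in> S \<Longrightarrow> eventually (\<lambda>x. x \<in> S) (nhdsin Z z)"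
  shows "openin Z S"
proof (rule iffD2[OF openin_subopen], intro ballI)
  fix z assume z: "z \<in> S"
  then obtain W where "openin Z W" "z \<in> W" "\<forall>x\<in>W. x \<in> S"
    using assms(2)[OF z] assms(1) by (auto simp: eventually_nhdsin)
  then show "\<exists>T. openin Z T \<and> z \<in> T \<and> T \<subseteq> S" by (intro exI[of _ W]) auto
qed

lemma eventually_nhdsin_topspace: "eventually (\<lambda>x. x \<in> topspace Z) (nhdsin Z z)"
  by (auto simp: eventually_nhdsin)

lemma filterlim_nhdsin:
  assumes f: "continuous_map Z Y f" and z: "z \<in> topspace Z"
  shows "filterlim f (nhdsin Y (f z)) (nhdsin Z z)"
  unfolding filterlim_iff
proof (intro allI impI)
  fix P assume "eventually P (nhdsin Y (f z))"
  moreover have "f z \<in> topspace Y" using continuous_map_funspace[OF f] z by auto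
  ultimately obtain S where S: "openin Y S" "f z \<in> S" "\<forall>x\<in>S. P x" by (auto simp: eventually_nhdsin)
  then show "eventually (\<lambda>x. P (f x)) (nhdsin Z z)"
    using openin_continuous_map_preimage[OF f S(1)] z
    by (auto simp: eventually_nhdsin intro!: exI[of _ "{x \<in> topspace Z. f x \<in> S}"])
qed

lemma smooth_convergent_filterlim:
  assumes "smooth_convergent \<Omega> G h h0" "filterlim f G F"
  shows "smooth_convergent \<Omega> F (\<lambda>z. h (f z)) h0"
  unfolding smooth_convergent_def uniform_limit_iff
proof (intro conjI allI impI)
  note ev = eventually_compose_filterlim[OF _ assms(2)]
  note h = assms(1)[unfolded smooth_convergent_def uniform_limit_iff]
  show "eventually (\<lambda>z. smooth_on \<Omega> (h (f z))) F" by (rule ev) (use h in simp)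
  show "smooth_on \<Omega> h0" using h by simp
  show "eventually (\<lambda>z. \<forall>x\<in>C. dist (iter_deriv vs (h (f z)) x) (iter_deriv vs h0 x) < e) F"
    if "compact C \<and> C \<subseteq> \<Omega>" "0 < e" for C vs and e :: real
    by (rule ev) (use h that in simp)
qed

lemma iter_deriv_const: "iter_deriv vs (\<lambda>_. c) = (\<lambda>_. if vs = [] then c else 0)"
proof (induction vs rule: rev_induct)
  case (snoc v vs)
  have "iter_deriv vs (\<lambda>_. 0 :: 'b) = (\<lambda>_. 0)" for vs :: "'a list"
    by (induction vs rule: rev_induct) (simp_all add: iter_deriv_snoc)
  then show ?case by (simp add: iter_deriv_snoc)
qed simp

lemma smooth_convergent_scalar:
  assumes "(k \<longlongrightarrow> k0) F"
  shows "smooth_convergent \<Omega> F (\<lambda>z y. k z) (\<lambda>y. k0)"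
  using assms
  by (auto simp: smooth_convergent_def smooth_on_const iter_deriv_const uniform_limit_iff tendsto_iff
      elim!: eventually_mono)

lemma iter_deriv_cmult:
  fixes f :: "'b::real_normed_vector \<Rightarrow> 'c::real_normed_field"
  assumes "open \<Omega>" "smooth_on \<Omega> f" "x \<in> \<Omega>"
  shows "iter_deriv vs (\<lambda>x. c * f x) x = c * iter_deriv vs f x"
  using assms(2,3)
proof (induction vs arbitrary: f x rule: rev_induct)
  case (snoc v vs)
  have "iter_deriv vs (\<lambda>x. frechet_derivative (\<lambda>x. c * f x) (at x) v) x =
      iter_deriv vs (\<lambda>x. c * frechet_derivative f (at x) v) x"
  proof (rule iter_deriv_cong_open[OF assms(1) _ snoc.prems(2)])
    show "frechet_derivative (\<lambda>x. c * f x) (at y) v = c * frechet_derivative f (at y) v" if "y \<in> \<Omega>" for y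
      using frechet_derivative_mult[of "\<lambda>_. c" y f v] smooth_on_differentiable[OF snoc.prems(1) that] by simp
  qed
  then show ?case
    using snoc.IH[OF smooth_on_frechet_derivative[OF snoc.prems(1)] snoc.prems(2)] by (simp add: iter_deriv_snoc)
qed simp

text \<open>The generating balls have arbitrary centres \<open>f\<close>, so a limit inside such a
  ball must be shown to keep a margin from its boundary; compactness of \<open>C\<close> provides
  one.\<close>

lemma continuous_into_smooth_topology:
  fixes g :: "'z \<Rightarrow> 'b::real_normed_vector \<Rightarrow> 'i \<Rightarrow> 'k::real_normed_field"
  assumes g: "\<And>z. z \<in> topspace Z \<Longrightarrow> g z \<in> smooth_maps \<Omega> I"
    and conv: "\<And>z0 i. z0 \<in> topspace Z \<Longrightarrow> i \<in> I \<Longrightarrow>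
      smooth_convergent \<Omega> (nhdsin Z z0) (\<lambda>z y. g z y i) (\<lambda>y. g z0 y i)"
  shows "continuous_map Z (smooth_topology \<Omega> I) g"
  unfolding smooth_topology_def
proof (rule continuous_on_generated_topo)
  fix U :: "('b \<Rightarrow> 'i \<Rightarrow> 'k) set"
  assume "U \<in> insert (smooth_maps \<Omega> I)
    {{g \<in> smooth_maps \<Omega> I. \<forall>y\<in>C.
        norm (iter_deriv vs (\<lambda>z. g z i) y - iter_deriv vs (\<lambda>z. f z i) y) < \<epsilon>} | f C vs i \<epsilon>.
      f \<in> smooth_maps \<Omega> I \<and> compact C \<and> C \<subseteq> \<Omega> \<and> i \<in> I \<and> 0 < \<epsilon>}"
  then consider "U = smooth_maps \<Omega> I" | f C vs i \<epsilon> where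
    "U = {g \<in> smooth_maps \<Omega> I. \<forall>y\<in>C. norm (iter_deriv vs (\<lambda>z. g z i) y - iter_deriv vs (\<lambda>z. f z i) y) < \<epsilon>}"
    "f \<in> smooth_maps \<Omega> I" "compact C" "C \<subseteq> \<Omega>" "i \<in> I" "0 < \<epsilon>" by blast
  then show "openin Z (g -` U \<inter> topspace Z)"
  proof cases
    case 1
    then have "g -` U \<inter> topspace Z = topspace Z" using g by auto
    then show ?thesis by simp
  next
    case 2
    show ?thesis
    proof (rule openin_if_eventually)
      fix z0 assume z0: "z0 \<in> g -` U \<inter> topspace Z"
      define h where "h = (\<lambda>y. norm (iter_deriv vs (\<lambda>z. g z0 z i) y - iter_deriv vs (\<lambda>z. f z i) y))"
      have sm: "smooth_on \<Omega> (\<lambda>z. g z0 z i)" "smooth_on \<Omega> (\<lambda>z. f z i)"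
        using g[of z0] z0 2(2,5) by (auto simp: smooth_maps_def)
      have "continuous_on C h"
        unfolding h_def by (intro continuous_on_norm continuous_on_diff smooth_on_continuous_iter_deriv[OF _ 2(4)] sm)
      moreover have h\<epsilon>: "h y < \<epsilon>" if "y \<in> C" for y using z0 that by (simp add: 2(1) h_def)
      \<comment> \<open>\<open>m\<close> is the maximum of the distance to the centre over
        \<open>C\<close>, or 0 if \<open>C\<close> is empty; a perturbation by less than
        \<open>\<epsilon> - m\<close> stays in the ball.\<close>
      ultimately obtain m where m: "m < \<epsilon>" "\<And>y. y \<in> C \<Longrightarrow> h y \<le> m"
      proof (cases "C = {}")
        case True
        then show ?thesis using that[of 0] 2(6) by simp
      next
        case False
        assume "continuous_on C h"
        then obtain y where "y \<in> C" "\<forall>y'\<in>C. h y' \<le> h y"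
          using continuous_attains_sup[OF 2(3) False] by blast
        then show ?thesis using that[of "h y"] h\<epsilon> by blast
      qed
      have "uniform_limit C (\<lambda>z. iter_deriv vs (\<lambda>y. g z y i)) (iter_deriv vs (\<lambda>y. g z0 y i)) (nhdsin Z z0)"
        using conv[of z0 i] z0 2(3-5) by (simp add: smooth_convergent_def)
      then have "eventually (\<lambda>z. \<forall>y\<in>C. dist (iter_deriv vs (\<lambda>y. g z y i) y) (iter_deriv vs (\<lambda>y. g z0 y i) y) < \<epsilon> - m) (nhdsin Z z0)"
        using m(1) by (simp add: uniform_limit_iff)
      then show "eventually (\<lambda>z. z \<in> g -` U \<inter> topspace Z) (nhdsin Z z0)"
        using eventually_nhdsin_topspace[of Z z0]
      proof eventually_elim
        case (elim z)
        have "norm (iter_deriv vs (\<lambda>y. g z y i) y - iter_deriv vs (\<lambda>y. f y i) y) < \<epsilon>" if y: "y \<in> C" for y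
        proof -
          have "norm (iter_deriv vs (\<lambda>y. g z y i) y - iter_deriv vs (\<lambda>y. f y i) y) \<le>
              dist (iter_deriv vs (\<lambda>y. g z y i) y) (iter_deriv vs (\<lambda>y. g z0 y i) y) + h y"
            unfolding h_def dist_norm by (rule order_trans[OF _ norm_triangle_ineq]) simp
          then show ?thesis using elim(1) m(2)[OF y] y by fastforce
        qed
        then show ?case using elim(2) g by (simp add: 2(1))
      qed
    qed simp
  qed
next
  show "g ` topspace Z \<subseteq> \<Union>(insert (smooth_maps \<Omega> I)
    {{g \<in> smooth_maps \<Omega> I. \<forall>y\<in>C.
        norm (iter_deriv vs (\<lambda>z. g z i) y - iter_deriv vs (\<lambda>z. f z i) y) < \<epsilon>} | f C vs i \<epsilon>.
      f \<in> smooth_maps \<Omega> I \<and> compact C \<and> C \<subseteq> \<Omega> \<and> i \<in> I \<and> 0 < \<epsilon>})"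
    using g by auto
qed

section \<open>Continuity and convergence in spaces of sections\<close>

context smooth_bundle begin

abbreviation "T\<Gamma> \<equiv> section_topology M E"

lemma topspace_section_topology: "topspace T\<Gamma> = smooth_sections M E"
  unfolding section_topology_def topology_generated_by_topspace by blast

lemma local_rep_smooth_maps:
  "s \<in> smooth_sections M E \<Longrightarrow> (U, \<phi>) \<in> atlas M \<Longrightarrow> (V, \<tau>) \<in> trivs E \<Longrightarrow>
    local_rep U \<phi> V \<tau> s \<in> smooth_maps (\<phi> ` (U \<inter> V)) (index E)"
  unfolding smooth_sections_def by fast

lemma openin_section_ball:
  assumes c: "(U, \<phi>) \<in> atlas M" "(V, \<tau>) \<in> trivs E" and f: "f \<in> smooth_maps (\<phi> ` (U \<inter> V)) (index E)"
    and C: "compact C" "C \<subseteq> \<phi> ` (U \<inter> V)" and i: "i \<in> index E" and \<epsilon>: "0 < \<epsilon>"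
  shows "openin T\<Gamma> {s \<in> smooth_sections M E. \<forall>y\<in>C.
    norm (iter_deriv vs (\<lambda>y. local_rep U \<phi> V \<tau> s y i) y - iter_deriv vs (\<lambda>y. f y i) y) < \<epsilon>}"
proof -
  let ?B = "{g \<in> smooth_maps (\<phi> ` (U \<inter> V)) (index E). \<forall>y\<in>C.
      norm (iter_deriv vs (\<lambda>z. g z i) y - iter_deriv vs (\<lambda>z. f z i) y) < \<epsilon>}"
  have "openin (smooth_topology (\<phi> ` (U \<inter> V)) (index E)) ?B"
    unfolding smooth_topology_def
    by (rule topology_generated_by_Basis) (use f C i \<epsilon> in blast)
  then have "openin T\<Gamma> {s \<in> smooth_sections M E. local_rep U \<phi> V \<tau> s \<in> ?B}"
    unfolding section_topology_def
    by (intro topology_generated_by_Basis insertI2 CollectI exI[of _ U] exI[of _ \<phi>] exI[of _ V]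
        exI[of _ \<tau>] exI[of _ ?B]) (simp add: c)
  moreover have "{s \<in> smooth_sections M E. local_rep U \<phi> V \<tau> s \<in> ?B} = {s \<in> smooth_sections M E. \<forall>y\<in>C.
    norm (iter_deriv vs (\<lambda>y. local_rep U \<phi> V \<tau> s y i) y - iter_deriv vs (\<lambda>y. f y i) y) < \<epsilon>}"
    using local_rep_smooth_maps[OF _ c] by auto
  ultimately show ?thesis by simp
qed

text \<open>The topology is generated by preimages under local representatives, so continuity is
  tested on each of these and becomes convergence of coordinates at every point. Its counterpart
  \<open>smooth_convergent_sections\<close> feeds in the convergence of the argument.\<close>

lemma continuous_into_sections:
  assumes f: "\<And>z. z \<in> topspace Z \<Longrightarrow> f z \<in> smooth_sections M E"
    and conv: "\<And>z0 U \<phi> V \<tau> i. z0 \<in> topspace Z \<Longrightarrow> (U, \<phi>) \<in> atlas M \<Longrightarrow> (V, \<tau>) \<in> trivs E \<Longrightarrow> i \<in> index E \<Longrightarrow>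
      smooth_convergent (\<phi> ` (U \<inter> V)) (nhdsin Z z0)
        (\<lambda>z. (\<lambda>x. \<tau> x (f z x) i) \<circ> inv_into U \<phi>) ((\<lambda>x. \<tau> x (f z0 x) i) \<circ> inv_into U \<phi>)"
  shows "continuous_map Z T\<Gamma> f"
  unfolding section_topology_def
proof (rule continuous_on_generated_topo)
  have cont: "continuous_map Z (smooth_topology (\<phi> ` (U \<inter> V)) (index E)) (\<lambda>z. local_rep U \<phi> V \<tau> (f z))"
    if c: "(U, \<phi>) \<in> atlas M" and V: "(V, \<tau>) \<in> trivs E" for U \<phi> V \<tau>
  proof (rule continuous_into_smooth_topology)
    show "local_rep U \<phi> V \<tau> (f z) \<in> smooth_maps (\<phi> ` (U \<inter> V)) (index E)" if "z \<in> topspace Z" for z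
      by (rule local_rep_smooth_maps[OF f[OF that] c V])
    show "smooth_convergent (\<phi> ` (U \<inter> V)) (nhdsin Z z0) (\<lambda>z y. local_rep U \<phi> V \<tau> (f z) y i)
        (\<lambda>y. local_rep U \<phi> V \<tau> (f z0) y i)" if "z0 \<in> topspace Z" "i \<in> index E" for z0 i
      by (rule smooth_convergent_cong[OF open_chart_image[OF c triv(1)[OF V]] _ _ conv[OF that(1) c V that(2)]])
        (simp_all add: local_rep_chart[OF c])
  qed
  fix S assume "S \<in> insert (smooth_sections M E)
    {{s \<in> smooth_sections M E. local_rep U \<phi> V \<tau> s \<in> B} | U \<phi> V \<tau> B.
      (U, \<phi>) \<in> atlas M \<and> (V, \<tau>) \<in> trivs E \<and> openin (smooth_topology (\<phi> ` (U \<inter> V)) (index E)) B}"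
  then consider "S = smooth_sections M E" | U \<phi> V \<tau> B where
    "S = {s \<in> smooth_sections M E. local_rep U \<phi> V \<tau> s \<in> B}" "(U, \<phi>) \<in> atlas M" "(V, \<tau>) \<in> trivs E"
    "openin (smooth_topology (\<phi> ` (U \<inter> V)) (index E)) B" by blast
  then show "openin Z (f -` S \<inter> topspace Z)"
  proof cases
    case 1
    then have "f -` S \<inter> topspace Z = topspace Z" using f by auto
    then show ?thesis by simp
  next
    case 2
    have "openin Z {z \<in> topspace Z. local_rep U \<phi> V \<tau> (f z) \<in> B}"
      by (rule openin_continuous_map_preimage[OF cont[OF 2(2,3)] 2(4)])
    moreover have "f -` S \<inter> topspace Z = {z \<in> topspace Z. local_rep U \<phi> V \<tau> (f z) \<in> B}"
      using f by (auto simp: 2(1))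
    ultimately show ?thesis by simp
  qed
next
  show "f ` topspace Z \<subseteq> \<Union>(insert (smooth_sections M E)
    {{s \<in> smooth_sections M E. local_rep U \<phi> V \<tau> s \<in> B} | U \<phi> V \<tau> B.
      (U, \<phi>) \<in> atlas M \<and> (V, \<tau>) \<in> trivs E \<and> openin (smooth_topology (\<phi> ` (U \<inter> V)) (index E)) B})"
    using f by auto
qed

lemma smooth_convergent_sections:
  assumes c: "(U, \<phi>) \<in> atlas M" and V: "(V, \<tau>) \<in> trivs E" and i: "i \<in> index E"
    and s0: "s0 \<in> smooth_sections M E"
  shows "smooth_convergent (\<phi> ` (U \<inter> V)) (nhdsin T\<Gamma> s0)
    (\<lambda>s. (\<lambda>x. \<tau> x (s x) i) \<circ> inv_into U \<phi>) ((\<lambda>x. \<tau> x (s0 x) i) \<circ> inv_into U \<phi>)"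
proof (rule smooth_convergent_cong[OF open_chart_image[OF c triv(1)[OF V]]])
  show "smooth_convergent (\<phi> ` (U \<inter> V)) (nhdsin T\<Gamma> s0)
    (\<lambda>s y. local_rep U \<phi> V \<tau> s y i) (\<lambda>y. local_rep U \<phi> V \<tau> s0 y i)"
    unfolding smooth_convergent_def
  proof (intro conjI allI impI)
    have sm: "smooth_on (\<phi> ` (U \<inter> V)) (\<lambda>y. local_rep U \<phi> V \<tau> s y i)" if "s \<in> smooth_sections M E" for s
      using local_rep_smooth_maps[OF that c V] i by (simp add: smooth_maps_def)
    show "smooth_on (\<phi> ` (U \<inter> V)) (\<lambda>y. local_rep U \<phi> V \<tau> s0 y i)" by (rule sm[OF s0])
    show "eventually (\<lambda>s. smooth_on (\<phi> ` (U \<inter> V)) (\<lambda>y. local_rep U \<phi> V \<tau> s y i)) (nhdsin T\<Gamma> s0)"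
      using eventually_nhdsin_topspace[of T\<Gamma> s0]
      by (rule eventually_mono) (simp add: topspace_section_topology sm)
    fix C :: "'b set" and vs assume C: "compact C \<and> C \<subseteq> \<phi> ` (U \<inter> V)"
    show "uniform_limit C (\<lambda>s. iter_deriv vs (\<lambda>y. local_rep U \<phi> V \<tau> s y i))
        (iter_deriv vs (\<lambda>y. local_rep U \<phi> V \<tau> s0 y i)) (nhdsin T\<Gamma> s0)"
      unfolding uniform_limit_iff
    proof (intro allI impI)
      fix \<epsilon> :: real assume \<epsilon>: "0 < \<epsilon>"
      let ?S = "{s \<in> smooth_sections M E. \<forall>y\<in>C.
        norm (iter_deriv vs (\<lambda>y. local_rep U \<phi> V \<tau> s y i) y - iter_deriv vs (\<lambda>y. local_rep U \<phi> V \<tau> s0 y i) y) < \<epsilon>}"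
      have "openin T\<Gamma> ?S"
        by (rule openin_section_ball[OF c V local_rep_smooth_maps[OF s0 c V] _ _ i \<epsilon>]) (use C in auto)
      moreover have "s0 \<in> ?S" using s0 \<epsilon> by simp
      ultimately show "eventually (\<lambda>s. \<forall>y\<in>C. dist (iter_deriv vs (\<lambda>y. local_rep U \<phi> V \<tau> s y i) y)
          (iter_deriv vs (\<lambda>y. local_rep U \<phi> V \<tau> s0 y i) y) < \<epsilon>) (nhdsin T\<Gamma> s0)"
        unfolding eventually_nhdsin by (intro disjI2 exI[of _ ?S] conjI) (auto simp: dist_norm)
    qed
  qed
qed (simp_all add: local_rep_chart[OF c])

lemma smooth_convergent_sections_compose:
  assumes f: "continuous_map Z T\<Gamma> f" and z0: "z0 \<in> topspace Z"
    and c: "(U, \<phi>) \<in> atlas M" and V: "(V, \<tau>) \<in> trivs E" and i: "i \<in> index E"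
  shows "smooth_convergent (\<phi> ` (U \<inter> V)) (nhdsin Z z0)
    (\<lambda>z. (\<lambda>x. \<tau> x (f z x) i) \<circ> inv_into U \<phi>) ((\<lambda>x. \<tau> x (f z0 x) i) \<circ> inv_into U \<phi>)"
proof -
  have "f z0 \<in> smooth_sections M E"
    using continuous_map_funspace[OF f] z0 by (auto simp: topspace_section_topology)
  from smooth_convergent_filterlim[OF smooth_convergent_sections[OF c V i this] filterlim_nhdsin[OF f z0]]
  show ?thesis .
qed

text \<open>Convergence is claimed on the whole chart image, whose compact subsets may meet several
  trivialising sets. On each of these the pairing is a finite sum of products of coordinates with
  fixed functions, and the pieces are glued by \<open>smooth_convergent_local\<close>.\<close>

lemma smooth_convergent_dual_section:
  assumes \<omega>: "dual_section \<omega>" and s0: "s0 \<in> smooth_sections M E" and c: "(U, \<phi>) \<in> atlas M"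
  shows "smooth_convergent (\<phi> ` U) (nhdsin T\<Gamma> s0)
    (\<lambda>s. (\<lambda>x. \<omega> x (s x)) \<circ> inv_into U \<phi>) ((\<lambda>x. \<omega> x (s0 x)) \<circ> inv_into U \<phi>)"
proof (rule smooth_convergent_local)
  have UM: "U \<inter> mset M = U" using chart_subset[OF c] by auto
  have "smooth_on (\<phi> ` U) ((\<lambda>x. \<omega> x (s x)) \<circ> inv_into U \<phi>)" if "s \<in> smooth_sections M E" for s
    using smooth_fun_onD[OF dual_section_smooth[OF \<omega> that] c] by (simp add: UM)
  then show "eventually (\<lambda>s. smooth_on (\<phi> ` U) ((\<lambda>x. \<omega> x (s x)) \<circ> inv_into U \<phi>)) (nhdsin T\<Gamma> s0)"
    using eventually_nhdsin_topspace[of T\<Gamma> s0] by (auto elim: eventually_mono simp: topspace_section_topology)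
  fix y assume "y \<in> \<phi> ` U"
  then obtain x where x: "x \<in> U" "y = \<phi> x" by auto
  then obtain V \<tau> where V: "(V, \<tau>) \<in> trivs E" "x \<in> V" using triv_cover chart_subset[OF c] by blast
  have o: "open (\<phi> ` (U \<inter> V))" by (rule open_chart_image[OF c triv(1)[OF V(1)]])
  let ?h = "\<lambda>s y. \<Sum>a\<in>index E. ((\<lambda>x. \<tau> x (s x) a) \<circ> inv_into U \<phi>) y * ((\<lambda>x. \<omega> x (local_frame \<tau> x a)) \<circ> inv_into U \<phi>) y"
  have conv: "smooth_convergent (\<phi> ` (U \<inter> V)) (nhdsin T\<Gamma> s0) ?h (?h s0)"
    by (intro smooth_convergent_sum smooth_convergent_mult smooth_convergent_const o
        smooth_convergent_sections[OF c V(1) _ s0] smooth_fun_onD[OF dual_sectionD(2)[OF \<omega> V(1)] c])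
  have eq: "?h s y = ((\<lambda>x. \<omega> x (s x)) \<circ> inv_into U \<phi>) y"
    if "s \<in> smooth_sections M E" "y \<in> \<phi> ` (U \<inter> V)" for s y
  proof -
    obtain z where z: "z \<in> U" "z \<in> V" "y = \<phi> z" using \<open>y \<in> \<phi> ` (U \<inter> V)\<close> by auto
    have zM: "z \<in> mset M" using z(1) chart_subset[OF c] by blast
    show ?thesis
      using functional_expand[OF V(1) z(2) sectionD(1)[OF that(1) zM] dual_sectionD(1)[OF \<omega> zM]] z
      by (simp add: chart_inv[OF c])
  qed
  have "smooth_convergent (\<phi> ` (U \<inter> V)) (nhdsin T\<Gamma> s0)
    (\<lambda>s. (\<lambda>x. \<omega> x (s x)) \<circ> inv_into U \<phi>) ((\<lambda>x. \<omega> x (s0 x)) \<circ> inv_into U \<phi>)"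
  proof (rule smooth_convergent_cong[OF o _ _ conv])
    show "eventually (\<lambda>s. \<forall>y\<in>\<phi> ` (U \<inter> V). ?h s y = ((\<lambda>x. \<omega> x (s x)) \<circ> inv_into U \<phi>) y) (nhdsin T\<Gamma> s0)"
      by (rule eventually_mono[OF eventually_nhdsin_topspace])
        (unfold topspace_section_topology, intro ballI eq)
  qed (rule eq[OF s0])
  then show "\<exists>\<Omega>'. open \<Omega>' \<and> y \<in> \<Omega>' \<and> smooth_convergent \<Omega>' (nhdsin T\<Gamma> s0)
      (\<lambda>s. (\<lambda>x. \<omega> x (s x)) \<circ> inv_into U \<phi>) ((\<lambda>x. \<omega> x (s0 x)) \<circ> inv_into U \<phi>)"
    using o x V(2) by (intro exI[of _ "\<phi> ` (U \<inter> V)"]) auto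
qed

section \<open>Spaces of sections are Hausdorff locally convex spaces\<close>

lemma continuous_section_add:
  "continuous_map (prod_topology T\<Gamma> T\<Gamma>) T\<Gamma> (\<lambda>(s, t). s \<oplus>\<^bsub>\<Gamma>\<^esub> t)"
proof (rule continuous_into_sections)
  let ?Z = "prod_topology T\<Gamma> T\<Gamma>"
  have Z: "fst z \<in> smooth_sections M E" "snd z \<in> smooth_sections M E" if "z \<in> topspace ?Z" for z
    using that by (auto simp: topspace_section_topology)
  show "(case z of (s, t) \<Rightarrow> s \<oplus>\<^bsub>\<Gamma>\<^esub> t) \<in> smooth_sections M E" if "z \<in> topspace ?Z" for z
    using section_add[OF Z[OF that]] by (simp add: case_prod_unfold)
  fix z0 U \<phi> V \<tau> i assume z0: "z0 \<in> topspace ?Z" and c: "(U, \<phi>) \<in> atlas M" and V: "(V, \<tau>) \<in> trivs E"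
    and i: "i \<in> index E"
  have o: "open (\<phi> ` (U \<inter> V))" by (rule open_chart_image[OF c triv(1)[OF V]])
  have eq: "((\<lambda>x. \<tau> x (fst z x) i) \<circ> inv_into U \<phi>) y + ((\<lambda>x. \<tau> x (snd z x) i) \<circ> inv_into U \<phi>) y =
      ((\<lambda>x. \<tau> x ((case z of (s, t) \<Rightarrow> s \<oplus>\<^bsub>\<Gamma>\<^esub> t) x) i) \<circ> inv_into U \<phi>) y"
    if z: "z \<in> topspace ?Z" and "y \<in> \<phi> ` (U \<inter> V)" for z y
  proof -
    obtain x where x: "x \<in> U" "x \<in> V" "y = \<phi> x" using \<open>y \<in> \<phi> ` (U \<inter> V)\<close> by auto
    have xM: "x \<in> mset M" using x(1) chart_subset[OF c] by blast
    show ?thesis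
      using linear_functionalD(1)[OF triv_functional[OF V x(2)] sectionD(1)[OF Z(1)[OF z] xM] sectionD(1)[OF Z(2)[OF z] xM], of i]
        x xM by (simp add: chart_inv[OF c] case_prod_unfold)
  qed
  show "smooth_convergent (\<phi> ` (U \<inter> V)) (nhdsin ?Z z0)
      (\<lambda>z. (\<lambda>x. \<tau> x ((case z of (s, t) \<Rightarrow> s \<oplus>\<^bsub>\<Gamma>\<^esub> t) x) i) \<circ> inv_into U \<phi>)
      ((\<lambda>x. \<tau> x ((case z0 of (s, t) \<Rightarrow> s \<oplus>\<^bsub>\<Gamma>\<^esub> t) x) i) \<circ> inv_into U \<phi>)"
  proof (rule smooth_convergent_cong[OF o _ _ smooth_convergent_add[OF o
          smooth_convergent_sections_compose[OF continuous_map_fst z0 c V i]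
          smooth_convergent_sections_compose[OF continuous_map_snd z0 c V i]]])
    show "eventually (\<lambda>z. \<forall>y\<in>\<phi> ` (U \<inter> V). ((\<lambda>x. \<tau> x (fst z x) i) \<circ> inv_into U \<phi>) y + ((\<lambda>x. \<tau> x (snd z x) i) \<circ> inv_into U \<phi>) y =
      ((\<lambda>x. \<tau> x ((case z of (s, t) \<Rightarrow> s \<oplus>\<^bsub>\<Gamma>\<^esub> t) x) i) \<circ> inv_into U \<phi>) y) (nhdsin ?Z z0)"
      by (rule eventually_mono[OF eventually_nhdsin_topspace]) (intro ballI eq)
  qed (rule eq[OF z0])
qed

lemma continuous_section_smult:
  "continuous_map (prod_topology euclidean T\<Gamma>) T\<Gamma> (\<lambda>(c, s). const_fun M c \<odot>\<^bsub>\<Gamma>\<^esub> s)"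
proof (rule continuous_into_sections)
  let ?Z = "prod_topology (euclidean :: 'k topology) T\<Gamma>"
  have Z: "snd z \<in> smooth_sections M E" if "z \<in> topspace ?Z" for z
    using that by (auto simp: topspace_section_topology)
  have sm: "smooth_fun_on M (mset M) (const_fun M k)" for k :: 'k
    using smooth_ring_restrictI[OF smooth_fun_on_const[of _ k]] by (simp add: smooth_ring_carrier const_fun_def)
  show "(case z of (k, s) \<Rightarrow> const_fun M k \<odot>\<^bsub>\<Gamma>\<^esub> s) \<in> smooth_sections M E" if "z \<in> topspace ?Z" for z
    using section_smult[OF sm Z[OF that]] by (simp add: case_prod_unfold)
  fix z0 U \<phi> V \<tau> i assume z0: "z0 \<in> topspace ?Z" and c: "(U, \<phi>) \<in> atlas M" and V: "(V, \<tau>) \<in> trivs E"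
    and i: "i \<in> index E"
  have o: "open (\<phi> ` (U \<inter> V))" by (rule open_chart_image[OF c triv(1)[OF V]])
  have eq: "fst z * ((\<lambda>x. \<tau> x (snd z x) i) \<circ> inv_into U \<phi>) y =
      ((\<lambda>x. \<tau> x ((case z of (k, s) \<Rightarrow> const_fun M k \<odot>\<^bsub>\<Gamma>\<^esub> s) x) i) \<circ> inv_into U \<phi>) y"
    if z: "z \<in> topspace ?Z" and "y \<in> \<phi> ` (U \<inter> V)" for z y
  proof -
    obtain x where x: "x \<in> U" "x \<in> V" "y = \<phi> x" using \<open>y \<in> \<phi> ` (U \<inter> V)\<close> by auto
    have xM: "x \<in> mset M" using x(1) chart_subset[OF c] by blast
    show ?thesis
      using linear_functionalD(2)[OF triv_functional[OF V x(2)] sectionD(1)[OF Z[OF z] xM], of "fst z" i]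
        x xM by (simp add: chart_inv[OF c] case_prod_unfold const_fun_def)
  qed
  have "(fst \<longlongrightarrow> fst z0) (nhdsin ?Z z0)"
    unfolding tendsto_iff
  proof (intro allI impI)
    fix \<epsilon> :: real assume "0 < \<epsilon>"
    have "openin ?Z {z \<in> topspace ?Z. fst z \<in> ball (fst z0) \<epsilon>}"
      by (rule openin_continuous_map_preimage[OF continuous_map_fst]) simp
    then show "eventually (\<lambda>z. dist (fst z) (fst z0) < \<epsilon>) (nhdsin ?Z z0)"
      unfolding eventually_nhdsin using z0 \<open>0 < \<epsilon>\<close>
      by (intro disjI2 exI[of _ "{z \<in> topspace ?Z. fst z \<in> ball (fst z0) \<epsilon>}"]) (auto simp: dist_commute)
  qed
  note conv = smooth_convergent_mult[OF o smooth_convergent_scalar[OF this]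
      smooth_convergent_sections_compose[OF continuous_map_snd z0 c V i]]
  show "smooth_convergent (\<phi> ` (U \<inter> V)) (nhdsin ?Z z0)
      (\<lambda>z. (\<lambda>x. \<tau> x ((case z of (k, s) \<Rightarrow> const_fun M k \<odot>\<^bsub>\<Gamma>\<^esub> s) x) i) \<circ> inv_into U \<phi>)
      ((\<lambda>x. \<tau> x ((case z0 of (k, s) \<Rightarrow> const_fun M k \<odot>\<^bsub>\<Gamma>\<^esub> s) x) i) \<circ> inv_into U \<phi>)"
  proof (rule smooth_convergent_cong[OF o _ _ conv])
    show "eventually (\<lambda>z. \<forall>y\<in>\<phi> ` (U \<inter> V). fst z * ((\<lambda>x. \<tau> x (snd z x) i) \<circ> inv_into U \<phi>) y =
      ((\<lambda>x. \<tau> x ((case z of (k, s) \<Rightarrow> const_fun M k \<odot>\<^bsub>\<Gamma>\<^esub> s) x) i) \<circ> inv_into U \<phi>) y) (nhdsin ?Z z0)"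
      by (rule eventually_mono[OF eventually_nhdsin_topspace]) (intro ballI eq)
  qed (rule eq[OF z0])
qed

text \<open>At a point of the chart image the iterated derivative of a coordinate is linear in the
  section, so the condition at each \<open>y\<close> is the preimage of a ball, which is
  convex.\<close>

lemma section_ball_convex:
  assumes c: "(U, \<phi>) \<in> atlas M" and V: "(V, \<tau>) \<in> trivs E" and C: "C \<subseteq> \<phi> ` (U \<inter> V)" and i: "i \<in> index E"
  shows "K_convex (restrict_scalars (const_fun M) \<Gamma>) {s \<in> smooth_sections M E. \<forall>y\<in>C.
    norm (iter_deriv vs (\<lambda>y. local_rep U \<phi> V \<tau> s y i) y - w y) < \<epsilon>}"
  unfolding K_convex_def
proof (intro ballI)
  fix s t and r :: real
  let ?D = "\<lambda>s y. iter_deriv vs (\<lambda>y. local_rep U \<phi> V \<tau> s y i) y"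
  assume "s \<in> {s \<in> smooth_sections M E. \<forall>y\<in>C. norm (?D s y - w y) < \<epsilon>}"
    and "t \<in> {s \<in> smooth_sections M E. \<forall>y\<in>C. norm (?D s y - w y) < \<epsilon>}" and r: "r \<in> {0..1}"
  then have s: "s \<in> smooth_sections M E" "\<And>y. y \<in> C \<Longrightarrow> norm (?D s y - w y) < \<epsilon>"
    and t: "t \<in> smooth_sections M E" "\<And>y. y \<in> C \<Longrightarrow> norm (?D t y - w y) < \<epsilon>" by auto
  let ?a = "of_real r :: 'k" and ?b = "of_real (1 - r) :: 'k"
  have sm: "smooth_fun_on M (mset M) (const_fun M k)" for k :: 'k
    using smooth_ring_restrictI[OF smooth_fun_on_const[of _ k]] by (simp add: smooth_ring_carrier const_fun_def)
  define u where "u = (const_fun M ?a \<odot>\<^bsub>\<Gamma>\<^esub> s) \<oplus>\<^bsub>\<Gamma>\<^esub> (const_fun M ?b \<odot>\<^bsub>\<Gamma>\<^esub> t)"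
  have u: "u \<in> smooth_sections M E"
    unfolding u_def section_module_simps by (intro section_add section_smult sm s(1) t(1))
  have o: "open (\<phi> ` (U \<inter> V))" by (rule open_chart_image[OF c triv(1)[OF V]])
  have sms: "smooth_on (\<phi> ` (U \<inter> V)) (\<lambda>y. local_rep U \<phi> V \<tau> s y i)" if "s \<in> smooth_sections M E" for s
    using local_rep_smooth_maps[OF that c V] i by (simp add: smooth_maps_def)
  have rep: "local_rep U \<phi> V \<tau> u y i = ?a * local_rep U \<phi> V \<tau> s y i + ?b * local_rep U \<phi> V \<tau> t y i"
    if "y \<in> \<phi> ` (U \<inter> V)" for y
  proof -
    obtain x where x: "x \<in> U" "x \<in> V" "y = \<phi> x" using \<open>y \<in> \<phi> ` (U \<inter> V)\<close> by auto
    have xM: "x \<in> mset M" using x(1) chart_subset[OF c] by blast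
    interpret F: module K "fiber E x" by (rule fiber_module[OF xM])
    note sx = sectionD(1)[OF s(1) xM] and tx = sectionD(1)[OF t(1) xM]
    show ?thesis
      using linear_functionalD(1)[OF triv_functional[OF V x(2), of i], of "?a \<odot>\<^bsub>fiber E x\<^esub> s x" "?b \<odot>\<^bsub>fiber E x\<^esub> t x"]
        linear_functionalD(2)[OF triv_functional[OF V x(2), of i], of "s x" ?a]
        linear_functionalD(2)[OF triv_functional[OF V x(2), of i], of "t x" ?b] sx tx x xM that
      by (simp add: local_rep_chart[OF c] chart_inv[OF c] u_def const_fun_def)
  qed
  have "norm (?D u y - w y) < \<epsilon>" if y: "y \<in> C" for y
  proof -
    have y': "y \<in> \<phi> ` (U \<inter> V)" using y C by blast
    have "?D u y = iter_deriv vs (\<lambda>y. ?a * local_rep U \<phi> V \<tau> s y i + ?b * local_rep U \<phi> V \<tau> t y i) y"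
      by (rule iter_deriv_cong_open[OF o rep y'])
    also have "\<dots> = ?a * ?D s y + ?b * ?D t y"
      using iter_deriv_add[OF o smooth_on_mult[OF o smooth_on_const sms[OF s(1)]]
          smooth_on_mult[OF o smooth_on_const sms[OF t(1)]] y', of vs ?a ?b]
        iter_deriv_cmult[OF o sms[OF s(1)] y', of vs ?a] iter_deriv_cmult[OF o sms[OF t(1)] y', of vs ?b]
      by simp
    finally have "?D u y - w y = ?a * (?D s y - w y) + ?b * (?D t y - w y)"
      by (simp add: algebra_simps)
    then have le: "norm (?D u y - w y) \<le> r * norm (?D s y - w y) + (1 - r) * norm (?D t y - w y)"
      using norm_triangle_ineq[of "?a * (?D s y - w y)" "?b * (?D t y - w y)"] r
      by (simp add: norm_mult del: of_real_diff)
    also have "\<dots> < \<epsilon>"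
      using s(2)[OF y] t(2)[OF y] r by (intro convex_bound_lt) auto
    finally show ?thesis .
  qed
  then show "of_real r \<odot>\<^bsub>restrict_scalars (const_fun M) \<Gamma>\<^esub> s \<oplus>\<^bsub>restrict_scalars (const_fun M) \<Gamma>\<^esub>
      of_real (1 - r) \<odot>\<^bsub>restrict_scalars (const_fun M) \<Gamma>\<^esub> t \<in>
      {s \<in> smooth_sections M E. \<forall>y\<in>C. norm (?D s y - w y) < \<epsilon>}"
    using u unfolding u_def restrict_scalars_simps by blast
qed

lemma locally_convex_sections:
  "locally_convex_topology (restrict_scalars (const_fun M) \<Gamma>) T\<Gamma>"
  unfolding locally_convex_topology_def
proof (intro conjI allI impI)
  let ?R = "restrict_scalars (const_fun M) \<Gamma>"
  interpret S: module fun_ring \<Gamma> by (rule module_section_module)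
  let ?Q = "K_convex ?R"
  have full: "openin T\<Gamma> (smooth_sections M E) \<and> ?Q (smooth_sections M E)"
  proof
    show "openin T\<Gamma> (smooth_sections M E)"
      using openin_topspace[of T\<Gamma>] by (simp add: topspace_section_topology)
    have "const_fun M k \<in> carrier fun_ring" for k :: 'k
      using smooth_ring_restrictI[OF smooth_fun_on_const[of _ k]] by (simp add: const_fun_def)
    then show "?Q (smooth_sections M E)"
      unfolding K_convex_def restrict_scalars_simps
      using S.smult_closed S.M.a_closed unfolding section_module_simps(1) by blast
  qed
  \<comment> \<open>The first layer: convex neighbourhoods for preimages of open sets of smooth
    maps. The second use of the local base lemma then passes to arbitrary open sets of
    sections.\<close>
  have inner: "\<exists>C. openin T\<Gamma> C \<and> s \<in> C \<and> (\<forall>z\<in>C. z \<in> smooth_sections M E \<and> local_rep U \<phi> V \<tau> z \<in> B) \<and> ?Q C"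
    if c: "(U, \<phi>) \<in> atlas M" and V: "(V, \<tau>) \<in> trivs E"
      and B: "openin (smooth_topology (\<phi> ` (U \<inter> V)) (index E)) B"
      and s: "s \<in> smooth_sections M E" "local_rep U \<phi> V \<tau> s \<in> B" for U \<phi> V \<tau> B s
  proof (rule topology_generated_local_base[where Q = ?Q and g = "local_rep U \<phi> V \<tau>" and T = T\<Gamma>
        and A = "smooth_sections M E", OF _ K_convex_Int B[unfolded smooth_topology_def] s])
    fix S s assume s: "s \<in> smooth_sections M E" "local_rep U \<phi> V \<tau> s \<in> S"
      and "S \<in> insert (smooth_maps (\<phi> ` (U \<inter> V)) (index E))
      {{g \<in> smooth_maps (\<phi> ` (U \<inter> V)) (index E). \<forall>y\<in>C.
          norm (iter_deriv vs (\<lambda>z. g z i) y - iter_deriv vs (\<lambda>z. f z i) y) < \<epsilon>} | f C vs i \<epsilon>.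
        f \<in> smooth_maps (\<phi> ` (U \<inter> V)) (index E) \<and> compact C \<and> C \<subseteq> \<phi> ` (U \<inter> V) \<and> i \<in> index E \<and> 0 < \<epsilon>}"
    then consider "S = smooth_maps (\<phi> ` (U \<inter> V)) (index E)" | f C vs i \<epsilon> where
      "S = {g \<in> smooth_maps (\<phi> ` (U \<inter> V)) (index E). \<forall>y\<in>C.
          norm (iter_deriv vs (\<lambda>z. g z i) y - iter_deriv vs (\<lambda>z. f z i) y) < \<epsilon>}"
      "f \<in> smooth_maps (\<phi> ` (U \<inter> V)) (index E)" "compact C" "C \<subseteq> \<phi> ` (U \<inter> V)" "i \<in> index E" "0 < \<epsilon>"
      by blast
    then show "\<exists>C. openin T\<Gamma> C \<and> s \<in> C \<and> (\<forall>z\<in>C. z \<in> smooth_sections M E \<and> local_rep U \<phi> V \<tau> z \<in> S) \<and> ?Q C"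
    proof cases
      case 1
      then show ?thesis using full s local_rep_smooth_maps[OF _ c V]
        by (intro exI[of _ "smooth_sections M E"]) simp
    next
      case 2
      let ?C = "{s \<in> smooth_sections M E. \<forall>y\<in>C.
        norm (iter_deriv vs (\<lambda>y. local_rep U \<phi> V \<tau> s y i) y - iter_deriv vs (\<lambda>y. f y i) y) < \<epsilon>}"
      show ?thesis
        using openin_section_ball[OF c V 2(2-6)] section_ball_convex[OF c V 2(4,5)] s local_rep_smooth_maps[OF _ c V]
        by (intro exI[of _ ?C]) (simp add: 2(1))
    qed
  qed
  fix W assume W: "openin T\<Gamma> W \<and> \<zero>\<^bsub>?R\<^esub> \<in> W"
  have "\<exists>C. openin T\<Gamma> C \<and> \<zero>\<^bsub>?R\<^esub> \<in> C \<and> (\<forall>z\<in>C. z \<in> smooth_sections M E \<and> z \<in> W) \<and> ?Q C"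
  proof (rule topology_generated_local_base[where Q = ?Q and g = "\<lambda>z. z", OF _ K_convex_Int])
    show "openin (topology_generated_by (insert (smooth_sections M E)
      {{s \<in> smooth_sections M E. local_rep U \<phi> V \<tau> s \<in> B} | U \<phi> V \<tau> B.
        (U, \<phi>) \<in> atlas M \<and> (V, \<tau>) \<in> trivs E \<and> openin (smooth_topology (\<phi> ` (U \<inter> V)) (index E)) B})) W"
      using W by (simp add: section_topology_def)
    show "\<zero>\<^bsub>?R\<^esub> \<in> smooth_sections M E" "\<zero>\<^bsub>?R\<^esub> \<in> W" using S.M.zero_closed W by simp_all
    fix S s assume s: "s \<in> smooth_sections M E" "s \<in> S"
      and "S \<in> insert (smooth_sections M E)
      {{s \<in> smooth_sections M E. local_rep U \<phi> V \<tau> s \<in> B} | U \<phi> V \<tau> B.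
        (U, \<phi>) \<in> atlas M \<and> (V, \<tau>) \<in> trivs E \<and> openin (smooth_topology (\<phi> ` (U \<inter> V)) (index E)) B}"
    then consider "S = smooth_sections M E" | U \<phi> V \<tau> B where
      "S = {s \<in> smooth_sections M E. local_rep U \<phi> V \<tau> s \<in> B}" "(U, \<phi>) \<in> atlas M" "(V, \<tau>) \<in> trivs E"
      "openin (smooth_topology (\<phi> ` (U \<inter> V)) (index E)) B" by blast
    then show "\<exists>C. openin T\<Gamma> C \<and> s \<in> C \<and> (\<forall>z\<in>C. z \<in> smooth_sections M E \<and> z \<in> S) \<and> ?Q C"
    proof cases
      case 1
      then show ?thesis using full s by (intro exI[of _ "smooth_sections M E"]) simp
    next
      case 2
      then show ?thesis using inner[OF 2(2-4) s(1)] s by simp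
    qed
  qed
  then show "\<exists>C. openin T\<Gamma> C \<and> \<zero>\<^bsub>?R\<^esub> \<in> C \<and> C \<subseteq> W \<and> ?Q C" by (elim exE) (rule exI, auto)
qed (simp add: topspace_section_topology,
  (unfold restrict_scalars_simps, (rule continuous_section_add continuous_section_smult)+))

lemma Hausdorff_sections: "Hausdorff_space T\<Gamma>"
  unfolding Hausdorff_space_def
proof (intro allI impI)
  fix s t assume st: "s \<in> topspace T\<Gamma> \<and> t \<in> topspace T\<Gamma> \<and> s \<noteq> t"
  then have s: "s \<in> smooth_sections M E" and t: "t \<in> smooth_sections M E" by (simp_all add: topspace_section_topology)
  have "\<exists>x\<in>mset M. s x \<noteq> t x"
  proof (rule ccontr)
    assume "\<not> ?thesis"
    then have "s = t" using extensional_eqI[OF sectionD(2)[OF s] sectionD(2)[OF t]] by blast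
    then show False using st by simp
  qed
  then obtain x where x: "x \<in> mset M" "s x \<noteq> t x" by blast
  obtain V \<tau> where V: "(V, \<tau>) \<in> trivs E" "x \<in> V" using triv_cover[OF x(1)] by blast
  obtain U \<phi> where c: "(U, \<phi>) \<in> atlas M" "x \<in> U" using atlas_cover[OF x(1)] by blast
  obtain i where i: "i \<in> index E" "\<tau> x (s x) i \<noteq> \<tau> x (t x) i"
    using triv_eqI[OF V sectionD(1)[OF s x(1)] sectionD(1)[OF t x(1)]] x(2) by blast
  define \<epsilon> where "\<epsilon> = norm (\<tau> x (s x) i - \<tau> x (t x) i) / 2"
  have \<epsilon>: "0 < \<epsilon>" using i(2) by (simp add: \<epsilon>_def)
  have y: "\<phi> x \<in> \<phi> ` (U \<inter> V)" using c(2) V(2) by blast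
  have rep: "local_rep U \<phi> V \<tau> r (\<phi> x) i = \<tau> x (r x) i" for r
    using local_rep_chart[OF c(1) y] by (simp add: chart_inv[OF c])
  \<comment> \<open>With a one-point compact set and no derivatives, the generating sets control the
    value of one coordinate at \<open>x\<close>, which tells \<open>s\<close> and \<open>t\<close>
    apart.\<close>
  let ?S = "\<lambda>r. {r' \<in> smooth_sections M E. \<forall>y\<in>{\<phi> x}.
      norm (iter_deriv [] (\<lambda>y. local_rep U \<phi> V \<tau> r' y i) y - iter_deriv [] (\<lambda>y. local_rep U \<phi> V \<tau> r y i) y) < \<epsilon>}"
  have o: "openin T\<Gamma> (?S r)" if "r \<in> smooth_sections M E" for r
    by (rule openin_section_ball[OF c(1) V(1) local_rep_smooth_maps[OF that c(1) V(1)] _ _ i(1) \<epsilon>]) (use y in auto)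
  have "disjnt (?S s) (?S t)"
  proof (rule ccontr)
    assume "\<not> ?thesis"
    then obtain r where "norm (\<tau> x (r x) i - \<tau> x (s x) i) < \<epsilon>" "norm (\<tau> x (r x) i - \<tau> x (t x) i) < \<epsilon>"
      by (auto simp: disjnt_iff rep)
    then have "norm (\<tau> x (s x) i - \<tau> x (t x) i) < \<epsilon> + \<epsilon>"
      by (metis dist_norm dist_commute dist_triangle_less_add)
    then show False by (simp add: \<epsilon>_def)
  qed
  then show "\<exists>A B. openin T\<Gamma> A \<and> openin T\<Gamma> B \<and> s \<in> A \<and> t \<in> B \<and> disjnt A B"
    using o[OF s] o[OF t] s t \<epsilon> by (intro exI[of _ "?S s"] exI[of _ "?S t"]) simp
qed

end

subsection \<open>Finite global frames\<close>

context smooth_bundle begin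

text \<open>At a given point at most one function of each colour is active, so products of sums over
  one colour have no mixed terms. The expansion is tested with functionals because it then involves
  scalars only and can be applied in one factor of a tensor.\<close>

lemma finite_global_frame:
  obtains J :: "((nat \<times> nat) \<times> 'i) set" and t \<omega> where "finite J"
    "\<And>j. j \<in> J \<Longrightarrow> t j \<in> smooth_sections M E" "\<And>j. j \<in> J \<Longrightarrow> dual_section (\<omega> j)"
    "\<And>x f e. x \<in> mset M \<Longrightarrow> linear_functional (fiber E x) f \<Longrightarrow> e \<in> carrier (fiber E x) \<Longrightarrow>
      f e = (\<Sum>j\<in>J. \<omega> j x e * f (t j x))"
proof -
  let ?\<V> = "{V. \<exists>\<tau>. (V, \<tau>) \<in> trivs E}"
  have cov: "openin (mtop M) V" if "V \<in> ?\<V>" for V using that triv(1) by blast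
  have cov': "mset M \<subseteq> \<Union>?\<V>" using triv_cover by blast
  obtain I :: "(nat \<times> 'm set) set" and g :: "nat \<times> 'm set \<Rightarrow> 'm \<Rightarrow> real" and col :: "nat \<times> 'm set \<Rightarrow> nat \<times> nat" and V
    where col: "finite (col ` I)" and g: "\<And>s. s \<in> I \<Longrightarrow> smooth_fun_on M (mset M) (g s)"
      and V: "\<And>s. s \<in> I \<Longrightarrow> V s \<in> ?\<V>"
      and Z: "\<And>s. s \<in> I \<Longrightarrow> \<exists>Z. closedin (mtop M) Z \<and> Z \<subseteq> V s \<and> {x. g s x \<noteq> 0} \<subseteq> Z"
      and disj: "\<And>s s' x. s \<in> I \<Longrightarrow> s' \<in> I \<Longrightarrow> col s = col s' \<Longrightarrow> g s x \<noteq> 0 \<Longrightarrow> g s' x \<noteq> 0 \<Longrightarrow> s = s'"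
      and act: "\<And>x. x \<in> mset M \<Longrightarrow> \<exists>s\<in>I. g s x \<noteq> 0"
      and lf: "\<And>x. x \<in> mset M \<Longrightarrow> \<exists>W. openin (mtop M) W \<and> x \<in> W \<and> finite {s \<in> I. \<exists>y\<in>W. g s y \<noteq> 0}"
    by (rule colored_functions[OF cov cov']) (assumption, rule that)
  from V have "\<forall>s\<in>I. \<exists>\<sigma>. (V s, \<sigma>) \<in> trivs E" by simp
  from bchoice[OF this] obtain \<tau> where "\<forall>s\<in>I. (V s, \<tau> s) \<in> trivs E" by (elim exE) (rule that)
  then have \<tau>: "(V s, \<tau> s) \<in> trivs E" if "s \<in> I" for s using that by blast
  define S where "S c x = {s \<in> I. col s = c \<and> g s x \<noteq> 0}" for c x
  define A where "A x = {s \<in> I. g s x \<noteq> 0}" for x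
  have finA: "finite (A x)" if x: "x \<in> mset M" for x
  proof -
    obtain W where "x \<in> W" "finite {s \<in> I. \<exists>y\<in>W. g s y \<noteq> 0}" using lf[OF x] by blast
    then show ?thesis unfolding A_def by (elim finite_subset[rotated]) auto
  qed
  have SA: "S c x \<subseteq> A x" for c x by (auto simp: S_def A_def)
  have finS: "finite (S c x)" if "x \<in> mset M" for c x by (rule finite_subset[OF SA finA[OF that]])
  have SI: "s \<in> I" "x \<in> V s" if "s \<in> S c x" for s c x using that Z[of s] by (auto simp: S_def)
  have AI: "s \<in> I" "x \<in> V s" if "s \<in> A x" for s x using that Z[of s] by (auto simp: A_def)
  \<comment> \<open>Serves both the frame sections and the dual sections: \<open>h s\<close> is
    smooth on \<open>V s \<inter> W\<close> only, the cutoff extends the product by 0, and local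
    finiteness handles the sum.\<close>
  have sum_smooth: "smooth_fun_on M W (\<lambda>x. \<Sum>s\<in>S c x. of_real (g s x) * h s x)"
    if W: "openin (mtop M) W" and h: "\<And>s. s \<in> I \<Longrightarrow> smooth_fun_on M (V s \<inter> W) (h s)"
    for W c and h :: "nat \<times> 'm set \<Rightarrow> 'm \<Rightarrow> 'k"
  proof -
    let ?I = "{s \<in> I. col s = c}" and ?f = "\<lambda>s x. of_real (g s x) * h s x"
    have "smooth_fun_on M W (\<lambda>x. \<Sum>s\<in>{s \<in> ?I. ?f s x \<noteq> 0}. ?f s x)"
    proof (rule smooth_fun_on_locally_finite_sum[OF W])
      show "smooth_fun_on M W (?f s)" if "s \<in> ?I" for s
      proof -
        have s: "s \<in> I" using that by simp
        then obtain Z where "closedin (mtop M) Z" "Z \<subseteq> V s" "{x. g s x \<noteq> 0} \<subseteq> Z" using Z by blast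
        then show ?thesis by (rule smooth_fun_on_cutoff[OF g[OF s] triv(1)[OF \<tau>[OF s]] W _ _ _ h[OF s]])
      qed
      fix x assume "x \<in> W"
      then have "x \<in> mset M" using openin_subset[OF W] by blast
      then obtain W' where W': "openin (mtop M) W'" "x \<in> W'" "finite {s \<in> I. \<exists>y\<in>W'. g s y \<noteq> 0}" using lf by blast
      have "finite {s \<in> ?I. \<exists>y\<in>W'. ?f s y \<noteq> 0}" by (rule finite_subset[OF _ W'(3)]) auto
      then show "\<exists>W'. openin (mtop M) W' \<and> x \<in> W' \<and> finite {s \<in> ?I. \<exists>y\<in>W'. ?f s y \<noteq> 0}" using W' by blast
    qed
    then show ?thesis
    proof (rule smooth_fun_on_cong[OF W, rotated])
      fix x assume "x \<in> W"
      then have "x \<in> mset M" using openin_subset[OF W] by blast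
      then show "(\<Sum>s\<in>{s \<in> ?I. ?f s x \<noteq> 0}. ?f s x) = (\<Sum>s\<in>S c x. ?f s x)"
        by (intro sum.mono_neutral_left finS) (auto simp: S_def)
    qed
  qed
  \<comment> \<open>Squares occur because a section \<open>t\<close> and its dual section
    \<open>\<omega>\<close> each carry one factor \<open>g s\<close>. Dividing by \<open>G\<close>
    makes the sum of these products 1, in the manner of a partition of unity.\<close>
  define G where "G x = (\<Sum>s\<in>A x. (g s x)\<^sup>2)" for x
  have G_pos: "G x > 0" if x: "x \<in> mset M" for x
  proof -
    obtain s where "s \<in> A x" using act[OF x] by (auto simp: A_def)
    then have "A x \<noteq> {}" by blast
    then show ?thesis unfolding G_def by (rule sum_pos[OF finA[OF x]]) (simp add: A_def)
  qed
  have G_smooth: "smooth_fun_on M (mset M) G"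
  proof -
    have "smooth_fun_on M (mset M) (\<lambda>x. \<Sum>s\<in>{s \<in> I. g s x * g s x \<noteq> 0}. g s x * g s x)"
    proof (rule smooth_fun_on_locally_finite_sum[OF openin_topspace])
      show "smooth_fun_on M (mset M) (\<lambda>x. g s x * g s x)" if "s \<in> I" for s
        by (intro smooth_fun_on_mult openin_topspace g that)
      show "\<exists>W'. openin (mtop M) W' \<and> x \<in> W' \<and> finite {s \<in> I. \<exists>y\<in>W'. g s y * g s y \<noteq> 0}"
        if "x \<in> mset M" for x using lf[OF that] by simp
    qed
    moreover have "G = (\<lambda>x. \<Sum>s\<in>{s \<in> I. g s x * g s x \<noteq> 0}. g s x * g s x)"
      by (rule ext) (simp add: G_def A_def power2_eq_square)
    ultimately show ?thesis by simp
  qed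
  define J where "J = col ` I \<times> index E"
  define t where "t = (\<lambda>(c, a). \<lambda>x\<in>mset M.
    \<Oplus>\<^bsub>fiber E x\<^esub>s\<in>S c x. of_real (g s x) \<odot>\<^bsub>fiber E x\<^esub> local_frame (\<tau> s) x a)"
  define \<omega> where "\<omega> = (\<lambda>(c, a) x e. of_real (inverse (G x)) * (\<Sum>s\<in>S c x. of_real (g s x) * \<tau> s x e a))"
  have lfr: "local_frame (\<tau> s) x a \<in> carrier (fiber E x)" if "s \<in> S c x" "a \<in> index E" for s c x a
    using local_frame(1)[OF \<tau>[OF SI(1)[OF that(1)]] SI(2)[OF that(1)] that(2)] .
  have t_coord: "t (c, a) x \<in> carrier (fiber E x)"
    "linear_functional (fiber E x) f \<Longrightarrow> f (t (c, a) x) = (\<Sum>s\<in>S c x. of_real (g s x) * f (local_frame (\<tau> s) x a))"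
    if x: "x \<in> mset M" and a: "a \<in> index E" for c a x f
  proof -
    interpret F: module K "fiber E x" by (rule fiber_module[OF x])
    have car: "of_real (g s x) \<odot>\<^bsub>fiber E x\<^esub> local_frame (\<tau> s) x a \<in> carrier (fiber E x)" if "s \<in> S c x" for s
      using lfr[OF that a] by simp
    then show "t (c, a) x \<in> carrier (fiber E x)" using x by (auto simp: t_def intro!: F.M.finsum_closed)
    assume f: "linear_functional (fiber E x) f"
    have "f (t (c, a) x) = (\<Sum>s\<in>S c x. f (of_real (g s x) \<odot>\<^bsub>fiber E x\<^esub> local_frame (\<tau> s) x a))"
      using linear_functional_finsum[OF F.M.abelian_group_axioms f finS[OF x] car] x by (simp add: t_def)
    also have "\<dots> = (\<Sum>s\<in>S c x. of_real (g s x) * f (local_frame (\<tau> s) x a))"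
      by (rule sum.cong[OF refl]) (rule linear_functionalD(2)[OF f lfr[OF _ a]])
    finally show "f (t (c, a) x) = \<dots>" .
  qed
  have t_section: "t (c, a) \<in> smooth_sections M E" if a: "a \<in> index E" for c a
  proof (rule sectionI)
    show "t (c, a) x \<in> carrier (fiber E x)" if "x \<in> mset M" for x by (rule t_coord(1)[OF that a])
    show "t (c, a) \<in> extensional (mset M)" by (simp add: t_def)
    fix W \<sigma> i assume W: "(W, \<sigma>) \<in> trivs E" and i: "i \<in> index E"
    have "smooth_fun_on M W (\<lambda>x. \<Sum>s\<in>S c x. of_real (g s x) * \<sigma> x (local_frame (\<tau> s) x a) i)"
      by (rule sum_smooth[OF triv(1)[OF W]]) (rule transition_smooth[OF \<tau> W i a])
    then show "smooth_fun_on M W (\<lambda>x. \<sigma> x (t (c, a) x) i)"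
    proof (rule smooth_fun_on_cong[OF triv(1)[OF W], rotated])
      fix x assume x: "x \<in> W"
      then have "x \<in> mset M" using triv_subset[OF W] by blast
      from t_coord(2)[OF this a triv_functional[OF W x], symmetric]
      show "(\<Sum>s\<in>S c x. of_real (g s x) * \<sigma> x (local_frame (\<tau> s) x a) i) = \<sigma> x (t (c, a) x) i" .
    qed
  qed
  have \<omega>_section: "dual_section (\<omega> (c, a))" if a: "a \<in> index E" for c a
    unfolding dual_section_def
  proof (intro conjI ballI allI impI)
    fix x assume x: "x \<in> mset M"
    have f: "\<tau> s x (e \<oplus>\<^bsub>fiber E x\<^esub> e') a = \<tau> s x e a + \<tau> s x e' a" "\<tau> s x (k \<odot>\<^bsub>fiber E x\<^esub> e) a = k * \<tau> s x e a"
      if "s \<in> S c x" "e \<in> carrier (fiber E x)" "e' \<in> carrier (fiber E x)" for s e e' k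
      using linear_functionalD(1,2)[OF triv_functional[OF \<tau>[OF SI(1)[OF that(1)]] SI(2)[OF that(1)], of a]] that(2,3)
      by simp_all
    have 1: "(\<Sum>s\<in>S c x. of_real (g s x) * \<tau> s x (e \<oplus>\<^bsub>fiber E x\<^esub> e') a) =
        (\<Sum>s\<in>S c x. of_real (g s x) * \<tau> s x e a) + (\<Sum>s\<in>S c x. of_real (g s x) * \<tau> s x e' a)"
      if "e \<in> carrier (fiber E x)" "e' \<in> carrier (fiber E x)" for e e'
      unfolding sum.distrib[symmetric] by (rule sum.cong[OF refl]) (simp add: f that algebra_simps)
    have 2: "(\<Sum>s\<in>S c x. of_real (g s x) * \<tau> s x (k \<odot>\<^bsub>fiber E x\<^esub> e) a) =
        k * (\<Sum>s\<in>S c x. of_real (g s x) * \<tau> s x e a)"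
      if "e \<in> carrier (fiber E x)" for e k
      unfolding sum_distrib_left by (rule sum.cong[OF refl]) (simp add: f(2)[OF _ that that] algebra_simps)
    show "linear_functional (fiber E x) (\<omega> (c, a) x)"
      unfolding linear_functional_def \<omega>_def by (simp add: 1 2 algebra_simps)
  next
    fix W \<sigma> b assume W: "(W, \<sigma>) \<in> trivs E" and b: "b \<in> index E"
    have "smooth_fun_on M (V s \<inter> W) (\<lambda>x. \<tau> s x (local_frame \<sigma> x b) a)" if "s \<in> I" for s
      using transition_smooth[OF W \<tau>[OF that] a b] by (simp add: Int_commute)
    then have "smooth_fun_on M W (\<lambda>x. \<Sum>s\<in>S c x. of_real (g s x) * \<tau> s x (local_frame \<sigma> x b) a)"
      by (rule sum_smooth[OF triv(1)[OF W]])
    moreover have "smooth_fun_on M W (\<lambda>x. of_real (inverse (G x)) :: 'k)"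
    proof (intro smooth_fun_on_bounded_linear[OF _ bounded_linear_of_real] smooth_fun_on_inverse triv(1)[OF W])
      show "smooth_fun_on M W G" by (rule smooth_fun_on_subset[OF G_smooth triv_subset[OF W]])
      show "G x \<noteq> 0" if "x \<in> W" for x using G_pos[of x] that triv_subset[OF W] by auto
    qed
    ultimately show "smooth_fun_on M W (\<lambda>x. \<omega> (c, a) x (local_frame \<sigma> x b))"
      unfolding \<omega>_def prod.case by (intro smooth_fun_on_mult triv(1)[OF W])
  qed
  show ?thesis
  proof (rule that[of J t \<omega>])
    show "finite J" using col finite_index by (simp add: J_def)
    show "t j \<in> smooth_sections M E" if "j \<in> J" for j
    proof -
      obtain c a where j: "j = (c, a)" by (cases j)
      show ?thesis unfolding j by (rule t_section) (use that j in \<open>simp add: J_def\<close>)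
    qed
    show "dual_section (\<omega> j)" if "j \<in> J" for j
    proof -
      obtain c a where j: "j = (c, a)" by (cases j)
      show ?thesis unfolding j by (rule \<omega>_section) (use that j in \<open>simp add: J_def\<close>)
    qed
    fix x f e assume x: "x \<in> mset M" and f: "linear_functional (fiber E x) f" and e: "e \<in> carrier (fiber E x)"
    let ?u = "of_real (inverse (G x)) :: 'k"
    \<comment> \<open>\<open>S c x\<close> has at most one element, by disjointness of supports
      within a colour.\<close>
    have prod: "(\<Sum>s\<in>S c x. p s) * (\<Sum>s\<in>S c x. q s) = (\<Sum>s\<in>S c x. p s * q s)" for c and p q :: "nat \<times> 'm set \<Rightarrow> 'k"
    proof (cases "S c x = {}")
      case False
      then obtain s where s: "s \<in> S c x" by blast
      have "s' = s" if "s' \<in> S c x" for s' using that s disj[of s' s x] by (simp add: S_def)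
      then have "S c x = {s}" using s by blast
      then show ?thesis by simp
    qed simp
    have *: "(\<Sum>a\<in>index E. \<omega> (c, a) x e * f (t (c, a) x)) = (\<Sum>s\<in>S c x. ?u * of_real ((g s x)\<^sup>2) * f e)" for c
    proof -
      have "(\<Sum>a\<in>index E. \<omega> (c, a) x e * f (t (c, a) x)) =
          (\<Sum>a\<in>index E. \<Sum>s\<in>S c x. ?u * of_real ((g s x)\<^sup>2) * (\<tau> s x e a * f (local_frame (\<tau> s) x a)))"
      proof (rule sum.cong[OF refl])
        fix a assume a: "a \<in> index E"
        have "\<omega> (c, a) x e * f (t (c, a) x) = ?u * ((\<Sum>s\<in>S c x. of_real (g s x) * \<tau> s x e a) *
            (\<Sum>s\<in>S c x. of_real (g s x) * f (local_frame (\<tau> s) x a)))"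
          by (simp add: \<omega>_def t_coord(2)[OF x a f])
        also have "\<dots> = (\<Sum>s\<in>S c x. ?u * of_real ((g s x)\<^sup>2) * (\<tau> s x e a * f (local_frame (\<tau> s) x a)))"
          unfolding prod unfolding sum_distrib_left by (rule sum.cong[OF refl]) (simp add: power2_eq_square algebra_simps)
        finally show "\<omega> (c, a) x e * f (t (c, a) x) = \<dots>" .
      qed
      also have "\<dots> = (\<Sum>s\<in>S c x. \<Sum>a\<in>index E. ?u * of_real ((g s x)\<^sup>2) * (\<tau> s x e a * f (local_frame (\<tau> s) x a)))"
        by (rule sum.swap)
      also have "\<dots> = (\<Sum>s\<in>S c x. ?u * of_real ((g s x)\<^sup>2) * f e)"
      proof (rule sum.cong[OF refl])
        fix s assume s: "s \<in> S c x"
        show "(\<Sum>a\<in>index E. ?u * of_real ((g s x)\<^sup>2) * (\<tau> s x e a * f (local_frame (\<tau> s) x a))) =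
            ?u * of_real ((g s x)\<^sup>2) * f e"
          unfolding functional_expand[OF \<tau>[OF SI(1)[OF s]] SI(2)[OF s] e f] by (rule sum_distrib_left[symmetric])
      qed
      finally show ?thesis .
    qed
    have "(\<Sum>j\<in>J. \<omega> j x e * f (t j x)) = (\<Sum>c\<in>col ` I. \<Sum>a\<in>index E. \<omega> (c, a) x e * f (t (c, a) x))"
      unfolding J_def sum.cartesian_product by (rule sum.cong[OF refl]) (simp add: case_prod_unfold)
    also have "\<dots> = (\<Sum>c\<in>col ` I. \<Sum>s\<in>{s \<in> A x. col s = c}. ?u * of_real ((g s x)\<^sup>2) * f e)"
      unfolding * by (intro sum.cong refl) (auto simp: S_def A_def)
    \<comment> \<open>The active indices are grouped by their colour.\<close>
    also have "\<dots> = (\<Sum>s\<in>A x. ?u * of_real ((g s x)\<^sup>2) * f e)"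
      by (rule sum.group[OF finA[OF x] col]) (auto simp: A_def)
    also have "\<dots> = ?u * of_real (G x) * f e"
      by (simp add: G_def sum_distrib_left sum_distrib_right)
    also have "\<dots> = f e" using G_pos[OF x] by (simp flip: of_real_mult)
    finally show "f e = (\<Sum>j\<in>J. \<omega> j x e * f (t j x))" by simp
  qed
qed

text \<open>Coordinates in a trivialisation are linear functionals and separate the points of a
  fiber.\<close>

lemma section_eqI:
  assumes s: "s \<in> smooth_sections M E" and t: "t \<in> smooth_sections M E"
    and eq: "\<And>x f. x \<in> mset M \<Longrightarrow> linear_functional (fiber E x) f \<Longrightarrow> f (s x) = f (t x)"
  shows "s = t"
proof (rule extensional_eqI[OF sectionD(2)[OF s] sectionD(2)[OF t]])
  fix x assume x: "x \<in> mset M"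
  obtain V \<tau> where V: "(V, \<tau>) \<in> trivs E" "x \<in> V" using triv_cover[OF x] by blast
  show "s x = t x"
    by (rule triv_eqI[OF V sectionD(1)[OF s x] sectionD(1)[OF t x] eq[OF x triv_functional[OF V]]])
qed

lemma functional_section_finsum:
  assumes x: "x \<in> mset M" and f: "linear_functional (fiber E x) f" and J: "finite J"
    and s: "\<And>j. j \<in> J \<Longrightarrow> s j \<in> smooth_sections M E"
  shows "f ((\<Oplus>\<^bsub>\<Gamma>\<^esub>j\<in>J. s j) x) = (\<Sum>j\<in>J. f (s j x))"
proof -
  have "(\<Oplus>\<^bsub>\<Gamma>\<^esub>j\<in>J. s j) x = (\<Oplus>\<^bsub>fiber E x\<^esub>j\<in>J. s j x)" by (rule section_finsum[OF J s x])
  moreover have "f (\<Oplus>\<^bsub>fiber E x\<^esub>j\<in>J. s j x) = (\<Sum>j\<in>J. f (s j x))"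
    by (rule linear_functional_finsum[OF fiber_group[OF x] f J sectionD(1)[OF s x]])
  ultimately show ?thesis by simp
qed

lemma dual_section_apply:
  assumes "dual_section \<omega>" "s \<in> smooth_sections M E"
  shows "(\<lambda>x\<in>mset M. \<omega> x (s x)) \<in> carrier fun_ring"
  by (rule smooth_ring_restrictI[OF dual_section_smooth[OF assms]])

lemma section_expand:
  assumes J: "finite J" and t: "\<And>j. j \<in> J \<Longrightarrow> t j \<in> smooth_sections M E"
    and \<omega>: "\<And>j. j \<in> J \<Longrightarrow> dual_section (\<omega> j)"
    and exp: "\<And>x f e. x \<in> mset M \<Longrightarrow> linear_functional (fiber E x) f \<Longrightarrow> e \<in> carrier (fiber E x) \<Longrightarrow>
      f e = (\<Sum>j\<in>J. \<omega> j x e * f (t j x))"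
    and s: "s \<in> smooth_sections M E"
  shows "s = (\<Oplus>\<^bsub>\<Gamma>\<^esub>j\<in>J. (\<lambda>x\<in>mset M. \<omega> j x (s x)) \<odot>\<^bsub>\<Gamma>\<^esub> t j)"
proof -
  interpret G: module fun_ring \<Gamma> by (rule module_section_module)
  have c: "(\<lambda>x\<in>mset M. \<omega> j x (s x)) \<odot>\<^bsub>\<Gamma>\<^esub> t j \<in> carrier \<Gamma>" if "j \<in> J" for j
    by (rule G.smult_closed[OF dual_section_apply[OF \<omega>[OF that] s]]) (simp add: t[OF that])
  show ?thesis
  proof (rule section_eqI[OF s])
    show "(\<Oplus>\<^bsub>\<Gamma>\<^esub>j\<in>J. (\<lambda>x\<in>mset M. \<omega> j x (s x)) \<odot>\<^bsub>\<Gamma>\<^esub> t j) \<in> smooth_sections M E"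
      unfolding section_module_simps(1)[symmetric] by (rule G.M.finsum_closed) (rule Pi_I, rule c)
    fix x f assume x: "x \<in> mset M" and f: "linear_functional (fiber E x) f"
    have "f ((\<Oplus>\<^bsub>\<Gamma>\<^esub>j\<in>J. (\<lambda>x\<in>mset M. \<omega> j x (s x)) \<odot>\<^bsub>\<Gamma>\<^esub> t j) x) =
        (\<Sum>j\<in>J. f (((\<lambda>x\<in>mset M. \<omega> j x (s x)) \<odot>\<^bsub>\<Gamma>\<^esub> t j) x))"
      by (rule functional_section_finsum[OF x f J c[unfolded section_module_simps(1)]])
    also have "\<dots> = (\<Sum>j\<in>J. \<omega> j x (s x) * f (t j x))"
      by (rule sum.cong[OF refl]) (simp add: x linear_functionalD(2)[OF f sectionD(1)[OF t x]])
    also have "\<dots> = f (s x)" by (rule exp[OF x f sectionD(1)[OF s x], symmetric])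
    finally show "f (s x) = f ((\<Oplus>\<^bsub>\<Gamma>\<^esub>j\<in>J. (\<lambda>x\<in>mset M. \<omega> j x (s x)) \<odot>\<^bsub>\<Gamma>\<^esub> t j) x)" by simp
  qed
qed

end

subsection \<open>Tensor products of bundles\<close>

lemma linear_functional_sum:
  assumes "\<And>i. i \<in> I \<Longrightarrow> linear_functional V (g i)"
  shows "linear_functional V (\<lambda>u. \<Sum>i\<in>I. g i u)"
  unfolding linear_functional_def sum.distrib[symmetric] sum_distrib_left
  by (intro conjI ballI allI sum.cong refl linear_functionalD(1,2)[OF assms])

lemma linear_functional_mult_right:
  "linear_functional V g \<Longrightarrow> linear_functional V (\<lambda>u. g u * c)"
  by (simp add: linear_functional_def algebra_simps)

lemma linear_functional_hom_comp:
  assumes "h \<in> module_hom ring_of_type_algebra V W" "linear_functional W f"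
  shows "linear_functional V (\<lambda>u. f (h u))"
  unfolding linear_functional_def using module_homD(2-4)[OF assms(1)] linear_functionalD(1,2)[OF assms(2)] by simp

lemma linear_functional_coord_space:
  "linear_functional (coord_space I) (\<lambda>v. v i)"
  by (simp add: linear_functional_def)

lemma module_coord_space:
  "module ring_of_type_algebra (coord_space I :: ('k::real_normed_field, 'i \<Rightarrow> 'k) module)"
proof (rule moduleI)
  show "abelian_group (coord_space I :: ('k, 'i \<Rightarrow> 'k) module)"
  proof (rule abelian_groupI)
    fix v :: "'i \<Rightarrow> 'k" assume "v \<in> carrier (coord_space I)"
    then show "\<exists>w\<in>carrier (coord_space I). w \<oplus>\<^bsub>coord_space I\<^esub> v = \<zero>\<^bsub>coord_space I\<^esub>"
      by (intro bexI[of _ "\<lambda>i. - v i"]) simp_all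
  qed (auto simp: algebra_simps)
qed (auto simp: algebra_simps intro: cring_from_type_algebra)

lemma linear_functional_tensor_eqI:
  fixes V :: "('k::{real_normed_field,euclidean_space}, 'e) module" and W :: "('k, 'f) module"
  assumes V: "module ring_of_type_algebra V" and W: "module ring_of_type_algebra W"
    and f: "linear_functional (tensor_module ring_of_type_algebra V W) f"
    and g: "linear_functional (tensor_module ring_of_type_algebra V W) g"
    and eq: "\<And>p q. p \<in> carrier V \<Longrightarrow> q \<in> carrier W \<Longrightarrow>
      f (pure_tensor ring_of_type_algebra V W p q) = g (pure_tensor ring_of_type_algebra V W p q)"
    and u: "u \<in> carrier (tensor_module ring_of_type_algebra V W)"
  shows "f u = g u"
  using u
proof (induction u rule: tensor_induct[OF V W, consumes 1, case_names pure add])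
  case (pure p q)
  then show ?case by (rule eq)
next
  case (add u v)
  then show ?case using linear_functionalD(1)[OF f] linear_functionalD(1)[OF g] by simp
qed

text \<open>Both sides are linear in \<open>u\<close>, so pure tensors suffice. There the expansions
  of the two factors are applied in turn to the functionals obtained from \<open>f\<close> by fixing
  the other factor.\<close>

lemma tensor_functional_expand:
  fixes V :: "('k::{real_normed_field,euclidean_space}, 'e) module" and W :: "('k, 'f) module"
  assumes V: "module ring_of_type_algebra V" and W: "module ring_of_type_algebra W"
    and \<omega>: "\<And>j. j \<in> J \<Longrightarrow> linear_functional V (\<omega> j)" and \<rho>: "\<And>l. l \<in> L \<Longrightarrow> linear_functional W (\<rho> l)"
    and t: "\<And>j. j \<in> J \<Longrightarrow> t j \<in> carrier V" and r: "\<And>l. l \<in> L \<Longrightarrow> r l \<in> carrier W"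
    and expV: "\<And>f e. linear_functional V f \<Longrightarrow> e \<in> carrier V \<Longrightarrow> f e = (\<Sum>j\<in>J. \<omega> j e * f (t j))"
    and expW: "\<And>f e. linear_functional W f \<Longrightarrow> e \<in> carrier W \<Longrightarrow> f e = (\<Sum>l\<in>L. \<rho> l e * f (r l))"
    and f: "linear_functional (tensor_module ring_of_type_algebra V W) f"
    and u: "u \<in> carrier (tensor_module ring_of_type_algebra V W)"
  shows "f u = (\<Sum>j\<in>J. \<Sum>l\<in>L. tensor_functional V W (\<omega> j) (\<rho> l) u *
    f (pure_tensor ring_of_type_algebra V W (t j) (r l)))"
proof (rule linear_functional_tensor_eqI[OF V W f _ _ u])
  let ?p = "pure_tensor ring_of_type_algebra V W"
  show "linear_functional (tensor_module ring_of_type_algebra V W)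
    (\<lambda>u. \<Sum>j\<in>J. \<Sum>l\<in>L. tensor_functional V W (\<omega> j) (\<rho> l) u * f (?p (t j) (r l)))"
    by (intro linear_functional_sum linear_functional_mult_right tensor_functional(1)[OF V W] \<omega> \<rho>)
  fix p q assume p: "p \<in> carrier V" and q: "q \<in> carrier W"
  have "f (?p p q) = (\<Sum>j\<in>J. \<omega> j p * f (?p (t j) q))"
    by (rule expV[OF linear_functional_hom_comp[OF pure_tensor_left_hom[OF V W q] f] p])
  also have "\<dots> = (\<Sum>j\<in>J. \<omega> j p * (\<Sum>l\<in>L. \<rho> l q * f (?p (t j) (r l))))"
    by (intro sum.cong refl arg_cong2[where f = "(*)"]
        expW[OF linear_functional_hom_comp[OF pure_tensor_right_hom[OF V W t] f] q])
  also have "\<dots> = (\<Sum>j\<in>J. \<Sum>l\<in>L. tensor_functional V W (\<omega> j) (\<rho> l) (?p p q) * f (?p (t j) (r l)))"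
    unfolding sum_distrib_left
    by (intro sum.cong refl) (simp add: tensor_functional(2)[OF V W \<omega> \<rho> p q])
  finally show "f (?p p q) = \<dots>" .
qed

section \<open>The tensor product bundle and its trivialisations\<close>

locale smooth_bundle_pair = E: smooth_bundle M E + F: smooth_bundle M F
  for M :: "('m, 'b::{real_inner,heine_borel}) manifold"
    and E :: "('m, 'k::{real_normed_field,euclidean_space}, 'e, 'i) vbundle"
    and F :: "('m, 'k, 'f, 'j) vbundle"
begin

abbreviation "TB \<equiv> tensor_bundle E F"
abbreviation "pt x \<equiv> pure_tensor (ring_of_type_algebra :: 'k ring) (fiber E x) (fiber F x)"
abbreviation "tf x \<equiv> tensor_functional (fiber E x) (fiber F x)"

definition tensor_triv ::
  "('m \<Rightarrow> 'e \<Rightarrow> 'i \<Rightarrow> 'k) \<Rightarrow> ('m \<Rightarrow> 'f \<Rightarrow> 'j \<Rightarrow> 'k) \<Rightarrow> 'm \<Rightarrow> ('e \<times> 'f \<Rightarrow> 'k) set \<Rightarrow> 'i \<times> 'j \<Rightarrow> 'k" where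
  "tensor_triv \<tau> \<sigma> = (\<lambda>x u (i, j). tf x (\<lambda>e. \<tau> x e i) (\<lambda>f. \<sigma> x f j) u)"

lemma tensor_bundle_simps [simp]:
  "fiber TB x = tensor_module ring_of_type_algebra (fiber E x) (fiber F x)" "index TB = index E \<times> index F"
  by (simp_all add: tensor_bundle_def)

lemma trivs_tensor_bundle:
  "(N, \<theta>) \<in> trivs TB \<longleftrightarrow> (\<exists>V \<tau> W \<sigma>. N = V \<inter> W \<and> \<theta> = tensor_triv \<tau> \<sigma> \<and> (V, \<tau>) \<in> trivs E \<and> (W, \<sigma>) \<in> trivs F)"
  by (simp add: tensor_bundle_def tensor_triv_def tensor_functional_def)

lemma fiber_tensor:
  assumes "x \<in> mset M"
  shows "e \<in> carrier (fiber E x) \<Longrightarrow> f \<in> carrier (fiber F x) \<Longrightarrow> pt x e f \<in> carrier (fiber TB x)"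
    "linear_functional (fiber E x) \<omega> \<Longrightarrow> linear_functional (fiber F x) \<rho> \<Longrightarrow> linear_functional (fiber TB x) (tf x \<omega> \<rho>)"
    "linear_functional (fiber E x) \<omega> \<Longrightarrow> linear_functional (fiber F x) \<rho> \<Longrightarrow>
      e \<in> carrier (fiber E x) \<Longrightarrow> f \<in> carrier (fiber F x) \<Longrightarrow> tf x \<omega> \<rho> (pt x e f) = \<omega> e * \<rho> f"
  using pure_tensor_carrier[OF cring_from_type_algebra] tensor_functional[OF E.fiber_module[OF assms] F.fiber_module[OF assms]]
  by simp_all

context
  fixes V \<tau> W \<sigma> x assumes V: "(V, \<tau>) \<in> trivs E" "x \<in> V" and W: "(W, \<sigma>) \<in> trivs F" "x \<in> W"
begin

lemma in_mset: "x \<in> mset M" using E.triv_subset[OF V(1)] V(2) by blast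

lemma tensor_triv_functional: "linear_functional (fiber TB x) (\<lambda>u. tensor_triv \<tau> \<sigma> x u (i, j))"
  unfolding tensor_triv_def prod.case
  by (rule fiber_tensor(2)[OF in_mset E.triv_functional[OF V] F.triv_functional[OF W]])

lemma tensor_triv_pure:
  "e \<in> carrier (fiber E x) \<Longrightarrow> f \<in> carrier (fiber F x) \<Longrightarrow>
    tensor_triv \<tau> \<sigma> x (pt x e f) (i, j) = \<tau> x e i * \<sigma> x f j"
  unfolding tensor_triv_def prod.case
  by (rule fiber_tensor(3)[OF in_mset E.triv_functional[OF V] F.triv_functional[OF W]])

text \<open>Over the field, the local frames with their coordinates form dual bases of the two
  fibers, so \<open>algebraic_iso\<close> applies with the coordinate space as target. The resulting
  map agrees with \<open>tensor_triv\<close> on pure tensors, coordinate by coordinate, hence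
  everywhere.\<close>

lemma tensor_triv_iso:
  "module_iso ring_of_type_algebra (fiber TB x) (coord_space (index TB)) (tensor_triv \<tau> \<sigma> x)"
proof -
  let ?K = "ring_of_type_algebra :: 'k ring"
  let ?R = "coord_space (index E \<times> index F) :: ('k, 'i \<times> 'j \<Rightarrow> 'k) module"
  let ?\<beta> = "\<lambda>e f. (\<lambda>(i, j). \<tau> x e i * \<sigma> x f j) :: 'i \<times> 'j \<Rightarrow> 'k"
  interpret EX: module ?K "fiber E x" by (rule E.fiber_module[OF in_mset])
  interpret FX: module ?K "fiber F x" by (rule F.fiber_module[OF in_mset])
  interpret R: module ?K ?R by (rule module_coord_space)
  interpret T: module ?K "fiber TB x"
    unfolding tensor_bundle_simps by (rule module_tensor_module[OF EX.module_axioms FX.module_axioms])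
  note \<tau> = linear_functionalD(1,2)[OF E.triv_functional[OF V]]
    and \<sigma> = linear_functionalD(1,2)[OF F.triv_functional[OF W]]
  have \<beta>c: "?\<beta> e f \<in> carrier ?R" if "e \<in> carrier (fiber E x)" "f \<in> carrier (fiber F x)" for e f
    using E.triv_outside[OF V that(1)] F.triv_outside[OF W that(2)] by auto
  have \<beta>: "bilinear_map ?K (fiber E x) (fiber F x) ?R ?\<beta>"
    unfolding bilinear_map_def
    by (intro conjI ballI module_homI \<beta>c) (auto simp: \<tau> \<sigma> algebra_simps)
  have expand: "u = (\<Oplus>\<^bsub>?R\<^esub>a\<in>index E. \<Oplus>\<^bsub>?R\<^esub>b\<in>index F. u (a, b) \<odot>\<^bsub>?R\<^esub> ?\<beta> (E.local_frame \<tau> x a) (F.local_frame \<sigma> x b))"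
    if u: "u \<in> carrier ?R" for u
  proof
    fix kl :: "'i \<times> 'j"
    obtain k l where kl: "kl = (k, l)" by (cases kl)
    have c: "u (a, b) \<odot>\<^bsub>?R\<^esub> ?\<beta> (E.local_frame \<tau> x a) (F.local_frame \<sigma> x b) \<in> carrier ?R"
      if "a \<in> index E" "b \<in> index F" for a b
      by (rule R.smult_closed[OF _ \<beta>c[OF E.local_frame(1)[OF V that(1)] F.local_frame(1)[OF W that(2)]]]) simp
    have "(\<Oplus>\<^bsub>?R\<^esub>a\<in>index E. \<Oplus>\<^bsub>?R\<^esub>b\<in>index F. u (a, b) \<odot>\<^bsub>?R\<^esub> ?\<beta> (E.local_frame \<tau> x a) (F.local_frame \<sigma> x b)) kl =
        (\<Sum>a\<in>index E. (\<Oplus>\<^bsub>?R\<^esub>b\<in>index F. u (a, b) \<odot>\<^bsub>?R\<^esub> ?\<beta> (E.local_frame \<tau> x a) (F.local_frame \<sigma> x b)) kl)"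
      by (rule linear_functional_finsum[OF R.M.abelian_group_axioms linear_functional_coord_space E.finite_index R.M.finsum_closed])
        (rule Pi_I, rule c)
    also have "\<dots> = (\<Sum>a\<in>index E. \<Sum>b\<in>index F. (u (a, b) \<odot>\<^bsub>?R\<^esub> ?\<beta> (E.local_frame \<tau> x a) (F.local_frame \<sigma> x b)) kl)"
      by (intro sum.cong refl linear_functional_finsum[OF R.M.abelian_group_axioms linear_functional_coord_space F.finite_index] c)
    also have "\<dots> = (\<Sum>a\<in>index E. if k = a then (\<Sum>b\<in>index F. if l = b then u (a, b) else 0) else 0)"
    proof (rule sum.cong[OF refl])
      fix a assume a: "a \<in> index E"
      have "(\<Sum>b\<in>index F. (u (a, b) \<odot>\<^bsub>?R\<^esub> ?\<beta> (E.local_frame \<tau> x a) (F.local_frame \<sigma> x b)) kl) =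
          (\<Sum>b\<in>index F. if k = a then if l = b then u (a, b) else 0 else 0)"
        by (rule sum.cong[OF refl]) (simp add: kl E.local_frame(2)[OF V a] F.local_frame(2)[OF W])
      then show "(\<Sum>b\<in>index F. (u (a, b) \<odot>\<^bsub>?R\<^esub> ?\<beta> (E.local_frame \<tau> x a) (F.local_frame \<sigma> x b)) kl) =
          (if k = a then (\<Sum>b\<in>index F. if l = b then u (a, b) else 0) else 0)" by simp
    qed
    also have "\<dots> = u kl" using u E.finite_index F.finite_index by (auto simp: kl)
    finally show "u kl = (\<Oplus>\<^bsub>?R\<^esub>a\<in>index E. \<Oplus>\<^bsub>?R\<^esub>b\<in>index F. u (a, b) \<odot>\<^bsub>?R\<^esub> ?\<beta> (E.local_frame \<tau> x a) (F.local_frame \<sigma> x b)) kl"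
      by simp
  qed
  have sa: "scalar_algebra ?K (\<lambda>c. c)"
    by (rule scalar_algebra.intro) (simp_all add: cring_from_type_algebra)
  have db: "dual_bases ?K (\<lambda>c. c) (fiber E x) (fiber F x) ?R ?\<beta> (index E) (index F) (E.local_frame \<tau> x) (\<lambda>a e. \<tau> x e a)
    (F.local_frame \<sigma> x) (\<lambda>b f. \<sigma> x f b) (\<lambda>a b u. u (a, b))"
    by (intro dual_bases.intro dual_bases_axioms.intro sa EX.module_axioms FX.module_axioms R.module_axioms \<beta>
        E.finite_index F.finite_index E.local_frame(1)[OF V] F.local_frame(1)[OF W] expand
        E.frame_expand[OF V] F.frame_expand[OF W]) simp_all
  obtain \<Psi> where iso: "module_iso ?K (tensor_module ?K (fiber E x) (fiber F x)) ?R \<Psi>"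
    and \<Psi>: "\<And>e f. e \<in> carrier (fiber E x) \<Longrightarrow> f \<in> carrier (fiber F x) \<Longrightarrow> \<Psi> (pt x e f) = ?\<beta> e f"
    by (rule dual_bases.algebraic_iso[OF db]) (rule that)
  from iso have hom: "\<Psi> \<in> module_hom ?K (fiber TB x) ?R" and bij: "bij_betw \<Psi> (carrier (fiber TB x)) (carrier ?R)"
    by (simp_all add: module_iso_def)
  have eq: "\<Psi> u = tensor_triv \<tau> \<sigma> x u" if u: "u \<in> carrier (fiber TB x)" for u
  proof
    fix ij :: "'i \<times> 'j"
    obtain i j where ij: "ij = (i, j)" by (cases ij)
    show "\<Psi> u ij = tensor_triv \<tau> \<sigma> x u ij"
      unfolding ij
    proof (rule linear_functional_tensor_eqI[OF EX.module_axioms FX.module_axioms])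
      show "\<Psi> (pt x p q) (i, j) = tensor_triv \<tau> \<sigma> x (pt x p q) (i, j)"
        if "p \<in> carrier (fiber E x)" "q \<in> carrier (fiber F x)" for p q
        using \<Psi>[OF that] tensor_triv_pure[OF that] by simp
    qed (use linear_functional_hom_comp[OF hom linear_functional_coord_space] tensor_triv_functional u in simp_all)
  qed
  have "tensor_triv \<tau> \<sigma> x \<in> module_hom ?K (fiber TB x) ?R"
    using module_homD(2-4)[OF hom] T.M.a_closed T.smult_closed eq by (intro module_homI) metis+
  moreover have "bij_betw (tensor_triv \<tau> \<sigma> x) (carrier (fiber TB x)) (carrier ?R)"
    using bij bij_betw_cong[of "carrier (fiber TB x)" \<Psi>, OF eq] by blast
  ultimately show ?thesis
    using T.module_axioms R.module_axioms by (simp add: module_iso_def)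
qed

text \<open>The tensor of two frame vectors has the standard basis vector at \<open>(a, b)\<close>
  as its coordinates, and the trivialisation is injective. This computes the local frame of the
  tensor bundle.\<close>

lemma tensor_local_frame:
  assumes a: "a \<in> index E" and b: "b \<in> index F"
  shows "inv_into (carrier (fiber TB x)) (tensor_triv \<tau> \<sigma> x) (\<lambda>l. if l = (a, b) then 1 else 0) =
    pt x (E.local_frame \<tau> x a) (F.local_frame \<sigma> x b)"
proof (rule inv_into_f_eq)
  note c = E.local_frame(1)[OF V a] F.local_frame(1)[OF W b]
  show "inj_on (tensor_triv \<tau> \<sigma> x) (carrier (fiber TB x))"
    using tensor_triv_iso by (simp add: module_iso_def bij_betw_def)
  show "pt x (E.local_frame \<tau> x a) (F.local_frame \<sigma> x b) \<in> carrier (fiber TB x)"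
    by (rule fiber_tensor(1)[OF in_mset c])
  show "tensor_triv \<tau> \<sigma> x (pt x (E.local_frame \<tau> x a) (F.local_frame \<sigma> x b)) = (\<lambda>l. if l = (a, b) then 1 else 0)"
  proof
    show "tensor_triv \<tau> \<sigma> x (pt x (E.local_frame \<tau> x a) (F.local_frame \<sigma> x b)) l = (if l = (a, b) then 1 else 0)" for l
      by (cases l) (simp add: tensor_triv_pure[OF c] E.local_frame(2)[OF V a] F.local_frame(2)[OF W b])
  qed
qed

end

lemma vector_bundle_tensor: "vector_bundle M TB"
  unfolding vector_bundle_def
proof (intro conjI ballI)
  show "finite (index TB)" using E.finite_index F.finite_index by simp
  show "(\<Union>(N, \<theta>)\<in>trivs TB. N) = mset M"
  proof (intro subset_antisym subsetI)
    fix x assume "x \<in> (\<Union>(N, \<theta>)\<in>trivs TB. N)"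
    then show "x \<in> mset M" by (auto simp: trivs_tensor_bundle dest!: E.triv_subset)
  next
    fix x assume x: "x \<in> mset M"
    obtain V \<tau> where V: "(V, \<tau>) \<in> trivs E" "x \<in> V" using E.triv_cover[OF x] by blast
    obtain W \<sigma> where W: "(W, \<sigma>) \<in> trivs F" "x \<in> W" using F.triv_cover[OF x] by blast
    have "(V \<inter> W, tensor_triv \<tau> \<sigma>) \<in> trivs TB" using V W by (auto simp: trivs_tensor_bundle)
    then show "x \<in> (\<Union>(N, \<theta>)\<in>trivs TB. N)" using V W by blast
  qed
next
  fix p assume p: "p \<in> trivs TB"
  obtain N \<theta> where p': "p = (N, \<theta>)" by (cases p)
  obtain V \<tau> W \<sigma> where N: "N = V \<inter> W" "\<theta> = tensor_triv \<tau> \<sigma>" "(V, \<tau>) \<in> trivs E" "(W, \<sigma>) \<in> trivs F"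
    using p unfolding p' trivs_tensor_bundle by blast
  have "openin (mtop M) (V \<inter> W)" by (rule openin_Int[OF E.triv(1)[OF N(3)] F.triv(1)[OF N(4)]])
  then show "case p of (N, \<theta>) \<Rightarrow> openin (mtop M) N \<and>
      (\<forall>x\<in>N. module_iso ring_of_type_algebra (fiber TB x) (coord_space (index TB)) (\<theta> x))"
    unfolding p' prod.case N(1,2) by (intro conjI ballI tensor_triv_iso[OF N(3) _ N(4)]) auto
  show "case p of (N, \<theta>) \<Rightarrow> \<forall>(N', \<theta>')\<in>trivs TB. \<forall>i\<in>index TB. \<forall>j\<in>index TB.
      smooth_fun_on M (N \<inter> N') (\<lambda>x. \<theta>' x (inv_into (carrier (fiber TB x)) (\<theta> x) (\<lambda>l. if l = j then 1 else 0)) i)"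
    unfolding p' prod.case
  proof
    fix q assume q: "q \<in> trivs TB"
    obtain N' \<theta>' where q': "q = (N', \<theta>')" by (cases q)
    obtain V' \<tau>' W' \<sigma>' where N': "N' = V' \<inter> W'" "\<theta>' = tensor_triv \<tau>' \<sigma>'" "(V', \<tau>') \<in> trivs E" "(W', \<sigma>') \<in> trivs F"
      using q unfolding q' trivs_tensor_bundle by blast
    \<comment> \<open>The transition matrix is a Kronecker product: its entries are products of
      entries for \<open>E\<close> and for \<open>F\<close>.\<close>
    have "smooth_fun_on M (N \<inter> N') (\<lambda>x. \<theta>' x (inv_into (carrier (fiber TB x)) (\<theta> x) (\<lambda>l. if l = (a, b) then 1 else 0)) (i, j))"
      if a: "a \<in> index E" and b: "b \<in> index F" and i: "i \<in> index E" and j: "j \<in> index F" for a b i j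
    proof -
      have o: "openin (mtop M) (N \<inter> N')"
        unfolding N(1) N'(1) by (intro openin_Int E.triv(1)[OF N(3)] F.triv(1)[OF N(4)] E.triv(1)[OF N'(3)] F.triv(1)[OF N'(4)])
      have "smooth_fun_on M (N \<inter> N') (\<lambda>x. \<tau>' x (E.local_frame \<tau> x a) i * \<sigma>' x (F.local_frame \<sigma> x b) j)"
        by (intro E.smooth_fun_on_mult o E.smooth_fun_on_subset[OF E.transition_smooth[OF N(3) N'(3) i a]]
            E.smooth_fun_on_subset[OF F.transition_smooth[OF N(4) N'(4) j b]]) (auto simp: N(1) N'(1))
      then show ?thesis
      proof (rule E.smooth_fun_on_cong[OF o, rotated])
        fix x assume "x \<in> N \<inter> N'"
        then have x: "x \<in> V" "x \<in> W" "x \<in> V'" "x \<in> W'" by (auto simp: N(1) N'(1))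
        show "\<tau>' x (E.local_frame \<tau> x a) i * \<sigma>' x (F.local_frame \<sigma> x b) j =
          \<theta>' x (inv_into (carrier (fiber TB x)) (\<theta> x) (\<lambda>l. if l = (a, b) then 1 else 0)) (i, j)"
          unfolding N(2) N'(2) tensor_local_frame[OF N(3) x(1) N(4) x(2) a b]
          by (rule tensor_triv_pure[OF N'(3) x(3) N'(4) x(4) E.local_frame(1)[OF N(3) x(1) a] F.local_frame(1)[OF N(4) x(2) b], symmetric])
      qed
    qed
    then show "case q of (N', \<theta>') \<Rightarrow> \<forall>i\<in>index TB. \<forall>j\<in>index TB.
        smooth_fun_on M (N \<inter> N') (\<lambda>x. \<theta>' x (inv_into (carrier (fiber TB x)) (\<theta> x) (\<lambda>l. if l = j then 1 else 0)) i)"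
      unfolding q' prod.case tensor_bundle_simps(2) by (intro ballI) (elim SigmaE, simp)
  qed
qed

sublocale T: smooth_bundle M TB
  by (intro smooth_bundle.intro smooth_bundle_axioms.intro vector_bundle_tensor E.smooth_mfd_axioms)

section \<open>Sections of the tensor product bundle\<close>

text \<open>On the tensor of two local frame vectors the functional is the product of the two smooth
  pairings.\<close>

lemma dual_section_tensor:
  assumes \<omega>: "E.dual_section \<omega>" and \<rho>: "F.dual_section \<rho>"
  shows "T.dual_section (\<lambda>x. tf x (\<omega> x) (\<rho> x))"
  unfolding T.dual_section_def
proof (intro conjI ballI allI impI)
  note \<omega>l = E.dual_sectionD(1)[OF \<omega>] and \<rho>l = F.dual_sectionD(1)[OF \<rho>]
  show "linear_functional (fiber TB x) (tf x (\<omega> x) (\<rho> x))" if "x \<in> mset M" for x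
    by (rule fiber_tensor(2)[OF that \<omega>l[OF that] \<rho>l[OF that]])
  fix N \<theta> c assume N: "(N, \<theta>) \<in> trivs TB" and c: "c \<in> index TB"
  obtain a b where ab: "c = (a, b)" "a \<in> index E" "b \<in> index F" using c by auto
  obtain V \<tau> W \<sigma> where V: "N = V \<inter> W" "\<theta> = tensor_triv \<tau> \<sigma>" "(V, \<tau>) \<in> trivs E" "(W, \<sigma>) \<in> trivs F"
    using N unfolding trivs_tensor_bundle by blast
  have "smooth_fun_on M N (\<lambda>x. \<omega> x (E.local_frame \<tau> x a) * \<rho> x (F.local_frame \<sigma> x b))"
    by (intro E.smooth_fun_on_mult T.triv(1)[OF N] E.smooth_fun_on_subset[OF E.dual_sectionD(2)[OF \<omega> V(3) ab(2)]]
        E.smooth_fun_on_subset[OF F.dual_sectionD(2)[OF \<rho> V(4) ab(3)]]) (auto simp: V(1))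
  then show "smooth_fun_on M N (\<lambda>x. tf x (\<omega> x) (\<rho> x) (T.local_frame \<theta> x c))"
  proof (rule E.smooth_fun_on_cong[OF T.triv(1)[OF N], rotated])
    fix x assume "x \<in> N"
    then have x: "x \<in> V" "x \<in> W" by (auto simp: V(1))
    have xM: "x \<in> mset M" using E.triv_subset[OF V(3)] x(1) by blast
    show "\<omega> x (E.local_frame \<tau> x a) * \<rho> x (F.local_frame \<sigma> x b) = tf x (\<omega> x) (\<rho> x) (T.local_frame \<theta> x c)"
      unfolding T.local_frame_def ab(1) V(2) tensor_local_frame[OF V(3) x(1) V(4) x(2) ab(2,3)]
      by (rule fiber_tensor(3)[OF xM \<omega>l[OF xM] \<rho>l[OF xM] E.local_frame(1)[OF V(3) x(1) ab(2)] F.local_frame(1)[OF V(4) x(2) ab(3)], symmetric])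
  qed
qed

lemma tensor_section_coord:
  assumes "s \<in> smooth_sections M E" "t \<in> smooth_sections M F"
    and V: "(V, \<tau>) \<in> trivs E" "x \<in> V" and W: "(W, \<sigma>) \<in> trivs F" "x \<in> W"
  shows "tensor_triv \<tau> \<sigma> x (tensor_section M E F s t x) (i, j) = \<tau> x (s x) i * \<sigma> x (t x) j"
  using tensor_triv_pure[OF V W E.sectionD(1)[OF assms(1)] F.sectionD(1)[OF assms(2)]] in_mset[OF V W]
  by (simp add: tensor_section_def)

lemma tensor_section_smooth:
  assumes s: "s \<in> smooth_sections M E" and t: "t \<in> smooth_sections M F"
  shows "tensor_section M E F s t \<in> smooth_sections M TB"
proof (rule T.sectionI)
  show "tensor_section M E F s t x \<in> carrier (fiber TB x)" if "x \<in> mset M" for x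
    using fiber_tensor(1)[OF that E.sectionD(1)[OF s that] F.sectionD(1)[OF t that]] that
    by (simp add: tensor_section_def)
  show "tensor_section M E F s t \<in> extensional (mset M)" by (simp add: tensor_section_def)
  fix N \<theta> c assume N: "(N, \<theta>) \<in> trivs TB" and c: "c \<in> index TB"
  obtain i j where ij: "c = (i, j)" "i \<in> index E" "j \<in> index F" using c by auto
  obtain V \<tau> W \<sigma> where V: "N = V \<inter> W" "\<theta> = tensor_triv \<tau> \<sigma>" "(V, \<tau>) \<in> trivs E" "(W, \<sigma>) \<in> trivs F"
    using N unfolding trivs_tensor_bundle by blast
  have "smooth_fun_on M N (\<lambda>x. \<tau> x (s x) i * \<sigma> x (t x) j)"
    by (intro E.smooth_fun_on_mult T.triv(1)[OF N] E.smooth_fun_on_subset[OF E.sectionD(3)[OF s V(3) ij(2)]]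
        E.smooth_fun_on_subset[OF F.sectionD(3)[OF t V(4) ij(3)]]) (auto simp: V(1))
  then show "smooth_fun_on M N (\<lambda>x. \<theta> x (tensor_section M E F s t x) c)"
    unfolding ij(1) V(2)
    by (rule E.smooth_fun_on_cong[OF T.triv(1)[OF N], rotated])
      (rule tensor_section_coord[OF s t V(3) _ V(4), symmetric], auto simp: V(1))
qed

lemma bilinear_tensor_section:
  "bilinear_map E.fun_ring E.\<Gamma> F.\<Gamma> T.\<Gamma> (tensor_section M E F)"
  unfolding bilinear_map_def
proof (intro conjI ballI)
  note r = module_homD(3,4)[OF pure_tensor_right_hom[OF E.fiber_module F.fiber_module]]
    and l = module_homD(3,4)[OF pure_tensor_left_hom[OF E.fiber_module F.fiber_module]]
  show "tensor_section M E F s \<in> module_hom E.fun_ring F.\<Gamma> T.\<Gamma>" if "s \<in> carrier E.\<Gamma>" for s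
  proof (rule module_homI)
    have s: "s \<in> smooth_sections M E" using that by simp
    show "tensor_section M E F s t \<in> carrier T.\<Gamma>" if "t \<in> carrier F.\<Gamma>" for t
      using tensor_section_smooth[OF s] that by simp
    show "tensor_section M E F s (t \<oplus>\<^bsub>F.\<Gamma>\<^esub> t') = tensor_section M E F s t \<oplus>\<^bsub>T.\<Gamma>\<^esub> tensor_section M E F s t'"
      if "t \<in> carrier F.\<Gamma>" "t' \<in> carrier F.\<Gamma>" for t t'
      using that r(1) E.sectionD(1)[OF s] F.sectionD(1) by (auto simp: tensor_section_def intro!: restrict_ext)
    show "tensor_section M E F s (a \<odot>\<^bsub>F.\<Gamma>\<^esub> t) = a \<odot>\<^bsub>T.\<Gamma>\<^esub> tensor_section M E F s t"
      if "t \<in> carrier F.\<Gamma>" for a t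
      using that r(2) E.sectionD(1)[OF s] F.sectionD(1) by (auto simp: tensor_section_def intro!: restrict_ext)
  qed
  show "(\<lambda>s. tensor_section M E F s t) \<in> module_hom E.fun_ring E.\<Gamma> T.\<Gamma>" if "t \<in> carrier F.\<Gamma>" for t
  proof (rule module_homI)
    have t: "t \<in> smooth_sections M F" using that by simp
    show "tensor_section M E F s t \<in> carrier T.\<Gamma>" if "s \<in> carrier E.\<Gamma>" for s
      using tensor_section_smooth[OF _ t] that by simp
    show "tensor_section M E F (s \<oplus>\<^bsub>E.\<Gamma>\<^esub> s') t = tensor_section M E F s t \<oplus>\<^bsub>T.\<Gamma>\<^esub> tensor_section M E F s' t"
      if "s \<in> carrier E.\<Gamma>" "s' \<in> carrier E.\<Gamma>" for s s'
      using that l(1) E.sectionD(1) F.sectionD(1)[OF t] by (auto simp: tensor_section_def intro!: restrict_ext)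
    show "tensor_section M E F (a \<odot>\<^bsub>E.\<Gamma>\<^esub> s) t = a \<odot>\<^bsub>T.\<Gamma>\<^esub> tensor_section M E F s t"
      if "s \<in> carrier E.\<Gamma>" for a s
      using that l(2) E.sectionD(1) F.sectionD(1)[OF t] by (auto simp: tensor_section_def intro!: restrict_ext)
  qed
qed

text \<open>In a trivialisation the coordinates of a tensor of sections are products of coordinates,
  and smooth convergence is stable under products.\<close>

lemma continuous_tensor_section:
  "continuous_map (prod_topology E.T\<Gamma> F.T\<Gamma>) T.T\<Gamma> (\<lambda>(s, t). tensor_section M E F s t)"
proof (rule T.continuous_into_sections)
  let ?Z = "prod_topology E.T\<Gamma> F.T\<Gamma>"
  have Z: "fst z \<in> smooth_sections M E" "snd z \<in> smooth_sections M F" if "z \<in> topspace ?Z" for z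
    using that by (auto simp: E.topspace_section_topology F.topspace_section_topology)
  show "(case z of (s, t) \<Rightarrow> tensor_section M E F s t) \<in> smooth_sections M TB" if "z \<in> topspace ?Z" for z
    using tensor_section_smooth[OF Z[OF that]] by (simp add: case_prod_unfold)
  fix z0 U \<phi> N \<theta> k assume z0: "z0 \<in> topspace ?Z" and c: "(U, \<phi>) \<in> atlas M" and N: "(N, \<theta>) \<in> trivs TB"
    and k: "k \<in> index TB"
  obtain i j where ij: "k = (i, j)" "i \<in> index E" "j \<in> index F" using k by auto
  obtain V \<tau> W \<sigma> where V: "N = V \<inter> W" "\<theta> = tensor_triv \<tau> \<sigma>" "(V, \<tau>) \<in> trivs E" "(W, \<sigma>) \<in> trivs F"
    using N unfolding trivs_tensor_bundle by blast
  have o: "open (\<phi> ` (U \<inter> N))" by (rule E.open_chart_image[OF c T.triv(1)[OF N]])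
  have sub: "\<phi> ` (U \<inter> N) \<subseteq> \<phi> ` (U \<inter> V)" "\<phi> ` (U \<inter> N) \<subseteq> \<phi> ` (U \<inter> W)" by (auto simp: V(1))
  have eq: "((\<lambda>x. \<tau> x (fst z x) i) \<circ> inv_into U \<phi>) y * ((\<lambda>x. \<sigma> x (snd z x) j) \<circ> inv_into U \<phi>) y =
      ((\<lambda>x. \<theta> x ((case z of (s, t) \<Rightarrow> tensor_section M E F s t) x) k) \<circ> inv_into U \<phi>) y"
    if z: "z \<in> topspace ?Z" and "y \<in> \<phi> ` (U \<inter> N)" for z y
  proof -
    obtain x where x: "x \<in> U" "x \<in> V" "x \<in> W" "y = \<phi> x" using \<open>y \<in> \<phi> ` (U \<inter> N)\<close> V(1) by auto
    show ?thesis
      using tensor_section_coord[OF Z[OF z] V(3) x(2) V(4) x(3), of i j] x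
      by (simp add: E.chart_inv[OF c] case_prod_unfold ij(1) V(2))
  qed
  note conv = smooth_convergent_mult[OF o
      smooth_convergent_subset[OF E.smooth_convergent_sections_compose[OF continuous_map_fst z0 c V(3) ij(2)] sub(1)]
      smooth_convergent_subset[OF F.smooth_convergent_sections_compose[OF continuous_map_snd z0 c V(4) ij(3)] sub(2)]]
  show "smooth_convergent (\<phi> ` (U \<inter> N)) (nhdsin ?Z z0)
      (\<lambda>z. (\<lambda>x. \<theta> x ((case z of (s, t) \<Rightarrow> tensor_section M E F s t) x) k) \<circ> inv_into U \<phi>)
      ((\<lambda>x. \<theta> x ((case z0 of (s, t) \<Rightarrow> tensor_section M E F s t) x) k) \<circ> inv_into U \<phi>)"
  proof (rule smooth_convergent_cong[OF o _ _ conv])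
    show "eventually (\<lambda>z. \<forall>y\<in>\<phi> ` (U \<inter> N).
        ((\<lambda>x. \<tau> x (fst z x) i) \<circ> inv_into U \<phi>) y * ((\<lambda>x. \<sigma> x (snd z x) j) \<circ> inv_into U \<phi>) y =
        ((\<lambda>x. \<theta> x ((case z of (s, t) \<Rightarrow> tensor_section M E F s t) x) k) \<circ> inv_into U \<phi>) y) (nhdsin ?Z z0)"
      by (rule eventually_mono[OF eventually_nhdsin_topspace]) (intro ballI eq)
  qed (rule eq[OF z0])
qed

text \<open>The continuity that \<open>topological_iso\<close> asks of the coordinates: pairing with
  a fixed dual section is continuous on each chart image, and the result multiplies the fixed
  coordinates of \<open>s\<close>.\<close>

lemma continuous_coordinate:
  assumes \<eta>: "T.dual_section \<eta>" and s: "s \<in> smooth_sections M E"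
  shows "continuous_map T.T\<Gamma> E.T\<Gamma> (\<lambda>u. (\<lambda>x\<in>mset M. \<eta> x (u x)) \<odot>\<^bsub>E.\<Gamma>\<^esub> s)"
proof (rule E.continuous_into_sections)
  interpret G: module E.fun_ring E.\<Gamma> by (rule E.module_section_module)
  show "(\<lambda>x\<in>mset M. \<eta> x (u x)) \<odot>\<^bsub>E.\<Gamma>\<^esub> s \<in> smooth_sections M E" if "u \<in> topspace T.T\<Gamma>" for u
    using G.smult_closed[OF T.dual_section_apply[OF \<eta>], of u s] that s
    by (simp add: T.topspace_section_topology)
  fix u0 U \<phi> V \<tau> i assume u0: "u0 \<in> topspace T.T\<Gamma>" and c: "(U, \<phi>) \<in> atlas M" and V: "(V, \<tau>) \<in> trivs E"
    and i: "i \<in> index E"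
  have u0': "u0 \<in> smooth_sections M TB" using u0 by (simp add: T.topspace_section_topology)
  have o: "open (\<phi> ` (U \<inter> V))" by (rule E.open_chart_image[OF c E.triv(1)[OF V]])
  have eq: "((\<lambda>x. \<eta> x (u x)) \<circ> inv_into U \<phi>) y * ((\<lambda>x. \<tau> x (s x) i) \<circ> inv_into U \<phi>) y =
      ((\<lambda>x. \<tau> x (((\<lambda>x\<in>mset M. \<eta> x (u x)) \<odot>\<^bsub>E.\<Gamma>\<^esub> s) x) i) \<circ> inv_into U \<phi>) y"
    if "y \<in> \<phi> ` (U \<inter> V)" for u y
  proof -
    obtain x where x: "x \<in> U" "x \<in> V" "y = \<phi> x" using \<open>y \<in> \<phi> ` (U \<inter> V)\<close> by auto
    have xM: "x \<in> mset M" using E.triv_subset[OF V] x(2) by blast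
    show ?thesis
      using linear_functionalD(2)[OF E.triv_functional[OF V x(2), of i] E.sectionD(1)[OF s xM]] x xM
      by (simp add: E.chart_inv[OF c])
  qed
  have "smooth_convergent (\<phi> ` (U \<inter> V)) (nhdsin T.T\<Gamma> u0)
      (\<lambda>u. (\<lambda>x. \<eta> x (u x)) \<circ> inv_into U \<phi>) ((\<lambda>x. \<eta> x (u0 x)) \<circ> inv_into U \<phi>)"
    by (rule smooth_convergent_subset[OF T.smooth_convergent_dual_section[OF \<eta> u0' c]]) auto
  note conv = smooth_convergent_mult[OF o this smooth_convergent_const[OF E.smooth_fun_onD[OF E.sectionD(3)[OF s V i] c]]]
  show "smooth_convergent (\<phi> ` (U \<inter> V)) (nhdsin T.T\<Gamma> u0)
      (\<lambda>u. (\<lambda>x. \<tau> x (((\<lambda>x\<in>mset M. \<eta> x (u x)) \<odot>\<^bsub>E.\<Gamma>\<^esub> s) x) i) \<circ> inv_into U \<phi>)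
      ((\<lambda>x. \<tau> x (((\<lambda>x\<in>mset M. \<eta> x (u0 x)) \<odot>\<^bsub>E.\<Gamma>\<^esub> s) x) i) \<circ> inv_into U \<phi>)"
    by (rule smooth_convergent_cong[OF o _ _ conv]) (intro always_eventually allI ballI eq, assumption, rule eq)
qed

text \<open>In each fiber this is \<open>tensor_functional_expand\<close>; functionals turn the sums
  of sections into sums of scalars, and \<open>section_eqI\<close> returns to sections.\<close>

lemma tensor_section_expand:
  assumes J: "finite J" and t: "\<And>j. j \<in> J \<Longrightarrow> t j \<in> smooth_sections M E"
    and \<omega>: "\<And>j. j \<in> J \<Longrightarrow> E.dual_section (\<omega> j)"
    and expE: "\<And>x f e. x \<in> mset M \<Longrightarrow> linear_functional (fiber E x) f \<Longrightarrow> e \<in> carrier (fiber E x) \<Longrightarrow>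
      f e = (\<Sum>j\<in>J. \<omega> j x e * f (t j x))"
    and L: "finite L" and r: "\<And>l. l \<in> L \<Longrightarrow> r l \<in> smooth_sections M F"
    and \<rho>: "\<And>l. l \<in> L \<Longrightarrow> F.dual_section (\<rho> l)"
    and expF: "\<And>x f e. x \<in> mset M \<Longrightarrow> linear_functional (fiber F x) f \<Longrightarrow> e \<in> carrier (fiber F x) \<Longrightarrow>
      f e = (\<Sum>l\<in>L. \<rho> l x e * f (r l x))"
    and u: "u \<in> smooth_sections M TB"
  shows "u = (\<Oplus>\<^bsub>T.\<Gamma>\<^esub>j\<in>J. \<Oplus>\<^bsub>T.\<Gamma>\<^esub>l\<in>L.
    (\<lambda>x\<in>mset M. tf x (\<omega> j x) (\<rho> l x) (u x)) \<odot>\<^bsub>T.\<Gamma>\<^esub> tensor_section M E F (t j) (r l))"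
proof -
  interpret G: module E.fun_ring T.\<Gamma> by (rule T.module_section_module)
  let ?c = "\<lambda>j l. (\<lambda>x\<in>mset M. tf x (\<omega> j x) (\<rho> l x) (u x)) \<odot>\<^bsub>T.\<Gamma>\<^esub> tensor_section M E F (t j) (r l)"
  have c: "?c j l \<in> carrier T.\<Gamma>" if "j \<in> J" "l \<in> L" for j l
    by (rule G.smult_closed[OF T.dual_section_apply[OF dual_section_tensor[OF \<omega>[OF that(1)] \<rho>[OF that(2)]] u]])
      (simp add: tensor_section_smooth[OF t[OF that(1)] r[OF that(2)]])
  have cL: "(\<Oplus>\<^bsub>T.\<Gamma>\<^esub>l\<in>L. ?c j l) \<in> carrier T.\<Gamma>" if "j \<in> J" for j
    by (rule G.M.finsum_closed) (rule Pi_I, rule c[OF that])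
  show ?thesis
  proof (rule T.section_eqI[OF u])
    show "(\<Oplus>\<^bsub>T.\<Gamma>\<^esub>j\<in>J. \<Oplus>\<^bsub>T.\<Gamma>\<^esub>l\<in>L. ?c j l) \<in> smooth_sections M TB"
      unfolding T.section_module_simps(1)[symmetric] by (rule G.M.finsum_closed) (rule Pi_I, rule cL)
    fix x f assume x: "x \<in> mset M" and f: "linear_functional (fiber TB x) f"
    have ux: "u x \<in> carrier (fiber TB x)" by (rule T.sectionD(1)[OF u x])
    have "f ((\<Oplus>\<^bsub>T.\<Gamma>\<^esub>j\<in>J. \<Oplus>\<^bsub>T.\<Gamma>\<^esub>l\<in>L. ?c j l) x) = (\<Sum>j\<in>J. f ((\<Oplus>\<^bsub>T.\<Gamma>\<^esub>l\<in>L. ?c j l) x))"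
      by (rule T.functional_section_finsum[OF x f J cL[unfolded T.section_module_simps(1)]])
    also have "\<dots> = (\<Sum>j\<in>J. \<Sum>l\<in>L. f (?c j l x))"
      by (intro sum.cong refl T.functional_section_finsum[OF x f L c[unfolded T.section_module_simps(1)]])
    also have "\<dots> = (\<Sum>j\<in>J. \<Sum>l\<in>L. tf x (\<omega> j x) (\<rho> l x) (u x) * f (pt x (t j x) (r l x)))"
    proof (intro sum.cong refl)
      fix j l assume jl: "j \<in> J" "l \<in> L"
      have "pt x (t j x) (r l x) \<in> carrier (fiber TB x)"
        by (rule fiber_tensor(1)[OF x E.sectionD(1)[OF t[OF jl(1)] x] F.sectionD(1)[OF r[OF jl(2)] x]])
      from linear_functionalD(2)[OF f this]
      show "f (?c j l x) = tf x (\<omega> j x) (\<rho> l x) (u x) * f (pt x (t j x) (r l x))"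
        using x by (simp add: tensor_section_def)
    qed
    also have "\<dots> = f (u x)"
      by (rule tensor_functional_expand[OF E.fiber_module[OF x] F.fiber_module[OF x], symmetric])
        (use E.dual_sectionD(1)[OF \<omega> x] F.dual_sectionD(1)[OF \<rho> x] E.sectionD(1)[OF t x] F.sectionD(1)[OF r x]
          expE[OF x] expF[OF x] f ux in simp_all)
    finally show "f (u x) = f ((\<Oplus>\<^bsub>T.\<Gamma>\<^esub>j\<in>J. \<Oplus>\<^bsub>T.\<Gamma>\<^esub>l\<in>L. ?c j l) x)" by simp
  qed
qed

text \<open>Combines the global frames of \<open>E\<close> and \<open>F\<close>; the coordinates of
  a section of the tensor bundle are its pairings with the tensors of dual sections. The last two
  conclusions are kept for the continuity of the inverse.\<close>

lemma sections_dual_bases: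
  obtains J :: "((nat \<times> nat) \<times> 'i) set" and L :: "((nat \<times> nat) \<times> 'j) set" and t \<omega> r \<rho>
  where "dual_bases E.fun_ring (const_fun M) E.\<Gamma> F.\<Gamma> T.\<Gamma> (tensor_section M E F) J L
      t (\<lambda>j s. \<lambda>x\<in>mset M. \<omega> j x (s x)) r (\<lambda>l s. \<lambda>x\<in>mset M. \<rho> l x (s x))
      (\<lambda>j l u. \<lambda>x\<in>mset M. tf x (\<omega> j x) (\<rho> l x) (u x))"
    "\<And>j. j \<in> J \<Longrightarrow> t j \<in> smooth_sections M E"
    "\<And>j l. j \<in> J \<Longrightarrow> l \<in> L \<Longrightarrow> T.dual_section (\<lambda>x. tf x (\<omega> j x) (\<rho> l x))"
proof -
  obtain J :: "((nat \<times> nat) \<times> 'i) set" and t \<omega> where J: "finite J"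
    and t: "\<And>j. j \<in> J \<Longrightarrow> t j \<in> smooth_sections M E" and \<omega>: "\<And>j. j \<in> J \<Longrightarrow> E.dual_section (\<omega> j)"
    and expE: "\<And>x f e. x \<in> mset M \<Longrightarrow> linear_functional (fiber E x) f \<Longrightarrow> e \<in> carrier (fiber E x) \<Longrightarrow>
      f e = (\<Sum>j\<in>J. \<omega> j x e * f (t j x))"
    by (rule E.finite_global_frame) (rule that)
  obtain L :: "((nat \<times> nat) \<times> 'j) set" and r \<rho> where L: "finite L"
    and r: "\<And>l. l \<in> L \<Longrightarrow> r l \<in> smooth_sections M F" and \<rho>: "\<And>l. l \<in> L \<Longrightarrow> F.dual_section (\<rho> l)"
    and expF: "\<And>x f e. x \<in> mset M \<Longrightarrow> linear_functional (fiber F x) f \<Longrightarrow> e \<in> carrier (fiber F x) \<Longrightarrow>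
      f e = (\<Sum>l\<in>L. \<rho> l x e * f (r l x))"
    by (rule F.finite_global_frame) (rule that)
  note D = dual_section_tensor[OF \<omega> \<rho>]
  show ?thesis
  proof (rule that)
    show "dual_bases E.fun_ring (const_fun M) E.\<Gamma> F.\<Gamma> T.\<Gamma> (tensor_section M E F) J L
      t (\<lambda>j s. \<lambda>x\<in>mset M. \<omega> j x (s x)) r (\<lambda>l s. \<lambda>x\<in>mset M. \<rho> l x (s x))
      (\<lambda>j l u. \<lambda>x\<in>mset M. tf x (\<omega> j x) (\<rho> l x) (u x))"
    proof (intro dual_bases.intro dual_bases_axioms.intro E.scalar_algebra_smooth_ring
        E.module_section_module F.module_section_module T.module_section_module bilinear_tensor_section J L,
        unfold E.section_module_simps(1) F.section_module_simps(1) T.section_module_simps(1))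
      fix j l assume j: "j \<in> J" and l: "l \<in> L"
      show "(\<lambda>x\<in>mset M. tf x (\<omega> j x) (\<rho> l x) (u x)) \<in> carrier E.fun_ring" if "u \<in> smooth_sections M TB" for u
        by (rule T.dual_section_apply[OF D[OF j l] that])
      show "(\<lambda>x\<in>mset M. tf x (\<omega> j x) (\<rho> l x) ((u \<oplus>\<^bsub>T.\<Gamma>\<^esub> v) x)) =
          (\<lambda>x\<in>mset M. tf x (\<omega> j x) (\<rho> l x) (u x)) \<oplus>\<^bsub>E.fun_ring\<^esub> (\<lambda>x\<in>mset M. tf x (\<omega> j x) (\<rho> l x) (v x))"
        if "u \<in> smooth_sections M TB" "v \<in> smooth_sections M TB" for u v
        unfolding E.smooth_ring_simps T.section_module_simps
        by (rule restrict_ext)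
          (simp add: linear_functionalD(1)[OF T.dual_sectionD(1)[OF D[OF j l]] T.sectionD(1)[OF that(1)] T.sectionD(1)[OF that(2)]]
            del: tensor_bundle_simps)
      show "(\<lambda>x\<in>mset M. tf x (\<omega> j x) (\<rho> l x) (tensor_section M E F p q x)) =
          (\<lambda>x\<in>mset M. \<omega> j x (p x)) \<otimes>\<^bsub>E.fun_ring\<^esub> (\<lambda>x\<in>mset M. \<rho> l x (q x))"
        if p: "p \<in> smooth_sections M E" and q: "q \<in> smooth_sections M F" for p q
        unfolding E.smooth_ring_simps
      proof (rule restrict_ext)
        fix x assume x: "x \<in> mset M"
        show "tf x (\<omega> j x) (\<rho> l x) (tensor_section M E F p q x) =
            (\<lambda>x\<in>mset M. \<omega> j x (p x)) x * (\<lambda>x\<in>mset M. \<rho> l x (q x)) x"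
          using fiber_tensor(3)[OF x E.dual_sectionD(1)[OF \<omega>[OF j] x] F.dual_sectionD(1)[OF \<rho>[OF l] x]
              E.sectionD(1)[OF p x] F.sectionD(1)[OF q x]] x
          by (simp add: tensor_section_def)
      qed
    next
      show "p = (\<Oplus>\<^bsub>E.\<Gamma>\<^esub>j\<in>J. (\<lambda>x\<in>mset M. \<omega> j x (p x)) \<odot>\<^bsub>E.\<Gamma>\<^esub> t j)" if "p \<in> smooth_sections M E" for p
        by (rule E.section_expand[OF J t \<omega> expE that])
      show "q = (\<Oplus>\<^bsub>F.\<Gamma>\<^esub>l\<in>L. (\<lambda>x\<in>mset M. \<rho> l x (q x)) \<odot>\<^bsub>F.\<Gamma>\<^esub> r l)" if "q \<in> smooth_sections M F" for q
        by (rule F.section_expand[OF L r \<rho> expF that])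
      show "u = (\<Oplus>\<^bsub>T.\<Gamma>\<^esub>j\<in>J. \<Oplus>\<^bsub>T.\<Gamma>\<^esub>l\<in>L.
          (\<lambda>x\<in>mset M. tf x (\<omega> j x) (\<rho> l x) (u x)) \<odot>\<^bsub>T.\<Gamma>\<^esub> tensor_section M E F (t j) (r l))"
        if "u \<in> smooth_sections M TB" for u
        by (rule tensor_section_expand[OF J t \<omega> expE L r \<rho> expF that])
    qed (rule t r E.dual_section_apply[OF \<omega>] F.dual_section_apply[OF \<rho>]; assumption)+
  qed (rule t D; assumption)+
qed

end

theorem theorem28:
  fixes M :: "('m, 'b::{real_inner,heine_borel}) manifold"
    and E :: "('m, 'k::{real_normed_field,euclidean_space}, 'e, 'i) vbundle"
    and F :: "('m, 'k, 'f, 'j) vbundle"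
  defines "A \<equiv> smooth_ring M :: ('m \<Rightarrow> 'k) ring"
    and "\<iota> \<equiv> const_fun M :: 'k \<Rightarrow> 'm \<Rightarrow> 'k"
    and "P \<equiv> section_module M E" and "TP \<equiv> section_topology M E"
    and "Q \<equiv> section_module M F" and "TQ \<equiv> section_topology M F"
    and "R \<equiv> section_module M (tensor_bundle E F)"
    and "TR \<equiv> section_topology M (tensor_bundle E F)"
  assumes "smooth_manifold M" and "vector_bundle M E" and "vector_bundle M F"
  shows "\<exists>\<Psi>. module_iso A (tensor_module A P Q) R \<Psi> \<and>
      (\<forall>s\<in>carrier P. \<forall>t\<in>carrier Q. \<Psi> (pure_tensor A P Q s t) = tensor_section M E F s t) \<and>
      (\<exists>\<Phi>. module_iso A (proj_tensor_module \<iota> A P TP Q TQ) R \<Phi> \<and>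
        homeomorphic_map (proj_tensor_topology \<iota> A P TP Q TQ) TR \<Phi> \<and>
        (\<forall>s\<in>carrier P. \<forall>t\<in>carrier Q.
          \<Phi> (proj_pure_tensor \<iota> A P TP Q TQ s t) = \<Psi> (pure_tensor A P Q s t)))"
proof -
  interpret B: smooth_bundle_pair M E F
    by (intro smooth_bundle_pair.intro smooth_bundle.intro smooth_mfd.intro smooth_bundle_axioms.intro assms(9-11))
  obtain J :: "((nat \<times> nat) \<times> 'i) set" and L :: "((nat \<times> nat) \<times> 'j) set" and t \<omega> r \<rho>
    where D: "dual_bases (smooth_ring M) (const_fun M) (section_module M E) (section_module M F)
      (section_module M (tensor_bundle E F)) (tensor_section M E F) J L
      t (\<lambda>j s. \<lambda>x\<in>mset M. \<omega> j x (s x)) r (\<lambda>l s. \<lambda>x\<in>mset M. \<rho> l x (s x))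
      (\<lambda>j l u. \<lambda>x\<in>mset M. B.tf x (\<omega> j x) (\<rho> l x) (u x))"
    and t: "\<And>j. j \<in> J \<Longrightarrow> t j \<in> smooth_sections M E"
    and coord: "\<And>j l. j \<in> J \<Longrightarrow> l \<in> L \<Longrightarrow> B.T.dual_section (\<lambda>x. B.tf x (\<omega> j x) (\<rho> l x))"
    by (rule B.sections_dual_bases) (rule that)
  interpret D: dual_bases A \<iota> P Q R "tensor_section M E F" J L
      t "\<lambda>j s. \<lambda>x\<in>mset M. \<omega> j x (s x)" r "\<lambda>l s. \<lambda>x\<in>mset M. \<rho> l x (s x)"
      "\<lambda>j l u. \<lambda>x\<in>mset M. B.tf x (\<omega> j x) (\<rho> l x) (u x)"
    unfolding A_def \<iota>_def P_def Q_def R_def by (rule D)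
  obtain \<Psi> where \<Psi>: "module_iso A (tensor_module A P Q) R \<Psi>"
    "\<And>s t. s \<in> carrier P \<Longrightarrow> t \<in> carrier Q \<Longrightarrow> \<Psi> (pure_tensor A P Q s t) = tensor_section M E F s t"
    by (rule D.algebraic_iso) (rule that)
  have top: "topspace TP = carrier P" "topspace TQ = carrier Q"
    unfolding TP_def TQ_def P_def Q_def
    by (simp_all add: B.E.topspace_section_topology B.F.topspace_section_topology)
  obtain \<Phi> where \<Phi>: "module_iso A (proj_tensor_module \<iota> A P TP Q TQ) R \<Phi>"
    "homeomorphic_map (proj_tensor_topology \<iota> A P TP Q TQ) TR \<Phi>"
    "\<And>s t. s \<in> carrier P \<Longrightarrow> t \<in> carrier Q \<Longrightarrow> \<Phi> (proj_pure_tensor \<iota> A P TP Q TQ s t) = tensor_section M E F s t"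
  proof (rule D.topological_iso[OF top])
    show "locally_convex_topology (restrict_scalars \<iota> R) TR"
      unfolding \<iota>_def R_def TR_def by (rule B.T.locally_convex_sections)
    show "Hausdorff_space TR" unfolding TR_def by (rule B.T.Hausdorff_sections)
    show "continuous_map (prod_topology TP TQ) TR (\<lambda>(s, t). tensor_section M E F s t)"
      unfolding TP_def TQ_def TR_def by (rule B.continuous_tensor_section)
    show "continuous_map TR TP (\<lambda>u. (\<lambda>x\<in>mset M. B.tf x (\<omega> j x) (\<rho> l x) (u x)) \<odot>\<^bsub>P\<^esub> t j)"
      if "j \<in> J" "l \<in> L" for j l
      unfolding TP_def TR_def P_def by (rule B.continuous_coordinate[OF coord[OF that] t[OF that(1)]])
  qed (rule that)
  \<comment> \<open>\<open>\<Phi>\<close> and \<open>\<Psi>\<close> both send a pure tensor to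
    \<open>tensor_section M E F s t\<close>, and in this sense \<open>\<Phi>\<close> is induced by
    \<open>\<Psi>\<close>.\<close>
  show ?thesis
    using \<Psi> \<Phi> by (intro exI[of _ \<Psi>] exI[of _ \<Phi>] conjI ballI) simp_all
qed

end
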